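(* Let $E$ be a Banach space, and let $X_E$ be the Banach space constructed from $E$ by Pisier's construction (as defined in the context). Then there is a well-bounded operator on $X_E$ that is not of type (B).
   Context: Conventions. Banach spaces are complex; $\mathbb{N}=\{0,1,2,\dots\}$; $B(X)$ is the space of bounded linear operators on $X$; a projection is a bounded linear operator $P$ with $P^2=P$; SOT is the strong operator topology. Well-bounded operators. $T\in B(X)$ is well-bounded if there are a compact interval $[a,b]$ and $K>0$ with $\|p(T)\|\le K\left(|p(a)|+\int_a^b|p'(t)|\,dt\right)$ for all polynomials $p$. A spectral family of projections on $X$ is a projection-valued function $F:\mathbb{R}\to B(X)$ such that: (i) there exist $a,b\in\mathbb{R}$ with $F(\lambda)=0$ for all $\lambda<a$ and $F(\lambda)=I$ for all $\lambda\ge b$; (ii) $\sup_\lambda\|F(\lambda)\|<\infty$; (iii) $F(a)=0$ and $F(b)=I$; (iv) $F(\lambda)F(\mu)=F(\min(\lambda,\mu))$ for all $\lambda,\mu\in\mathbb{R}$; (v) for all $\mu\in\mathbb{R}$ and $x\in X$, $\lim_{\lambda\to\mu^+}F(\lambda)x=F(\mu)x$ and $\lim_{\lambda\to\mu^-}F(\lambda)x$ exists. For such $F$ and $g\in BV[a,b]$, $\int_{[a,b]}^{\oplus}g(\lambda)\,dF(\lambda)$ denotes the SOT limit, with respect to refinement of partitions $\{t_j\}_{j=0}^n$ of $[a,b]$, of the sums $g(a)F(a)+\sum_{j=1}^n g(t_j)(F(t_j)-F(t_{j-1}))$. A well-bounded operator $T$ is of type (B) if $T=\int_{[a,b]}^{\oplus}\lambda\,dF(\lambda)$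 for some spectral family of projections $F$ (with $a,b$ as in (i), (iii)). Notation $\ell^1$. For Banach spaces $(X_i)_{i\in I}$, $\ell^1(X_i)_{i\in I}=\{(x_i)\in\prod_i X_i:\|(x_i)\|=\sum_i\|x_i\|<\infty\}$. Basic spaces. Let $\mathbb{T}$ be the complex unit circle with normalised Lebesgue measure, and $D=\{-1,1\}^{\mathbb{N}}$ with normalised Haar measure $\mu$. $B_1=L^1(D,\mu)$ and $S_1=\overline{\mathrm{span}}\{\varepsilon_k\}_{k=0}^\infty$, where $\varepsilon_k((d_i)_{i=0}^\infty)=d_k$. $B_2=L^1(\mathbb{T})$ and $S_2=H^1(\mathbb{T})$, the subspace of functions whose negative Fourier coefficients are zero. $B_3=L^1(\mathbb{T})/H^1(\mathbb{T})$ and $S_3=\overline{\mathrm{span}}\{\xi_k\}_{k=1}^\infty$, where $\xi_k$ is the coset of $z\mapsto z^{-3^k}$. The space $\tilde E$ and the isometry $j$. Given a Banach space $E$, let $F(S_i,E)$ be the set of non-zero bounded finite rank operators $S_i\to E$ and $A=\bigcup_{i=1}^3F(S_i,E)$ (a disjoint union). For $\alpha\in F(S_i,E)$ put $B_\alpha=B_i$, $S_\alpha=S_i$. Let $B=\ell^1(B_\alpha)_{\alpha\in A}$, $S=\ell^1(S_\alpha)_{\alpha\in A}\subseteq B$, and define $u:S\to E$ by $u((s_\alpha)_{\alpha\in A})=\sum_{\alpha\in A}\alpha s_\alpha/\|\alpha\|$. Equip $B\oplus E$ with the norm $\|(x,e)\|=\|x\|+\|e\|$, let $\tilde E=(B\oplus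 E)/\{(s,-us):s\in S\}$ with quotient map $\pi$, and let $j:E\to\tilde E$, $je=\pi(0,e)$, which is a linear isometry. The space $X_E$. Put $E_0=E$, $E_{n+1}=\tilde{E_n}$, and let $j_n:E_n\to E_{n+1}$ be the corresponding isometry. $X_E$ is the Banach inductive limit of $(E_n,j_n)$: let $\mathcal X$ be the space of sequences $(x_n)\in\prod_{n\ge0}E_n$ with $j_nx_n=x_{n+1}$ for all large $n$, with semi-norm $\rho((x_n))=\lim_n\|x_n\|$; then $X_E$ is the completion of $\mathcal X/\ker\rho$.
   Formalization: The Banach space E is assumed to be nonzero: for E = {0} there are no non-zero finite rank operators into E, so X_E = {0}, whose only operator is of type (B), and the claim fails. *)

theory Defs
  imports
    "HOL-Probability.Probability"
    "HOL-Computational_Algebra.Polynomial"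
    "HOL-Library.Countable_Set_Type"
    "HOL-Algebra.Module"
    "HOL-Algebra.AbelCoset"
begin

text \<open>
  Iterating a construction of Banach spaces needs spaces with explicit carriers, since all
  stages must live in one type. A complex normed space is a \<open>HOL-Algebra\<close> module over the
  field of complex numbers together with a norm; the ring multiplication and unit that the
  module record inherits are never used.
\<close>

section \<open>Complex normed spaces with carriers\<close>

record 'a cnormed = "(complex, 'a) module" +
  nrm :: "'a \<Rightarrow> real"

definition complex_ring :: "complex ring" where
  "complex_ring = \<lparr>carrier = UNIV, monoid.mult = (*), one = 1, ring.zero = 0, add = (+)\<rparr>"

definition mk_cnormed ::
  "'a set \<Rightarrow> 'a \<Rightarrow> ('a \<Rightarrow> 'a \<Rightarrow> 'a) \<Rightarrow> (complex \<Rightarrow> 'a \<Rightarrow> 'a) \<Rightarrow> ('a \<Rightarrow> real) \<Rightarrow> 'a cnormed" where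
  "mk_cnormed C z p s n =
     \<lparr>carrier = C, monoid.mult = undefined, one = undefined, ring.zero = z, add = p,
      smult = s, nrm = n\<rparr>"

text \<open>The locale for metric spaces wants symmetry and positivity also off the carrier.\<close>

definition ndist :: "'a cnormed \<Rightarrow> 'a \<Rightarrow> 'a \<Rightarrow> real" where
  "ndist V x y = (if x \<in> carrier V \<and> y \<in> carrier V then nrm V (x \<ominus>\<^bsub>V\<^esub> y) else 0)"

abbreviation ntop :: "'a cnormed \<Rightarrow> 'a topology" where
  "ntop V \<equiv> Metric_space.mtopology (carrier V) (ndist V)"

locale complex_normed_space = Module.module complex_ring V for V :: "'a cnormed" (structure) +
  assumes nrm_eq_0: "x \<in> carrier V \<Longrightarrow> nrm V x = 0 \<longleftrightarrow> x = \<zero>"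
    and nrm_triangle: "x \<in> carrier V \<Longrightarrow> y \<in> carrier V \<Longrightarrow> nrm V (x \<oplus> y) \<le> nrm V x + nrm V y"
    and nrm_smult: "x \<in> carrier V \<Longrightarrow> nrm V (c \<odot> x) = cmod c * nrm V x"

locale complex_banach_space = complex_normed_space +
  assumes complete: "Metric_space.mcomplete (carrier V) (ndist V)"

definition lin_span :: "'a cnormed \<Rightarrow> 'a set \<Rightarrow> 'a set" where
  "lin_span V Y = {finsum V (\<lambda>y. c y \<odot>\<^bsub>V\<^esub> y) G |c G. finite G \<and> G \<subseteq> Y}"

definition closed_span :: "'a cnormed \<Rightarrow> 'a set \<Rightarrow> 'a set" where
  "closed_span V Y = Abstract_Topology.closure_of (ntop V) (lin_span V Y)"

text \<open>The sum of a family, as the limit of the net of its finite partial sums.\<close>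

definition vsum :: "'a cnormed \<Rightarrow> ('i \<Rightarrow> 'a) \<Rightarrow> 'i set \<Rightarrow> 'a" where
  "vsum V f I = (THE l. limitin (ntop V) (finsum V f) l (finite_subsets_at_top I))"

section \<open>Bounded operators\<close>

text \<open>Operators are \<open>undefined\<close> off the carrier, so that equal operators are equal functions.\<close>

definition bounded_ops :: "'a cnormed \<Rightarrow> 'b cnormed \<Rightarrow> ('a \<Rightarrow> 'b) set" where
  "bounded_ops V W = {T \<in> carrier V \<rightarrow>\<^sub>E carrier W.
     (\<forall>x\<in>carrier V. \<forall>y\<in>carrier V. T (x \<oplus>\<^bsub>V\<^esub> y) = T x \<oplus>\<^bsub>W\<^esub> T y) \<and>
     (\<forall>c. \<forall>x\<in>carrier V. T (c \<odot>\<^bsub>V\<^esub> x) = c \<odot>\<^bsub>W\<^esub> T x) \<and>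
     (\<exists>K. \<forall>x\<in>carrier V. nrm W (T x) \<le> K * nrm V x)}"

definition opnorm :: "'a cnormed \<Rightarrow> 'b cnormed \<Rightarrow> ('a \<Rightarrow> 'b) \<Rightarrow> real" where
  "opnorm V W T = (SUP x\<in>{x \<in> carrier V. nrm V x \<le> 1}. nrm W (T x))"

definition finite_rank_ops :: "'a cnormed \<Rightarrow> 'b cnormed \<Rightarrow> ('a \<Rightarrow> 'b) set" where
  "finite_rank_ops V W = {T \<in> bounded_ops V W.
     (\<exists>Y. finite Y \<and> Y \<subseteq> carrier W \<and> T ` carrier V \<subseteq> lin_span W Y)}"

definition nonzero_finite_rank_ops :: "'a cnormed \<Rightarrow> 'b cnormed \<Rightarrow> ('a \<Rightarrow> 'b) set" where
  "nonzero_finite_rank_ops V W = {T \<in> finite_rank_ops V W. \<exists>x\<in>carrier V. T x \<noteq> \<zero>\<^bsub>W\<^esub>}"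

definition id_op :: "'a cnormed \<Rightarrow> 'a \<Rightarrow> 'a" where
  "id_op V = (\<lambda>x\<in>carrier V. x)"

definition zero_op :: "'a cnormed \<Rightarrow> 'a \<Rightarrow> 'a" where
  "zero_op V = (\<lambda>x\<in>carrier V. \<zero>\<^bsub>V\<^esub>)"

definition projections :: "'a cnormed \<Rightarrow> ('a \<Rightarrow> 'a) set" where
  "projections V = {P \<in> bounded_ops V V. compose (carrier V) P P = P}"

definition poly_op :: "'a cnormed \<Rightarrow> complex poly \<Rightarrow> ('a \<Rightarrow> 'a) \<Rightarrow> 'a \<Rightarrow> 'a" where
  "poly_op V p T = (\<lambda>x\<in>carrier V. finsum V (\<lambda>k. coeff p k \<odot>\<^bsub>V\<^esub> (T ^^ k) x) {..degree p})"

section \<open>Well-bounded operators\<close>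

definition well_bounded :: "'a cnormed \<Rightarrow> ('a \<Rightarrow> 'a) \<Rightarrow> bool" where
  "well_bounded V T \<longleftrightarrow> T \<in> bounded_ops V V \<and>
     (\<exists>a b K. a \<le> b \<and> K > 0 \<and>
       (\<forall>p. opnorm V V (poly_op V p T) \<le>
          K * (cmod (poly p (of_real a)) +
               integral {a..b} (\<lambda>t. cmod (poly (pderiv p) (of_real t))))))"

definition spectral_family :: "'a cnormed \<Rightarrow> (real \<Rightarrow> 'a \<Rightarrow> 'a) \<Rightarrow> real \<Rightarrow> real \<Rightarrow> bool" where
  "spectral_family V F a b \<longleftrightarrow>
     range F \<subseteq> projections V \<and>
     (\<forall>l<a. F l = zero_op V) \<and> (\<forall>l\<ge>b. F l = id_op V) \<and>
     bdd_above (range (\<lambda>l. opnorm V V (F l))) \<and>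
     F a = zero_op V \<and> F b = id_op V \<and>
     (\<forall>l m. compose (carrier V) (F l) (F m) = F (min l m)) \<and>
     (\<forall>m. \<forall>x\<in>carrier V.
        limitin (ntop V) (\<lambda>l. F l x) (F m x) (at_right m) \<and>
        (\<exists>y. limitin (ntop V) (\<lambda>l. F l x) y (at_left m)))"

definition is_partition :: "real \<Rightarrow> real \<Rightarrow> nat \<Rightarrow> (nat \<Rightarrow> real) \<Rightarrow> bool" where
  "is_partition a b n t \<longleftrightarrow> t 0 = a \<and> t n = b \<and> strict_mono_on {..n} t"

definition stieltjes_sum ::
  "'a cnormed \<Rightarrow> (real \<Rightarrow> 'a \<Rightarrow> 'a) \<Rightarrow> (real \<Rightarrow> complex) \<Rightarrow> nat \<Rightarrow> (nat \<Rightarrow> real) \<Rightarrow> 'a \<Rightarrow> 'a" where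
  "stieltjes_sum V F g n t x =
     g (t 0) \<odot>\<^bsub>V\<^esub> F (t 0) x \<oplus>\<^bsub>V\<^esub>
     finsum V (\<lambda>j. g (t j) \<odot>\<^bsub>V\<^esub> (F (t j) x \<ominus>\<^bsub>V\<^esub> F (t (j - 1)) x)) {1..n}"

definition has_spectral_integral ::
  "'a cnormed \<Rightarrow> (real \<Rightarrow> 'a \<Rightarrow> 'a) \<Rightarrow> real \<Rightarrow> real \<Rightarrow> (real \<Rightarrow> complex) \<Rightarrow> ('a \<Rightarrow> 'a) \<Rightarrow> bool" where
  "has_spectral_integral V F a b g T \<longleftrightarrow>
     (\<forall>x\<in>carrier V. \<forall>e>0. \<exists>m s. is_partition a b m s \<and>
        (\<forall>n t. is_partition a b n t \<and> s ` {..m} \<subseteq> t ` {..n} \<longrightarrow>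
           nrm V (stieltjes_sum V F g n t x \<ominus>\<^bsub>V\<^esub> T x) < e))"

definition type_B :: "'a cnormed \<Rightarrow> ('a \<Rightarrow> 'a) \<Rightarrow> bool" where
  "type_B V T \<longleftrightarrow> well_bounded V T \<and>
     (\<exists>F a b. a \<le> b \<and> spectral_family V F a b \<and> has_spectral_integral V F a b of_real T)"

section \<open>Constructions of normed spaces\<close>

text \<open>Isomorphic copy along a function that is injective on the carrier.\<close>

definition transport :: "('a \<Rightarrow> 'b) \<Rightarrow> 'a cnormed \<Rightarrow> 'b cnormed" where
  "transport f V =
     (let h = inv_into (carrier V) f in
      mk_cnormed (f ` carrier V) (f \<zero>\<^bsub>V\<^esub>) (\<lambda>x y. f (h x \<oplus>\<^bsub>V\<^esub> h y))
        (\<lambda>c x. f (c \<odot>\<^bsub>V\<^esub> h x)) (\<lambda>x. nrm V (h x)))"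

definition subspace_of :: "'a cnormed \<Rightarrow> 'a set \<Rightarrow> 'a cnormed" where
  "subspace_of V Y = V\<lparr>carrier := Y\<rparr>"

text \<open>Adding \<open>N\<close> in the scalar multiplication only matters for the scalar \<open>0\<close>.\<close>

definition quotient :: "'a cnormed \<Rightarrow> 'a set \<Rightarrow> 'a set cnormed" where
  "quotient V N = mk_cnormed (a_rcosets\<^bsub>V\<^esub> N) N (set_add V)
     (\<lambda>c C. (\<lambda>x. c \<odot>\<^bsub>V\<^esub> x) ` C <+>\<^bsub>V\<^esub> N) (\<lambda>C. INF x\<in>C. nrm V x)"

text \<open>The normed space of a seminormed space.\<close>

definition seminorm_kernel :: "'a cnormed \<Rightarrow> 'a set" where
  "seminorm_kernel V = {x \<in> carrier V. nrm V x = 0}"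

definition separated :: "'a cnormed \<Rightarrow> 'a set cnormed" where
  "separated V = quotient V (seminorm_kernel V)"

definition completion :: "'a cnormed \<Rightarrow> (nat \<Rightarrow> 'a) set cnormed" where
  "completion V = separated (mk_cnormed
     {x. Metric_space.MCauchy (carrier V) (ndist V) x}
     (\<lambda>n. \<zero>\<^bsub>V\<^esub>) (\<lambda>x y n. x n \<oplus>\<^bsub>V\<^esub> y n) (\<lambda>c x n. c \<odot>\<^bsub>V\<^esub> x n)
     (\<lambda>x. lim (\<lambda>n. nrm V (x n))))"

definition l1_sum :: "'i set \<Rightarrow> ('i \<Rightarrow> 'a cnormed) \<Rightarrow> ('i \<Rightarrow> 'a) cnormed" where
  "l1_sum I X = mk_cnormed
     {x \<in> \<Pi>\<^sub>E i\<in>I. carrier (X i). (\<lambda>i. nrm (X i) (x i)) summable_on I}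
     (\<lambda>i\<in>I. \<zero>\<^bsub>X i\<^esub>) (\<lambda>x y. \<lambda>i\<in>I. x i \<oplus>\<^bsub>X i\<^esub> y i) (\<lambda>c x. \<lambda>i\<in>I. c \<odot>\<^bsub>X i\<^esub> x i)
     (\<lambda>x. \<Sum>\<^sub>\<infinity>i\<in>I. nrm (X i) (x i))"

definition l1_prod :: "'a cnormed \<Rightarrow> 'b cnormed \<Rightarrow> ('a \<times> 'b) cnormed" where
  "l1_prod V W = mk_cnormed (carrier V \<times> carrier W) (\<zero>\<^bsub>V\<^esub>, \<zero>\<^bsub>W\<^esub>)
     (\<lambda>(x, y) (x', y'). (x \<oplus>\<^bsub>V\<^esub> x', y \<oplus>\<^bsub>W\<^esub> y')) (\<lambda>c (x, y). (c \<odot>\<^bsub>V\<^esub> x, c \<odot>\<^bsub>W\<^esub> y))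
     (\<lambda>(x, y). nrm V x + nrm W y)"

text \<open>Sequences that eventually follow the maps \<open>j n\<close> from \<open>E n\<close> to \<open>E (Suc n)\<close>.\<close>

definition thread_space :: "(nat \<Rightarrow> 'a cnormed) \<Rightarrow> (nat \<Rightarrow> 'a \<Rightarrow> 'a) \<Rightarrow> (nat \<Rightarrow> 'a) cnormed" where
  "thread_space E j = mk_cnormed
     {x. (\<forall>n. x n \<in> carrier (E n)) \<and> (\<exists>N. \<forall>n\<ge>N. j n (x n) = x (Suc n))}
     (\<lambda>n. \<zero>\<^bsub>E n\<^esub>) (\<lambda>x y n. x n \<oplus>\<^bsub>E n\<^esub> y n) (\<lambda>c x n. c \<odot>\<^bsub>E n\<^esub> x n)
     (\<lambda>x. lim (\<lambda>n. nrm (E n) (x n)))"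

definition banach_inductive_limit ::
  "(nat \<Rightarrow> 'a cnormed) \<Rightarrow> (nat \<Rightarrow> 'a \<Rightarrow> 'a) \<Rightarrow> (nat \<Rightarrow> (nat \<Rightarrow> 'a) set) set cnormed" where
  "banach_inductive_limit E j = completion (separated (thread_space E j))"

section \<open>The basic spaces\<close>

definition integrable_space :: "'a measure \<Rightarrow> ('a \<Rightarrow> complex) cnormed" where
  "integrable_space M = mk_cnormed {f. integrable M f} (\<lambda>z. 0) (\<lambda>f g z. f z + g z)
     (\<lambda>c f z. c * f z) (\<lambda>f. \<integral>z. cmod (f z) \<partial>M)"

definition L1 :: "'a measure \<Rightarrow> ('a \<Rightarrow> complex) set cnormed" where
  "L1 M = separated (integrable_space M)"

definition L1_class :: "'a measure \<Rightarrow> ('a \<Rightarrow> complex) \<Rightarrow> ('a \<Rightarrow> complex) set" where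
  "L1_class M f = seminorm_kernel (integrable_space M) +>\<^bsub>integrable_space M\<^esub> f"

text \<open>Normalised Haar measure on the Cantor group is the fair coin-tossing measure.\<close>

definition haar_D :: "(nat \<Rightarrow> real) measure" where
  "haar_D = PiM UNIV (\<lambda>_. uniform_count_measure {-1, 1})"

definition haar_T :: "complex measure" where
  "haar_T = distr (uniform_measure lborel {0..<2 * pi}) (restrict_space borel (sphere 0 1)) cis"

definition B1 :: "((nat \<Rightarrow> real) \<Rightarrow> complex) set cnormed" where
  "B1 = L1 haar_D"

definition S1 :: "((nat \<Rightarrow> real) \<Rightarrow> complex) set set" where
  "S1 = closed_span B1 (range (\<lambda>k. L1_class haar_D (\<lambda>d. of_real (d k))))"

definition B2 :: "(complex \<Rightarrow> complex) set cnormed" where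
  "B2 = L1 haar_T"

definition fourier_coeff :: "(complex \<Rightarrow> complex) \<Rightarrow> int \<Rightarrow> complex" where
  "fourier_coeff f n = (\<integral>z. f z * z powi (-n) \<partial>haar_T)"

definition S2 :: "(complex \<Rightarrow> complex) set set" where
  "S2 = {C \<in> carrier B2. \<forall>f\<in>C. \<forall>n<0. fourier_coeff f n = 0}"

definition B3 :: "(complex \<Rightarrow> complex) set set cnormed" where
  "B3 = quotient B2 S2"

definition S3 :: "(complex \<Rightarrow> complex) set set set" where
  "S3 = closed_span B3
     ((\<lambda>k::nat. S2 +>\<^bsub>B2\<^esub> L1_class haar_T (\<lambda>z. z powi (- (3 ^ k)))) ` {1..})"

text \<open>One type for the elements of all three spaces.\<close>

datatype basic =
    Basic1 "((nat \<Rightarrow> real) \<Rightarrow> complex) set"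
  | Basic2 "(complex \<Rightarrow> complex) set"
  | Basic3 "(complex \<Rightarrow> complex) set set"

definition basic_B :: "nat \<Rightarrow> basic cnormed" where
  "basic_B i =
     (if i = 1 then transport Basic1 B1 else if i = 2 then transport Basic2 B2
      else transport Basic3 B3)"

definition basic_S :: "nat \<Rightarrow> basic cnormed" where
  "basic_S i = subspace_of (basic_B i)
     (if i = 1 then Basic1 ` S1 else if i = 2 then Basic2 ` S2 else Basic3 ` S3)"

section \<open>The space \<open>tilde E\<close>\<close>

type_synonym 'a op_index = "nat \<times> (basic \<Rightarrow> 'a)"

definition index_A :: "'a cnormed \<Rightarrow> 'a op_index set" where
  "index_A E = (SIGMA i:{1, 2, 3}. nonzero_finite_rank_ops (basic_S i) E)"

definition big_B :: "'a cnormed \<Rightarrow> ('a op_index \<Rightarrow> basic) cnormed" where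
  "big_B E = l1_sum (index_A E) (\<lambda>(i, \<alpha>). basic_B i)"

definition big_S :: "'a cnormed \<Rightarrow> ('a op_index \<Rightarrow> basic) cnormed" where
  "big_S E = l1_sum (index_A E) (\<lambda>(i, \<alpha>). basic_S i)"

definition op_u :: "'a cnormed \<Rightarrow> ('a op_index \<Rightarrow> basic) \<Rightarrow> 'a" where
  "op_u E s = vsum E
     (\<lambda>(i, \<alpha>). of_real (1 / opnorm (basic_S i) E \<alpha>) \<odot>\<^bsub>E\<^esub> \<alpha> (s (i, \<alpha>))) (index_A E)"

definition graph_u :: "'a cnormed \<Rightarrow> (('a op_index \<Rightarrow> basic) \<times> 'a) set" where
  "graph_u E = {(s, \<ominus>\<^bsub>E\<^esub> op_u E s) |s. s \<in> carrier (big_S E)}"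

definition tilde :: "'a cnormed \<Rightarrow> (('a op_index \<Rightarrow> basic) \<times> 'a) set cnormed" where
  "tilde E = quotient (l1_prod (big_B E) E) (graph_u E)"

definition tilde_j :: "'a cnormed \<Rightarrow> 'a \<Rightarrow> (('a op_index \<Rightarrow> basic) \<times> 'a) set" where
  "tilde_j E e = graph_u E +>\<^bsub>l1_prod (big_B E) E\<^esub> (\<zero>\<^bsub>big_B E\<^esub>, e)"

section \<open>The space \<open>X\<^sub>E\<close>\<close>

text \<open>
  All stages of the construction are copied into one type: an element of \<open>tilde E\<close> is encoded by a
  chosen representative \<open>(x, e)\<close> of the coset, where \<open>x\<close> is stored as the graph of its
  restriction to its support. The support is countable because \<open>x\<close> is summable, and \<open>code\<close> is
  injective on \<open>tilde E\<close> for every Banach space \<open>E\<close>.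
\<close>

datatype 'e stage = Atom 'e | Node "((nat \<times> (basic \<Rightarrow> 'e stage)) \<times> basic) cset" "'e stage"

definition support_graph ::
  "'e stage cnormed \<Rightarrow> ('e stage op_index \<Rightarrow> basic) \<Rightarrow> ('e stage op_index \<times> basic) set" where
  "support_graph E x = {(\<alpha>, x \<alpha>) |\<alpha>. \<alpha> \<in> index_A E \<and> x \<alpha> \<noteq> \<zero>\<^bsub>basic_B (fst \<alpha>)\<^esub>}"

definition code ::
  "'e stage cnormed \<Rightarrow> (('e stage op_index \<Rightarrow> basic) \<times> 'e stage) set \<Rightarrow> 'e stage" where
  "code E C = (let (x, e) = (SOME p. p \<in> C) in Node (acset (support_graph E x)) e)"

primrec tower :: "'e cnormed \<Rightarrow> nat \<Rightarrow> 'e stage cnormed" where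
  "tower E 0 = transport Atom E"
| "tower E (Suc n) = transport (code (tower E n)) (tilde (tower E n))"

definition tower_j :: "'e cnormed \<Rightarrow> nat \<Rightarrow> 'e stage \<Rightarrow> 'e stage" where
  "tower_j E n e = code (tower E n) (tilde_j (tower E n) e)"

definition pisier_space ::
  "'e cnormed \<Rightarrow> (nat \<Rightarrow> (nat \<Rightarrow> 'e stage) set) set cnormed" where
  "pisier_space E = banach_inductive_limit (tower E) (tower_j E)"

end

theory Submission
  imports Defs "HOL-Library.Nat_Bijection"
begin

text \<open>
  The operator is built from contractive projections \<open>R 0 = 1, R 1, R 2, \<dots>\<close> of the space \<open>X\<close> that
  satisfy \<open>R m R n = R (max m n)\<close> and for which some sequence \<open>R n x\<close> does not converge. Put
  \<open>T = \<Sum>n. 2\<^sup>-\<^sup>(\<^sup>n\<^sup>+\<^sup>1\<^sup>) R n\<close>. On the range of \<open>R n - R (n+1)\<close> this is the scalar \<open>1 - 2\<^sup>-\<^sup>(\<^sup>n\<^sup>+\<^sup>1\<^sup>)\<close>, and \<open>T\<close> tends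
  to the identity on the ranges of the \<open>R n\<close>. Summation by parts bounds \<open>p(T)\<close> by \<open>|p(0)|\<close> and the
  variation of \<open>p\<close> on \<open>[0, 1]\<close> (lemma \<open>poly_op_T_bound\<close>). If \<open>T\<close> were the integral of a spectral
  family \<open>F\<close>, the existence of the left limit of \<open>F\<close> at \<open>1\<close> would make every sequence \<open>R n x\<close> converge:
  the \<open>R n\<close> tend to \<open>0\<close> on spectral pieces away from \<open>1\<close> and fix the jump of \<open>F\<close> at \<open>1\<close> (lemma
  \<open>R_converges\<close>).

  The projections are means over growing finite groups of isometries: commuting isometric
  involutions \<open>\<tau> 0, \<tau> 1, \<dots>\<close> give \<open>R n\<close> as the product of the \<open>(1 + \<tau> i) / 2\<close> with \<open>i < n\<close>.

  Such involutions exist because the construction of \<open>tilde E\<close> is redundant. The operators \<open>t \<alpha>\<close> with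
  \<open>t > 0\<close> all have the same normalisation \<open>\<alpha> / \<parallel>\<alpha>\<parallel>\<close>, so their summands are glued to \<open>E\<close> in the same
  way, and permuting them is an isometry of \<open>tilde E\<close> that fixes \<open>E\<close>. A vector \<open>b\<close> of one summand is
  spread by the averages evenly over \<open>2\<^sup>n\<close> summands. If \<open>b\<close> is outside the glued subspace, such as
  \<open>1/z\<close> outside \<open>H\<^sup>1\<close>, consecutive averages keep a fixed distance (lemma
  \<open>involutions_with_drifting_averages\<close>).

  The involutions of \<open>tilde E\<close> extend to all later spaces because the construction is functorial for
  isometric involutions \<open>\<tau>\<close>: composition with \<open>\<tau>\<close> permutes the operators into the space and keeps
  their norms (lemma \<open>involutions_functorial\<close>). They pass to the limit, in which \<open>tilde E\<close> is embedded
  isometrically and equivariantly, so the averages still do not converge there.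

  The relation divided out of \<open>B \<oplus> E\<close> is a closed subspace only because \<open>E\<close> and the basic spaces
  are complete and the subspaces \<open>S\<^sub>i\<close> are closed. Hence completeness is carried through each
  construction: spaces of integrable functions, quotients, sums, and completions.
\<close>

section \<open>Seminormed spaces with carriers\<close>

lemma complex_ring_simps [simp]:
  "carrier complex_ring = UNIV" "a \<otimes>\<^bsub>complex_ring\<^esub> b = a * b" "\<one>\<^bsub>complex_ring\<^esub> = 1"
  "\<zero>\<^bsub>complex_ring\<^esub> = 0" "a \<oplus>\<^bsub>complex_ring\<^esub> b = a + b"
  by (simp_all add: complex_ring_def)

lemma cring_complex_ring: "cring complex_ring"
proof (rule cringI)
  show "abelian_group complex_ring"
    by (rule abelian_groupI) (auto intro: exI[of _ "- _"] simp: add.assoc add.commute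
        intro!: exI[of _ "- x" for x])
  show "comm_monoid complex_ring"
    by unfold_locales auto
qed (auto simp: algebra_simps)

lemma complex_ring_a_inv [simp]: "\<ominus>\<^bsub>complex_ring\<^esub> a = - a"
proof -
  interpret cring complex_ring by (rule cring_complex_ring)
  show ?thesis
    by (rule minus_equality[symmetric, THEN sym]) auto
qed

locale complex_seminormed_space = Module.module complex_ring V for V :: "'a cnormed" (structure) +
  assumes nrm_triangle: "x \<in> carrier V \<Longrightarrow> y \<in> carrier V \<Longrightarrow> nrm V (x \<oplus> y) \<le> nrm V x + nrm V y"
    and nrm_smult: "x \<in> carrier V \<Longrightarrow> nrm V (c \<odot> x) = cmod c * nrm V x"

sublocale complex_normed_space \<subseteq> complex_seminormed_space
  by unfold_locales (simp_all add: nrm_triangle nrm_smult)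

lemma complex_normed_spaceI:
  assumes "complex_seminormed_space V"
    and "\<And>x. x \<in> carrier V \<Longrightarrow> nrm V x = 0 \<Longrightarrow> x = \<zero>\<^bsub>V\<^esub>"
  shows "complex_normed_space V"
proof -
  interpret complex_seminormed_space V by fact
  have "nrm V \<zero>\<^bsub>V\<^esub> = 0"
    using nrm_smult[of "\<zero>\<^bsub>V\<^esub>" 0] smult_l_null[of "\<zero>\<^bsub>V\<^esub>"] by simp
  then show ?thesis
    by unfold_locales (use assms(2) nrm_triangle nrm_smult in auto)
qed

text \<open>
  The additive inverse is multiplication by \<open>-1\<close>, so that a zero scalar giving the zero vector
  replaces the existence of inverses among the axioms to be checked.
\<close>

lemma mk_seminormed_space:
  assumes z: "z \<in> C" and add: "\<And>x y. x \<in> C \<Longrightarrow> y \<in> C \<Longrightarrow> p x y \<in> C"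
    and smul: "\<And>c x. x \<in> C \<Longrightarrow> s c x \<in> C"
    and assoc: "\<And>x y w. x \<in> C \<Longrightarrow> y \<in> C \<Longrightarrow> w \<in> C \<Longrightarrow> p (p x y) w = p x (p y w)"
    and comm: "\<And>x y. x \<in> C \<Longrightarrow> y \<in> C \<Longrightarrow> p x y = p y x"
    and zero: "\<And>x. x \<in> C \<Longrightarrow> p z x = x"
    and s0: "\<And>x. x \<in> C \<Longrightarrow> s 0 x = z"
    and s1: "\<And>x. x \<in> C \<Longrightarrow> s 1 x = x"
    and sl: "\<And>c d x. x \<in> C \<Longrightarrow> s (c + d) x = p (s c x) (s d x)"
    and sr: "\<And>c x y. x \<in> C \<Longrightarrow> y \<in> C \<Longrightarrow> s c (p x y) = p (s c x) (s c y)"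
    and sa: "\<And>c d x. x \<in> C \<Longrightarrow> s (c * d) x = s c (s d x)"
    and tri: "\<And>x y. x \<in> C \<Longrightarrow> y \<in> C \<Longrightarrow> n (p x y) \<le> n x + n y"
    and ns: "\<And>c x. x \<in> C \<Longrightarrow> n (s c x) = cmod c * n x"
  shows "complex_seminormed_space (mk_cnormed C z p s n)"
proof -
  have inv: "p (s (- 1) x) x = z" if "x \<in> C" for x
    using sl[OF that, of "-1" 1] s0[OF that] s1[OF that] by simp
  have "abelian_group (mk_cnormed C z p s n)"
  proof (rule abelian_groupI)
    fix x
    assume "x \<in> carrier (mk_cnormed C z p s n)"
    then have x: "x \<in> C" by (simp add: mk_cnormed_def)
    then show "\<exists>y\<in>carrier (mk_cnormed C z p s n). y \<oplus>\<^bsub>mk_cnormed C z p s n\<^esub> x = \<zero>\<^bsub>mk_cnormed C z p s n\<^esub>"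
      by (intro bexI[of _ "s (- 1) x"]) (simp_all add: mk_cnormed_def inv smul)
  qed (auto simp: mk_cnormed_def z add assoc zero intro: comm)
  then have "Module.module complex_ring (mk_cnormed C z p s n)"
    by (intro moduleI cring_complex_ring) (auto simp: mk_cnormed_def smul sl sr sa s1)
  then show ?thesis
    unfolding complex_seminormed_space_def complex_seminormed_space_axioms_def
    by (auto simp: mk_cnormed_def tri ns)
qed

lemma mk_cnormed_simps [simp]:
  "carrier (mk_cnormed C z p s n) = C" "\<zero>\<^bsub>mk_cnormed C z p s n\<^esub> = z"
  "x \<oplus>\<^bsub>mk_cnormed C z p s n\<^esub> y = p x y" "c \<odot>\<^bsub>mk_cnormed C z p s n\<^esub> x = s c x"
  "nrm (mk_cnormed C z p s n) = n"
  by (simp_all add: mk_cnormed_def)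

context complex_seminormed_space
begin

lemma seminormed: "complex_seminormed_space V" ..

lemma sm_closed [simp, intro]: "x \<in> carrier V \<Longrightarrow> c \<odot> x \<in> carrier V"
  using smult_closed[of c x] by simp

lemma sm_add_l: "x \<in> carrier V \<Longrightarrow> (c + d) \<odot> x = c \<odot> x \<oplus> d \<odot> x"
  using smult_l_distr[of c d x] by simp

lemma sm_add_r: "x \<in> carrier V \<Longrightarrow> y \<in> carrier V \<Longrightarrow> c \<odot> (x \<oplus> y) = c \<odot> x \<oplus> c \<odot> y"
  using smult_r_distr[of c x y] by simp

lemma sm_assoc: "x \<in> carrier V \<Longrightarrow> c \<odot> (d \<odot> x) = (c * d) \<odot> x"
  using smult_assoc1[of c d x] by simp

lemma sm_one [simp]: "x \<in> carrier V \<Longrightarrow> 1 \<odot> x = x"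
  using smult_one[of x] by simp

lemma sm_zero_l [simp]: "x \<in> carrier V \<Longrightarrow> 0 \<odot> x = \<zero>"
  using smult_l_null[of x] by simp

lemma sm_zero_r [simp]: "c \<odot> \<zero> = \<zero>"
  using smult_r_null[of c] by simp

lemma sm_minus_l: "x \<in> carrier V \<Longrightarrow> (- c) \<odot> x = \<ominus> (c \<odot> x)"
  using smult_l_minus[of c x] by simp

lemma sm_minus_r: "x \<in> carrier V \<Longrightarrow> c \<odot> (\<ominus> x) = \<ominus> (c \<odot> x)"
  using smult_r_minus[of c x] by simp

lemma neg_eq: "x \<in> carrier V \<Longrightarrow> \<ominus> x = (- 1) \<odot> x"
  using sm_minus_l[of x 1] by simp

lemma sm_diff_l: "x \<in> carrier V \<Longrightarrow> (c - d) \<odot> x = c \<odot> x \<ominus> d \<odot> x"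
  using sm_add_l[of x c "-d"] by (simp add: sm_minus_l minus_eq)

lemma sm_diff_r: "x \<in> carrier V \<Longrightarrow> y \<in> carrier V \<Longrightarrow> c \<odot> (x \<ominus> y) = c \<odot> x \<ominus> c \<odot> y"
  by (simp add: minus_eq sm_add_r sm_minus_r)

lemma minus_self [simp]: "x \<in> carrier V \<Longrightarrow> x \<ominus> x = \<zero>"
  by (simp add: minus_eq r_neg)

lemma diff_zero [simp]: "x \<in> carrier V \<Longrightarrow> x \<ominus> \<zero> = x"
  by (simp add: minus_eq)

lemma neg_diff: "x \<in> carrier V \<Longrightarrow> y \<in> carrier V \<Longrightarrow> \<ominus> (x \<ominus> y) = y \<ominus> x"
  by (simp add: minus_eq minus_add a_comm)

lemma diff_add_diff: "x \<in> carrier V \<Longrightarrow> y \<in> carrier V \<Longrightarrow> z \<in> carrier V \<Longrightarrow>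
    (x \<ominus> y) \<oplus> (y \<ominus> z) = x \<ominus> z"
  by (metis (no_types, lifting) a_assoc a_inv_closed minus_closed minus_eq r_neg2 r_neg1)

lemma diff_add_cancel [simp]: "x \<in> carrier V \<Longrightarrow> y \<in> carrier V \<Longrightarrow> (x \<ominus> y) \<oplus> y = x"
  using diff_add_diff[of x y \<zero>] by simp

lemma add_diff_add: "x \<in> carrier V \<Longrightarrow> y \<in> carrier V \<Longrightarrow> x' \<in> carrier V \<Longrightarrow> y' \<in> carrier V \<Longrightarrow>
    (x \<oplus> y) \<ominus> (x' \<oplus> y') = (x \<ominus> x') \<oplus> (y \<ominus> y')"
  by (simp add: minus_eq minus_add a_ac)

lemma diff_eq_iff: "x \<in> carrier V \<Longrightarrow> y \<in> carrier V \<Longrightarrow> z \<in> carrier V \<Longrightarrow>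
    x \<ominus> y = z \<longleftrightarrow> x = z \<oplus> y"
  by (metis add.inv_solve_right' minus_eq)

lemma eq_if_diff_zero: "x \<in> carrier V \<Longrightarrow> y \<in> carrier V \<Longrightarrow> x \<ominus> y = \<zero> \<Longrightarrow> x = y"
  by (simp add: diff_eq_iff)

lemma nrm_zero [simp]: "nrm V \<zero> = 0"
  using nrm_smult[of \<zero> 0] by simp

lemma nrm_neg: "x \<in> carrier V \<Longrightarrow> nrm V (\<ominus> x) = nrm V x"
  by (simp add: neg_eq nrm_smult)

lemma nrm_nonneg [simp]: "x \<in> carrier V \<Longrightarrow> 0 \<le> nrm V x"
  using nrm_triangle[of x "\<ominus> x"] by (simp add: nrm_neg r_neg)

lemma nrm_diff_comm: "x \<in> carrier V \<Longrightarrow> y \<in> carrier V \<Longrightarrow> nrm V (x \<ominus> y) = nrm V (y \<ominus> x)"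
  by (metis minus_closed neg_diff nrm_neg)

lemma nrm_diff_triangle: "x \<in> carrier V \<Longrightarrow> y \<in> carrier V \<Longrightarrow> z \<in> carrier V \<Longrightarrow>
    nrm V (x \<ominus> z) \<le> nrm V (x \<ominus> y) + nrm V (y \<ominus> z)"
  by (metis minus_closed diff_add_diff nrm_triangle)

lemma nrm_add_diff: "x \<in> carrier V \<Longrightarrow> y \<in> carrier V \<Longrightarrow> x' \<in> carrier V \<Longrightarrow> y' \<in> carrier V \<Longrightarrow>
    nrm V ((x \<oplus> y) \<ominus> (x' \<oplus> y')) \<le> nrm V (x \<ominus> x') + nrm V (y \<ominus> y')"
  by (simp add: add_diff_add nrm_triangle)

lemma nrm_sm_diff: "x \<in> carrier V \<Longrightarrow> y \<in> carrier V \<Longrightarrow>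
    nrm V (c \<odot> x \<ominus> c \<odot> y) = cmod c * nrm V (x \<ominus> y)"
  by (simp add: sm_diff_r[symmetric] nrm_smult)

lemma nrm_diff_le: "x \<in> carrier V \<Longrightarrow> y \<in> carrier V \<Longrightarrow> nrm V (x \<ominus> y) \<le> nrm V x + nrm V y"
  by (metis a_inv_closed minus_eq nrm_neg nrm_triangle)

lemma nrm_le_diff: "x \<in> carrier V \<Longrightarrow> y \<in> carrier V \<Longrightarrow> nrm V x \<le> nrm V (x \<ominus> y) + nrm V y"
  using nrm_diff_triangle[of x y \<zero>] by simp

lemma abs_nrm_diff: "x \<in> carrier V \<Longrightarrow> y \<in> carrier V \<Longrightarrow> \<bar>nrm V x - nrm V y\<bar> \<le> nrm V (x \<ominus> y)"
  using nrm_le_diff[of x y] nrm_le_diff[of y x] nrm_diff_comm[of x y] by linarith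

lemma nrm_finsum_le: "f \<in> A \<rightarrow> carrier V \<Longrightarrow> nrm V (finsum V f A) \<le> (\<Sum>i\<in>A. nrm V (f i))"
proof (induction A rule: infinite_finite_induct)
  case (insert x F)
  then have "nrm V (finsum V f (insert x F)) \<le> nrm V (f x) + nrm V (finsum V f F)"
    by (simp add: finsum_insert Pi_def nrm_triangle)
  with insert show ?case by (simp add: Pi_def)
qed (simp_all add: finsum_infinite finsum_empty)

end

text \<open>
  Limits and completeness are phrased by sequences, so that they make sense for seminorms, where
  limits are not unique and no metric is at hand.
\<close>

definition cauchy_seq :: "'a cnormed \<Rightarrow> (nat \<Rightarrow> 'a) \<Rightarrow> bool" where
  "cauchy_seq V x \<longleftrightarrow> (\<forall>n. x n \<in> carrier V) \<and>
     (\<forall>e>0. \<exists>N. \<forall>m\<ge>N. \<forall>n\<ge>N. nrm V (x m \<ominus>\<^bsub>V\<^esub> x n) < e)"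

definition converges :: "'a cnormed \<Rightarrow> (nat \<Rightarrow> 'a) \<Rightarrow> 'a \<Rightarrow> bool" where
  "converges V x l \<longleftrightarrow> l \<in> carrier V \<and> (\<lambda>n. nrm V (x n \<ominus>\<^bsub>V\<^esub> l)) \<longlonglongrightarrow> 0"

definition seq_complete :: "'a cnormed \<Rightarrow> bool" where
  "seq_complete V \<longleftrightarrow> (\<forall>x. cauchy_seq V x \<longrightarrow> (\<exists>l. converges V x l))"

context complex_seminormed_space
begin

lemma geometric_cauchy:
  assumes x: "\<And>n. x n \<in> carrier V" and d: "\<And>n. nrm V (x (Suc n) \<ominus> x n) \<le> C * (1/2)^n" and "n \<le> m"
    and "C \<ge> 0"
  shows "nrm V (x m \<ominus> x n) \<le> 2 * C * (1/2)^n"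
proof -
  have "nrm V (x (n + k) \<ominus> x n) \<le> 2 * C * (1/2)^n - 2 * C * (1/2)^(n+k)" for k
  proof (induction k)
    case 0 then show ?case using x by simp
  next
    case (Suc k)
    have "nrm V (x (n + Suc k) \<ominus> x n) \<le> nrm V (x (Suc (n + k)) \<ominus> x (n+k)) + nrm V (x (n+k) \<ominus> x n)"
      using nrm_diff_triangle x by simp
    with d[of "n+k"] Suc show ?case by simp
  qed
  from this[of "m - n"] \<open>n \<le> m\<close> \<open>C \<ge> 0\<close> show ?thesis
    by (simp add: order_trans)
qed

lemma cauchy_if_geometric:
  assumes x: "\<And>n. x n \<in> carrier V" and d: "\<And>n. nrm V (x (Suc n) \<ominus> x n) \<le> C * (1/2)^n" and "C \<ge> 0"
  shows "cauchy_seq V x"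
  unfolding cauchy_seq_def
proof (intro conjI allI impI x)
  fix e :: real assume "e > 0"
  have "(\<lambda>n. 2 * C * (1/2)^n) \<longlonglongrightarrow> 0"
    by (intro tendsto_mult_right_zero LIMSEQ_realpow_zero) auto
  from order_tendstoD(2)[OF this \<open>e > 0\<close>] obtain N where N: "2 * C * (1/2)^N < e"
    by (auto simp: eventually_sequentially)
  have *: "nrm V (x m \<ominus> x n) < e" if "n \<ge> N" "n \<le> m" for m n
  proof -
    have "nrm V (x m \<ominus> x n) \<le> 2 * C * (1/2)^n" by (rule geometric_cauchy[OF x d that(2) \<open>C \<ge> 0\<close>])
    also have "\<dots> \<le> 2 * C * (1/2)^N" using that \<open>C \<ge> 0\<close> by (intro mult_left_mono power_decreasing) auto
    finally show ?thesis using N by simp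
  qed
  show "\<exists>N. \<forall>m\<ge>N. \<forall>n\<ge>N. nrm V (x m \<ominus> x n) < e"
  proof (intro exI allI impI)
    fix m n assume "m \<ge> N" "n \<ge> N"
    then show "nrm V (x m \<ominus> x n) < e"
      using *[of m n] *[of n m] nrm_diff_comm[OF x x, of m n] by (cases "n \<le> m") auto
  qed
qed

text \<open>
  A Cauchy sequence converges as soon as some subsequence does, and one can pass to a subsequence
  whose increments are below \<open>2\<^sup>-\<^sup>n\<close>. Completeness of each construction below is tested on such
  sequences only.
\<close>

lemma seq_complete_if_fast:
  assumes fast: "\<And>x. (\<And>n. x n \<in> carrier V) \<Longrightarrow> (\<And>n. nrm V (x (Suc n) \<ominus> x n) \<le> (1/2)^n) \<Longrightarrow>
      \<exists>l. converges V x l"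
  shows "seq_complete V"
  unfolding seq_complete_def
proof (intro allI impI)
  fix x assume x: "cauchy_seq V x"
  then have xc: "x n \<in> carrier V" for n by (simp add: cauchy_seq_def)
  have "\<exists>N. \<forall>m\<ge>N. \<forall>n\<ge>N. nrm V (x m \<ominus> x n) < (1/2)^k" for k::nat
    using x unfolding cauchy_seq_def by simp
  then obtain N where N: "\<And>k m n. m \<ge> N k \<Longrightarrow> n \<ge> N k \<Longrightarrow> nrm V (x m \<ominus> x n) < (1/2)^k" by metis
  \<comment> \<open>the sum makes \<open>M\<close> monotone and at least \<open>N\<close>; the summand \<open>k\<close> makes it unbounded\<close>
  define M where "M k = k + (\<Sum>i\<le>k. N i)" for k
  have MN: "N k \<le> M k" for k
    unfolding M_def using member_le_sum[of k "{..k}" N] by simp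
  have Mm: "M k \<le> M (Suc k)" for k unfolding M_def by simp
  have Mk: "k \<le> M k" for k unfolding M_def by simp
  have "nrm V (x (M (Suc k)) \<ominus> x (M k)) \<le> (1/2)^k" for k
    using N[of k "M (Suc k)" "M k"] MN[of k] Mm[of k] by force
  then obtain l where l: "converges V (\<lambda>k. x (M k)) l" using fast[of "\<lambda>k. x (M k)"] xc by auto
  then have lc: "l \<in> carrier V" by (simp add: converges_def)
  have "(\<lambda>n. nrm V (x n \<ominus> l)) \<longlonglongrightarrow> 0"
  proof (rule LIMSEQ_I)
    fix e :: real assume "e > 0"
    then obtain K where K: "\<And>m n. m \<ge> K \<Longrightarrow> n \<ge> K \<Longrightarrow> nrm V (x m \<ominus> x n) < e/2"
      using x unfolding cauchy_seq_def by (meson half_gt_zero)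
    have "(\<lambda>k. nrm V (x (M k) \<ominus> l)) \<longlonglongrightarrow> 0" using l by (simp add: converges_def)
    from LIMSEQ_D[OF this, of "e/2"] \<open>e > 0\<close>
    obtain k0 where k0: "\<And>k. k \<ge> k0 \<Longrightarrow> \<bar>nrm V (x (M k) \<ominus> l)\<bar> < e/2" by auto
    have "nrm V (x n \<ominus> l) < e" if "n \<ge> K" for n
    proof -
      let ?k = "max k0 K"
      have "nrm V (x n \<ominus> l) \<le> nrm V (x n \<ominus> x (M ?k)) + nrm V (x (M ?k) \<ominus> l)"
        using nrm_diff_triangle xc lc by simp
      moreover have "nrm V (x n \<ominus> x (M ?k)) < e/2"
        using K[of n "M ?k"] that Mk[of ?k] by simp
      ultimately show ?thesis using k0[of ?k] by (smt (verit) field_sum_of_halves max.cobounded1)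
    qed
    then show "\<exists>no. \<forall>n\<ge>no. norm (nrm V (x n \<ominus> l) - 0) < e" using xc lc by auto
  qed
  with lc show "\<exists>l. converges V x l" by (auto simp: converges_def)
qed

lemma converges_unique_nrm:
  assumes "converges V x l" "converges V x l'" "\<And>n. x n \<in> carrier V"
  shows "nrm V (l \<ominus> l') = 0"
proof -
  have "(\<lambda>n. nrm V (x n \<ominus> l) + nrm V (x n \<ominus> l')) \<longlonglongrightarrow> 0"
    using tendsto_add[of "\<lambda>n. nrm V (x n \<ominus> l)" 0 sequentially "\<lambda>n. nrm V (x n \<ominus> l')" 0] assms
    by (simp add: converges_def)
  moreover have "nrm V (l \<ominus> l') \<le> nrm V (x n \<ominus> l) + nrm V (x n \<ominus> l')" for n
    using nrm_diff_triangle[of l "x n" l'] nrm_diff_comm[of l "x n"] assms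
    by (simp add: converges_def)
  ultimately have "nrm V (l \<ominus> l') \<le> 0"
    by (intro LIMSEQ_le_const[of _ 0]) auto
  then show ?thesis using assms by (auto simp: converges_def intro: antisym)
qed

lemma converges_nrm:
  assumes "converges V x l" "\<And>n. x n \<in> carrier V"
  shows "(\<lambda>n. nrm V (x n)) \<longlonglongrightarrow> nrm V l"
proof -
  have l: "l \<in> carrier V" using assms by (simp add: converges_def)
  have "(\<lambda>n. nrm V (x n) - nrm V l) \<longlonglongrightarrow> 0"
    by (rule tendsto_0_le[where K=1 and f="\<lambda>n. nrm V (x n \<ominus> l)"])
       (use assms abs_nrm_diff[OF _ l] l in \<open>auto simp: converges_def\<close>)
  then show ?thesis by (simp add: LIM_zero_iff)
qed

lemma converges_add:
  assumes "converges V x l" "converges V y k" "\<And>n. x n \<in> carrier V" "\<And>n. y n \<in> carrier V"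
  shows "converges V (\<lambda>n. x n \<oplus> y n) (l \<oplus> k)"
proof -
  have c: "l \<in> carrier V" "k \<in> carrier V" using assms by (simp_all add: converges_def)
  have "(\<lambda>n. nrm V (x n \<ominus> l) + nrm V (y n \<ominus> k)) \<longlonglongrightarrow> 0"
    using assms by (auto simp: converges_def intro: tendsto_add_zero)
  then have "(\<lambda>n. nrm V (x n \<oplus> y n \<ominus> (l \<oplus> k))) \<longlonglongrightarrow> 0"
    by (rule tendsto_0_le[where K=1])
      (use nrm_add_diff[OF assms(3,4) c] assms c in auto)
  then show ?thesis using c by (simp add: converges_def)
qed

lemma converges_smult:
  assumes "converges V x l" "\<And>n. x n \<in> carrier V"
  shows "converges V (\<lambda>n. c \<odot> x n) (c \<odot> l)"
  using assms tendsto_mult_right_zero[of "\<lambda>n. nrm V (x n \<ominus> l)" sequentially "cmod c"]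
  by (auto simp: converges_def nrm_sm_diff)

lemma converges_minus:
  assumes "converges V x l" "converges V y k" "\<And>n. x n \<in> carrier V" "\<And>n. y n \<in> carrier V"
  shows "converges V (\<lambda>n. x n \<ominus> y n) (l \<ominus> k)"
  using converges_add[OF assms(1) converges_smult[OF assms(2,4), of "-1"]] assms
  by (simp add: neg_eq[symmetric] minus_eq converges_def)

lemma converges_const: "l \<in> carrier V \<Longrightarrow> converges V (\<lambda>n. l) l"
  by (simp add: converges_def)

lemma converges_eventually_const:
  assumes "converges V x l" "\<And>n. n \<ge> N \<Longrightarrow> x n = k"
  shows "nrm V (k \<ominus> l) = 0"
proof -
  have "(\<lambda>n. nrm V (x n \<ominus> l)) \<longlonglongrightarrow> 0" using assms by (simp add: converges_def)
  then have "(\<lambda>n. nrm V (x (n + N) \<ominus> l)) \<longlonglongrightarrow> 0" by (rule LIMSEQ_ignore_initial_segment)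
  then have "(\<lambda>n::nat. nrm V (k \<ominus> l)) \<longlonglongrightarrow> 0" by (simp add: assms(2))
  then show ?thesis by (simp add: LIMSEQ_const_iff)
qed

lemma converges_scalar:
  assumes "c \<longlonglongrightarrow> d" "x \<in> carrier V"
  shows "converges V (\<lambda>n. c n \<odot> x) (d \<odot> x)"
proof -
  have "(\<lambda>n. cmod (c n - d) * nrm V x) \<longlonglongrightarrow> 0"
    using assms(1) by (intro tendsto_mult_left_zero tendsto_norm_zero LIM_zero)
  then show ?thesis using assms(2)
    by (simp add: converges_def sm_diff_l[symmetric] nrm_smult)
qed

lemma nrm_finsum_diff_le: "f \<in> A \<rightarrow> carrier V \<Longrightarrow> g \<in> A \<rightarrow> carrier V \<Longrightarrow>
    nrm V (finsum V f A \<ominus> finsum V g A) \<le> (\<Sum>i\<in>A. nrm V (f i \<ominus> g i))"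
proof (induction A rule: infinite_finite_induct)
  case (insert x F)
  then have c: "f x \<in> carrier V" "g x \<in> carrier V" "finsum V f F \<in> carrier V" "finsum V g F \<in> carrier V"
      "f \<in> F \<rightarrow> carrier V" "g \<in> F \<rightarrow> carrier V"
    by (auto intro!: finsum_closed)
  from insert nrm_add_diff[OF c(1,3,2,4)] c show ?case
    by (simp add: finsum_insert)
qed (simp_all add: finsum_infinite finsum_empty)

lemma finsum_smult_left: "v \<in> carrier V \<Longrightarrow> finsum V (\<lambda>k. c k \<odot> v) A = sum c A \<odot> v"
proof (induction A rule: infinite_finite_induct)
  case (insert x F)
  then show ?case by (simp add: finsum_insert Pi_def sm_add_l)
qed (simp_all add: finsum_infinite finsum_empty)

lemma cauchy_if_converges:
  assumes "converges V x l" "\<And>n. x n \<in> carrier V"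
  shows "cauchy_seq V x"
  unfolding cauchy_seq_def
proof (intro conjI allI impI)
  fix e :: real assume "e > 0"
  have l: "l \<in> carrier V" using assms by (simp add: converges_def)
  have "(\<lambda>n. nrm V (x n \<ominus> l)) \<longlonglongrightarrow> 0" using assms by (simp add: converges_def)
  from LIMSEQ_D[OF this, of "e/2"] \<open>e > 0\<close>
  obtain N where N: "\<And>n. n \<ge> N \<Longrightarrow> nrm V (x n \<ominus> l) < e/2" by fastforce
  show "\<exists>N. \<forall>m\<ge>N. \<forall>n\<ge>N. nrm V (x m \<ominus> x n) < e"
  proof (intro exI allI impI)
    fix m n assume "m \<ge> N" "n \<ge> N"
    with N[of m] N[of n] nrm_diff_triangle[of "x m" l "x n"] nrm_diff_comm[of l "x n"] assms(2) l
    show "nrm V (x m \<ominus> x n) < e" by auto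
  qed
qed (use assms in simp)

end

lemma (in complex_normed_space) Metric_space_ndist: "Metric_space (carrier V) (ndist V)"
proof
  fix x y z
  show "0 \<le> ndist V x y" "ndist V x y = ndist V y x"
    by (auto simp: ndist_def nrm_diff_comm)
  assume "x \<in> carrier V" "y \<in> carrier V"
  then show "(ndist V x y = 0) = (x = y)"
    by (auto simp: ndist_def nrm_eq_0 intro: eq_if_diff_zero)
  assume "z \<in> carrier V"
  with \<open>x \<in> carrier V\<close> \<open>y \<in> carrier V\<close> show "ndist V x z \<le> ndist V x y + ndist V y z"
    by (simp add: ndist_def nrm_diff_triangle)
qed

lemma (in complex_normed_space) MCauchy_iff:
  "Metric_space.MCauchy (carrier V) (ndist V) x \<longleftrightarrow> cauchy_seq V x"
proof -
  interpret Metric_space "carrier V" "ndist V" by (rule Metric_space_ndist)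
  show ?thesis
    by (auto simp: MCauchy_def cauchy_seq_def ndist_def image_subset_iff)
qed

lemma (in complex_banach_space) seq_complete: "seq_complete V"
  unfolding seq_complete_def
proof (intro allI impI)
  interpret Metric_space "carrier V" "ndist V" by (rule Metric_space_ndist)
  fix x assume x: "cauchy_seq V x"
  then obtain l where "limitin mtopology x l sequentially"
    using complete by (auto simp: mcomplete_def MCauchy_iff)
  then have l: "l \<in> carrier V" "(\<lambda>n. ndist V (x n) l) \<longlonglongrightarrow> 0"
    by (auto simp: limitin_metric_dist_null)
  moreover have "ndist V (x n) l = nrm V (x n \<ominus> l)" for n
    using x l by (simp add: ndist_def cauchy_seq_def)
  ultimately show "\<exists>l. converges V x l" by (auto simp: converges_def)
qed

section \<open>Linear maps and bounded operators\<close>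

definition linear_map :: "'a cnormed \<Rightarrow> 'b cnormed \<Rightarrow> ('a \<Rightarrow> 'b) \<Rightarrow> bool" where
  "linear_map V W h \<longleftrightarrow> h \<in> carrier V \<rightarrow> carrier W \<and>
     (\<forall>x\<in>carrier V. \<forall>y\<in>carrier V. h (x \<oplus>\<^bsub>V\<^esub> y) = h x \<oplus>\<^bsub>W\<^esub> h y) \<and>
     (\<forall>c. \<forall>x\<in>carrier V. h (c \<odot>\<^bsub>V\<^esub> x) = c \<odot>\<^bsub>W\<^esub> h x)"

lemma linear_mapD:
  assumes "linear_map V W h"
  shows "x \<in> carrier V \<Longrightarrow> h x \<in> carrier W"
    and "x \<in> carrier V \<Longrightarrow> y \<in> carrier V \<Longrightarrow> h (x \<oplus>\<^bsub>V\<^esub> y) = h x \<oplus>\<^bsub>W\<^esub> h y"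
    and "x \<in> carrier V \<Longrightarrow> h (c \<odot>\<^bsub>V\<^esub> x) = c \<odot>\<^bsub>W\<^esub> h x"
  using assms by (auto simp: linear_map_def)

lemma linear_map_comp: "linear_map V W h \<Longrightarrow> linear_map W U g \<Longrightarrow> linear_map V U (\<lambda>x. g (h x))"
  by (auto simp: linear_map_def Pi_iff)

lemma linear_map_zero_diff:
  assumes "complex_seminormed_space V" "complex_seminormed_space W" "linear_map V W h"
  shows "h \<zero>\<^bsub>V\<^esub> = \<zero>\<^bsub>W\<^esub>"
    and "x \<in> carrier V \<Longrightarrow> y \<in> carrier V \<Longrightarrow> h (x \<ominus>\<^bsub>V\<^esub> y) = h x \<ominus>\<^bsub>W\<^esub> h y"
    and "x \<in> carrier V \<Longrightarrow> h (\<ominus>\<^bsub>V\<^esub> x) = \<ominus>\<^bsub>W\<^esub> h x"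
proof -
  interpret V: complex_seminormed_space V by fact
  interpret W: complex_seminormed_space W by fact
  note h = linear_mapD[OF assms(3)]
  show "h \<zero>\<^bsub>V\<^esub> = \<zero>\<^bsub>W\<^esub>" using h(3)[of "\<zero>\<^bsub>V\<^esub>" 0] h(1) by simp
  show n: "h (\<ominus>\<^bsub>V\<^esub> x) = \<ominus>\<^bsub>W\<^esub> h x" if "x \<in> carrier V" for x
    using h(3)[of x "-1"] h(1) that by (simp add: V.neg_eq W.neg_eq)
  show "h (x \<ominus>\<^bsub>V\<^esub> y) = h x \<ominus>\<^bsub>W\<^esub> h y" if "x \<in> carrier V" "y \<in> carrier V"
    using that by (simp add: V.minus_eq W.minus_eq h n)
qed

lemma linear_map_finsum:
  assumes "complex_seminormed_space V" "complex_seminormed_space W" "linear_map V W h"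
    and "f \<in> A \<rightarrow> carrier V"
  shows "h (finsum V f A) = finsum W (\<lambda>i. h (f i)) A"
proof -
  interpret V: complex_seminormed_space V by fact
  interpret W: complex_seminormed_space W by fact
  note h = linear_mapD[OF assms(3)]
  show ?thesis using assms(4)
  proof (induction A rule: infinite_finite_induct)
    case (insert x F)
    then have "(\<lambda>i. h (f i)) \<in> F \<rightarrow> carrier W" "f \<in> F \<rightarrow> carrier V" "f x \<in> carrier V" using h(1) by auto
    with insert show ?case by (simp add: V.finsum_insert W.finsum_insert h)
  qed (simp_all add: V.finsum_infinite W.finsum_infinite V.finsum_empty W.finsum_empty
      linear_map_zero_diff(1)[OF assms(1-3)])
qed

lemma converges_linear_map:
  assumes "complex_seminormed_space V" "complex_seminormed_space W" "linear_map V W h"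
    and "\<And>x. x \<in> carrier V \<Longrightarrow> nrm W (h x) \<le> K * nrm V x"
    and "converges V x l" "\<And>n. x n \<in> carrier V"
  shows "converges W (\<lambda>n. h (x n)) (h l)"
proof -
  interpret V: complex_seminormed_space V by fact
  interpret W: complex_seminormed_space W by fact
  note h = linear_mapD[OF assms(3)] linear_map_zero_diff[OF assms(1-3)]
  have l: "l \<in> carrier V" "(\<lambda>n. nrm V (x n \<ominus>\<^bsub>V\<^esub> l)) \<longlonglongrightarrow> 0" using assms by (simp_all add: converges_def)
  have "(\<lambda>n. K * nrm V (x n \<ominus>\<^bsub>V\<^esub> l)) \<longlonglongrightarrow> 0" using l(2) by (rule tendsto_mult_right_zero)
  then have "(\<lambda>n. nrm W (h (x n) \<ominus>\<^bsub>W\<^esub> h l)) \<longlonglongrightarrow> 0"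
  proof (rule tendsto_0_le[where K=1], intro eventuallyI)
    fix n
    have "nrm W (h (x n) \<ominus>\<^bsub>W\<^esub> h l) \<le> K * nrm V (x n \<ominus>\<^bsub>V\<^esub> l)"
      using assms(4)[of "x n \<ominus>\<^bsub>V\<^esub> l"] l(1) assms(6) by (simp add: h)
    then show "norm (nrm W (h (x n) \<ominus>\<^bsub>W\<^esub> h l)) \<le> norm (K * nrm V (x n \<ominus>\<^bsub>V\<^esub> l)) * 1"
      using l(1) assms(6) h(1) by simp
  qed
  with l(1) h(1) show ?thesis by (simp add: converges_def)
qed

lemma bounded_opsD:
  assumes "T \<in> bounded_ops V W"
  shows "linear_map V W T" "T \<in> extensional (carrier V)" "\<exists>K. \<forall>x\<in>carrier V. nrm W (T x) \<le> K * nrm V x"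
  using assms by (auto simp: bounded_ops_def linear_map_def PiE_def)

lemma bounded_opsI:
  assumes "linear_map V W T" "T \<in> extensional (carrier V)" "\<And>x. x \<in> carrier V \<Longrightarrow> nrm W (T x) \<le> K * nrm V x"
  shows "T \<in> bounded_ops V W"
  using assms by (auto simp: bounded_ops_def linear_map_def PiE_def)

lemma opnorm_bounds:
  assumes "complex_seminormed_space V" "complex_seminormed_space W" "T \<in> bounded_ops V W"
  shows "0 \<le> opnorm V W T"
    and "x \<in> carrier V \<Longrightarrow> nrm W (T x) \<le> opnorm V W T * nrm V x"
proof -
  interpret V: complex_seminormed_space V by fact
  interpret W: complex_seminormed_space W by fact
  note T = bounded_opsD[OF assms(3)]
  note L = linear_mapD[OF T(1)]
  obtain K where K: "\<And>x. x \<in> carrier V \<Longrightarrow> nrm W (T x) \<le> K * nrm V x" using T(3) by auto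
  have bdd: "bdd_above ((\<lambda>x. nrm W (T x)) ` {x \<in> carrier V. nrm V x \<le> 1})"
  proof (rule bdd_aboveI2)
    fix x assume "x \<in> {x \<in> carrier V. nrm V x \<le> 1}"
    then have x: "x \<in> carrier V" "nrm V x \<le> 1" by auto
    have "K * nrm V x \<le> \<bar>K\<bar> * 1" using x by (intro mult_mono) auto
    with K[OF x(1)] show "nrm W (T x) \<le> \<bar>K\<bar>" by simp
  qed
  have le: "nrm W (T x) \<le> opnorm V W T" if "x \<in> carrier V" "nrm V x \<le> 1" for x
    unfolding opnorm_def by (rule cSUP_upper[OF _ bdd]) (use that in auto)
  from le[of "\<zero>\<^bsub>V\<^esub>"] L(1) show "0 \<le> opnorm V W T"
    by (simp add: linear_map_zero_diff(1)[OF assms(1,2) T(1)])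
  show "nrm W (T x) \<le> opnorm V W T * nrm V x" if x: "x \<in> carrier V"
  proof (cases "nrm V x = 0")
    case True
    then show ?thesis using K[OF x] by simp
  next
    case False
    then have p: "nrm V x > 0" using x V.nrm_nonneg[OF x] by linarith
    let ?c = "of_real (1 / nrm V x) :: complex"
    have "nrm W (T (?c \<odot>\<^bsub>V\<^esub> x)) \<le> opnorm V W T"
      by (rule le) (use x p in \<open>auto simp: V.nrm_smult norm_divide\<close>)
    then have "nrm W (T x) / nrm V x \<le> opnorm V W T"
      using x p L(1) by (simp add: L(3) W.nrm_smult norm_divide)
    then show ?thesis using p by (simp add: field_simps)
  qed
qed

lemma opnorm_leI:
  assumes "complex_seminormed_space V" and "K \<ge> 0"
    and "\<And>x. x \<in> carrier V \<Longrightarrow> nrm W (T x) \<le> K * nrm V x"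
  shows "opnorm V W T \<le> K"
proof -
  interpret V: complex_seminormed_space V by fact
  show ?thesis unfolding opnorm_def
  proof (rule cSUP_least)
    show "{x \<in> carrier V. nrm V x \<le> 1} \<noteq> {}"
      by (auto intro!: exI[of _ "\<zero>\<^bsub>V\<^esub>"])
    fix x assume "x \<in> {x \<in> carrier V. nrm V x \<le> 1}"
    then have "nrm W (T x) \<le> K * nrm V x" "K * nrm V x \<le> K * 1"
      using assms by (auto intro: mult_left_mono simp del: mult_1_right)
    then show "nrm W (T x) \<le> K" by simp
  qed
qed

section \<open>Polynomials of an operator\<close>

lemma poly_op_eq:
  assumes "x \<in> carrier V"
  shows "poly_op V p T x = finsum V (\<lambda>k. coeff p k \<odot>\<^bsub>V\<^esub> (T ^^ k) x) {..degree p}"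
  using assms by (simp add: poly_op_def)

context complex_seminormed_space
begin

lemma funpow_closed:
  assumes "linear_map V V T" "x \<in> carrier V"
  shows "(T ^^ k) x \<in> carrier V"
  using linear_mapD(1)[OF assms(1)] assms(2) by (induction k) auto

lemma funpow_linear:
  assumes "linear_map V V T"
  shows "linear_map V V (T ^^ k)"
proof (induction k)
  case 0
  show ?case by (simp add: linear_map_def)
next
  case (Suc k)
  have "(T ^^ Suc k) = (\<lambda>x. T ((T ^^ k) x))" by auto
  with linear_map_comp[OF Suc assms] show ?case by simp
qed

lemma poly_op_closed:
  assumes "linear_map V V T" "x \<in> carrier V"
  shows "poly_op V p T x \<in> carrier V"
  using assms by (simp add: poly_op_eq finsum_closed Pi_def funpow_closed)

lemma poly_op_add:
  assumes "linear_map V V T" "x \<in> carrier V" "y \<in> carrier V"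
  shows "poly_op V p T (x \<oplus> y) = poly_op V p T x \<oplus> poly_op V p T y"
proof -
  have "poly_op V p T (x \<oplus> y) =
      finsum V (\<lambda>k. coeff p k \<odot> (T ^^ k) x \<oplus> coeff p k \<odot> (T ^^ k) y) {..degree p}"
    using assms by (simp add: poly_op_eq linear_mapD(2)[OF funpow_linear] funpow_closed sm_add_r)
  also have "\<dots> = poly_op V p T x \<oplus> poly_op V p T y"
    using assms by (simp add: poly_op_eq finsum_addf Pi_def funpow_closed)
  finally show ?thesis .
qed

lemma poly_op_eigenvector:
  assumes "linear_map V V T" "x \<in> carrier V" "T x = c \<odot> x"
  shows "poly_op V p T x = poly p c \<odot> x"
proof -
  have pow: "(T ^^ k) x = c ^ k \<odot> x" for k
    by (induction k) (use assms in \<open>auto simp: linear_mapD(3) sm_assoc mult.commute\<close>)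
  show ?thesis
    using assms(2) by (simp add: poly_op_eq pow sm_assoc finsum_smult_left poly_altdef)
qed

text \<open>
  For a contraction \<open>T\<close>, the identity \<open>T\<^sup>k - 1 = (1 + T + \<dots> + T\<^sup>k\<^sup>-\<^sup>1)(T - 1)\<close> bounds \<open>T\<^sup>k x - x\<close> by
  \<open>k\<close> times the norm of \<open>T x - x\<close>. So a vector that is nearly fixed by \<open>T\<close> is nearly an
  eigenvector of \<open>p(T)\<close>, for the eigenvalue \<open>p(1)\<close>.
\<close>

lemma poly_op_approx_eigenvector:
  assumes "linear_map V V T" "x \<in> carrier V" and contr: "\<And>y. y \<in> carrier V \<Longrightarrow> nrm V (T y) \<le> nrm V y"
  shows "nrm V (poly_op V p T x \<ominus> poly p 1 \<odot> x)
      \<le> (\<Sum>k\<le>degree p. cmod (coeff p k) * real k) * nrm V (T x \<ominus> x)"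
proof -
  note T = linear_mapD[OF assms(1)]
  note Td = linear_map_zero_diff[OF seminormed seminormed assms(1)]
  have pow: "nrm V ((T ^^ k) x \<ominus> x) \<le> real k * nrm V (T x \<ominus> x)" for k
  proof (induction k)
    case 0
    show ?case using assms by simp
  next
    case (Suc k)
    have c: "(T ^^ k) x \<in> carrier V" "T x \<in> carrier V"
      using T assms(2) funpow_closed[OF assms(1,2)] by auto
    have "nrm V ((T ^^ Suc k) x \<ominus> x) \<le> nrm V (T ((T ^^ k) x) \<ominus> T x) + nrm V (T x \<ominus> x)"
      using nrm_diff_triangle[of "T ((T ^^ k) x)" "T x" x] T c assms by simp
    also have "T ((T ^^ k) x) \<ominus> T x = T ((T ^^ k) x \<ominus> x)" using c assms by (simp add: Td)
    also have "nrm V (T ((T ^^ k) x \<ominus> x)) \<le> nrm V ((T ^^ k) x \<ominus> x)" using c assms by (intro contr) auto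
    finally show ?case using Suc by (simp add: algebra_simps)
  qed
  have "poly p 1 \<odot> x = finsum V (\<lambda>k. coeff p k \<odot> x) {..degree p}"
    using assms(2) by (simp add: finsum_smult_left poly_altdef)
  then have "nrm V (poly_op V p T x \<ominus> poly p 1 \<odot> x)
      \<le> (\<Sum>k\<le>degree p. nrm V (coeff p k \<odot> (T ^^ k) x \<ominus> coeff p k \<odot> x))"
    using assms by (simp add: poly_op_eq) (rule nrm_finsum_diff_le, auto simp: funpow_closed)
  also have "\<dots> \<le> (\<Sum>k\<le>degree p. cmod (coeff p k) * (real k * nrm V (T x \<ominus> x)))"
    using assms by (intro sum_mono) (simp add: nrm_sm_diff funpow_closed mult_left_mono pow)
  finally show ?thesis by (simp add: sum_distrib_right mult.assoc)
qed

end

text \<open>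
  By the fundamental theorem of calculus, increments of \<open>p\<close> along an increasing sequence are
  bounded by integrals of \<open>|p'|\<close> over adjacent intervals.
\<close>

lemma cmod_poly_diff_le_integral:
  fixes p :: "complex poly" and r s :: real
  assumes "r \<le> s"
  shows "cmod (poly p (of_real s) - poly p (of_real r))
      \<le> integral {r..s} (\<lambda>t. cmod (poly (pderiv p) (of_real t)))"
proof -
  have "((\<lambda>t. poly p (of_real t)) has_vector_derivative poly (pderiv p) (of_real t)) (at t within {r..s})" for t :: real
  proof -
    have "((\<lambda>z. poly p z) has_field_derivative poly (pderiv p) (of_real t)) (at (of_real t))"
      by (rule poly_DERIV)
    from has_vector_derivative_real_field[OF this] show ?thesis
      by (simp add: o_def has_vector_derivative_at_within)
  qed
  then have I: "((\<lambda>t. poly (pderiv p) (of_real t)) has_integral poly p (of_real s) - poly p (of_real r)) {r..s}"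
    using assms by (intro fundamental_theorem_of_calculus) auto
  have "norm (integral {r..s} (\<lambda>t. poly (pderiv p) (complex_of_real t)))
      \<le> integral {r..s} (\<lambda>t. cmod (poly (pderiv p) (of_real t)))"
    by (rule integral_norm_bound_integral)
       (auto intro!: integrable_continuous_interval continuous_intros)
  with integral_unique[OF I] show ?thesis by simp
qed

lemma sum_poly_increments_le_integral:
  fixes p :: "complex poly" and t :: "nat \<Rightarrow> real"
  assumes "t 0 = a" "\<And>n. t n \<le> t (Suc n)" "\<And>n. t n \<le> b"
  shows "(\<Sum>n<N. cmod (poly p (of_real (t (Suc n))) - poly p (of_real (t n))))
      \<le> integral {a..b} (\<lambda>t. cmod (poly (pderiv p) (of_real t)))"
proof -
  let ?g = "\<lambda>t. cmod (poly (pderiv p) (complex_of_real t))"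
  have int: "?g integrable_on {r..s}" for r s
    by (auto intro!: integrable_continuous_interval continuous_intros)
  have mono: "a \<le> t n" for n
    using assms(1,2) by (induction n) (auto intro: order_trans)
  have "(\<Sum>n<N. cmod (poly p (of_real (t (Suc n))) - poly p (of_real (t n)))) \<le> integral {a..t N} ?g"
  proof (induction N)
    case 0
    then show ?case using assms by simp
  next
    case (Suc N)
    then show ?case
      using cmod_poly_diff_le_integral[OF assms(2), of p N]
        Henstock_Kurzweil_Integration.integral_combine[OF mono assms(2) int, of N] by simp
  qed
  also have "\<dots> \<le> integral {a..b} ?g"
    using assms(3) int by (intro integral_subset_le) auto
  finally show ?thesis .
qed

section \<open>Well-bounded operators from decreasing projections\<close>

text \<open>
  The setting for the operator \<open>T\<close> below. A vector on which the projections do not converge is what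
  will rule out type (B).
\<close>

locale decreasing_projections = complex_banach_space +
  fixes R :: "nat \<Rightarrow> 'a \<Rightarrow> 'a"
  assumes R_linear: "linear_map V V (R n)"
    and R_nrm: "x \<in> carrier V \<Longrightarrow> nrm V (R n x) \<le> nrm V x"
    and R_R: "x \<in> carrier V \<Longrightarrow> R m (R n x) = R (max m n) x"
    and R_0: "x \<in> carrier V \<Longrightarrow> R 0 x = x"
begin

lemmas R_simps = linear_mapD[OF R_linear] linear_map_zero_diff[OF seminormed seminormed R_linear]

text \<open>
  The operator is \<open>T = \<Sum>n. 2\<^sup>-\<^sup>(\<^sup>n\<^sup>+\<^sup>1\<^sup>) R n\<close>. The projection \<open>R m\<close> is the identity on the range of
  \<open>R n - R (n+1)\<close> for \<open>m \<le> n\<close> and vanishes there for \<open>m > n\<close>. So \<open>T\<close> acts on this range as the sum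
  of its first \<open>n + 1\<close> weights, which is \<open>\<sigma> (n+1)\<close> below. These eigenvalues increase to \<open>1\<close>.
\<close>

primrec partial :: "nat \<Rightarrow> 'a \<Rightarrow> 'a" where
  "partial 0 x = \<zero>"
| "partial (Suc n) x = partial n x \<oplus> of_real ((1/2) ^ Suc n) \<odot> R n x"

definition T :: "'a \<Rightarrow> 'a" where
  "T = (\<lambda>x\<in>carrier V. SOME l. converges V (\<lambda>n. partial n x) l)"

lemma partial_closed [simp]: "x \<in> carrier V \<Longrightarrow> partial n x \<in> carrier V"
  by (induction n) (auto simp: R_simps)

lemma partial_linear: "linear_map V V (partial n)"
proof -
  have "partial n (x \<oplus> y) = partial n x \<oplus> partial n y" if "x \<in> carrier V" "y \<in> carrier V" for x y
    by (induction n) (use that in \<open>simp_all add: R_simps sm_add_r a_ac\<close>)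
  moreover have "partial n (c \<odot> x) = c \<odot> partial n x" if "x \<in> carrier V" for x c
    by (induction n) (use that in \<open>simp_all add: R_simps sm_add_r sm_assoc mult.commute\<close>)
  ultimately show ?thesis by (auto simp: linear_map_def)
qed

lemma nrm_partial: "x \<in> carrier V \<Longrightarrow> nrm V (partial n x) \<le> (1 - (1/2)^n) * nrm V x"
proof (induction n)
  case (Suc n)
  have "nrm V (partial (Suc n) x) \<le> nrm V (partial n x) + nrm V (of_real ((1/2) ^ Suc n) \<odot> R n x)"
    using Suc by (simp add: nrm_triangle R_simps)
  also have "nrm V (of_real ((1/2) ^ Suc n) \<odot> R n x) \<le> (1/2)^Suc n * nrm V x"
    using R_nrm[OF Suc.prems, of n] Suc.prems
    by (simp add: nrm_smult R_simps norm_mult norm_divide norm_power power_divide divide_right_mono)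
  finally show ?case using Suc by (simp add: algebra_simps)
qed simp

lemma partial_converges: "x \<in> carrier V \<Longrightarrow> converges V (\<lambda>n. partial n x) (T x)"
proof -
  assume x: "x \<in> carrier V"
  have "cauchy_seq V (\<lambda>n. partial n x)"
  proof (rule cauchy_if_geometric[where C="nrm V x"])
    fix n
    have "partial (Suc n) x \<ominus> partial n x = of_real ((1/2) ^ Suc n) \<odot> R n x"
      using x by (subst diff_eq_iff) (auto simp: R_simps a_comm)
    then have "nrm V (partial (Suc n) x \<ominus> partial n x) \<le> (1/2) ^ Suc n * nrm V x"
      using R_nrm[OF x, of n] x
      by (simp add: nrm_smult R_simps norm_mult norm_divide norm_power power_divide divide_right_mono del: partial.simps)
    also have "\<dots> \<le> nrm V x * (1/2)^n" using x by (simp add: field_simps)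
    finally show "nrm V (partial (Suc n) x \<ominus> partial n x) \<le> nrm V x * (1/2)^n" .
  qed (use x in auto)
  then have "\<exists>l. converges V (\<lambda>n. partial n x) l"
    using seq_complete by (simp add: seq_complete_def)
  then show ?thesis using x by (simp add: T_def someI_ex)
qed

lemma T_closed [simp]: "x \<in> carrier V \<Longrightarrow> T x \<in> carrier V"
  using partial_converges by (simp add: converges_def)

lemma limit_unique:
  "converges V x l \<Longrightarrow> converges V x l' \<Longrightarrow> (\<And>n. x n \<in> carrier V) \<Longrightarrow> l = l'"
  using converges_unique_nrm[of x l l'] eq_if_diff_zero[of l l'] nrm_eq_0[of "l \<ominus> l'"]
  by (auto simp: converges_def)

lemma T_linear: "linear_map V V T"
proof -
  note P = linear_mapD[OF partial_linear]
  have "T (x \<oplus> y) = T x \<oplus> T y" if "x \<in> carrier V" "y \<in> carrier V" for x y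
    by (rule limit_unique[OF partial_converges])
      (use that converges_add[OF partial_converges[of x] partial_converges[of y]] in \<open>auto simp: P\<close>)
  moreover have "T (c \<odot> x) = c \<odot> T x" if "x \<in> carrier V" for x c
    by (rule limit_unique[OF partial_converges])
      (use that converges_smult[OF partial_converges[of x]] in \<open>auto simp: P\<close>)
  ultimately show ?thesis by (auto simp: linear_map_def)
qed

lemmas T_simps = linear_mapD(2,3)[OF T_linear] linear_map_zero_diff[OF seminormed seminormed T_linear]

lemma nrm_T: "x \<in> carrier V \<Longrightarrow> nrm V (T x) \<le> nrm V x"
proof -
  assume x: "x \<in> carrier V"
  have "nrm V (partial n x) \<le> nrm V x" for n
  proof -
    have "(1 - (1/2)^n) * nrm V x \<le> 1 * nrm V x" using x by (intro mult_right_mono) auto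
    with nrm_partial[OF x, of n] show ?thesis by simp
  qed
  then show ?thesis
    by (intro LIMSEQ_le_const2[OF converges_nrm[OF partial_converges[OF x]]]) (use x in auto)
qed

lemma T_bounded: "T \<in> bounded_ops V V"
  by (rule bounded_opsI[OF T_linear, of 1]) (auto simp: nrm_T, simp add: T_def)

definition \<sigma> :: "nat \<Rightarrow> real" where "\<sigma> n = 1 - (1/2)^n"

lemma R_T_commute: "x \<in> carrier V \<Longrightarrow> T (R n x) = R n (T x)"
proof -
  assume x: "x \<in> carrier V"
  have "partial m (R n x) = R n (partial m x)" for m
    by (induction m) (use x in \<open>auto simp: R_simps R_R max.commute\<close>)
  moreover have "converges V (\<lambda>m. R n (partial m x)) (R n (T x))"
    by (rule converges_linear_map[OF seminormed seminormed R_linear _ partial_converges[OF x], of _ 1])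
       (use x R_nrm in auto)
  ultimately show ?thesis
    using limit_unique[OF partial_converges[of "R n x"]] x by (auto simp: R_simps)
qed

lemma T_eigenvector:
  assumes x: "x \<in> carrier V"
  shows "T (R n x \<ominus> R (Suc n) x) = of_real (\<sigma> (Suc n)) \<odot> (R n x \<ominus> R (Suc n) x)"
proof -
  let ?v = "R n x \<ominus> R (Suc n) x"
  have v: "?v \<in> carrier V" using x by (simp add: R_simps)
  have Rv: "R m ?v = (if m \<le> n then ?v else \<zero>)" for m
    using x by (auto simp: R_simps R_R max_def le_Suc_eq)
  have p: "partial m ?v = of_real (\<sigma> (min m (Suc n))) \<odot> ?v" for m
  proof (induction m)
    case (Suc m)
    show ?case
    proof (cases "m \<le> n")
      case True
      then have "partial (Suc m) ?v = of_real (\<sigma> m) \<odot> ?v \<oplus> of_real ((1/2)^Suc m) \<odot> ?v"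
        using Suc Rv[of m] by (simp add: min_def)
      also have "\<dots> = of_real (\<sigma> m + (1/2)^Suc m) \<odot> ?v" using v by (simp only: sm_add_l of_real_add)
      also have "\<sigma> m + (1/2)^Suc m = \<sigma> (Suc m)" by (simp add: \<sigma>_def)
      finally show ?thesis using True by (simp add: min_def)
    next
      case False
      then have "min m (Suc n) = Suc n" "min (Suc m) (Suc n) = Suc n" by auto
      then show ?thesis using False Suc Rv[of m] v by simp
    qed
  qed (use v in \<open>simp add: \<sigma>_def\<close>)
  have "nrm V (of_real (\<sigma> (Suc n)) \<odot> ?v \<ominus> T ?v) = 0"
    by (rule converges_eventually_const[OF partial_converges[OF v], of "Suc n"]) (simp add: p min_def)
  then show ?thesis
    using nrm_eq_0 v eq_if_diff_zero by (metis T_closed minus_closed sm_closed)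
qed

text \<open>
  On the range of \<open>R n\<close> the weights up to \<open>n\<close> act as scalars; all later weights together are at
  most \<open>2\<^sup>-\<^sup>n\<close> and each summand moves the vector by at most twice its norm.
\<close>

lemma T_approx_fix:
  assumes x: "x \<in> carrier V"
  shows "nrm V (T (R n x) \<ominus> R n x) \<le> 2 * (1/2)^n * nrm V x"
proof -
  let ?v = "R n x"
  have v: "?v \<in> carrier V" using x by (simp add: R_simps)
  have "nrm V (partial m ?v \<ominus> of_real (\<sigma> m) \<odot> ?v) \<le> 2 * ((1/2)^n - (1/2)^(max m n)) * nrm V x" for m
  proof (induction m)
    case 0
    show ?case using v by (simp add: \<sigma>_def)
  next
    case (Suc m)
    let ?w = "of_real ((1/2)^Suc m) :: complex"
    have "of_real (\<sigma> (Suc m)) \<odot> ?v = (of_real (\<sigma> m) + ?w) \<odot> ?v" by (simp add: \<sigma>_def)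
    also have "\<dots> = of_real (\<sigma> m) \<odot> ?v \<oplus> ?w \<odot> ?v" using v by (simp only: sm_add_l)
    finally have "nrm V (partial (Suc m) ?v \<ominus> of_real (\<sigma> (Suc m)) \<odot> ?v)
        \<le> nrm V (partial m ?v \<ominus> of_real (\<sigma> m) \<odot> ?v) + nrm V (?w \<odot> R m ?v \<ominus> ?w \<odot> ?v)"
      using nrm_add_diff[of "partial m ?v" "?w \<odot> R m ?v" "of_real (\<sigma> m) \<odot> ?v" "?w \<odot> ?v"] v
      by (simp add: R_simps del: of_real_power power_Suc)
    also have "nrm V (?w \<odot> R m ?v \<ominus> ?w \<odot> ?v) = (1/2)^Suc m * nrm V (R m ?v \<ominus> ?v)"
      using v by (simp add: nrm_sm_diff R_simps norm_mult norm_power norm_divide power_divide)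
    also have "\<dots> \<le> 2 * ((1/2)^(max m n) - (1/2)^(max (Suc m) n)) * nrm V x"
    proof (cases "m < n")
      case True
      then have "R m ?v = ?v" using x by (simp add: R_R max_def)
      then show ?thesis using v True by (simp add: max_def)
    next
      case False
      have "nrm V (R m ?v \<ominus> ?v) \<le> nrm V (R m ?v) + nrm V ?v" using v by (simp add: nrm_diff_le R_simps)
      also have "\<dots> \<le> 2 * nrm V x" using R_nrm[OF x, of n] R_nrm[OF v, of m] by simp
      finally show ?thesis using False by (simp add: max_def field_simps)
    qed
    finally show ?case using Suc by (simp add: algebra_simps)
  qed
  then have le: "nrm V (partial m ?v \<ominus> of_real (\<sigma> m) \<odot> ?v) \<le> 2 * (1/2)^n * nrm V x" for m
    by (rule order_trans) (use x in \<open>auto intro!: mult_right_mono\<close>)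
  have "(\<lambda>m. complex_of_real (\<sigma> m)) \<longlonglongrightarrow> of_real (1 - 0)"
    unfolding \<sigma>_def by (intro tendsto_of_real tendsto_diff tendsto_const LIMSEQ_realpow_zero) auto
  then have "converges V (\<lambda>m. of_real (\<sigma> m) \<odot> ?v) (1 \<odot> ?v)" using converges_scalar[of "\<lambda>m. of_real (\<sigma> m)" 1 ?v] v by simp
  from converges_minus[OF partial_converges[OF v] this]
  have "converges V (\<lambda>m. partial m ?v \<ominus> of_real (\<sigma> m) \<odot> ?v) (T ?v \<ominus> ?v)" using v by simp
  from converges_nrm[OF this] v le show ?thesis
    by (intro LIMSEQ_le_const2[where X="\<lambda>m. nrm V (partial m ?v \<ominus> of_real (\<sigma> m) \<odot> ?v)"]) auto
qed

lemma T_approx_fix_tendsto: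
  assumes x: "x \<in> carrier V"
  shows "(\<lambda>n. nrm V (T (R n x) \<ominus> R n x)) \<longlonglongrightarrow> 0"
proof -
  have "(\<lambda>n. 2 * (1/2)^n * nrm V x) \<longlonglongrightarrow> 0"
    by (intro tendsto_mult_left_zero tendsto_mult_right_zero LIMSEQ_realpow_zero) auto
  then show ?thesis
    by (rule tendsto_0_le[where K=1]) (use T_approx_fix[OF x] x in \<open>auto simp: R_simps\<close>)
qed

text \<open>
  The vectors \<open>R n x - R (n+1) x\<close> are eigenvectors, but their sum need not converge to \<open>x\<close>. The
  proof follows the errors \<open>g n = \<parallel>p(T) R n x - p(\<sigma> n) R n x\<parallel>\<close> instead. Splitting off one eigenvector
  shows that \<open>g n\<close> exceeds \<open>g (n+1)\<close> by at most \<open>|p(\<sigma> (n+1)) - p(\<sigma> n)| \<parallel>x\<parallel>\<close>, and \<open>g n\<close> tends to \<open>0\<close>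
  because \<open>T\<close> is close to the identity on the range of \<open>R n\<close>. Hence \<open>g 0\<close> is at most the variation
  of \<open>p\<close> along the \<open>\<sigma> n\<close>, times \<open>\<parallel>x\<parallel>\<close>.
\<close>

lemma poly_op_T_bound:
  assumes x: "x \<in> carrier V"
  shows "nrm V (poly_op V p T x) \<le> (cmod (poly p 0) +
      integral {0..1} (\<lambda>t. cmod (poly (pderiv p) (of_real t)))) * nrm V x"
proof -
  let ?P = "poly_op V p T" and ?I = "integral {0..1} (\<lambda>t. cmod (poly (pderiv p) (of_real t)))"
  define q where "q n = poly p (of_real (\<sigma> n))" for n
  have Rc [simp]: "R n x \<in> carrier V" for n using x by (simp add: R_simps)
  have Pc [simp]: "?P y \<in> carrier V" if "y \<in> carrier V" for y using poly_op_closed[OF T_linear that] .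
  have step: "?P (R n x) \<ominus> q (Suc n) \<odot> R n x = ?P (R (Suc n) x) \<ominus> q (Suc n) \<odot> R (Suc n) x" for n
  proof -
    let ?v = "R n x \<ominus> R (Suc n) x"
    have "?P (R n x) = ?P (?v \<oplus> R (Suc n) x)" by simp
    also have "\<dots> = q (Suc n) \<odot> ?v \<oplus> ?P (R (Suc n) x)"
      unfolding q_def using poly_op_eigenvector[OF T_linear _ T_eigenvector[OF x, of n], of p]
      by (subst poly_op_add[OF T_linear]) auto
    finally have "?P (R n x) = q (Suc n) \<odot> ?v \<oplus> ?P (R (Suc n) x)" .
    moreover have "q (Suc n) \<odot> R n x = q (Suc n) \<odot> ?v \<oplus> q (Suc n) \<odot> R (Suc n) x"
      by (subst sm_add_r[symmetric]) auto
    ultimately show ?thesis by (simp add: add_diff_add)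
  qed
  define g where "g n = nrm V (?P (R n x) \<ominus> q n \<odot> R n x)" for n
  have Rn: "nrm V (R n x) \<le> nrm V x" for n using R_nrm[OF x] .
  have gstep: "g n \<le> cmod (q (Suc n) - q n) * nrm V x + g (Suc n)" for n
  proof -
    have "g n \<le> nrm V (?P (R n x) \<ominus> q (Suc n) \<odot> R n x) + nrm V (q (Suc n) \<odot> R n x \<ominus> q n \<odot> R n x)"
      unfolding g_def by (rule nrm_diff_triangle) auto
    also have "nrm V (q (Suc n) \<odot> R n x \<ominus> q n \<odot> R n x) = cmod (q (Suc n) - q n) * nrm V (R n x)"
      by (simp add: sm_diff_l[symmetric] nrm_smult)
    also have "\<dots> \<le> cmod (q (Suc n) - q n) * nrm V x" using Rn by (intro mult_left_mono) auto
    finally show ?thesis by (simp add: step g_def)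
  qed
  have g0: "g 0 \<le> (\<Sum>n<N. cmod (q (Suc n) - q n)) * nrm V x + g N" for N
  proof (induction N)
    case (Suc N)
    with gstep[of N] show ?case by (simp add: algebra_simps)
  qed simp
  have gbound: "g n \<le> (\<Sum>k\<le>degree p. cmod (coeff p k) * real k) * nrm V (T (R n x) \<ominus> R n x)
      + cmod (poly p 1 - q n) * nrm V x" for n
  proof -
    have "g n \<le> nrm V (?P (R n x) \<ominus> poly p 1 \<odot> R n x) + nrm V (poly p 1 \<odot> R n x \<ominus> q n \<odot> R n x)"
      unfolding g_def by (rule nrm_diff_triangle) auto
    also have "nrm V (poly p 1 \<odot> R n x \<ominus> q n \<odot> R n x) = cmod (poly p 1 - q n) * nrm V (R n x)"
      by (simp add: sm_diff_l[symmetric] nrm_smult)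
    also have "\<dots> \<le> cmod (poly p 1 - q n) * nrm V x" using Rn by (intro mult_left_mono) auto
    finally show ?thesis using poly_op_approx_eigenvector[OF T_linear Rc nrm_T, of p n] by simp
  qed
  have "\<sigma> \<longlonglongrightarrow> 1 - 0"
    unfolding \<sigma>_def by (intro tendsto_diff tendsto_const LIMSEQ_realpow_zero) auto
  then have "q \<longlonglongrightarrow> poly p (of_real 1)"
    unfolding q_def by (intro tendsto_poly tendsto_of_real) simp
  then have "(\<lambda>n. poly p 1 - q n) \<longlonglongrightarrow> poly p 1 - poly p 1"
    by (intro tendsto_diff tendsto_const) simp
  then have "(\<lambda>n. cmod (poly p 1 - q n)) \<longlonglongrightarrow> 0" using tendsto_norm_zero by fastforce
  then have "(\<lambda>n. (\<Sum>k\<le>degree p. cmod (coeff p k) * real k) * nrm V (T (R n x) \<ominus> R n x)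
      + cmod (poly p 1 - q n) * nrm V x) \<longlonglongrightarrow> 0"
    by (intro tendsto_add_zero tendsto_mult_right_zero tendsto_mult_left_zero T_approx_fix_tendsto x)
  moreover have "g 0 - ?I * nrm V x \<le> (\<Sum>k\<le>degree p. cmod (coeff p k) * real k) * nrm V (T (R n x) \<ominus> R n x)
      + cmod (poly p 1 - q n) * nrm V x" for n
  proof -
    have "(\<Sum>n<n. cmod (q (Suc n) - q n)) \<le> ?I"
      unfolding q_def by (rule sum_poly_increments_le_integral) (auto simp: \<sigma>_def)
    then have "(\<Sum>n<n. cmod (q (Suc n) - q n)) * nrm V x \<le> ?I * nrm V x"
      using x by (intro mult_right_mono) auto
    with g0[of n] gbound[of n] show ?thesis by linarith
  qed
  ultimately have "g 0 - ?I * nrm V x \<le> 0" by (intro LIMSEQ_le_const[of _ 0]) auto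
  moreover have "g 0 = nrm V (?P x \<ominus> poly p 0 \<odot> x)"
    using x by (simp add: g_def q_def R_0 \<sigma>_def)
  moreover have "nrm V (?P x) \<le> nrm V (?P x \<ominus> poly p 0 \<odot> x) + nrm V (poly p 0 \<odot> x)"
    using x by (intro nrm_le_diff) auto
  ultimately show ?thesis using x by (simp add: nrm_smult algebra_simps)
qed

lemma T_well_bounded: "well_bounded V T"
  unfolding well_bounded_def
proof (intro conjI T_bounded exI allI)
  show "(0::real) \<le> 1" "(1::real) > 0" by auto
  fix p :: "complex poly"
  have "integral {0..1} (\<lambda>t. cmod (poly (pderiv p) (of_real t))) \<ge> 0"
    by (rule Henstock_Kurzweil_Integration.integral_nonneg) (auto intro!: integrable_continuous_interval continuous_intros)
  then show "opnorm V V (poly_op V p T) \<le> 1 * (cmod (poly p (of_real 0)) +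
      integral {0..1} (\<lambda>t. cmod (poly (pderiv p) (of_real t))))"
    using poly_op_T_bound[of _ p] by (intro opnorm_leI[OF seminormed]) auto
qed

text \<open>
  If \<open>R m\<close> fixes \<open>y\<close>, then \<open>y - R (m+1) y\<close> is an eigenvector for \<open>\<sigma> (m+1) < 1\<close>, while it is also
  fixed by \<open>T\<close>; so it vanishes.
\<close>

lemma fixed_by_R:
  assumes "y \<in> carrier V" "T y = y"
  shows "R m y = y"
proof (induction m)
  case 0
  show ?case using assms by (simp add: R_0)
next
  case (Suc m)
  let ?v = "y \<ominus> R (Suc m) y"
  have v: "?v \<in> carrier V" using assms by (simp add: R_simps)
  have "T ?v = of_real (\<sigma> (Suc m)) \<odot> ?v" using T_eigenvector[OF assms(1), of m] Suc by simp
  moreover have "T ?v = ?v" using assms by (simp add: T_simps R_simps R_T_commute)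
  ultimately have "1 \<odot> ?v \<ominus> of_real (\<sigma> (Suc m)) \<odot> ?v = \<zero>" using v by simp
  then have "(1 - of_real (\<sigma> (Suc m))) \<odot> ?v = \<zero>" using v by (simp only: sm_diff_l)
  then have "cmod (1 - of_real (\<sigma> (Suc m))) * nrm V ?v = 0" using v nrm_smult[OF v] nrm_zero by metis
  then have "nrm V ?v = 0" by (simp add: \<sigma>_def)
  then have "?v = \<zero>" using v nrm_eq_0 by blast
  then show ?case using assms eq_if_diff_zero by (metis R_simps(1))
qed

end

section \<open>Spectral families\<close>

lemma finite_set_is_partition:
  assumes "finite A" "a \<in> A" "b \<in> A" "A \<subseteq> {a..b}"
  shows "\<exists>n t. is_partition a b n t \<and> t ` {..n} = A"
proof -
  let ?l = "sorted_list_of_set A"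
  define n where "n = card A - 1"
  have card: "card A > 0" using assms by (auto simp: card_gt_0_iff)
  have len: "length ?l = Suc n" using card by (simp add: n_def)
  have set: "set ?l = A" using assms by simp
  have img: "(!) ?l ` {..n} = A"
    using set len by (auto simp: set_conv_nth image_iff lessThan_Suc_atMost[symmetric])
  have sm: "strict_mono_on {..n} ((!) ?l)"
    by (rule strict_mono_onI) (use len in \<open>auto intro: sorted_wrt_nth_less[of "(<)"]\<close>)
  have le: "?l ! i \<le> ?l ! j" if "i \<le> j" "j \<le> n" for i j
    using that len by (intro sorted_nth_mono) auto
  have bnd: "a \<le> ?l ! i" "?l ! i \<le> b" if "i \<le> n" for i
    using img that assms(4) by fastforce+
  have "?l ! 0 = a"
  proof -
    from img assms(2) obtain i where "i \<le> n" "?l ! i = a" by (metis imageE atMost_iff)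
    with le[of 0 i] bnd(1)[of 0] show ?thesis by simp
  qed
  moreover have "?l ! n = b"
  proof -
    from img assms(3) obtain i where "i \<le> n" "?l ! i = b" by (metis imageE atMost_iff)
    with le[of i n] bnd(2)[of n] show ?thesis by simp
  qed
  ultimately show ?thesis using sm img unfolding is_partition_def by blast
qed

lemma is_partitionD:
  assumes "is_partition a b n t"
  shows "a \<in> t ` {..n}" "b \<in> t ` {..n}" "t ` {..n} \<subseteq> {a..b}"
proof -
  have t: "t 0 = a" "t n = b" and sm: "strict_mono_on {..n} t"
    using assms by (auto simp: is_partition_def)
  show "a \<in> t ` {..n}" "b \<in> t ` {..n}" using t by auto
  show "t ` {..n} \<subseteq> {a..b}"
    using t strict_mono_on_leD[OF sm, of 0] strict_mono_on_leD[OF sm, of _ n] by fastforce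
qed

lemma common_refinement:
  assumes "is_partition a b m s" "is_partition a b m' s'"
  shows "\<exists>n t. is_partition a b n t \<and> s ` {..m} \<subseteq> t ` {..n} \<and> s' ` {..m'} \<subseteq> t ` {..n} \<and>
      (c \<in> {a..b} \<longrightarrow> c \<in> t ` {..n})"
proof -
  let ?A = "s ` {..m} \<union> s' ` {..m'} \<union> ({c} \<inter> {a..b})"
  have "finite ?A" by simp
  with finite_set_is_partition[of ?A a b] is_partitionD[OF assms(1)] is_partitionD[OF assms(2)]
  obtain n t where "is_partition a b n t" "t ` {..n} = ?A" by auto
  then show ?thesis by (intro exI[of _ n] exI[of _ t]) auto
qed

lemma (in complex_seminormed_space) add_diff_cancel_mid:
  assumes "x \<in> carrier V" "p \<in> carrier V" "q \<in> carrier V"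
  shows "x \<oplus> (p \<ominus> q) \<ominus> p = x \<ominus> q"
proof -
  have "x \<oplus> (p \<ominus> q) \<ominus> (\<zero> \<oplus> p) = (x \<ominus> \<zero>) \<oplus> ((p \<ominus> q) \<ominus> p)"
    using assms by (intro add_diff_add) auto
  also have "(p \<ominus> q) \<ominus> p = \<ominus> p \<oplus> (p \<oplus> \<ominus> q)"
    using assms by (simp add: minus_eq a_comm)
  also have "\<dots> = \<ominus> q" using assms by (simp add: r_neg1)
  finally show ?thesis using assms by (simp add: minus_eq)
qed

locale spectral_resolution = complex_banach_space +
  fixes F :: "real \<Rightarrow> 'a \<Rightarrow> 'a" and a b :: real and T :: "'a \<Rightarrow> 'a"
  assumes F: "spectral_family V F a b" and ab: "a \<le> b"
    and integral: "has_spectral_integral V F a b of_real T"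
    and T_linear: "linear_map V V T"
begin

lemma F_bounded_op: "F l \<in> bounded_ops V V"
  using F by (auto simp: spectral_family_def projections_def)

lemma F_linear: "linear_map V V (F l)"
  using bounded_opsD(1)[OF F_bounded_op] .

lemmas F_simps = linear_mapD[OF F_linear] linear_map_zero_diff[OF seminormed seminormed F_linear]
lemmas T_simps = linear_mapD[OF T_linear] linear_map_zero_diff[OF seminormed seminormed T_linear]

lemma F_F: "x \<in> carrier V \<Longrightarrow> F l (F m x) = F (min l m) x"
proof -
  assume x: "x \<in> carrier V"
  have "compose (carrier V) (F l) (F m) x = F (min l m) x"
    using F by (simp add: spectral_family_def)
  with x show ?thesis by (simp add: compose_def)
qed

lemma F_below: "x \<in> carrier V \<Longrightarrow> l \<le> a \<Longrightarrow> F l x = \<zero>"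
  using F by (cases "l = a") (auto simp: spectral_family_def zero_op_def)

lemma F_above: "x \<in> carrier V \<Longrightarrow> b \<le> l \<Longrightarrow> F l x = x"
  using F by (auto simp: spectral_family_def id_op_def)

definition M :: real where "M = (SUP l. opnorm V V (F l)) + 1"

lemma F_bound: "x \<in> carrier V \<Longrightarrow> nrm V (F l x) \<le> M * nrm V x"
  and M_ge: "M \<ge> 1"
proof -
  have bdd: "bdd_above (range (\<lambda>l. opnorm V V (F l)))" using F by (simp add: spectral_family_def)
  have le: "opnorm V V (F l) \<le> M - 1" for l
    unfolding M_def using cSUP_upper[OF UNIV_I bdd, of l] by simp
  with opnorm_bounds(1)[OF seminormed seminormed F_bounded_op, of l] show "M \<ge> 1" by (smt (verit))
  assume x: "x \<in> carrier V"
  have "nrm V (F l x) \<le> opnorm V V (F l) * nrm V x"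
    by (rule opnorm_bounds(2)[OF seminormed seminormed F_bounded_op x])
  also have "\<dots> \<le> M * nrm V x" using le[of l] x by (intro mult_right_mono) auto
  finally show "nrm V (F l x) \<le> M * nrm V x" .
qed

abbreviation S :: "nat \<Rightarrow> (nat \<Rightarrow> real) \<Rightarrow> 'a \<Rightarrow> 'a" where
  "S n t x \<equiv> stieltjes_sum V F of_real n t x"

lemma S_eq:
  assumes "is_partition a b n t" "x \<in> carrier V"
  shows "S n t x = finsum V (\<lambda>j. of_real (t j) \<odot> (F (t j) x \<ominus> F (t (j - 1)) x)) {1..n}"
  using assms F_below[of x a]
  by (simp add: stieltjes_sum_def is_partition_def finsum_closed Pi_def F_simps)

lemma integral_approx:
  assumes "x \<in> carrier V" "y \<in> carrier V" "e > 0"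
  obtains n t where "is_partition a b n t" "nrm V (S n t x \<ominus> T x) < e" "nrm V (S n t y \<ominus> T y) < e"
    "c \<in> {a..b} \<longrightarrow> c \<in> t ` {..n}"
proof -
  have "\<exists>m s. is_partition a b m s \<and> (\<forall>n t. is_partition a b n t \<and> s ` {..m} \<subseteq> t ` {..n} \<longrightarrow>
      nrm V (S n t z \<ominus> T z) < e)" if "z \<in> carrier V" for z
    using integral that \<open>e > 0\<close> unfolding has_spectral_integral_def by blast
  then obtain m s m' s' where p: "is_partition a b m s" "is_partition a b m' s'"
    and s: "\<And>n t. is_partition a b n t \<Longrightarrow> s ` {..m} \<subseteq> t ` {..n} \<Longrightarrow> nrm V (S n t x \<ominus> T x) < e"
    and s': "\<And>n t. is_partition a b n t \<Longrightarrow> s' ` {..m'} \<subseteq> t ` {..n} \<Longrightarrow> nrm V (S n t y \<ominus> T y) < e"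
    using assms(1,2) by metis
  obtain n t where n: "is_partition a b n t" "s ` {..m} \<subseteq> t ` {..n}" "s' ` {..m'} \<subseteq> t ` {..n}"
      "c \<in> {a..b} \<longrightarrow> c \<in> t ` {..n}"
    using common_refinement[OF p, of c] by blast
  show ?thesis by (rule that[OF n(1) s[OF n(1,2)] s'[OF n(1,3)] n(4)])
qed

lemma S_closed [simp]: "x \<in> carrier V \<Longrightarrow> S n t x \<in> carrier V"
  by (simp add: stieltjes_sum_def finsum_closed Pi_def F_simps)

lemma F_T_commute:
  assumes x: "x \<in> carrier V"
  shows "T (F l x) = F l (T x)"
proof -
  have c: "F l x \<in> carrier V" "T x \<in> carrier V" using x by (simp_all add: F_simps T_simps)
  have "nrm V (T (F l x) \<ominus> F l (T x)) \<le> (1 + M) * e" if e0: "e > 0" for e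
  proof -
    obtain n t where p: "is_partition a b n t" and e: "nrm V (S n t x \<ominus> T x) < e"
        "nrm V (S n t (F l x) \<ominus> T (F l x)) < e" and "a \<in> {a..b} \<longrightarrow> a \<in> t ` {..n}"
      by (rule integral_approx[OF x c(1) e0, of a])
    have Fx: "F m x \<in> carrier V" for m using x by (simp add: F_simps)
    have "F l (S n t x) = finsum V (\<lambda>j. F l (of_real (t j) \<odot> (F (t j) x \<ominus> F (t (j - 1)) x))) {1..n}"
      unfolding S_eq[OF p x] by (rule linear_map_finsum[OF seminormed seminormed F_linear]) (use Fx in auto)
    moreover have "F l (of_real (t j) \<odot> (F (t j) x \<ominus> F (t (j - 1)) x)) =
        of_real (t j) \<odot> (F (t j) (F l x) \<ominus> F (t (j - 1)) (F l x))" for j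
    proof -
      have comm: "F l (F m x) = F m (F l x)" for m
        unfolding F_F[OF x] min.commute[of l m] by (rule refl)
      show ?thesis
        by (subst comm[symmetric], subst comm[symmetric], subst F_simps(3), rule minus_closed[OF Fx Fx],
            subst F_simps(5)[OF Fx Fx], rule refl)
    qed
    ultimately have S: "S n t (F l x) = F l (S n t x)"
      by (simp only: S_eq[OF p c(1)])
    have Sc: "S n t x \<in> carrier V" "S n t (F l x) \<in> carrier V" using x c by auto
    have Tc: "T (F l x) \<in> carrier V" "F l (T x) \<in> carrier V" using c by (simp_all add: F_simps(1) T_simps(1))
    have "nrm V (T (F l x) \<ominus> F l (T x)) \<le>
        nrm V (T (F l x) \<ominus> S n t (F l x)) + nrm V (S n t (F l x) \<ominus> F l (T x))"
      using Tc Sc by (intro nrm_diff_triangle)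
    moreover have "nrm V (T (F l x) \<ominus> S n t (F l x)) < e"
      using e(2) nrm_diff_comm[OF Tc(1) Sc(2)] by simp
    moreover have "nrm V (S n t (F l x) \<ominus> F l (T x)) = nrm V (F l (S n t x \<ominus> T x))"
      unfolding S F_simps(5)[OF Sc(1) c(2)] by (rule refl)
    moreover have "nrm V (F l (S n t x \<ominus> T x)) \<le> M * nrm V (S n t x \<ominus> T x)"
      using Sc(1) c(2) by (intro F_bound minus_closed)
    moreover have "M * nrm V (S n t x \<ominus> T x) \<le> M * e" using e M_ge by (intro mult_left_mono) auto
    ultimately have "nrm V (T (F l x) \<ominus> F l (T x)) \<le> e + M * e" by linarith
    then show ?thesis by (simp add: distrib_right)
  qed
  note bound = this
  have Tc: "T (F l x) \<in> carrier V" "F l (T x) \<in> carrier V" using c by (simp_all add: F_simps T_simps)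
  have "nrm V (T (F l x) \<ominus> F l (T x)) \<le> 0 + e" if "e > 0" for e
  proof -
    have pos: "1 + M > 0" using M_ge by linarith
    have "nrm V (T (F l x) \<ominus> F l (T x)) \<le> (1 + M) * (e / (1 + M))"
      by (rule bound) (rule divide_pos_pos[OF that pos])
    also have "(1 + M) * (e / (1 + M)) = 0 + e" using pos by (metis add_0 less_irrefl nonzero_mult_div_cancel_left times_divide_eq_right)
    finally show ?thesis .
  qed
  then have "nrm V (T (F l x) \<ominus> F l (T x)) \<le> 0" by (rule field_le_epsilon)
  then have "nrm V (T (F l x) \<ominus> F l (T x)) = 0" using Tc by (intro antisym) auto
  then have "T (F l x) \<ominus> F l (T x) = \<zero>" using Tc nrm_eq_0[of "T (F l x) \<ominus> F l (T x)"] by auto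
  then show ?thesis by (rule eq_if_diff_zero[rotated 2]) (use Tc in auto)
qed

text \<open>
  On the range of \<open>F \<mu> - F \<nu>\<close> the Stieltjes sums only see points between \<open>\<nu>\<close> and \<open>\<mu>\<close>;
  summation by parts then bounds the distance of \<open>T\<close> from the scalar \<open>\<mu>\<close>.
\<close>

lemma near_scalar:
  assumes x: "x \<in> carrier V" and "\<nu> < \<mu>" and keep: "F \<mu> x = x" and kill: "F \<nu> x = \<zero>"
  shows "nrm V (T x \<ominus> of_real \<mu> \<odot> x) \<le> M * (\<mu> - \<nu>) * nrm V x"
proof (cases "x = \<zero>")
  case True
  then show ?thesis by (simp add: T_simps)
next
  case False
  have "\<nu> < b" using F_above[OF x, of \<nu>] kill False by force
  have "a < \<mu>" using F_below[OF x, of \<mu>] keep False by force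
  define \<phi> where "\<phi> t = min t \<mu>" for t :: real
  define \<psi> where "\<psi> t = max \<nu> (min t \<mu>)" for t :: real
  have Fx [simp]: "F l x \<in> carrier V" for l using x by (simp add: F_simps)
  have F_lo: "F l x = \<zero>" if "l \<le> \<nu>" for l
    using F_F[OF x, of l \<nu>] kill that by (simp add: min_def F_simps)
  have F_hi: "F l x = x" if "l \<ge> \<mu>" for l
    using F_F[OF x, of l \<mu>] keep that by (simp add: min_def split: if_splits)
  have key: "nrm V (S n t x \<ominus> of_real (\<phi> b) \<odot> x) \<le> M * nrm V x * (\<psi> b - \<psi> a)"
    if p: "is_partition a b n t" and \<mu>: "\<mu> \<in> {a..b} \<longrightarrow> \<mu> \<in> t ` {..n}" for n t
  proof -
    have t: "t 0 = a" "t n = b" and sm: "strict_mono_on {..n} t"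
      using p by (auto simp: is_partition_def)
    \<comment> \<open>no interval of the partition straddles \<open>\<mu>\<close>, as \<open>\<mu>\<close> is a partition point if it lies in \<open>[a, b]\<close>\<close>
    have jump: "t (Suc k) \<le> \<mu>" if "Suc k \<le> n" "t k < \<mu>" for k
    proof (rule ccontr)
      assume neg: "\<not> t (Suc k) \<le> \<mu>"
      have "t (Suc k) \<le> b" using is_partitionD(3)[OF p] that(1) by auto
      then have "\<mu> \<in> t ` {..n}" using neg \<open>a < \<mu>\<close> \<mu> by auto
      then obtain i where i: "i \<le> n" "t i = \<mu>" by auto
      have "k < i"
        using strict_mono_on_less[OF sm, of k i] that i by simp
      moreover have "i < Suc k"
        using strict_mono_on_less[OF sm, of i "Suc k"] that i neg by simp
      ultimately show False by simp
    qed
    let ?d = "\<lambda>j. of_real (t j) \<odot> (F (t j) x \<ominus> F (t (j - 1)) x)"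
    \<comment> \<open>summation by parts: the error grows only while the partition runs through \<open>[\<nu>, \<mu>]\<close>\<close>
    have "nrm V (finsum V ?d {1..k} \<ominus> of_real (\<phi> (t k)) \<odot> F (t k) x) \<le> M * nrm V x * (\<psi> (t k) - \<psi> a)"
      if "k \<le> n" for k
      using that
    proof (induction k)
      case 0
      then show ?case using t F_below[OF x, of a] by (simp add: finsum_empty)
    next
      case (Suc k)
      have tk: "t k < t (Suc k)" using sm Suc by (auto simp: strict_mono_on_def)
      let ?s = "finsum V ?d {1..k}"
      let ?F0 = "F (t k) x" and ?F1 = "F (t (Suc k)) x"
      have sc: "?s \<in> carrier V" by (auto intro!: finsum_closed)
      have s1: "finsum V ?d {1..Suc k} = ?s \<oplus> of_real (t (Suc k)) \<odot> (?F1 \<ominus> ?F0)"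
        using sc by (simp add: atLeastAtMostSuc_conv finsum_insert Pi_def a_comm)
      have "of_real (t (Suc k)) \<odot> (?F1 \<ominus> ?F0) = of_real (\<phi> (t (Suc k))) \<odot> (?F1 \<ominus> ?F0)"
      proof (cases "t k < \<mu>")
        case True
        with jump[of k] Suc show ?thesis by (simp add: \<phi>_def min_def)
      next
        case False
        then show ?thesis using F_hi[of "t k"] F_hi[of "t (Suc k)"] tk x by simp
      qed
      also have "\<dots> = of_real (\<phi> (t (Suc k))) \<odot> ?F1 \<ominus> of_real (\<phi> (t (Suc k))) \<odot> ?F0"
        by (simp add: sm_diff_r)
      finally have s2: "finsum V ?d {1..Suc k} \<ominus> of_real (\<phi> (t (Suc k))) \<odot> ?F1
          = ?s \<ominus> of_real (\<phi> (t (Suc k))) \<odot> ?F0"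
        using sc s1 by (simp add: add_diff_cancel_mid)
      have "nrm V (?s \<ominus> of_real (\<phi> (t (Suc k))) \<odot> ?F0) \<le>
          nrm V (?s \<ominus> of_real (\<phi> (t k)) \<odot> ?F0) +
          nrm V (of_real (\<phi> (t k)) \<odot> ?F0 \<ominus> of_real (\<phi> (t (Suc k))) \<odot> ?F0)"
        using sc by (intro nrm_diff_triangle) auto
      also have "nrm V (of_real (\<phi> (t k)) \<odot> ?F0 \<ominus> of_real (\<phi> (t (Suc k))) \<odot> ?F0) =
          cmod (of_real (\<phi> (t k) - \<phi> (t (Suc k)))) * nrm V ?F0"
        by (simp add: sm_diff_l[symmetric] nrm_smult)
      also have "\<dots> \<le> M * nrm V x * (\<psi> (t (Suc k)) - \<psi> (t k))"
      proof (cases "t k \<le> \<nu>")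
        case True
        have "\<psi> (t k) \<le> \<psi> (t (Suc k))" using tk by (auto simp: \<psi>_def)
        then have "M * nrm V x * (\<psi> (t (Suc k)) - \<psi> (t k)) \<ge> 0" using M_ge x by simp
        then show ?thesis using F_lo[OF True] by simp
      next
        case False
        then have "cmod (of_real (\<phi> (t k) - \<phi> (t (Suc k)))) = \<psi> (t (Suc k)) - \<psi> (t k)"
          unfolding norm_of_real using tk \<open>\<nu> < \<mu>\<close> by (auto simp: \<phi>_def \<psi>_def)
        moreover have "\<psi> (t k) \<le> \<psi> (t (Suc k))" using tk by (auto simp: \<psi>_def)
        ultimately show ?thesis using mult_right_mono[OF F_bound[OF x, of "t k"], of "\<psi> (t (Suc k)) - \<psi> (t k)"]
          by (simp add: mult.commute)
      qed
      finally show ?case using Suc s2 by (simp add: algebra_simps)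
    qed
    from this[of n] show ?thesis using F_above[OF x, of b] p t by (simp add: S_eq[OF p x])
  qed
  have "nrm V (T x \<ominus> of_real \<mu> \<odot> x) \<le> M * (\<mu> - \<nu>) * nrm V x + e" if e0: "e > 0" for e
  proof -
    obtain n t where p: "is_partition a b n t" and e: "nrm V (S n t x \<ominus> T x) < e"
      and "nrm V (S n t x \<ominus> T x) < e" and \<mu>: "\<mu> \<in> {a..b} \<longrightarrow> \<mu> \<in> t ` {..n}"
      by (rule integral_approx[OF x x e0, of \<mu>])
    have c: "T x \<in> carrier V" using x by (simp add: T_simps)
    have "nrm V (T x \<ominus> of_real \<mu> \<odot> x) \<le> nrm V (T x \<ominus> S n t x) + nrm V (S n t x \<ominus> of_real \<mu> \<odot> x)"
      using x c by (intro nrm_diff_triangle) auto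
    also have "nrm V (T x \<ominus> S n t x) < e" using e x c by (simp add: nrm_diff_comm)
    also have "nrm V (S n t x \<ominus> of_real \<mu> \<odot> x) \<le> nrm V (S n t x \<ominus> of_real (\<phi> b) \<odot> x)
        + nrm V (of_real (\<phi> b) \<odot> x \<ominus> of_real \<mu> \<odot> x)"
      using x c by (intro nrm_diff_triangle) auto
    also have "nrm V (of_real (\<phi> b) \<odot> x \<ominus> of_real \<mu> \<odot> x) = cmod (of_real (\<phi> b - \<mu>)) * nrm V x"
      using x by (simp add: sm_diff_l[symmetric] nrm_smult)
    also have "\<dots> = (\<mu> - \<phi> b) * nrm V x" unfolding norm_of_real by (simp add: \<phi>_def)
    also have "\<dots> \<le> M * (\<mu> - \<phi> b) * nrm V x"
      using M_ge mult_right_mono[of 1 M "(\<mu> - \<phi> b) * nrm V x"] x by (simp add: \<phi>_def mult.assoc)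
    also note key[OF p \<mu>]
    also have "M * nrm V x * (\<psi> b - \<psi> a) \<le> M * nrm V x * (\<phi> b - \<nu>)"
      using M_ge x \<open>\<nu> < b\<close> \<open>\<nu> < \<mu>\<close> by (intro mult_left_mono) (auto simp: \<phi>_def \<psi>_def)
    finally show ?thesis by (simp add: algebra_simps)
  qed
  then show ?thesis by (rule field_le_epsilon)
qed

end

locale projections_with_resolution =
  decreasing_projections V R + res: spectral_resolution V F a b "decreasing_projections.T V R"
  for V (structure) and R F a b
begin

text \<open>
  Since \<open>T\<close> is nearly the identity on the range of \<open>R m\<close>, the vector \<open>R m (T - \<mu>) x\<close> is nearly
  \<open>(1 - \<mu>) R m x\<close> for large \<open>m\<close>. On a short spectral piece \<open>T - \<mu>\<close> has norm at most \<open>|1 - \<mu>| / 2\<close> and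
  maps the piece to itself. Each application of \<open>T - \<mu>\<close> therefore halves the bound on \<open>R m x\<close>.
\<close>

lemma decay_short:
  assumes "\<nu> < \<mu>" "\<mu> \<noteq> 1" and short: "res.M * (\<mu> - \<nu>) \<le> \<bar>1 - \<mu>\<bar> / 2"
    and x: "x \<in> carrier V" "F \<mu> x = x" "F \<nu> x = \<zero>"
  shows "(\<lambda>m. nrm V (R m x)) \<longlonglongrightarrow> 0"
proof -
  let ?d = "\<bar>1 - \<mu>\<bar>"
  have d: "?d > 0" using assms by simp
  have iter: "\<exists>N. \<forall>m\<ge>N. nrm V (R m x) \<le> (1/2)^k * nrm V x + e"
    if "x \<in> carrier V" "F \<mu> x = x" "F \<nu> x = \<zero>" "e > 0" for k x e
    using that
  proof (induction k arbitrary: x e)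
    case 0
    then show ?case using R_nrm[of x] by (intro exI[of _ 0]) (auto intro: add_increasing2)
  next
    case (Suc k)
    note x = Suc.prems(1-3)
    define x' where "x' = T x \<ominus> of_real \<mu> \<odot> x"
    have x': "x' \<in> carrier V" "F \<mu> x' = x'" "F \<nu> x' = \<zero>"
      using x by (auto simp: x'_def res.F_simps res.F_T_commute[symmetric] res.T_simps)
    have "nrm V x' \<le> res.M * (\<mu> - \<nu>) * nrm V x"
      unfolding x'_def by (rule res.near_scalar) (use x assms in auto)
    also have "\<dots> \<le> ?d / 2 * nrm V x" using short x by (intro mult_right_mono) auto
    finally have nx': "nrm V x' \<le> ?d / 2 * nrm V x" .
    have e: "?d * e / 2 > 0" using d Suc by simp
    from Suc.IH[OF x' e] obtain N1 where N1: "\<And>m. m \<ge> N1 \<Longrightarrow> nrm V (R m x') \<le> (1/2)^k * nrm V x' + ?d * e / 2" by blast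
    from order_tendstoD(2)[OF T_approx_fix_tendsto[OF x(1)] e]
    obtain N2 where N2: "\<And>m. m \<ge> N2 \<Longrightarrow> nrm V (T (R m x) \<ominus> R m x) < ?d * e / 2"
      by (auto simp: eventually_sequentially)
    show ?case
    proof (intro exI[of _ "max N1 N2"] allI impI)
      fix m assume m: "max N1 N2 \<le> m"
      let ?y = "R m x"
      have y: "?y \<in> carrier V" using x by (simp add: R_simps)
      have "(1 - of_real \<mu>) \<odot> ?y = (?y \<ominus> T ?y) \<oplus> (T ?y \<ominus> of_real \<mu> \<odot> ?y)"
        using y by (simp add: sm_diff_l diff_add_diff)
      moreover have "T ?y \<ominus> of_real \<mu> \<odot> ?y = R m x'"
        using x by (simp add: x'_def R_simps R_T_commute)
      ultimately have f1: "nrm V ((1 - of_real \<mu>) \<odot> ?y) \<le> nrm V (?y \<ominus> T ?y) + nrm V (R m x')"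
        using y x' by (simp add: nrm_triangle R_simps)
      have "cmod (1 - of_real \<mu>) = ?d" by (metis norm_of_real of_real_1 of_real_diff)
      then have f2: "nrm V ((1 - of_real \<mu>) \<odot> ?y) = ?d * nrm V ?y"
        using y by (simp only: nrm_smult)
      have f3: "nrm V (?y \<ominus> T ?y) < ?d * e / 2"
        using N2[of m] m y by (simp add: nrm_diff_comm)
      have f4: "(1/2)^k * nrm V x' \<le> (1/2)^k * (?d / 2 * nrm V x)" by (intro mult_left_mono nx') auto
      have f5: "nrm V (R m x') \<le> (1/2)^k * nrm V x' + ?d * e / 2" using N1[of m] m by simp
      have "?d * nrm V ?y \<le> (1/2)^k * (?d / 2 * nrm V x) + ?d * e"
        using f1 f2 f3 f4 f5 by linarith
      also have "\<dots> = ?d * ((1/2)^Suc k * nrm V x + e)" by (simp add: distrib_left)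
      finally have "?d * nrm V ?y \<le> ?d * ((1/2)^Suc k * nrm V x + e)" .
      then show "nrm V ?y \<le> (1/2)^Suc k * nrm V x + e" using d by (simp only: mult_le_cancel_left_pos)
    qed
  qed
  show ?thesis
  proof (rule LIMSEQ_I)
    fix e :: real assume "e > 0"
    have "(\<lambda>k. (1/2)^k * nrm V x) \<longlonglongrightarrow> 0"
      by (intro tendsto_mult_left_zero LIMSEQ_realpow_zero) auto
    from order_tendstoD(2)[OF this, of "e/2"] \<open>e > 0\<close> obtain k where "(1/2)^k * nrm V x < e/2"
      by (auto simp: eventually_sequentially)
    moreover obtain N where "\<forall>m\<ge>N. nrm V (R m x) \<le> (1/2)^k * nrm V x + e/2"
      using iter[OF x, of "e/2" k] \<open>e > 0\<close> by auto
    ultimately have "\<forall>m\<ge>N. nrm V (R m x) < e" by (smt (verit) field_sum_of_halves)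
    with x show "\<exists>N. \<forall>m\<ge>N. norm (nrm V (R m x) - 0) < e"
      by (intro exI[of _ N]) (simp add: R_simps)
  qed
qed

text \<open>
  The interval \<open>[\<nu>, \<mu>]\<close> keeps a distance \<open>d\<close> from \<open>1\<close>, so it can be cut into pieces that are
  short compared with \<open>d\<close>.
\<close>

lemma decay_away_from_1:
  assumes "\<nu> < \<mu>" "1 \<notin> {\<nu>..\<mu>}" and x: "x \<in> carrier V"
  shows "(\<lambda>m. nrm V (R m (F \<mu> x \<ominus> F \<nu> x))) \<longlonglongrightarrow> 0"
proof -
  define d where "d = (if \<mu> < 1 then 1 - \<mu> else \<nu> - 1)"
  have d: "d > 0" using assms by (auto simp: d_def)
  have d_le: "d \<le> \<bar>1 - t\<bar>" if "\<nu> \<le> t" "t \<le> \<mu>" for t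
    using that assms by (auto simp: d_def)
  obtain n :: nat where n: "real n > res.M * (\<mu> - \<nu>) / (d / 2)" using reals_Archimedean2 by blast
  have M0: "res.M * (\<mu> - \<nu>) > 0" using res.M_ge assms by simp
  then have "res.M * (\<mu> - \<nu>) / (d / 2) > 0" using d by simp
  with n have "real n > 0" by linarith
  then have n0: "n > 0" by simp
  define h where "h = (\<mu> - \<nu>) / n"
  have h: "h > 0" using n0 assms by (simp add: h_def)
  have Mh: "res.M * h \<le> d / 2"
    using n n0 d by (simp add: h_def field_simps)
  have Fc [simp]: "F l x \<in> carrier V" for l using x by (simp add: res.F_simps)
  have "(\<lambda>m. nrm V (R m (F (\<nu> + i * h) x \<ominus> F \<nu> x))) \<longlonglongrightarrow> 0" if "i \<le> n" for i :: nat
    using that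
  proof (induction i)
    case 0
    show ?case by (simp add: R_simps)
  next
    case (Suc i)
    let ?l = "\<nu> + i * h" and ?r = "\<nu> + Suc i * h"
    have lr: "?l < ?r" "?r - ?l = h" using h by (auto simp: algebra_simps)
    have "Suc i * h \<le> n * h" using Suc h by (intro mult_right_mono) auto
    moreover have "n * h = \<mu> - \<nu>" using n0 by (simp add: h_def)
    moreover have "Suc i * h \<ge> 0" using h by (intro mult_nonneg_nonneg) auto
    ultimately have r: "\<nu> \<le> ?r" "?r \<le> \<mu>" by linarith+
    have "?r \<noteq> 1" using r assms by auto
    have "(\<lambda>m. nrm V (R m (F ?r x \<ominus> F ?l x))) \<longlonglongrightarrow> 0"
    proof (rule decay_short[OF lr(1) \<open>?r \<noteq> 1\<close>])
      show "res.M * (?r - ?l) \<le> \<bar>1 - ?r\<bar> / 2" unfolding lr(2) using Mh d_le[OF r] by simp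
    qed (use x lr in \<open>auto simp: res.F_simps res.F_F min_def\<close>)
    moreover have "(\<lambda>m. nrm V (R m (F ?l x \<ominus> F \<nu> x))) \<longlonglongrightarrow> 0" using Suc by simp
    ultimately have "(\<lambda>m. nrm V (R m (F ?r x \<ominus> F ?l x)) + nrm V (R m (F ?l x \<ominus> F \<nu> x))) \<longlonglongrightarrow> 0"
      by (rule tendsto_add_zero)
    then show ?case
    proof (rule tendsto_0_le[where K=1], intro eventuallyI)
      fix m
      have "R m (F ?r x \<ominus> F \<nu> x) = R m (F ?r x \<ominus> F ?l x) \<oplus> R m (F ?l x \<ominus> F \<nu> x)"
        by (subst R_simps(2)[symmetric]) (auto simp: diff_add_diff)
      then show "norm (nrm V (R m (F ?r x \<ominus> F \<nu> x)))
          \<le> norm (nrm V (R m (F ?r x \<ominus> F ?l x)) + nrm V (R m (F ?l x \<ominus> F \<nu> x))) * 1"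
        by (simp add: R_simps nrm_triangle del: of_nat_Suc)
    qed
  qed
  from this[of n] show ?thesis using n0 by (simp add: h_def)
qed

text \<open>
  Split \<open>x\<close> into the parts of \<open>F\<close> below, above and close to \<open>1\<close>. The projections \<open>R m\<close> tend to \<open>0\<close>
  on the first two. The third tends to the jump \<open>y = F 1 x - F 1\<^sup>- x\<close>, which exists because \<open>F\<close> has
  left limits and is right continuous. As \<open>y\<close> lies in the range of \<open>F 1 - F l\<close> for all \<open>l < 1\<close>, it is
  fixed by \<open>T\<close> and so by every \<open>R m\<close>. Hence \<open>R m x\<close> tends to \<open>y\<close>.
\<close>

lemma R_converges:
  assumes x: "x \<in> carrier V"
  shows "\<exists>y. converges V (\<lambda>m. R m x) y"
proof -
  interpret Metric_space "carrier V" "ndist V" by (rule Metric_space_ndist)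
  have Fc [simp]: "F l x \<in> carrier V" for l using x by (simp add: res.F_simps)
  have lims: "limitin mtopology (\<lambda>l. F l x) (F 1 x) (at_right 1)"
    "\<exists>y. limitin mtopology (\<lambda>l. F l x) y (at_left 1)"
    using res.F x unfolding spectral_family_def by blast+
  then obtain k where k: "limitin mtopology (\<lambda>l. F l x) k (at_left 1)" by blast
  have kc [simp]: "k \<in> carrier V" using k limitin_mspace by blast
  have left: "\<exists>s<1. \<forall>l. s < l \<and> l < 1 \<longrightarrow> nrm V (F l x \<ominus> k) < e" if "e > 0" for e
  proof -
    have "\<forall>\<^sub>F l in at_left 1. ndist V (F l x) k < e" using k that by (auto simp: limitin_metric elim: eventually_mono)
    then have "\<exists>s<1. \<forall>l>s. l < 1 \<longrightarrow> ndist V (F l x) k < e"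
      by (subst (asm) eventually_at_left[of "0::real" 1]) auto
    then show ?thesis by (auto simp: ndist_def)
  qed
  have right: "\<exists>s>1. \<forall>l. 1 < l \<and> l < s \<longrightarrow> nrm V (F l x \<ominus> F 1 x) < e" if "e > 0" for e
  proof -
    have "\<forall>\<^sub>F l in at_right 1. ndist V (F l x) (F 1 x) < e" using lims(1) that
      by (auto simp: limitin_metric elim: eventually_mono)
    then have "\<exists>s>1. \<forall>l>1. l < s \<longrightarrow> ndist V (F l x) (F 1 x) < e"
      by (subst (asm) eventually_at_right[of 1 "2::real"]) auto
    then show ?thesis by (auto simp: ndist_def)
  qed
  have zeroI: "v = \<zero>" if "v \<in> carrier V" "\<And>e. e > 0 \<Longrightarrow> nrm V v \<le> res.M * e" for v
  proof -
    have "nrm V v \<le> 0 + e" if "e > 0" for e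
      using \<open>\<And>e. e > 0 \<Longrightarrow> nrm V v \<le> res.M * e\<close>[of "e / res.M"] that res.M_ge by (simp add: field_simps)
    then have "nrm V v \<le> 0" by (rule field_le_epsilon)
    then show ?thesis using that(1) nrm_eq_0 nrm_nonneg by (metis antisym)
  qed
  \<comment> \<open>the left limit \<open>k\<close> of \<open>F l x\<close> at \<open>1\<close> behaves like \<open>F 1\<^sup>- x\<close>\<close>
  have Fk: "F l k = (if l < 1 then F l x else k)" for l
  proof -
    have "F l k \<ominus> (if l < 1 then F l x else k) = \<zero>"
    proof (rule zeroI)
      fix e :: real assume "e > 0"
      from left[OF this] obtain s where s: "s < 1" "\<And>r. s < r \<Longrightarrow> r < 1 \<Longrightarrow> nrm V (F r x \<ominus> k) < e" by blast
      show "nrm V (F l k \<ominus> (if l < 1 then F l x else k)) \<le> res.M * e"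
      proof (cases "l < 1")
        case True
        define r where "r = (max s l + 1) / 2"
        have r: "s < r" "r < 1" "l < r" using s True by (auto simp: r_def)
        have "F l x = F l (F r x)" using r x by (simp add: res.F_F min_def)
        then have "nrm V (F l k \<ominus> F l x) = nrm V (F l (k \<ominus> F r x))" by (simp add: res.F_simps)
        also have "\<dots> \<le> res.M * nrm V (k \<ominus> F r x)" by (rule res.F_bound) simp
        also have "\<dots> \<le> res.M * e" using s(2)[OF r(1,2)] res.M_ge by (intro mult_left_mono) (auto simp: nrm_diff_comm)
        finally show ?thesis using True by simp
      next
        case False
        have e2: "e / 2 > 0" using \<open>e > 0\<close> by simp
        from left[OF this] obtain s where s: "s < 1" "\<And>r. s < r \<Longrightarrow> r < 1 \<Longrightarrow> nrm V (F r x \<ominus> k) < e/2" by blast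
        obtain r where r: "s < r" "r < 1" using dense s(1) by blast
        have "F l (F r x) = F r x" using r False x by (simp add: res.F_F min_def)
        then have "nrm V (F l k \<ominus> F r x) = nrm V (F l (k \<ominus> F r x))" by (simp add: res.F_simps)
        also have "\<dots> \<le> res.M * nrm V (k \<ominus> F r x)" by (rule res.F_bound) simp
        also have "\<dots> \<le> res.M * (e/2)" using s(2)[OF r] res.M_ge by (intro mult_left_mono) (auto simp: nrm_diff_comm)
        finally have "nrm V (F l k \<ominus> F r x) \<le> res.M * (e/2)" .
        moreover have "nrm V (F r x \<ominus> k) \<le> res.M * (e/2)"
        proof -
          have "1 * (e/2) \<le> res.M * (e/2)" using e2 res.M_ge by (intro mult_right_mono) auto
          with s(2)[OF r] show ?thesis by linarith
        qed
        moreover have "nrm V (F l k \<ominus> k) \<le> nrm V (F l k \<ominus> F r x) + nrm V (F r x \<ominus> k)"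
          by (rule nrm_diff_triangle) (auto simp: res.F_simps)
        ultimately show ?thesis using False by simp
      qed
    qed (auto simp: res.F_simps)
    then show ?thesis by (rule eq_if_diff_zero[rotated 2]) (auto simp: res.F_simps)
  qed
  define y where "y = F 1 x \<ominus> k"
  have y [simp]: "y \<in> carrier V" by (simp add: y_def)
  have "F 1 y = y" using x Fk[of 1] by (simp add: y_def res.F_simps res.F_F)
  moreover have "F l y = \<zero>" if "l < 1" for l
    using x Fk[of l] that by (simp add: y_def res.F_simps res.F_F min_def)
  ultimately have near: "nrm V (T y \<ominus> y) \<le> res.M * (1 - l) * nrm V y" if "l < 1" for l
    using res.near_scalar[of y l 1] that by simp
  have "T y \<ominus> y = \<zero>"
  proof (rule zeroI)
    fix e :: real assume "e > 0"
    define l where "l = 1 - e / (nrm V y + 1)"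
    have p: "nrm V y + 1 > 0" using nrm_nonneg[OF y] by linarith
    then have "l < 1" using \<open>e > 0\<close> by (simp add: l_def)
    have "(1 - l) * nrm V y \<le> e" using p \<open>e > 0\<close> by (simp add: l_def field_simps)
    then have "res.M * ((1 - l) * nrm V y) \<le> res.M * e" using res.M_ge by (intro mult_left_mono) auto
    with near[OF \<open>l < 1\<close>] show "nrm V (T y \<ominus> y) \<le> res.M * e" by (simp add: mult.assoc)
  qed auto
  then have "T y = y" by (rule eq_if_diff_zero[rotated 2]) auto
  then have Ry: "R m y = y" for m by (rule fixed_by_R[OF y])
  have "(\<lambda>m. nrm V (R m x \<ominus> y)) \<longlonglongrightarrow> 0"
  proof (rule LIMSEQ_I)
    fix e :: real assume "e > 0"
    then have e4: "e / 4 > 0" by simp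
    from left[OF e4] obtain s where s: "s < 1" "\<And>r. s < r \<Longrightarrow> r < 1 \<Longrightarrow> nrm V (F r x \<ominus> k) < e/4" by blast
    obtain l where l: "s < l" "l < 1" using dense s(1) by blast
    from right[OF e4] obtain s' where s': "1 < s'" "\<And>r. 1 < r \<Longrightarrow> r < s' \<Longrightarrow> nrm V (F r x \<ominus> F 1 x) < e/4" by blast
    obtain r where r: "1 < r" "r < s'" using dense s'(1) by blast
    define l0 r0 where "l0 = min a l - 1" and "r0 = max b r + 1"
    have F0: "F l0 x = \<zero>" "F r0 x = x" using x by (auto simp: l0_def r0_def res.F_below res.F_above)
    define A B C where "A = F l x \<ominus> F l0 x" and "B = F r x \<ominus> F l x" and "C = F r0 x \<ominus> F r x"
    have ABC [simp]: "A \<in> carrier V" "B \<in> carrier V" "C \<in> carrier V" by (auto simp: A_def B_def C_def)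
    have "(\<lambda>m. nrm V (R m A)) \<longlonglongrightarrow> 0"
      unfolding A_def by (rule decay_away_from_1) (use l x in \<open>auto simp: l0_def\<close>)
    from order_tendstoD(2)[OF this e4] obtain N1 where N1: "\<And>m. m \<ge> N1 \<Longrightarrow> nrm V (R m A) < e/4"
      by (auto simp: eventually_sequentially)
    have "(\<lambda>m. nrm V (R m C)) \<longlonglongrightarrow> 0"
      unfolding C_def by (rule decay_away_from_1) (use r x in \<open>auto simp: r0_def\<close>)
    from order_tendstoD(2)[OF this e4] obtain N2 where N2: "\<And>m. m \<ge> N2 \<Longrightarrow> nrm V (R m C) < e/4"
      by (auto simp: eventually_sequentially)
    have sum: "x = (C \<oplus> B) \<oplus> A"
      unfolding A_def B_def C_def using F0 x by (simp add: diff_add_diff)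
    have "B \<ominus> y = (F r x \<ominus> F 1 x) \<ominus> (F l x \<ominus> k)"
      unfolding B_def y_def by (simp add: minus_eq minus_add a_ac)
    then have "nrm V (B \<ominus> y) \<le> nrm V (F r x \<ominus> F 1 x) + nrm V (F l x \<ominus> k)"
      by (simp add: nrm_diff_le)
    then have By: "nrm V (B \<ominus> y) < e/2" using s(2)[OF l] s'(2)[OF r] by simp
    show "\<exists>N. \<forall>m\<ge>N. norm (nrm V (R m x \<ominus> y) - 0) < e"
    proof (intro exI[of _ "max N1 N2"] allI impI)
      fix m assume m: "m \<ge> max N1 N2"
      have "R m x \<ominus> y = R m (x \<ominus> y)" using x by (simp add: R_simps Ry)
      also have "x \<ominus> y = (C \<oplus> A) \<oplus> (B \<ominus> y)"
        by (subst sum) (simp add: minus_eq a_ac)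
      finally have "R m x \<ominus> y = (R m C \<oplus> R m A) \<oplus> R m (B \<ominus> y)" by (simp add: R_simps)
      then have "nrm V (R m x \<ominus> y) \<le> nrm V (R m C \<oplus> R m A) + nrm V (R m (B \<ominus> y))"
        by (simp add: nrm_triangle R_simps)
      also have "nrm V (R m C \<oplus> R m A) \<le> nrm V (R m C) + nrm V (R m A)"
        by (simp add: nrm_triangle R_simps)
      also have "nrm V (R m (B \<ominus> y)) \<le> nrm V (B \<ominus> y)" by (rule R_nrm) simp
      finally show "norm (nrm V (R m x \<ominus> y) - 0) < e"
        using N1[of m] N2[of m] m By x by (simp add: R_simps)
    qed
  qed
  then show ?thesis by (intro exI[of _ y]) (simp add: converges_def)
qed

end

theorem (in decreasing_projections) exists_not_type_B:
  assumes "x \<in> carrier V" "\<not> cauchy_seq V (\<lambda>n. R n x)"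
  shows "\<exists>T. well_bounded V T \<and> \<not> type_B V T"
proof (intro exI[of _ T] conjI notI)
  show "well_bounded V T" by (rule T_well_bounded)
  assume "type_B V T"
  then obtain F a b where F: "spectral_family V F a b" "a \<le> b" "has_spectral_integral V F a b of_real T"
    by (auto simp: type_B_def)
  interpret projections_with_resolution V R F a b
    by unfold_locales (use F T_linear in auto)
  show False
    using R_converges[OF assms(1)] cauchy_if_converges assms by (auto simp: R_simps)
qed

section \<open>Constructions of Banach spaces\<close>

definition banach :: "'a cnormed \<Rightarrow> bool" where
  "banach V \<longleftrightarrow> complex_normed_space V \<and> seq_complete V"

lemma banachD:
  assumes "banach V"
  shows "complex_normed_space V" "seq_complete V" "complex_seminormed_space V"
proof -
  interpret complex_normed_space V using assms by (simp add: banach_def)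
  show "complex_normed_space V" "complex_seminormed_space V" by unfold_locales
  show "seq_complete V" using assms by (simp add: banach_def)
qed

lemma banach_iff: "banach V \<longleftrightarrow> complex_banach_space V"
proof
  assume V: "banach V"
  interpret complex_normed_space V using V by (rule banachD)
  interpret Metric_space "carrier V" "ndist V" by (rule Metric_space_ndist)
  have "mcomplete"
    unfolding mcomplete_def
  proof (intro allI impI)
    fix x assume "MCauchy x"
    then have x: "cauchy_seq V x" by (simp add: MCauchy_iff)
    with V obtain l where l: "converges V x l" by (auto simp: banach_def seq_complete_def)
    have "ndist V (x n) l = nrm V (x n \<ominus>\<^bsub>V\<^esub> l)" for n
      using x l by (simp add: ndist_def cauchy_seq_def converges_def)
    then have "limitin mtopology x l sequentially"
      using l x by (auto simp: limitin_metric_dist_null converges_def cauchy_seq_def)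
    then show "\<exists>l. limitin mtopology x l sequentially" by blast
  qed
  then show "complex_banach_space V"
    by unfold_locales
next
  assume "complex_banach_space V"
  then interpret complex_banach_space V .
  show "banach V" using seq_complete by (simp add: banach_def complex_normed_space_axioms)
qed

subsection \<open>Subspaces and quotients\<close>

definition lin_subspace :: "'a cnormed \<Rightarrow> 'a set \<Rightarrow> bool" where
  "lin_subspace V N \<longleftrightarrow> N \<subseteq> carrier V \<and> \<zero>\<^bsub>V\<^esub> \<in> N \<and>
     (\<forall>x\<in>N. \<forall>y\<in>N. x \<oplus>\<^bsub>V\<^esub> y \<in> N) \<and> (\<forall>c. \<forall>x\<in>N. c \<odot>\<^bsub>V\<^esub> x \<in> N)"

text \<open>
  A closed subspace for a seminorm contains the kernel of the seminorm, so the quotient by it is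
  normed even when the space itself is not.
\<close>

definition nrm_closed :: "'a cnormed \<Rightarrow> 'a set \<Rightarrow> bool" where
  "nrm_closed V N \<longleftrightarrow> (\<forall>x\<in>carrier V. (\<forall>e>0. \<exists>n\<in>N. nrm V (x \<ominus>\<^bsub>V\<^esub> n) < e) \<longrightarrow> x \<in> N)"

lemma (in complex_seminormed_space) a_r_coset_iff: "y \<in> N +> x \<longleftrightarrow> (\<exists>n\<in>N. y = n \<oplus> x)"
  by (auto simp: a_r_coset_def')

lemma (in complex_seminormed_space) add_diff_cancel_right [simp]:
  "x \<in> carrier V \<Longrightarrow> y \<in> carrier V \<Longrightarrow> (x \<oplus> y) \<ominus> y = x"
  by (simp add: diff_eq_iff)

locale quotient_space = complex_seminormed_space +
  fixes N assumes N: "lin_subspace V N"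
begin

lemma N_closed: "n \<in> N \<Longrightarrow> n \<in> carrier V" and N_zero: "\<zero> \<in> N"
  and N_add: "m \<in> N \<Longrightarrow> n \<in> N \<Longrightarrow> m \<oplus> n \<in> N" and N_smult: "n \<in> N \<Longrightarrow> c \<odot> n \<in> N"
  using N by (auto simp: lin_subspace_def)

lemma N_neg: "n \<in> N \<Longrightarrow> \<ominus> n \<in> N"
  using N_smult[of n "-1"] N_closed by (simp add: neg_eq)

lemma mem_coset_iff: "x \<in> carrier V \<Longrightarrow> y \<in> N +> x \<longleftrightarrow> y \<in> carrier V \<and> y \<ominus> x \<in> N"
proof
  assume x: "x \<in> carrier V" and "y \<in> N +> x"
  then obtain n where "n \<in> N" "y = n \<oplus> x" by (auto simp: a_r_coset_iff)
  with x N_closed show "y \<in> carrier V \<and> y \<ominus> x \<in> N" by simp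
next
  assume x: "x \<in> carrier V" and y: "y \<in> carrier V \<and> y \<ominus> x \<in> N"
  then have "y = (y \<ominus> x) \<oplus> x" by simp
  with y show "y \<in> N +> x" unfolding a_r_coset_iff by blast
qed

lemma self_mem_coset: "x \<in> carrier V \<Longrightarrow> x \<in> N +> x"
  by (simp add: mem_coset_iff N_zero)

lemma coset_eq_iff:
  assumes "x \<in> carrier V" "y \<in> carrier V"
  shows "N +> x = N +> y \<longleftrightarrow> x \<ominus> y \<in> N"
proof
  assume "N +> x = N +> y"
  with self_mem_coset[OF assms(1)] assms(2) show "x \<ominus> y \<in> N" by (simp add: mem_coset_iff)
next
  assume xy: "x \<ominus> y \<in> N"
  show "N +> x = N +> y"
  proof (intro Set.set_eqI)
    fix z
    have "z \<ominus> x \<in> N \<longleftrightarrow> z \<ominus> y \<in> N" if z: "z \<in> carrier V"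
    proof
      assume "z \<ominus> x \<in> N"
      from N_add[OF this xy] show "z \<ominus> y \<in> N" using assms z by (simp add: diff_add_diff)
    next
      assume "z \<ominus> y \<in> N"
      moreover have "y \<ominus> x \<in> N" using N_neg[OF xy] assms by (simp add: neg_diff)
      ultimately show "z \<ominus> x \<in> N" using N_add assms z by (metis diff_add_diff)
    qed
    then show "z \<in> N +> x \<longleftrightarrow> z \<in> N +> y" using assms by (auto simp: mem_coset_iff)
  qed
qed

lemma mem_coset_eq: "x \<in> carrier V \<Longrightarrow> y \<in> N +> x \<Longrightarrow> N +> y = N +> x"
  by (simp add: mem_coset_iff coset_eq_iff)

lemma carrier_quotient: "carrier (quotient V N) = (\<lambda>x. N +> x) ` carrier V"
  by (auto simp: quotient_def A_RCOSETS_def' a_r_coset_def')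

lemma zero_quotient: "\<zero>\<^bsub>quotient V N\<^esub> = N +> \<zero>"
proof -
  have "N +> \<zero> = N" using N_closed by (force simp: a_r_coset_iff)
  then show ?thesis by (simp add: quotient_def)
qed

lemma add_quotient:
  assumes x: "x \<in> carrier V" and y: "y \<in> carrier V"
  shows "(N +> x) \<oplus>\<^bsub>quotient V N\<^esub> (N +> y) = N +> (x \<oplus> y)"
proof (intro Set.set_eqI iffI)
  fix z assume "z \<in> (N +> x) \<oplus>\<^bsub>quotient V N\<^esub> (N +> y)"
  then obtain u v where uv: "u \<in> N +> x" "v \<in> N +> y" "z = u \<oplus> v"
    by (auto simp: quotient_def set_add_def')
  then have c: "u \<in> carrier V" "v \<in> carrier V" "(u \<ominus> x) \<oplus> (v \<ominus> y) \<in> N"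
    using x y by (auto simp: mem_coset_iff intro: N_add)
  then have "(u \<oplus> v) \<ominus> (x \<oplus> y) \<in> N" using x y by (simp add: add_diff_add)
  then show "z \<in> N +> (x \<oplus> y)" using x y uv c by (simp add: mem_coset_iff)
next
  fix z assume "z \<in> N +> (x \<oplus> y)"
  then obtain n where n: "n \<in> N" "z = n \<oplus> (x \<oplus> y)" by (auto simp: a_r_coset_iff)
  then have "z = (n \<oplus> x) \<oplus> y" using x y N_closed by (simp add: a_assoc)
  moreover have "n \<oplus> x \<in> N +> x" "y \<in> N +> y"
    using n self_mem_coset[OF y] by (auto simp: a_r_coset_iff)
  ultimately show "z \<in> (N +> x) \<oplus>\<^bsub>quotient V N\<^esub> (N +> y)"
    by (auto simp: quotient_def set_add_def')
qed

lemma smult_quotient: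
  assumes x: "x \<in> carrier V"
  shows "c \<odot>\<^bsub>quotient V N\<^esub> (N +> x) = N +> (c \<odot> x)"
proof (intro Set.set_eqI iffI)
  fix z assume "z \<in> c \<odot>\<^bsub>quotient V N\<^esub> (N +> x)"
  then obtain n m where nm: "n \<in> N" "m \<in> N" "z = c \<odot> (n \<oplus> x) \<oplus> m"
    by (auto simp: quotient_def set_add_def' a_r_coset_iff)
  then have "z = (c \<odot> n \<oplus> m) \<oplus> c \<odot> x" using x N_closed by (simp add: sm_add_r a_ac)
  with nm show "z \<in> N +> (c \<odot> x)" unfolding a_r_coset_iff by (blast intro: N_add N_smult)
next
  fix z assume "z \<in> N +> (c \<odot> x)"
  then obtain n where n: "n \<in> N" "z = n \<oplus> c \<odot> x" by (auto simp: a_r_coset_iff)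
  then have "z = c \<odot> x \<oplus> n" using x N_closed by (simp add: a_comm)
  then have "\<exists>u\<in>N +> x. \<exists>m\<in>N. z = c \<odot> u \<oplus> m" using n(1) self_mem_coset[OF x] by blast
  then show "z \<in> c \<odot>\<^bsub>quotient V N\<^esub> (N +> x)"
    by (auto simp: quotient_def set_add_def')
qed

lemma nrm_quotient_le: "x \<in> carrier V \<Longrightarrow> y \<in> N +> x \<Longrightarrow> nrm (quotient V N) (N +> x) \<le> nrm V y"
  unfolding quotient_def mk_cnormed_simps
  by (rule cINF_lower) (auto simp: mem_coset_iff intro!: bdd_belowI2[of _ 0])

lemma nrm_quotient_less:
  assumes "x \<in> carrier V" "e > 0"
  shows "\<exists>y\<in>N +> x. nrm V y < nrm (quotient V N) (N +> x) + e"
proof (rule ccontr)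
  assume "\<not> ?thesis"
  then have "nrm (quotient V N) (N +> x) + e \<le> nrm V y" if "y \<in> N +> x" for y
    using that by (auto simp: not_less)
  then have "nrm (quotient V N) (N +> x) + e \<le> (INF y\<in>N +> x. nrm V y)"
    using self_mem_coset[OF assms(1)] by (intro cINF_greatest) auto
  with assms(2) show False by (simp add: quotient_def)
qed

lemma nrm_quotient_nonneg: "x \<in> carrier V \<Longrightarrow> 0 \<le> nrm (quotient V N) (N +> x)"
  unfolding quotient_def mk_cnormed_simps
proof (rule cINF_greatest)
  assume x: "x \<in> carrier V"
  then show "N +> x \<noteq> {}" using self_mem_coset by blast
  show "0 \<le> nrm V y" if "y \<in> N +> x" for y using that x by (simp add: mem_coset_iff)
qed

lemma nrm_quotient_greatest:
  "x \<in> carrier V \<Longrightarrow> (\<And>y. y \<in> N +> x \<Longrightarrow> b \<le> nrm V y) \<Longrightarrow> b \<le> nrm (quotient V N) (N +> x)"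
  unfolding quotient_def mk_cnormed_simps
  using self_mem_coset[of x] by (intro cINF_greatest) auto

lemma seminormed_quotient: "complex_seminormed_space (quotient V N)"
proof -
  let ?Q = "quotient V N"
  have nrm_smult_le: "nrm ?Q (N +> (c \<odot> x)) \<le> cmod c * nrm ?Q (N +> x)" if x: "x \<in> carrier V" for c x
  proof -
    have "nrm ?Q (N +> (c \<odot> x)) \<le> cmod c * nrm ?Q (N +> x) + e" if "e > 0" for e
    proof -
      have c1: "cmod c + 1 > 0" by (simp add: add_nonneg_pos)
      then have "e / (cmod c + 1) > 0" using that by simp
      from nrm_quotient_less[OF x this]
      obtain y where y: "y \<in> N +> x" "nrm V y < nrm ?Q (N +> x) + e / (cmod c + 1)" by blast
      have "c \<odot> y \<in> N +> (c \<odot> x)"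
        using y(1) x by (auto simp: mem_coset_iff sm_diff_r[symmetric] N_smult)
      then have "nrm ?Q (N +> (c \<odot> x)) \<le> cmod c * nrm V y"
        using nrm_quotient_le[of "c \<odot> x" "c \<odot> y"] x y(1) by (simp add: nrm_smult mem_coset_iff)
      also have "\<dots> \<le> cmod c * (nrm ?Q (N +> x) + e / (cmod c + 1))"
        using y by (intro mult_left_mono) auto
      also have "\<dots> \<le> cmod c * nrm ?Q (N +> x) + e"
        using c1 that by (simp add: field_simps)
      finally show ?thesis .
    qed
    then show ?thesis by (rule field_le_epsilon)
  qed
  have "complex_seminormed_space (mk_cnormed (carrier ?Q) \<zero>\<^bsub>?Q\<^esub> (\<lambda>x y. x \<oplus>\<^bsub>?Q\<^esub> y) (\<lambda>c x. c \<odot>\<^bsub>?Q\<^esub> x) (nrm ?Q))"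
  proof (rule mk_seminormed_space; (unfold carrier_quotient)?; (elim imageE)?; (hypsubst)?)
    show "\<zero>\<^bsub>?Q\<^esub> \<in> (\<lambda>x. N +> x) ` carrier V" by (simp add: zero_quotient)
  next
    fix x y assume xy: "x \<in> carrier V" "y \<in> carrier V"
    show "nrm ?Q ((N +> x) \<oplus>\<^bsub>?Q\<^esub> (N +> y)) \<le> nrm ?Q (N +> x) + nrm ?Q (N +> y)"
    proof (rule field_le_epsilon)
      fix e :: real assume "e > 0"
      obtain u where u: "u \<in> N +> x" "nrm V u < nrm ?Q (N +> x) + e/2"
        using nrm_quotient_less[OF xy(1), of "e/2"] \<open>e > 0\<close> by auto
      obtain v where v: "v \<in> N +> y" "nrm V v < nrm ?Q (N +> y) + e/2"
        using nrm_quotient_less[OF xy(2), of "e/2"] \<open>e > 0\<close> by auto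
      have uv: "u \<in> carrier V" "v \<in> carrier V" "u \<ominus> x \<in> N" "v \<ominus> y \<in> N"
        using u v xy by (auto simp: mem_coset_iff)
      then have "u \<oplus> v \<in> N +> (x \<oplus> y)"
        using xy by (simp add: mem_coset_iff add_diff_add N_add)
      then have "nrm ?Q (N +> (x \<oplus> y)) \<le> nrm V (u \<oplus> v)"
        using xy by (intro nrm_quotient_le) auto
      also have "\<dots> \<le> nrm V u + nrm V v" using uv by (simp add: nrm_triangle)
      finally show "nrm ?Q ((N +> x) \<oplus>\<^bsub>?Q\<^esub> (N +> y)) \<le> nrm ?Q (N +> x) + nrm ?Q (N +> y) + e"
        using u v xy by (simp add: add_quotient)
    qed
  next
    fix c x assume x: "x \<in> carrier V"
    show "nrm ?Q (c \<odot>\<^bsub>?Q\<^esub> (N +> x)) = cmod c * nrm ?Q (N +> x)"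
    proof (cases "c = 0")
      case True
      then have "nrm ?Q (N +> (c \<odot> x)) \<le> 0" using nrm_smult_le[OF x, of c] by simp
      then show ?thesis using True nrm_quotient_nonneg[of "c \<odot> x"] x by (simp add: smult_quotient)
    next
      case False
      have "nrm ?Q (N +> (inverse c \<odot> (c \<odot> x))) \<le> cmod (inverse c) * nrm ?Q (N +> (c \<odot> x))"
        using x by (intro nrm_smult_le) auto
      then have "nrm ?Q (N +> x) \<le> nrm ?Q (N +> (c \<odot> x)) / cmod c"
        using False x by (simp add: sm_assoc norm_inverse divide_inverse mult.commute)
      then have "cmod c * nrm ?Q (N +> x) \<le> nrm ?Q (N +> (c \<odot> x))"
        using False by (simp add: field_simps)
      then show ?thesis using nrm_smult_le[OF x, of c] x by (simp add: smult_quotient)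
    qed
  qed (auto simp: add_quotient smult_quotient zero_quotient a_assoc sm_add_l sm_add_r sm_assoc, simp_all add: a_comm)
  moreover have "mk_cnormed (carrier ?Q) \<zero>\<^bsub>?Q\<^esub> (\<lambda>x y. x \<oplus>\<^bsub>?Q\<^esub> y) (\<lambda>c x. c \<odot>\<^bsub>?Q\<^esub> x) (nrm ?Q) = ?Q"
    by (simp add: quotient_def)
  ultimately show ?thesis by simp
qed

lemma linear_map_quotient: "linear_map V (quotient V N) (\<lambda>x. N +> x)"
  by (auto simp: linear_map_def carrier_quotient add_quotient smult_quotient)

lemma diff_quotient: "x \<in> carrier V \<Longrightarrow> y \<in> carrier V \<Longrightarrow>
    (N +> x) \<ominus>\<^bsub>quotient V N\<^esub> (N +> y) = N +> (x \<ominus> y)"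
  using linear_map_zero_diff(2)[OF seminormed seminormed_quotient linear_map_quotient] by simp

lemma normed_quotient:
  assumes "nrm_closed V N"
  shows "complex_normed_space (quotient V N)"
proof (rule complex_normed_spaceI[OF seminormed_quotient])
  fix C assume "C \<in> carrier (quotient V N)" and C0: "nrm (quotient V N) C = 0"
  then obtain x where x: "x \<in> carrier V" "C = N +> x" by (auto simp: carrier_quotient)
  have "\<exists>n\<in>N. nrm V (x \<ominus> n) < e" if e: "e > 0" for e
  proof -
    obtain y where y: "y \<in> N +> x" "nrm V y < e" using nrm_quotient_less[OF x(1) e] C0 x by auto
    then obtain n where n: "n \<in> N" "y = n \<oplus> x" by (auto simp: a_r_coset_iff)
    then have "y = x \<ominus> (\<ominus> n)" using x N_closed by (simp add: minus_eq a_comm)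
    with y(2) have "nrm V (x \<ominus> (\<ominus> n)) < e" by simp
    then show ?thesis using N_neg[OF n(1)] by (rule bexI)
  qed
  then have "x \<in> N" using assms x by (auto simp: nrm_closed_def)
  then show "C = \<zero>\<^bsub>quotient V N\<^esub>" using x by (simp add: zero_quotient coset_eq_iff)
qed

text \<open>
  Cosets with increments below \<open>2\<^sup>-\<^sup>n\<close> are lifted one after the other: the representative of the
  next coset is chosen so that its increment nearly attains the quotient norm.
\<close>

lemma complete_quotient:
  assumes "seq_complete V"
  shows "seq_complete (quotient V N)"
proof -
  let ?Q = "quotient V N"
  interpret Q: complex_seminormed_space ?Q by (rule seminormed_quotient)
  show ?thesis
  proof (rule Q.seq_complete_if_fast)
    fix C assume C: "\<And>n. C n \<in> carrier ?Q" and fast: "\<And>n. nrm ?Q (C (Suc n) \<ominus>\<^bsub>?Q\<^esub> C n) \<le> (1/2)^n"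
    have "\<exists>f. \<forall>n. (f n \<in> carrier V \<and> C n = N +> f n) \<and> nrm V (f (Suc n) \<ominus> f n) < 2 * (1/2)^n"
    proof (rule dependent_nat_choice)
      show "\<exists>x. x \<in> carrier V \<and> C 0 = N +> x" using C[of 0] by (auto simp: carrier_quotient)
    next
      fix x n assume x: "x \<in> carrier V \<and> C n = N +> x"
      obtain y where y: "y \<in> carrier V" "C (Suc n) = N +> y" using C[of "Suc n"] by (auto simp: carrier_quotient)
      have d: "nrm ?Q (N +> (y \<ominus> x)) \<le> (1/2)^n" using fast[of n] x y by (simp add: diff_quotient)
      have "y \<ominus> x \<in> carrier V" using x y by simp
      from nrm_quotient_less[OF this, of "(1/2)^n"] obtain z where
        z: "z \<in> N +> (y \<ominus> x)" "nrm V z < nrm ?Q (N +> (y \<ominus> x)) + (1/2)^n" by auto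
      have zc: "z \<in> carrier V" "z \<ominus> (y \<ominus> x) \<in> N" using z(1) x y by (auto simp: mem_coset_iff)
      have "(z \<oplus> x) \<ominus> y = (z \<oplus> x) \<ominus> ((y \<ominus> x) \<oplus> x)" using x y by simp
      also have "\<dots> = z \<ominus> (y \<ominus> x)" using x y zc(1) by (subst add_diff_add) auto
      finally have "N +> (z \<oplus> x) = N +> y" using x y zc by (simp add: coset_eq_iff)
      moreover have "(z \<oplus> x) \<ominus> x = z" using x zc by (simp add: diff_eq_iff)
      ultimately show "\<exists>w. (w \<in> carrier V \<and> C (Suc n) = N +> w) \<and> nrm V (w \<ominus> x) < 2 * (1/2)^n"
        using x y zc z d by (intro exI[of _ "z \<oplus> x"]) auto
    qed
    then obtain f where f: "\<And>n. f n \<in> carrier V" "\<And>n. C n = N +> f n"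
        "\<And>n. nrm V (f (Suc n) \<ominus> f n) < 2 * (1/2)^n" by metis
    have "cauchy_seq V f"
      by (rule cauchy_if_geometric[where C=2]) (use f in \<open>auto intro: less_imp_le\<close>)
    then obtain l where l: "converges V f l" using assms by (auto simp: seq_complete_def)
    have "nrm ?Q (N +> x) \<le> 1 * nrm V x" if "x \<in> carrier V" for x
      using nrm_quotient_le[OF that self_mem_coset[OF that]] by simp
    from converges_linear_map[OF seminormed seminormed_quotient linear_map_quotient this l] f
    show "\<exists>L. converges ?Q C L" by (auto simp: f(2)[abs_def])
  qed
qed

end

subsection \<open>The normed space of a seminormed space\<close>

context complex_seminormed_space
begin

lemma kernel_subspace: "lin_subspace V (seminorm_kernel V)"
  unfolding lin_subspace_def seminorm_kernel_def
  by (auto simp: nrm_smult intro!: antisym[OF order_trans[OF nrm_triangle]])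

lemma kernel_closed: "nrm_closed V (seminorm_kernel V)"
  unfolding nrm_closed_def
proof (intro ballI impI)
  fix x assume x: "x \<in> carrier V" and *: "\<forall>e>0. \<exists>n\<in>seminorm_kernel V. nrm V (x \<ominus> n) < e"
  have "nrm V x \<le> 0 + e" if e: "e > 0" for e
  proof -
    obtain n where n: "n \<in> seminorm_kernel V" "nrm V (x \<ominus> n) < e" using * e by auto
    then show ?thesis using nrm_le_diff[OF x, of n] by (simp add: seminorm_kernel_def)
  qed
  then have "nrm V x \<le> 0" by (rule field_le_epsilon)
  then show "x \<in> seminorm_kernel V" using x by (auto simp: seminorm_kernel_def intro: antisym)
qed

sublocale sep: quotient_space V "seminorm_kernel V"
  by unfold_locales (rule kernel_subspace)

lemma normed_separated: "complex_normed_space (separated V)"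
  unfolding separated_def by (rule sep.normed_quotient[OF kernel_closed])

lemma complete_separated: "seq_complete V \<Longrightarrow> seq_complete (separated V)"
  unfolding separated_def by (rule sep.complete_quotient)

lemma linear_map_separated: "linear_map V (separated V) (\<lambda>x. seminorm_kernel V +> x)"
  unfolding separated_def by (rule sep.linear_map_quotient)

lemma nrm_separated:
  assumes x: "x \<in> carrier V"
  shows "nrm (separated V) (seminorm_kernel V +> x) = nrm V x"
proof (rule antisym)
  show "nrm (separated V) (seminorm_kernel V +> x) \<le> nrm V x"
    unfolding separated_def by (rule sep.nrm_quotient_le[OF x sep.self_mem_coset[OF x]])
  show "nrm V x \<le> nrm (separated V) (seminorm_kernel V +> x)"
    unfolding separated_def
  proof (rule sep.nrm_quotient_greatest[OF x])
    fix y assume "y \<in> seminorm_kernel V +> x"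
    then have y: "y \<in> carrier V" "y \<ominus> x \<in> seminorm_kernel V"
      using sep.mem_coset_iff[OF x] by auto
    then have "nrm V (y \<ominus> x) = 0" by (simp add: seminorm_kernel_def)
    with nrm_le_diff[OF x y(1)] nrm_diff_comm[OF x y(1)] show "nrm V x \<le> nrm V y" by simp
  qed
qed

end

subsection \<open>Isomorphic copies\<close>

locale transported = complex_seminormed_space +
  fixes f assumes inj: "inj_on f (carrier V)"
begin

lemma inv_f: "x \<in> carrier V \<Longrightarrow> inv_into (carrier V) f (f x) = x"
  using inj by simp

lemma carrier_transport: "carrier (transport f V) = f ` carrier V"
  by (simp add: transport_def Let_def)

lemma zero_transport: "\<zero>\<^bsub>transport f V\<^esub> = f \<zero>"
  by (simp add: transport_def Let_def)

lemma transport_simps: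
  "x \<in> carrier V \<Longrightarrow> y \<in> carrier V \<Longrightarrow> f x \<oplus>\<^bsub>transport f V\<^esub> f y = f (x \<oplus> y)"
  "x \<in> carrier V \<Longrightarrow> c \<odot>\<^bsub>transport f V\<^esub> f x = f (c \<odot> x)"
  "x \<in> carrier V \<Longrightarrow> nrm (transport f V) (f x) = nrm V x"
  by (simp_all add: transport_def Let_def inv_f)

lemma seminormed_transport: "complex_seminormed_space (transport f V)"
  unfolding transport_def Let_def
  by (rule mk_seminormed_space)
    (auto simp: inv_f a_assoc sm_add_l sm_add_r sm_assoc nrm_triangle nrm_smult, simp add: a_comm)

lemma linear_map_transport: "linear_map V (transport f V) f"
  by (auto simp: linear_map_def carrier_transport transport_simps)

lemma diff_transport:
  "x \<in> carrier V \<Longrightarrow> y \<in> carrier V \<Longrightarrow> f x \<ominus>\<^bsub>transport f V\<^esub> f y = f (x \<ominus> y)"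
  using linear_map_zero_diff(2)[OF seminormed seminormed_transport linear_map_transport] by simp

lemma complete_transport:
  assumes "seq_complete V"
  shows "seq_complete (transport f V)"
  unfolding seq_complete_def
proof (intro allI impI)
  let ?W = "transport f V"
  fix y assume y: "cauchy_seq ?W y"
  define x where "x n = inv_into (carrier V) f (y n)" for n
  have yc: "y n \<in> f ` carrier V" for n using y by (simp add: cauchy_seq_def carrier_transport)
  then have x: "x n \<in> carrier V" "f (x n) = y n" for n
    using f_inv_into_f[OF yc] inv_into_into[OF yc] by (auto simp: x_def)
  have "nrm ?W (y m \<ominus>\<^bsub>?W\<^esub> y n) = nrm V (x m \<ominus> x n)" for m n
    using x(1)[of m] x(1)[of n] by (simp add: x(2)[symmetric] diff_transport transport_simps)
  with y x have "cauchy_seq V x" by (simp add: cauchy_seq_def)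
  then obtain l where l: "converges V x l" using assms by (auto simp: seq_complete_def)
  have "nrm ?W (f z) \<le> 1 * nrm V z" if "z \<in> carrier V" for z using that by (simp add: transport_simps)
  from converges_linear_map[OF seminormed seminormed_transport linear_map_transport this l] x
  show "\<exists>l. converges ?W y l" by (auto simp: x(2)[abs_def])
qed

end

lemma banach_transport:
  assumes "banach V" "inj_on f (carrier V)"
  shows "banach (transport f V)"
proof -
  interpret V: complex_normed_space V using assms by (simp add: banach_def)
  interpret transported V f by unfold_locales fact
  have "complex_normed_space (transport f V)"
    by (rule complex_normed_spaceI[OF seminormed_transport])
      (auto simp: carrier_transport transport_simps zero_transport V.nrm_eq_0)
  then show ?thesis using complete_transport assms by (simp add: banach_def)
qed

lemma subspace_of_simps [simp]:
  "carrier (subspace_of V Y) = Y" "\<zero>\<^bsub>subspace_of V Y\<^esub> = \<zero>\<^bsub>V\<^esub>"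
  "x \<oplus>\<^bsub>subspace_of V Y\<^esub> y = x \<oplus>\<^bsub>V\<^esub> y" "c \<odot>\<^bsub>subspace_of V Y\<^esub> x = c \<odot>\<^bsub>V\<^esub> x"
  "nrm (subspace_of V Y) = nrm V"
  by (simp_all add: subspace_of_def)

lemma (in quotient_space) subspace_seminormed: "complex_seminormed_space (subspace_of V N)"
proof -
  have "abelian_group (subspace_of V N)"
    by (rule abelian_groupI)
      (auto simp: N_closed N_zero N_add a_assoc intro: a_comm intro!: bexI[OF _ N_neg] l_neg)
  then have "Module.module complex_ring (subspace_of V N)"
    by (intro moduleI cring_complex_ring) (auto simp: N_closed N_smult sm_add_l sm_add_r sm_assoc)
  then show ?thesis
    unfolding complex_seminormed_space_def complex_seminormed_space_axioms_def
    by (auto simp: N_closed nrm_triangle nrm_smult)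
qed

subsection \<open>Sums of two spaces\<close>

lemma l1_prod_simps [simp]:
  "carrier (l1_prod V W) = carrier V \<times> carrier W" "\<zero>\<^bsub>l1_prod V W\<^esub> = (\<zero>\<^bsub>V\<^esub>, \<zero>\<^bsub>W\<^esub>)"
  "(x, y) \<oplus>\<^bsub>l1_prod V W\<^esub> (x', y') = (x \<oplus>\<^bsub>V\<^esub> x', y \<oplus>\<^bsub>W\<^esub> y')"
  "c \<odot>\<^bsub>l1_prod V W\<^esub> (x, y) = (c \<odot>\<^bsub>V\<^esub> x, c \<odot>\<^bsub>W\<^esub> y)"
  "nrm (l1_prod V W) (x, y) = nrm V x + nrm W y"
  by (simp_all add: l1_prod_def)

locale l1_prod_space = V: complex_seminormed_space V + W: complex_seminormed_space W for V W
begin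

lemma seminormed: "complex_seminormed_space (l1_prod V W)"
  unfolding l1_prod_def
proof (rule mk_seminormed_space; clarsimp)
  fix a b a' b' assume "a \<in> carrier V" "b \<in> carrier W" "a' \<in> carrier V" "b' \<in> carrier W"
  then show "nrm V (a \<oplus>\<^bsub>V\<^esub> a') + nrm W (b \<oplus>\<^bsub>W\<^esub> b') \<le> nrm V a + nrm W b + (nrm V a' + nrm W b')"
    using V.nrm_triangle[of a a'] W.nrm_triangle[of b b'] by linarith
qed (auto simp: V.a_assoc W.a_assoc V.sm_add_l W.sm_add_l V.sm_add_r W.sm_add_r V.sm_assoc W.sm_assoc
    V.nrm_smult W.nrm_smult distrib_left intro: V.a_comm W.a_comm)

sublocale P: complex_seminormed_space "l1_prod V W" by (rule seminormed)

lemma diff [simp]: "x \<in> carrier V \<Longrightarrow> x' \<in> carrier V \<Longrightarrow> y \<in> carrier W \<Longrightarrow> y' \<in> carrier W \<Longrightarrow>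
    (x, y) \<ominus>\<^bsub>l1_prod V W\<^esub> (x', y') = (x \<ominus>\<^bsub>V\<^esub> x', y \<ominus>\<^bsub>W\<^esub> y')"
  by (subst P.diff_eq_iff) auto

lemma complete:
  assumes "seq_complete V" "seq_complete W"
  shows "seq_complete (l1_prod V W)"
  unfolding seq_complete_def
proof (intro allI impI)
  fix p assume p: "cauchy_seq (l1_prod V W) p"
  define x where "x n = fst (p n)" for n
  define y where "y n = snd (p n)" for n
  have c: "x n \<in> carrier V" "y n \<in> carrier W" "p n = (x n, y n)" for n
    using p by (auto simp: cauchy_seq_def x_def y_def mem_Times_iff)
  have d: "nrm (l1_prod V W) (p m \<ominus>\<^bsub>l1_prod V W\<^esub> p n) = nrm V (x m \<ominus>\<^bsub>V\<^esub> x n) + nrm W (y m \<ominus>\<^bsub>W\<^esub> y n)" for m n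
    by (simp add: c)
  have "cauchy_seq V x" "cauchy_seq W y"
    unfolding cauchy_seq_def
    using p c by (auto simp: cauchy_seq_def d)
      (meson V.minus_closed V.nrm_nonneg W.minus_closed W.nrm_nonneg c(1,2) le_add_same_cancel1 le_add_same_cancel2 le_less_trans)+
  then obtain k l where k: "converges V x k" and l: "converges W y l" using assms unfolding seq_complete_def by blast
  have "(\<lambda>n. nrm V (x n \<ominus>\<^bsub>V\<^esub> k) + nrm W (y n \<ominus>\<^bsub>W\<^esub> l)) \<longlonglongrightarrow> 0"
    using k l by (intro tendsto_add_zero) (auto simp: converges_def)
  then have "converges (l1_prod V W) p (k, l)"
    using k l by (simp add: converges_def c)
  then show "\<exists>l. converges (l1_prod V W) p l" by blast
qed

end

lemma banach_l1_prod:
  assumes "banach V" "banach W"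
  shows "banach (l1_prod V W)"
proof -
  interpret V: complex_normed_space V using assms by (simp add: banach_def)
  interpret W: complex_normed_space W using assms by (simp add: banach_def)
  interpret l1_prod_space V W by unfold_locales
  have "complex_normed_space (l1_prod V W)"
  proof (rule complex_normed_spaceI[OF seminormed])
    fix p assume "p \<in> carrier (l1_prod V W)" "nrm (l1_prod V W) p = 0"
    then show "p = \<zero>\<^bsub>l1_prod V W\<^esub>"
      by (auto simp: V.nrm_eq_0 W.nrm_eq_0 add_nonneg_eq_0_iff)
  qed
  then show ?thesis using complete assms by (simp add: banach_def)
qed

section \<open>Sums of families\<close>

lemma l1_sum_simps [simp]:
  "\<zero>\<^bsub>l1_sum I X\<^esub> = (\<lambda>i\<in>I. \<zero>\<^bsub>X i\<^esub>)"
  "x \<oplus>\<^bsub>l1_sum I X\<^esub> y = (\<lambda>i\<in>I. x i \<oplus>\<^bsub>X i\<^esub> y i)"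
  "c \<odot>\<^bsub>l1_sum I X\<^esub> x = (\<lambda>i\<in>I. c \<odot>\<^bsub>X i\<^esub> x i)"
  "nrm (l1_sum I X) x = (\<Sum>\<^sub>\<infinity>i\<in>I. nrm (X i) (x i))"
  by (simp_all add: l1_sum_def)

lemma carrier_l1_sum:
  "x \<in> carrier (l1_sum I X) \<longleftrightarrow> x \<in> (\<Pi>\<^sub>E i\<in>I. carrier (X i)) \<and> (\<lambda>i. nrm (X i) (x i)) summable_on I"
  by (simp add: l1_sum_def)

locale l1_sum_space =
  fixes I :: "'i set" and X :: "'i \<Rightarrow> 'a cnormed"
  assumes X: "i \<in> I \<Longrightarrow> complex_seminormed_space (X i)"
begin

abbreviation L where "L \<equiv> l1_sum I X"

lemma memD:
  assumes "x \<in> carrier L"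
  shows "i \<in> I \<Longrightarrow> x i \<in> carrier (X i)" "(\<lambda>i. nrm (X i) (x i)) summable_on I"
    "i \<in> I \<Longrightarrow> 0 \<le> nrm (X i) (x i)" "x \<in> extensional I"
proof -
  have x: "x \<in> (\<Pi>\<^sub>E i\<in>I. carrier (X i))" "(\<lambda>i. nrm (X i) (x i)) summable_on I"
    using assms unfolding carrier_l1_sum by auto
  show "(\<lambda>i. nrm (X i) (x i)) summable_on I" by (rule x(2))
  show "x \<in> extensional I" using x(1) by (simp add: PiE_def)
  show xi: "x i \<in> carrier (X i)" if "i \<in> I" using x(1) that by (rule PiE_mem)
  show "0 \<le> nrm (X i) (x i)" if "i \<in> I"
    by (rule complex_seminormed_space.nrm_nonneg[OF X[OF that] xi[OF that]])
qed

lemma memI: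
  assumes "x \<in> extensional I" "\<And>i. i \<in> I \<Longrightarrow> x i \<in> carrier (X i)" "(\<lambda>i. nrm (X i) (x i)) summable_on I"
  shows "x \<in> carrier L"
  using assms by (auto simp: carrier_l1_sum PiE_def)

lemma zero_mem: "(\<lambda>i\<in>I. \<zero>\<^bsub>X i\<^esub>) \<in> carrier L"
proof (rule memI)
  fix i assume "i \<in> I"
  then interpret complex_seminormed_space "X i" by (rule X)
  show "(\<lambda>i\<in>I. \<zero>\<^bsub>X i\<^esub>) i \<in> carrier (X i)" using \<open>i \<in> I\<close> by simp
next
  have "nrm (X i) ((\<lambda>i\<in>I. \<zero>\<^bsub>X i\<^esub>) i) = 0" if "i \<in> I" for i
    using that complex_seminormed_space.nrm_zero[OF X[OF that]] by simp
  then show "(\<lambda>i. nrm (X i) ((\<lambda>i\<in>I. \<zero>\<^bsub>X i\<^esub>) i)) summable_on I"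
    using summable_on_cong[of I "\<lambda>i. nrm (X i) ((\<lambda>i\<in>I. \<zero>\<^bsub>X i\<^esub>) i)" "\<lambda>i. 0"] by simp
qed simp

lemma add_mem:
  assumes x: "x \<in> carrier L" and y: "y \<in> carrier L"
  shows "(\<lambda>i\<in>I. x i \<oplus>\<^bsub>X i\<^esub> y i) \<in> carrier L"
    and "(\<Sum>\<^sub>\<infinity>i\<in>I. nrm (X i) ((\<lambda>i\<in>I. x i \<oplus>\<^bsub>X i\<^esub> y i) i))
      \<le> (\<Sum>\<^sub>\<infinity>i\<in>I. nrm (X i) (x i)) + (\<Sum>\<^sub>\<infinity>i\<in>I. nrm (X i) (y i))"
proof -
  let ?s = "\<lambda>i\<in>I. x i \<oplus>\<^bsub>X i\<^esub> y i"
  have s: "?s i \<in> carrier (X i)" "0 \<le> nrm (X i) (?s i)"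
    "nrm (X i) (?s i) \<le> nrm (X i) (x i) + nrm (X i) (y i)" if "i \<in> I" for i
  proof -
    interpret complex_seminormed_space "X i" using that by (rule X)
    show "?s i \<in> carrier (X i)" "0 \<le> nrm (X i) (?s i)" "nrm (X i) (?s i) \<le> nrm (X i) (x i) + nrm (X i) (y i)"
      using that memD(1)[OF x] memD(1)[OF y] by (auto intro!: nrm_triangle)
  qed
  have sum: "(\<lambda>i. nrm (X i) (x i) + nrm (X i) (y i)) summable_on I"
    using memD(2)[OF x] memD(2)[OF y] by (rule summable_on_add)
  have ssum: "(\<lambda>i. nrm (X i) (?s i)) summable_on I"
    by (rule summable_on_comparison_test[OF sum]) (use s in auto)
  show "?s \<in> carrier L" by (rule memI) (use s ssum in auto)
  have "(\<Sum>\<^sub>\<infinity>i\<in>I. nrm (X i) (?s i)) \<le> (\<Sum>\<^sub>\<infinity>i\<in>I. nrm (X i) (x i) + nrm (X i) (y i))"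
    by (rule infsum_mono[OF ssum sum s(3)])
  also have "\<dots> = (\<Sum>\<^sub>\<infinity>i\<in>I. nrm (X i) (x i)) + (\<Sum>\<^sub>\<infinity>i\<in>I. nrm (X i) (y i))"
    using memD(2)[OF x] memD(2)[OF y] by (rule infsum_add)
  finally show "(\<Sum>\<^sub>\<infinity>i\<in>I. nrm (X i) (?s i))
      \<le> (\<Sum>\<^sub>\<infinity>i\<in>I. nrm (X i) (x i)) + (\<Sum>\<^sub>\<infinity>i\<in>I. nrm (X i) (y i))" .
qed

lemma smult_mem:
  assumes x: "x \<in> carrier L"
  shows "(\<lambda>i\<in>I. c \<odot>\<^bsub>X i\<^esub> x i) \<in> carrier L"
    and "(\<Sum>\<^sub>\<infinity>i\<in>I. nrm (X i) ((\<lambda>i\<in>I. c \<odot>\<^bsub>X i\<^esub> x i) i)) = cmod c * (\<Sum>\<^sub>\<infinity>i\<in>I. nrm (X i) (x i))"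
proof -
  let ?s = "\<lambda>i\<in>I. c \<odot>\<^bsub>X i\<^esub> x i"
  have s: "?s i \<in> carrier (X i)" "nrm (X i) (?s i) = cmod c * nrm (X i) (x i)" if "i \<in> I" for i
  proof -
    interpret complex_seminormed_space "X i" using that by (rule X)
    show "?s i \<in> carrier (X i)" "nrm (X i) (?s i) = cmod c * nrm (X i) (x i)"
      using that memD(1)[OF x] by (auto simp: nrm_smult)
  qed
  have "(\<lambda>i. nrm (X i) (?s i)) summable_on I \<longleftrightarrow> (\<lambda>i. cmod c * nrm (X i) (x i)) summable_on I"
    by (rule summable_on_cong) (rule s(2))
  then have "(\<lambda>i. nrm (X i) (?s i)) summable_on I"
    using summable_on_cmult_right[OF memD(2)[OF x]] by simp
  then show "?s \<in> carrier L" by (intro memI) (use s in auto)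
  have "(\<Sum>\<^sub>\<infinity>i\<in>I. nrm (X i) (?s i)) = (\<Sum>\<^sub>\<infinity>i\<in>I. cmod c * nrm (X i) (x i))"
    by (rule infsum_cong) (rule s(2))
  also have "\<dots> = cmod c * (\<Sum>\<^sub>\<infinity>i\<in>I. nrm (X i) (x i))"
    by (rule infsum_cmult_right) (rule memD(2)[OF x])
  finally show "(\<Sum>\<^sub>\<infinity>i\<in>I. nrm (X i) (?s i)) = cmod c * (\<Sum>\<^sub>\<infinity>i\<in>I. nrm (X i) (x i))" .
qed

lemma seminormed: "complex_seminormed_space L"
proof -
  have eq: "u = v" if "u \<in> extensional I" "v \<in> extensional I" "\<And>i. i \<in> I \<Longrightarrow> complex_seminormed_space (X i) \<Longrightarrow> u i = v i" for u v
    using that X by (intro extensionalityI) auto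
  show ?thesis
    unfolding l1_sum_def
  proof (rule mk_seminormed_space)
    let ?C = "{x \<in> \<Pi>\<^sub>E i\<in>I. carrier (X i). (\<lambda>i. nrm (X i) (x i)) summable_on I}"
    have C: "?C = carrier L" by (simp add: l1_sum_def)
    show "(\<lambda>i\<in>I. \<zero>\<^bsub>X i\<^esub>) \<in> ?C" unfolding C by (rule zero_mem)
    fix x assume "x \<in> ?C"
    then have x: "x \<in> carrier L" unfolding C .
    note xD = memD[OF x]
    show "(\<lambda>i\<in>I. c \<odot>\<^bsub>X i\<^esub> x i) \<in> ?C" for c unfolding C by (rule smult_mem[OF x])
    show "(\<Sum>\<^sub>\<infinity>i\<in>I. nrm (X i) ((\<lambda>i\<in>I. c \<odot>\<^bsub>X i\<^esub> x i) i)) = cmod c * (\<Sum>\<^sub>\<infinity>i\<in>I. nrm (X i) (x i))" for c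
      by (rule smult_mem[OF x])
    show "(\<lambda>i\<in>I. (\<lambda>i\<in>I. \<zero>\<^bsub>X i\<^esub>) i \<oplus>\<^bsub>X i\<^esub> x i) = x"
      by (rule eq) (use xD in \<open>auto simp: complex_seminormed_space_def module_def abelian_group.axioms(1) abelian_monoid.l_zero\<close>)
    show "(\<lambda>i\<in>I. 0 \<odot>\<^bsub>X i\<^esub> x i) = (\<lambda>i\<in>I. \<zero>\<^bsub>X i\<^esub>)"
      by (rule eq) (use xD in \<open>auto simp: complex_seminormed_space.sm_zero_l\<close>)
    show "(\<lambda>i\<in>I. 1 \<odot>\<^bsub>X i\<^esub> x i) = x"
      by (rule eq) (use xD in \<open>auto simp: complex_seminormed_space.sm_one\<close>)
    show "(\<lambda>i\<in>I. (c + d) \<odot>\<^bsub>X i\<^esub> x i) = (\<lambda>i\<in>I. (\<lambda>i\<in>I. c \<odot>\<^bsub>X i\<^esub> x i) i \<oplus>\<^bsub>X i\<^esub> (\<lambda>i\<in>I. d \<odot>\<^bsub>X i\<^esub> x i) i)" for c d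
      by (rule eq) (use xD in \<open>auto simp: complex_seminormed_space.sm_add_l\<close>)
    show "(\<lambda>i\<in>I. (c * d) \<odot>\<^bsub>X i\<^esub> x i) = (\<lambda>i\<in>I. c \<odot>\<^bsub>X i\<^esub> (\<lambda>i\<in>I. d \<odot>\<^bsub>X i\<^esub> x i) i)" for c d
      by (rule eq) (use xD in \<open>auto simp: complex_seminormed_space.sm_assoc\<close>)
    fix y assume "y \<in> ?C"
    then have y: "y \<in> carrier L" unfolding C .
    note yD = memD[OF y]
    show "(\<lambda>i\<in>I. x i \<oplus>\<^bsub>X i\<^esub> y i) \<in> ?C" unfolding C by (rule add_mem[OF x y])
    show "(\<Sum>\<^sub>\<infinity>i\<in>I. nrm (X i) ((\<lambda>i\<in>I. x i \<oplus>\<^bsub>X i\<^esub> y i) i))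
        \<le> (\<Sum>\<^sub>\<infinity>i\<in>I. nrm (X i) (x i)) + (\<Sum>\<^sub>\<infinity>i\<in>I. nrm (X i) (y i))" by (rule add_mem[OF x y])
    show "(\<lambda>i\<in>I. x i \<oplus>\<^bsub>X i\<^esub> y i) = (\<lambda>i\<in>I. y i \<oplus>\<^bsub>X i\<^esub> x i)"
      by (rule eq) (use xD yD in \<open>auto simp: complex_seminormed_space_def module_def abelian_group.axioms(1) abelian_monoid.a_comm\<close>)
    show "(\<lambda>i\<in>I. c \<odot>\<^bsub>X i\<^esub> (\<lambda>i\<in>I. x i \<oplus>\<^bsub>X i\<^esub> y i) i) =
        (\<lambda>i\<in>I. (\<lambda>i\<in>I. c \<odot>\<^bsub>X i\<^esub> x i) i \<oplus>\<^bsub>X i\<^esub> (\<lambda>i\<in>I. c \<odot>\<^bsub>X i\<^esub> y i) i)" for c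
      by (rule eq) (use xD yD in \<open>auto simp: complex_seminormed_space.sm_add_r\<close>)
    fix w assume "w \<in> ?C"
    then have w: "w \<in> carrier L" unfolding C .
    show "(\<lambda>i\<in>I. (\<lambda>i\<in>I. x i \<oplus>\<^bsub>X i\<^esub> y i) i \<oplus>\<^bsub>X i\<^esub> w i) = (\<lambda>i\<in>I. x i \<oplus>\<^bsub>X i\<^esub> (\<lambda>i\<in>I. y i \<oplus>\<^bsub>X i\<^esub> w i) i)"
      by (rule eq) (use xD yD memD[OF w] in \<open>auto simp: complex_seminormed_space_def module_def abelian_group.axioms(1) abelian_monoid.a_assoc\<close>)
  qed
qed

sublocale L: complex_seminormed_space L by (rule seminormed)

lemma diff: 
  assumes x: "x \<in> carrier L" and y: "y \<in> carrier L"
  shows "x \<ominus>\<^bsub>L\<^esub> y = (\<lambda>i\<in>I. x i \<ominus>\<^bsub>X i\<^esub> y i)"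
proof -
  have "x \<ominus>\<^bsub>L\<^esub> y = x \<oplus>\<^bsub>L\<^esub> ((-1) \<odot>\<^bsub>L\<^esub> y)" using y by (simp only: L.minus_eq L.neg_eq)
  also have "\<dots> = (\<lambda>i\<in>I. x i \<ominus>\<^bsub>X i\<^esub> y i)"
  proof (rule extensionalityI)
    fix i assume i: "i \<in> I"
    then interpret complex_seminormed_space "X i" by (rule X)
    show "(x \<oplus>\<^bsub>L\<^esub> ((-1) \<odot>\<^bsub>L\<^esub> y)) i = (\<lambda>i\<in>I. x i \<ominus>\<^bsub>X i\<^esub> y i) i"
      using i memD(1)[OF y i] by (simp add: minus_eq neg_eq)
  qed auto
  finally show ?thesis .
qed

lemma coordinate_le:
  assumes "x \<in> carrier L" "i \<in> I"
  shows "nrm (X i) (x i) \<le> nrm L x"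
  using finite_sum_le_infsum[OF memD(2)[OF assms(1)], of "{i}"] memD(3)[OF assms(1)] assms by simp

lemma finite_sum_le: "x \<in> carrier L \<Longrightarrow> finite G \<Longrightarrow> G \<subseteq> I \<Longrightarrow> (\<Sum>i\<in>G. nrm (X i) (x i)) \<le> nrm L x"
  using finite_sum_le_infsum[of "\<lambda>i. nrm (X i) (x i)" I G] memD[of x] by simp

lemma coordinate_diff_le:
  assumes "x \<in> carrier L" "y \<in> carrier L" "i \<in> I"
  shows "nrm (X i) (x i \<ominus>\<^bsub>X i\<^esub> y i) \<le> nrm L (x \<ominus>\<^bsub>L\<^esub> y)"
proof -
  have "x \<ominus>\<^bsub>L\<^esub> y \<in> carrier L" using assms by (intro L.minus_closed)
  from coordinate_le[OF this assms(3)] have "nrm (X i) ((x \<ominus>\<^bsub>L\<^esub> y) i) \<le> nrm L (x \<ominus>\<^bsub>L\<^esub> y)" .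
  then show ?thesis using assms(3) by (simp only: diff[OF assms(1,2)] restrict_apply if_True)
qed

text \<open>
  The coordinates converge. Finite partial sums of the norms of the error pass to the limit, which
  bounds the error in the whole sum.
\<close>

lemma complete:
  assumes Xc: "\<And>i. i \<in> I \<Longrightarrow> seq_complete (X i)"
  shows "seq_complete L"
proof (rule L.seq_complete_if_fast)
  fix x assume x: "\<And>n. x n \<in> carrier L" and fast: "\<And>n. nrm L (x (Suc n) \<ominus>\<^bsub>L\<^esub> x n) \<le> (1/2)^n"
  have geo: "nrm L (x m \<ominus>\<^bsub>L\<^esub> x n) \<le> 2 * (1/2)^n" if "n \<le> m" for m n
    using L.geometric_cauchy[of x 1, OF x _ that] fast by simp
  have "\<exists>l. converges (X i) (\<lambda>n. x n i) l" if i: "i \<in> I" for i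
  proof -
    interpret complex_seminormed_space "X i" using i by (rule X)
    have "cauchy_seq (X i) (\<lambda>n. x n i)"
    proof (rule cauchy_if_geometric[where C=1])
      show "nrm (X i) (x (Suc n) i \<ominus>\<^bsub>X i\<^esub> x n i) \<le> 1 * (1/2)^n" for n
        using coordinate_diff_le[OF x x i, of "Suc n" n] fast[of n] by simp
    qed (use memD(1)[OF x i] in auto)
    with Xc[OF i] show ?thesis by (simp add: seq_complete_def)
  qed
  then obtain l0 where l0: "\<And>i. i \<in> I \<Longrightarrow> converges (X i) (\<lambda>n. x n i) (l0 i)" by metis
  define l where "l = restrict l0 I"
  have l: "converges (X i) (\<lambda>n. x n i) (l i)" if "i \<in> I" for i using l0[OF that] that by (simp add: l_def)
  have lc: "l i \<in> carrier (X i)" if "i \<in> I" for i using l[OF that] by (simp add: converges_def)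
  have fin: "(\<Sum>i\<in>G. nrm (X i) (l i \<ominus>\<^bsub>X i\<^esub> x n i)) \<le> 2 * (1/2)^n" if G: "finite G" "G \<subseteq> I" for G n
  proof -
    have "(\<lambda>m. \<Sum>i\<in>G. nrm (X i) (x m i \<ominus>\<^bsub>X i\<^esub> x n i)) \<longlonglongrightarrow> (\<Sum>i\<in>G. nrm (X i) (l i \<ominus>\<^bsub>X i\<^esub> x n i))"
    proof (rule tendsto_sum)
      fix i assume "i \<in> G"
      then have i: "i \<in> I" using G by auto
      interpret complex_seminormed_space "X i" using i by (rule X)
      show "(\<lambda>m. nrm (X i) (x m i \<ominus>\<^bsub>X i\<^esub> x n i)) \<longlonglongrightarrow> nrm (X i) (l i \<ominus>\<^bsub>X i\<^esub> x n i)"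
        by (rule converges_nrm[OF converges_minus[OF l[OF i] converges_const]]) (use memD(1)[OF x i] in auto)
    qed
    moreover have "(\<Sum>i\<in>G. nrm (X i) (x m i \<ominus>\<^bsub>X i\<^esub> x n i)) \<le> 2 * (1/2)^n" if "m \<ge> n" for m
    proof -
      have "(\<Sum>i\<in>G. nrm (X i) (x m i \<ominus>\<^bsub>X i\<^esub> x n i)) = (\<Sum>i\<in>G. nrm (X i) ((x m \<ominus>\<^bsub>L\<^esub> x n) i))"
        using G by (intro sum.cong) (auto simp: diff[OF x x])
      also have "\<dots> \<le> nrm L (x m \<ominus>\<^bsub>L\<^esub> x n)" using x G by (intro finite_sum_le) auto
      finally show ?thesis using geo[OF that] by simp
    qed
    ultimately show ?thesis by (intro LIMSEQ_le_const2) auto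
  qed
  define d where "d n = (\<lambda>i\<in>I. l i \<ominus>\<^bsub>X i\<^esub> x n i)" for n
  have dc: "d n i \<in> carrier (X i)" "nrm (X i) (d n i) \<ge> 0" if "i \<in> I" for n i
  proof -
    interpret complex_seminormed_space "X i" using that by (rule X)
    show "d n i \<in> carrier (X i)" "nrm (X i) (d n i) \<ge> 0" using that lc memD(1)[OF x that] by (auto simp: d_def)
  qed
  have fin': "(\<Sum>i\<in>G. nrm (X i) (d n i)) \<le> 2 * (1/2)^n" if G: "finite G" "G \<subseteq> I" for G n
  proof -
    have "(\<Sum>i\<in>G. nrm (X i) (d n i)) = (\<Sum>i\<in>G. nrm (X i) (l i \<ominus>\<^bsub>X i\<^esub> x n i))"
      using G by (intro sum.cong) (auto simp: d_def)
    with fin[OF G] show ?thesis by simp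
  qed
  have ds: "(\<lambda>i. nrm (X i) (d n i)) summable_on I" for n
    by (rule nonneg_bdd_above_summable_on) (use dc fin' in \<open>auto intro!: bdd_aboveI2[of _ _ "2 * (1/2)^n"]\<close>)
  have dL: "d n \<in> carrier L" for n by (rule memI) (use dc ds in \<open>auto simp: d_def\<close>)
  have dn: "nrm L (d n) \<le> 2 * (1/2)^n" for n
    using infsum_le_finite_sums[OF ds[of n], of "2 * (1/2)^n"] fin' by simp
  have l_eq: "l = d n \<oplus>\<^bsub>L\<^esub> x n" for n
  proof (rule extensionalityI)
    fix i assume i: "i \<in> I"
    then interpret complex_seminormed_space "X i" by (rule X)
    show "l i = (d n \<oplus>\<^bsub>L\<^esub> x n) i"
      using i lc[OF i] memD(1)[OF x i] by (simp add: d_def)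
  qed (auto simp: l_def)
  have lL: "l \<in> carrier L" using l_eq[of 0] dL x L.add.m_closed by metis
  have "l \<ominus>\<^bsub>L\<^esub> x n = d n" for n using l_eq[of n] dL x lL by (simp only: L.diff_eq_iff)
  then have le: "nrm L (x n \<ominus>\<^bsub>L\<^esub> l) \<le> 2 * (1/2)^n" for n
    using dn[of n] L.nrm_diff_comm[OF x lL, of n] by simp
  have ge: "nrm L (x n \<ominus>\<^bsub>L\<^esub> l) \<ge> 0" for n using x lL by (intro L.nrm_nonneg L.minus_closed)
  have "(\<lambda>n. nrm L (x n \<ominus>\<^bsub>L\<^esub> l)) \<longlonglongrightarrow> 0"
  proof (rule Lim_null_comparison)
    show "\<forall>\<^sub>F n in sequentially. norm (nrm L (x n \<ominus>\<^bsub>L\<^esub> l)) \<le> 2 * (1/2)^n" using le ge by simp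
    show "(\<lambda>n. 2 * (1/2)^n :: real) \<longlonglongrightarrow> 0"
      by (intro tendsto_mult_right_zero LIMSEQ_realpow_zero) auto
  qed
  then show "\<exists>l. converges L x l" using lL by (auto simp: converges_def)
qed

lemma normed:
  assumes Xn: "\<And>i. i \<in> I \<Longrightarrow> complex_normed_space (X i)"
  shows "complex_normed_space L"
proof (rule complex_normed_spaceI[OF seminormed])
  fix x assume x: "x \<in> carrier L" and "nrm L x = 0"
  have "x i = \<zero>\<^bsub>X i\<^esub>" if i: "i \<in> I" for i
  proof -
    interpret complex_normed_space "X i" using i by (rule Xn)
    have "nrm (X i) (x i) = 0" using coordinate_le[OF x i] memD(3)[OF x i] \<open>nrm L x = 0\<close> by simp
    then show ?thesis using memD(1)[OF x i] nrm_eq_0 by simp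
  qed
  then show "x = \<zero>\<^bsub>L\<^esub>" using memD(4)[OF x] by (auto intro: extensionalityI)
qed

end

lemma banach_l1_sum:
  assumes "\<And>i. i \<in> I \<Longrightarrow> banach (X i)"
  shows "banach (l1_sum I X)"
proof -
  interpret l1_sum_space I X by (rule l1_sum_space.intro) (rule banachD(3)[OF assms])
  show ?thesis
    unfolding banach_def by (intro conjI normed complete banachD(1,2)[OF assms])
qed

subsection \<open>Unordered sums in a Banach space\<close>

definition has_vsum :: "'a cnormed \<Rightarrow> ('i \<Rightarrow> 'a) \<Rightarrow> 'i set \<Rightarrow> 'a \<Rightarrow> bool" where
  "has_vsum V f I l \<longleftrightarrow> f \<in> I \<rightarrow> carrier V \<and> l \<in> carrier V \<and>
     (\<forall>e>0. \<exists>F. finite F \<and> F \<subseteq> I \<and> (\<forall>G. finite G \<and> F \<subseteq> G \<and> G \<subseteq> I \<longrightarrow> nrm V (finsum V f G \<ominus>\<^bsub>V\<^esub> l) < e))"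

context complex_normed_space
begin

lemma has_vsum_iff_limitin:
  assumes "f \<in> I \<rightarrow> carrier V"
  shows "has_vsum V f I l \<longleftrightarrow> limitin (ntop V) (finsum V f) l (finite_subsets_at_top I)"
proof -
  interpret Metric_space "carrier V" "ndist V" by (rule Metric_space_ndist)
  have c: "finsum V f G \<in> carrier V" if "G \<subseteq> I" for G
    using assms that by (intro finsum_closed) auto
  show ?thesis
  proof (cases "l \<in> carrier V")
    case True
    then show ?thesis
      unfolding has_vsum_def limitin_metric eventually_finite_subsets_at_top using assms c
      by (simp add: ndist_def conj_commute cong: conj_cong)
  qed (simp add: has_vsum_def limitin_metric)
qed

lemma has_vsum_unique:
  assumes "has_vsum V f I l" "has_vsum V f I l'"
  shows "l = l'"
proof -
  interpret Metric_space "carrier V" "ndist V" by (rule Metric_space_ndist)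
  have "f \<in> I \<rightarrow> carrier V" using assms by (simp add: has_vsum_def)
  then show ?thesis
    using limitin_metric_unique[of "finsum V f" l "finite_subsets_at_top I" l'] assms
    by (simp add: has_vsum_iff_limitin finite_subsets_at_top_neq_bot)
qed

lemma vsum_eqI:
  assumes "has_vsum V f I l"
  shows "vsum V f I = l"
  unfolding vsum_def
proof (rule the_equality)
  have f: "f \<in> I \<rightarrow> carrier V" using assms by (simp add: has_vsum_def)
  show "limitin (ntop V) (finsum V f) l (finite_subsets_at_top I)"
    using assms by (simp add: has_vsum_iff_limitin[OF f])
  show "l' = l" if "limitin (ntop V) (finsum V f) l' (finite_subsets_at_top I)" for l'
    using that assms has_vsum_unique by (simp add: has_vsum_iff_limitin[OF f, symmetric])
qed

lemma has_vsum_add: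
  assumes "has_vsum V f I l" "has_vsum V g I k"
  shows "has_vsum V (\<lambda>i. f i \<oplus> g i) I (l \<oplus> k)"
  unfolding has_vsum_def
proof (intro conjI allI impI)
  have c: "f \<in> I \<rightarrow> carrier V" "g \<in> I \<rightarrow> carrier V" "l \<in> carrier V" "k \<in> carrier V"
    using assms by (auto simp: has_vsum_def)
  then show "(\<lambda>i. f i \<oplus> g i) \<in> I \<rightarrow> carrier V" "l \<oplus> k \<in> carrier V" by auto
  fix e :: real assume "e > 0"
  then have e2: "e/2 > 0" by simp
  obtain F1 where F1: "finite F1" "F1 \<subseteq> I"
    "\<And>G. finite G \<Longrightarrow> F1 \<subseteq> G \<Longrightarrow> G \<subseteq> I \<Longrightarrow> nrm V (finsum V f G \<ominus> l) < e/2"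
    using assms(1) e2 unfolding has_vsum_def by metis
  obtain F2 where F2: "finite F2" "F2 \<subseteq> I"
    "\<And>G. finite G \<Longrightarrow> F2 \<subseteq> G \<Longrightarrow> G \<subseteq> I \<Longrightarrow> nrm V (finsum V g G \<ominus> k) < e/2"
    using assms(2) e2 unfolding has_vsum_def by metis
  show "\<exists>F. finite F \<and> F \<subseteq> I \<and> (\<forall>G. finite G \<and> F \<subseteq> G \<and> G \<subseteq> I \<longrightarrow>
      nrm V (finsum V (\<lambda>i. f i \<oplus> g i) G \<ominus> (l \<oplus> k)) < e)"
  proof (intro exI[of _ "F1 \<union> F2"] conjI allI impI)
    fix G assume "finite G \<and> F1 \<union> F2 \<subseteq> G \<and> G \<subseteq> I"
    then have G: "finite G" "F1 \<subseteq> G" "F2 \<subseteq> G" "G \<subseteq> I" by auto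
    have fc: "f \<in> G \<rightarrow> carrier V" "g \<in> G \<rightarrow> carrier V" using c G by auto
    then have "nrm V (finsum V (\<lambda>i. f i \<oplus> g i) G \<ominus> (l \<oplus> k))
        \<le> nrm V (finsum V f G \<ominus> l) + nrm V (finsum V g G \<ominus> k)"
      using c by (simp add: finsum_addf nrm_add_diff finsum_closed)
    with F1(3)[of G] F2(3)[of G] G show "nrm V (finsum V (\<lambda>i. f i \<oplus> g i) G \<ominus> (l \<oplus> k)) < e" by linarith
  qed (use F1 F2 in auto)
qed

end

lemma has_vsum_linear_map:
  assumes "complex_normed_space V" "complex_normed_space W" "linear_map V W h"
    and K: "\<And>x. x \<in> carrier V \<Longrightarrow> nrm W (h x) \<le> K * nrm V x"
    and f: "has_vsum V f I l"
  shows "has_vsum W (\<lambda>i. h (f i)) I (h l)"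
  unfolding has_vsum_def
proof (intro conjI allI impI)
  interpret V: complex_normed_space V by fact
  interpret W: complex_normed_space W by fact
  note h = linear_mapD[OF assms(3)] linear_map_zero_diff[OF V.seminormed W.seminormed assms(3)]
  have c: "f \<in> I \<rightarrow> carrier V" "l \<in> carrier V" using f by (auto simp: has_vsum_def)
  then show "(\<lambda>i. h (f i)) \<in> I \<rightarrow> carrier W" "h l \<in> carrier W" using h(1) by auto
  fix e :: real assume "e > 0"
  have K1: "\<bar>K\<bar> + 1 > 0" by linarith
  then have "e / (\<bar>K\<bar> + 1) > 0" using \<open>e > 0\<close> by simp
  then obtain F where F: "finite F" "F \<subseteq> I"
    "\<And>G. finite G \<Longrightarrow> F \<subseteq> G \<Longrightarrow> G \<subseteq> I \<Longrightarrow> nrm V (finsum V f G \<ominus>\<^bsub>V\<^esub> l) < e / (\<bar>K\<bar> + 1)"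
    using f unfolding has_vsum_def by metis
  show "\<exists>F. finite F \<and> F \<subseteq> I \<and> (\<forall>G. finite G \<and> F \<subseteq> G \<and> G \<subseteq> I \<longrightarrow>
      nrm W (finsum W (\<lambda>i. h (f i)) G \<ominus>\<^bsub>W\<^esub> h l) < e)"
  proof (intro exI[of _ F] conjI allI impI)
    fix G assume G: "finite G \<and> F \<subseteq> G \<and> G \<subseteq> I"
    have fc: "f \<in> G \<rightarrow> carrier V" using c G by auto
    then have sc: "finsum V f G \<in> carrier V" by (rule V.finsum_closed)
    have "nrm W (finsum W (\<lambda>i. h (f i)) G \<ominus>\<^bsub>W\<^esub> h l) = nrm W (h (finsum V f G \<ominus>\<^bsub>V\<^esub> l))"
      using sc c by (simp add: h(5) linear_map_finsum[OF V.seminormed W.seminormed assms(3) fc])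
    also have "\<dots> \<le> K * nrm V (finsum V f G \<ominus>\<^bsub>V\<^esub> l)" using sc c by (intro K) auto
    also have "\<dots> \<le> (\<bar>K\<bar> + 1) * nrm V (finsum V f G \<ominus>\<^bsub>V\<^esub> l)"
      using sc c by (intro mult_right_mono) auto
    also have "\<dots> < (\<bar>K\<bar> + 1) * (e / (\<bar>K\<bar> + 1))"
      using F(3)[of G] G K1 by (intro mult_strict_left_mono) auto
    also have "\<dots> = e" using K1 by simp
    finally show "nrm W (finsum W (\<lambda>i. h (f i)) G \<ominus>\<^bsub>W\<^esub> h l) < e" .
  qed (use F in auto)
qed

context complex_seminormed_space
begin

lemma finsum_subset_diff:
  assumes "finite G" "F \<subseteq> G" "f \<in> G \<rightarrow> carrier V"
  shows "finsum V f G \<ominus> finsum V f F = finsum V f (G - F)"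
proof -
  have c: "finsum V f (G - F) \<in> carrier V" "finsum V f F \<in> carrier V"
    using assms by (auto intro!: finsum_closed)
  have "finsum V f G = finsum V f ((G - F) \<union> F)" using assms(2) by (simp add: Un_absorb2)
  also have "\<dots> = finsum V f (G - F) \<oplus> finsum V f F"
    using assms finite_subset[OF assms(2,1)] by (intro finsum_Un_disjoint) auto
  finally show ?thesis using c by simp
qed

end

text \<open>
  Outside a finite set \<open>F n\<close> the norms add up to at most \<open>2\<^sup>-\<^sup>n\<close>. The sums over the growing finite
  sets \<open>H n\<close> therefore form a Cauchy sequence, and its limit is the limit of the whole net.
\<close>

lemma (in complex_normed_space) has_vsum_exists:
  assumes V: "seq_complete V" and f: "f \<in> I \<rightarrow> carrier V" and s: "(\<lambda>i. nrm V (f i)) summable_on I"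
  shows "\<exists>l. has_vsum V f I l \<and> nrm V l \<le> (\<Sum>\<^sub>\<infinity>i\<in>I. nrm V (f i))"
proof -
  have nn: "nrm V (f i) \<ge> 0" if "i \<in> I" for i using f that by (intro nrm_nonneg) (auto simp: Pi_iff)
  let ?S = "\<Sum>\<^sub>\<infinity>i\<in>I. nrm V (f i)"
  have "\<exists>F. finite F \<and> F \<subseteq> I \<and> (\<forall>G. finite G \<and> G \<subseteq> I - F \<longrightarrow> (\<Sum>i\<in>G. nrm V (f i)) \<le> (1/2)^n)" for n :: nat
  proof -
    have "(1/2)^n > (0::real)" by simp
    from infsum_finite_approximation[OF s this] obtain F where
      F: "finite F" "F \<subseteq> I" "dist (\<Sum>i\<in>F. nrm V (f i)) ?S \<le> (1/2)^n" by auto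
    have "(\<Sum>i\<in>G. nrm V (f i)) \<le> (1/2)^n" if G: "finite G" "G \<subseteq> I - F" for G
    proof -
      have "(\<Sum>i\<in>G. nrm V (f i)) + (\<Sum>i\<in>F. nrm V (f i)) = (\<Sum>i\<in>G \<union> F. nrm V (f i))"
        using G F by (subst sum.union_disjoint) auto
      also have "\<dots> \<le> ?S" using G F nn by (intro finite_sum_le_infsum s) auto
      finally show ?thesis using F(3) by (simp add: dist_real_def)
    qed
    with F show ?thesis by blast
  qed
  then obtain F where F: "\<And>n. finite (F n)" "\<And>n. F n \<subseteq> I"
    "\<And>n G. finite G \<Longrightarrow> G \<subseteq> I - F n \<Longrightarrow> (\<Sum>i\<in>G. nrm V (f i)) \<le> (1/2)^n" by metis
  define H where "H n = (\<Union>k\<le>n. F k)" for n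
  have H: "finite (H n)" "H n \<subseteq> I" "F n \<subseteq> H n" "H n \<subseteq> H (Suc n)" for n
    using F(1,2) by (auto simp: H_def intro: le_SucI)
  have tail: "nrm V (finsum V f G \<ominus> finsum V f (H n)) \<le> (1/2)^n" if "finite G" "H n \<subseteq> G" "G \<subseteq> I" for G n
  proof -
    have "nrm V (finsum V f G \<ominus> finsum V f (H n)) = nrm V (finsum V f (G - H n))"
      using that f by (subst finsum_subset_diff) auto
    also have "\<dots> \<le> (\<Sum>i\<in>G - H n. nrm V (f i))" using that f by (intro nrm_finsum_le) auto
    also have "\<dots> \<le> (1/2)^n" using that H(3)[of n] by (intro F(3)) auto
    finally show ?thesis .
  qed
  have xc: "finsum V f G \<in> carrier V" if "G \<subseteq> I" for G using f that by (intro finsum_closed) auto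
  have "cauchy_seq V (\<lambda>n. finsum V f (H n))"
    by (rule cauchy_if_geometric[where C=1]) (use xc H tail[OF H(1) H(4) H(2)] in auto)
  then obtain l where l: "converges V (\<lambda>n. finsum V f (H n)) l" using V by (auto simp: seq_complete_def)
  then have lc: "l \<in> carrier V" by (simp add: converges_def)
  have "has_vsum V f I l"
    unfolding has_vsum_def
  proof (intro conjI allI impI f lc)
    fix e :: real assume "e > 0"
    have "(\<lambda>n. (1/2)^n + nrm V (finsum V f (H n) \<ominus> l)) \<longlonglongrightarrow> 0"
      using l by (intro tendsto_add_zero LIMSEQ_realpow_zero) (auto simp: converges_def)
    from order_tendstoD(2)[OF this \<open>e > 0\<close>] obtain n where n: "(1/2)^n + nrm V (finsum V f (H n) \<ominus> l) < e"
      by (auto simp: eventually_sequentially)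
    show "\<exists>F. finite F \<and> F \<subseteq> I \<and> (\<forall>G. finite G \<and> F \<subseteq> G \<and> G \<subseteq> I \<longrightarrow> nrm V (finsum V f G \<ominus> l) < e)"
    proof (intro exI[of _ "H n"] conjI allI impI H)
      fix G assume G: "finite G \<and> H n \<subseteq> G \<and> G \<subseteq> I"
      then have "nrm V (finsum V f G \<ominus> l) \<le> nrm V (finsum V f G \<ominus> finsum V f (H n)) + nrm V (finsum V f (H n) \<ominus> l)"
        using xc H lc by (intro nrm_diff_triangle) auto
      with tail[of G n] G n show "nrm V (finsum V f G \<ominus> l) < e" by auto
    qed
  qed
  moreover have "nrm V (finsum V f (H n)) \<le> ?S" for n
  proof -
    have "nrm V (finsum V f (H n)) \<le> (\<Sum>i\<in>H n. nrm V (f i))" using f H by (intro nrm_finsum_le) auto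
    also have "\<dots> \<le> ?S" using H nn by (intro finite_sum_le_infsum s) auto
    finally show ?thesis .
  qed
  then have "nrm V l \<le> ?S"
    by (intro LIMSEQ_le_const2[OF converges_nrm[OF l]]) (use xc H in auto)
  ultimately show ?thesis by blast
qed

lemma has_vsum_reindex:
  assumes V: "complex_seminormed_space V" and g: "bij_betw g I J" and f: "has_vsum V f J l"
  shows "has_vsum V (\<lambda>i. f (g i)) I l"
  unfolding has_vsum_def
proof (intro conjI allI impI)
  interpret complex_seminormed_space V by fact
  have gI: "g ` I = J" "inj_on g I" using g by (auto simp: bij_betw_def)
  have c: "f \<in> J \<rightarrow> carrier V" "l \<in> carrier V" using f by (auto simp: has_vsum_def)
  then show "(\<lambda>i. f (g i)) \<in> I \<rightarrow> carrier V" "l \<in> carrier V" using gI by auto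
  fix e :: real assume "e > 0"
  then obtain F where F: "finite F" "F \<subseteq> J"
    "\<And>G. finite G \<Longrightarrow> F \<subseteq> G \<Longrightarrow> G \<subseteq> J \<Longrightarrow> nrm V (finsum V f G \<ominus>\<^bsub>V\<^esub> l) < e"
    using f unfolding has_vsum_def by metis
  obtain F' where F': "F' \<subseteq> I" "finite F'" "F = g ` F'"
    using F(1,2) gI finite_subset_image[of F g I] by auto
  show "\<exists>F. finite F \<and> F \<subseteq> I \<and> (\<forall>G. finite G \<and> F \<subseteq> G \<and> G \<subseteq> I \<longrightarrow>
      nrm V (finsum V (\<lambda>i. f (g i)) G \<ominus>\<^bsub>V\<^esub> l) < e)"
  proof (intro exI[of _ F'] conjI allI impI F')
    fix G assume G: "finite G \<and> F' \<subseteq> G \<and> G \<subseteq> I"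
    have "f \<in> g ` G \<rightarrow> carrier V" using c(1) G unfolding gI(1)[symmetric] by (auto simp: Pi_iff)
    moreover have "inj_on g G" using inj_on_subset[OF gI(2)] G by blast
    ultimately have "finsum V (\<lambda>i. f (g i)) G = finsum V f (g ` G)"
      by (rule finsum_reindex[symmetric])
    moreover have "nrm V (finsum V f (g ` G) \<ominus>\<^bsub>V\<^esub> l) < e"
      using G F' gI by (intro F(3)) auto
    ultimately show "nrm V (finsum V (\<lambda>i. f (g i)) G \<ominus>\<^bsub>V\<^esub> l) < e" by simp
  qed
qed

section \<open>Closed spans\<close>

context complex_seminormed_space
begin

lemma finsum_extend_coeffs:
  assumes "finite H" "G \<subseteq> H" "H \<subseteq> carrier V"
  shows "finsum V (\<lambda>y. c y \<odot> y) G = finsum V (\<lambda>y. (if y \<in> G then c y else 0) \<odot> y) H"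
  using assms by (intro add.finprod_mono_neutral_cong_left) auto

lemma lin_span_subspace:
  assumes Y: "Y \<subseteq> carrier V"
  shows "lin_subspace V (lin_span V Y)"
  unfolding lin_subspace_def
proof (intro conjI ballI allI)
  show "lin_span V Y \<subseteq> carrier V"
    using Y by (auto simp: lin_span_def intro!: finsum_closed)
  show "\<zero> \<in> lin_span V Y"
    unfolding lin_span_def by (auto intro!: exI[of _ "{}"] simp: finsum_empty)
  fix x y assume "x \<in> lin_span V Y" "y \<in> lin_span V Y"
  then obtain c G d H where x: "x = finsum V (\<lambda>y. c y \<odot> y) G" "finite G" "G \<subseteq> Y"
    and y: "y = finsum V (\<lambda>y. d y \<odot> y) H" "finite H" "H \<subseteq> Y"
    by (auto simp: lin_span_def)
  let ?c = "\<lambda>y. if y \<in> G then c y else 0" and ?d = "\<lambda>y. if y \<in> H then d y else 0"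
  have sub: "G \<union> H \<subseteq> carrier V" "finite (G \<union> H)" using x y Y by auto
  have "x \<oplus> y = finsum V (\<lambda>y. ?c y \<odot> y) (G \<union> H) \<oplus> finsum V (\<lambda>y. ?d y \<odot> y) (G \<union> H)"
    unfolding x(1) y(1) using finsum_extend_coeffs[OF sub(2) _ sub(1), of G c]
      finsum_extend_coeffs[OF sub(2) _ sub(1), of H d] by simp
  also have "\<dots> = finsum V (\<lambda>y. ?c y \<odot> y \<oplus> ?d y \<odot> y) (G \<union> H)"
    using sub by (subst finsum_addf) auto
  also have "\<dots> = finsum V (\<lambda>y. (?c y + ?d y) \<odot> y) (G \<union> H)"
    using sub by (intro finsum_cong') (auto simp: sm_add_l)
  finally show "x \<oplus> y \<in> lin_span V Y"
    unfolding lin_span_def using x y by (intro CollectI exI[of _ "\<lambda>y. ?c y + ?d y"] exI[of _ "G \<union> H"]) auto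
next
  fix x a assume "x \<in> lin_span V Y"
  then obtain c G where x: "x = finsum V (\<lambda>y. c y \<odot> y) G" "finite G" "G \<subseteq> Y"
    by (auto simp: lin_span_def)
  then have "(\<lambda>y. c y \<odot> y) \<in> G \<rightarrow> carrier V" using Y by auto
  then have "a \<odot> x = finsum V (\<lambda>y. a \<odot> (c y \<odot> y)) G"
    unfolding x(1) using x(2) by (intro finsum_smult_ldistr) auto
  also have "\<dots> = finsum V (\<lambda>y. (a * c y) \<odot> y) G"
    using x Y by (intro finsum_cong') (auto simp: sm_assoc)
  finally show "a \<odot> x \<in> lin_span V Y"
    unfolding lin_span_def using x by (intro CollectI exI[of _ "\<lambda>y. a * c y"] exI[of _ G]) auto
qed

end

lemma (in complex_normed_space) closed_span_eq:
  assumes "Y \<subseteq> carrier V"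
  shows "closed_span V Y = {x \<in> carrier V. \<forall>e>0. \<exists>y\<in>lin_span V Y. nrm V (x \<ominus> y) < e}"
proof -
  interpret Metric_space "carrier V" "ndist V" by (rule Metric_space_ndist)
  have sub: "lin_span V Y \<subseteq> carrier V" using lin_span_subspace[OF assms] by (simp add: lin_subspace_def)
  have iff: "y \<in> mball x e \<longleftrightarrow> nrm V (x \<ominus> y) < e" if "x \<in> carrier V" "y \<in> lin_span V Y" for x y e
    using that sub by (auto simp: ndist_def)
  show ?thesis
    unfolding closed_span_def metric_closure_of using iff by blast
qed

lemma (in complex_normed_space) closed_span_subspace:
  assumes Y: "Y \<subseteq> carrier V"
  shows "lin_subspace V (closed_span V Y)" "nrm_closed V (closed_span V Y)"
proof -
  note eq = closed_span_eq[OF Y]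
  have S: "lin_subspace V (lin_span V Y)" by (rule lin_span_subspace[OF Y])
  then have sub: "y \<in> carrier V" if "y \<in> lin_span V Y" for y using that by (auto simp: lin_subspace_def)
  show "lin_subspace V (closed_span V Y)"
    unfolding lin_subspace_def eq
  proof (intro conjI ballI allI)
    show "\<zero> \<in> {x \<in> carrier V. \<forall>e>0. \<exists>y\<in>lin_span V Y. nrm V (x \<ominus> y) < e}"
      using S by (auto simp: lin_subspace_def intro!: bexI[of _ \<zero>])
  next
    fix x x' assume "x \<in> {x \<in> carrier V. \<forall>e>0. \<exists>y\<in>lin_span V Y. nrm V (x \<ominus> y) < e}"
      "x' \<in> {x \<in> carrier V. \<forall>e>0. \<exists>y\<in>lin_span V Y. nrm V (x \<ominus> y) < e}"
    then have x: "x \<in> carrier V" "\<And>e. e > 0 \<Longrightarrow> \<exists>y\<in>lin_span V Y. nrm V (x \<ominus> y) < e"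
      "x' \<in> carrier V" "\<And>e. e > 0 \<Longrightarrow> \<exists>y\<in>lin_span V Y. nrm V (x' \<ominus> y) < e" by auto
    have "\<exists>y\<in>lin_span V Y. nrm V (x \<oplus> x' \<ominus> y) < e" if "e > 0" for e
    proof -
      have e2: "e / 2 > 0" using that by simp
      obtain y where y: "y \<in> lin_span V Y" "nrm V (x \<ominus> y) < e/2" using x(2)[OF e2] by blast
      obtain y' where y': "y' \<in> lin_span V Y" "nrm V (x' \<ominus> y') < e/2" using x(4)[OF e2] by blast
      have "nrm V (x \<oplus> x' \<ominus> (y \<oplus> y')) \<le> nrm V (x \<ominus> y) + nrm V (x' \<ominus> y')"
        using x y y' sub by (intro nrm_add_diff) auto
      then show ?thesis using y y' S by (intro bexI[of _ "y \<oplus> y'"]) (auto simp: lin_subspace_def)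
    qed
    then show "x \<oplus> x' \<in> {x \<in> carrier V. \<forall>e>0. \<exists>y\<in>lin_span V Y. nrm V (x \<ominus> y) < e}" using x by auto
  next
    fix x c assume "x \<in> {x \<in> carrier V. \<forall>e>0. \<exists>y\<in>lin_span V Y. nrm V (x \<ominus> y) < e}"
    then have x: "x \<in> carrier V" "\<And>e. e > 0 \<Longrightarrow> \<exists>y\<in>lin_span V Y. nrm V (x \<ominus> y) < e" by auto
    have "\<exists>y\<in>lin_span V Y. nrm V (c \<odot> x \<ominus> y) < e" if "e > 0" for e
    proof -
      have p: "cmod c + 1 > 0" by (simp add: add_nonneg_pos)
      then have "e / (cmod c + 1) > 0" using that by simp
      then obtain y where y: "y \<in> lin_span V Y" "nrm V (x \<ominus> y) < e / (cmod c + 1)" using x(2) by blast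
      have "nrm V (c \<odot> x \<ominus> c \<odot> y) = cmod c * nrm V (x \<ominus> y)" using x y sub by (intro nrm_sm_diff) auto
      also have "\<dots> \<le> (cmod c + 1) * nrm V (x \<ominus> y)" using x y sub by (intro mult_right_mono) auto
      also have "\<dots> < e" using y p by (simp add: field_simps)
      finally show ?thesis using y S by (intro bexI[of _ "c \<odot> y"]) (auto simp: lin_subspace_def)
    qed
    then show "c \<odot> x \<in> {x \<in> carrier V. \<forall>e>0. \<exists>y\<in>lin_span V Y. nrm V (x \<ominus> y) < e}" using x by auto
  qed auto
  show "nrm_closed V (closed_span V Y)"
    unfolding nrm_closed_def eq
  proof (intro ballI impI CollectI conjI allI)
    fix x e assume x: "x \<in> carrier V" and e: "(e::real) > 0"
      and "\<forall>e>0. \<exists>n\<in>{x \<in> carrier V. \<forall>e>0. \<exists>y\<in>lin_span V Y. nrm V (x \<ominus> y) < e}. nrm V (x \<ominus> n) < e"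
    then obtain n where n: "n \<in> carrier V" "\<forall>e>0. \<exists>y\<in>lin_span V Y. nrm V (n \<ominus> y) < e" "nrm V (x \<ominus> n) < e/2"
      using half_gt_zero by blast
    then obtain y where y: "y \<in> lin_span V Y" "nrm V (n \<ominus> y) < e/2" using e half_gt_zero by blast
    have "nrm V (x \<ominus> y) \<le> nrm V (x \<ominus> n) + nrm V (n \<ominus> y)"
      using x n y sub by (intro nrm_diff_triangle) auto
    then show "\<exists>y\<in>lin_span V Y. nrm V (x \<ominus> y) < e" using y n by (intro bexI[of _ y]) auto
  qed
qed

section \<open>Spaces of integrable functions\<close>

lemma integrable_space_simps [simp]:
  "carrier (integrable_space M) = {f. integrable M f}" "\<zero>\<^bsub>integrable_space M\<^esub> = (\<lambda>z. 0)"
  "f \<oplus>\<^bsub>integrable_space M\<^esub> g = (\<lambda>z. f z + g z)" "c \<odot>\<^bsub>integrable_space M\<^esub> f = (\<lambda>z. c * f z)"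
  "nrm (integrable_space M) f = (\<integral>z. cmod (f z) \<partial>M)"
  by (simp_all add: integrable_space_def)

lemma seminormed_integrable_space: "complex_seminormed_space (integrable_space M)"
  unfolding integrable_space_def
proof (rule mk_seminormed_space)
  fix f g :: "'a \<Rightarrow> complex" assume fg: "f \<in> {f. integrable M f}" "g \<in> {f. integrable M f}"
  have "(\<integral>z. cmod (f z + g z) \<partial>M) \<le> (\<integral>z. cmod (f z) + cmod (g z) \<partial>M)"
    using fg by (intro integral_mono) (auto intro: norm_triangle_ineq)
  also have "\<dots> = (\<integral>z. cmod (f z) \<partial>M) + (\<integral>z. cmod (g z) \<partial>M)" using fg by simp
  finally show "(\<integral>z. cmod (f z + g z) \<partial>M) \<le> (\<integral>z. cmod (f z) \<partial>M) + (\<integral>z. cmod (g z) \<partial>M)" .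
qed (auto simp: algebra_simps norm_mult)

lemma diff_integrable_space:
  assumes "integrable M f" "integrable M g"
  shows "f \<ominus>\<^bsub>integrable_space M\<^esub> g = (\<lambda>z. f z - g z)"
proof -
  interpret complex_seminormed_space "integrable_space M" by (rule seminormed_integrable_space)
  show ?thesis using assms by (subst diff_eq_iff) auto
qed

text \<open>
  The theorem of Riesz and Fischer: if the norms of the increments are summable, so are almost
  everywhere their absolute values, and the pointwise limit is also the limit in mean.
\<close>

lemma complete_integrable_space: "seq_complete (integrable_space M)"
proof -
  interpret complex_seminormed_space "integrable_space M" by (rule seminormed_integrable_space)
  show ?thesis
  proof (rule seq_complete_if_fast)
    fix x assume x': "\<And>n. x n \<in> carrier (integrable_space M)"
      and fast': "\<And>n. nrm (integrable_space M) (x (Suc n) \<ominus>\<^bsub>integrable_space M\<^esub> x n) \<le> (1/2)^n"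
    have x: "integrable M (x n)" for n using x' by simp
    define h where "h n z = x (Suc n) z - x n z" for n z
    have h [measurable]: "integrable M (h n)" for n unfolding h_def using x by auto
    have hm [measurable]: "h n \<in> borel_measurable M" for n using h by auto
    have fast: "(\<integral>z. cmod (h n z) \<partial>M) \<le> (1/2)^n" for n
      using fast'[of n] x by (simp add: diff_integrable_space h_def)
    have geo: "summable (\<lambda>n. (1/2)^n :: real)" by (rule summable_geometric) simp
    have sums: "summable (\<lambda>n. \<integral>z. cmod (h (n + k) z) \<partial>M)" for k
    proof (rule summable_comparison_test[OF _ summable_ignore_initial_segment[OF geo, of k]], intro exI allI impI)
      fix n
      have "(\<integral>z. cmod (h (n + k) z) \<partial>M) \<ge> 0" by (rule Bochner_Integration.integral_nonneg) simp
      then show "norm (\<integral>z. cmod (h (n + k) z) \<partial>M) \<le> (1/2)^(n + k)" using fast[of "n + k"] by simp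
    qed
    have ae: "AE z in M. summable (\<lambda>n. cmod (h n z))"
    proof -
      have "(\<integral>\<^sup>+ z. (\<Sum>n. ennreal (cmod (h n z))) \<partial>M) = (\<Sum>n. \<integral>\<^sup>+ z. ennreal (cmod (h n z)) \<partial>M)"
        by (rule nn_integral_suminf) simp
      also have "\<dots> = (\<Sum>n. ennreal (\<integral>z. cmod (h n z) \<partial>M))"
        using h by (intro suminf_cong nn_integral_eq_integral) auto
      also have "\<dots> = ennreal (\<Sum>n. \<integral>z. cmod (h n z) \<partial>M)"
        using sums[of 0] by (intro suminf_ennreal2) auto
      finally have "(\<integral>\<^sup>+ z. (\<Sum>n. ennreal (cmod (h n z))) \<partial>M) \<noteq> \<infinity>" by simp
      then have "AE z in M. (\<Sum>n. ennreal (cmod (h n z))) \<noteq> \<infinity>"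
        by (intro nn_integral_PInf_AE) auto
      then show ?thesis
        by (rule AE_mp) (auto intro!: AE_I2 summable_suminf_not_top)
    qed
    have aek: "AE z in M. summable (\<lambda>n. cmod (h (n + k) z))" for k
      using ae by eventually_elim (rule summable_ignore_initial_segment)
    define l where "l z = x 0 z + (\<Sum>n. h n z)" for z
    have "integrable M (\<lambda>z. \<Sum>n. h n z)"
      using integrable_suminf[of M h, OF h ae] sums[of 0] by simp
    then have l: "integrable M l" unfolding l_def using x by auto
    have le: "(\<integral>z. cmod (x k z - l z) \<partial>M) \<le> (\<Sum>n. (1/2)^(n + k))" for k
    proof -
      have tele: "x k z = x 0 z + (\<Sum>n<k. h n z)" for z
        by (induction k) (auto simp: h_def)
      have "AE z in M. cmod (x k z - l z) \<le> (\<Sum>n. cmod (h (n + k) z))"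
        using ae
      proof eventually_elim
        case (elim z)
        then have s: "summable (\<lambda>n. h n z)" by (rule summable_norm_cancel)
        have "x k z - l z = - (\<Sum>n. h (n + k) z)"
          unfolding l_def tele[of z] by (simp add: suminf_split_initial_segment[OF s, of k])
        then have "cmod (x k z - l z) = cmod (\<Sum>n. h (n + k) z)" by simp
        also have "\<dots> \<le> (\<Sum>n. cmod (h (n + k) z))"
          using elim by (intro summable_norm summable_ignore_initial_segment)
        finally show ?case .
      qed
      moreover have "integrable M (\<lambda>z. \<Sum>n. cmod (h (n + k) z))"
        using integrable_suminf[of M "\<lambda>n z. cmod (h (n + k) z)"] h aek[of k] sums[of k] by simp
      ultimately have "(\<integral>z. cmod (x k z - l z) \<partial>M) \<le> (\<integral>z. (\<Sum>n. cmod (h (n + k) z)) \<partial>M)"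
        using x l by (intro integral_mono_AE) auto
      also have "\<dots> = (\<Sum>n. \<integral>z. cmod (h (n + k) z) \<partial>M)"
        using integral_suminf[of M "\<lambda>n z. cmod (h (n + k) z)"] h aek[of k] sums[of k] by simp
      also have "\<dots> \<le> (\<Sum>n. (1/2)^(n + k))"
        by (intro suminf_le fast sums summable_ignore_initial_segment[OF geo])
      finally show ?thesis .
    qed
    have lim: "(\<lambda>k. \<Sum>n. (1/2::real)^(n + k)) \<longlonglongrightarrow> 0" by (rule suminf_exist_split2[OF geo])
    have "(\<lambda>k. \<integral>z. cmod (x k z - l z) \<partial>M) \<longlonglongrightarrow> 0"
      by (rule Lim_null_comparison[OF _ lim]) (use le in simp)
    then have "converges (integrable_space M) x l"
      using l x by (simp add: converges_def diff_integrable_space)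
    then show "\<exists>l. converges (integrable_space M) x l" by blast
  qed
qed

lemma banach_L1: "banach (L1 M)"
proof -
  interpret complex_seminormed_space "integrable_space M" by (rule seminormed_integrable_space)
  show ?thesis
    unfolding banach_def L1_def using normed_separated complete_separated[OF complete_integrable_space] by blast
qed

lemma carrier_L1: "carrier (L1 M) = L1_class M ` {f. integrable M f}"
proof -
  interpret complex_seminormed_space "integrable_space M" by (rule seminormed_integrable_space)
  show ?thesis unfolding L1_def separated_def sep.carrier_quotient by (simp add: L1_class_def)
qed

lemma L1_class_mem:
  assumes "integrable M f"
  shows "g \<in> L1_class M f \<longleftrightarrow> integrable M g \<and> (\<integral>z. cmod (g z - f z) \<partial>M) = 0"
proof -
  interpret complex_seminormed_space "integrable_space M" by (rule seminormed_integrable_space)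
  show ?thesis
    using assms sep.mem_coset_iff[of f g]
    by (auto simp: L1_class_def seminorm_kernel_def diff_integrable_space)
qed

lemma L1_class_simps:
  assumes "integrable M f"
  shows "integrable M g \<Longrightarrow> L1_class M f \<oplus>\<^bsub>L1 M\<^esub> L1_class M g = L1_class M (\<lambda>z. f z + g z)"
    and "c \<odot>\<^bsub>L1 M\<^esub> L1_class M f = L1_class M (\<lambda>z. c * f z)"
    and "nrm (L1 M) (L1_class M f) = (\<integral>z. cmod (f z) \<partial>M)"
proof -
  interpret complex_seminormed_space "integrable_space M" by (rule seminormed_integrable_space)
  show "integrable M g \<Longrightarrow> L1_class M f \<oplus>\<^bsub>L1 M\<^esub> L1_class M g = L1_class M (\<lambda>z. f z + g z)"
    "c \<odot>\<^bsub>L1 M\<^esub> L1_class M f = L1_class M (\<lambda>z. c * f z)"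
    "nrm (L1 M) (L1_class M f) = (\<integral>z. cmod (f z) \<partial>M)"
    using assms sep.add_quotient[of f g] sep.smult_quotient[of f c] nrm_separated[of f]
    by (simp_all add: L1_def L1_class_def separated_def)
qed

section \<open>The basic spaces\<close>

lemma prob_space_haar_D: "prob_space haar_D"
  unfolding haar_D_def
  by (intro prob_space_PiM prob_space_uniform_count_measure) auto

lemma integrable_coordinate: "integrable haar_D (\<lambda>d. complex_of_real (d k))"
proof -
  interpret prob_space haar_D by (rule prob_space_haar_D)
  have "(\<lambda>d. d k) \<in> measurable haar_D (uniform_count_measure {-1, 1::real})"
    unfolding haar_D_def by measurable
  moreover have "(\<lambda>r. complex_of_real r) \<in> borel_measurable (uniform_count_measure {-1, 1::real})"
    by (simp add: measurable_def space_uniform_count_measure sets_uniform_count_measure)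
  ultimately have m: "(\<lambda>d. complex_of_real (d k)) \<in> borel_measurable haar_D"
    by (rule measurable_compose)
  show ?thesis
  proof (rule integrable_const_bound[OF _ m, of 1], rule AE_I2)
    fix d assume "d \<in> space haar_D"
    then have "d k \<in> {-1, 1}"
      by (auto simp: haar_D_def space_PiM PiE_iff space_uniform_count_measure)
    then show "cmod (complex_of_real (d k)) \<le> 1" by auto
  qed
qed

lemma cis_measurable:
  "cis \<in> measurable (uniform_measure lborel A) (restrict_space borel (sphere 0 1))"
proof (rule measurable_restrict_space2)
  have "cis \<in> borel_measurable borel" by (intro borel_measurable_continuous_onI continuous_intros)
  then have "cis \<in> borel_measurable lborel" by simp
  then show "cis \<in> borel_measurable (uniform_measure lborel A)"
    by (subst measurable_cong_sets[OF sets_uniform_measure refl])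
qed auto

lemma prob_space_haar_T: "prob_space haar_T"
  unfolding haar_T_def
proof (rule prob_space.prob_space_distr)
  show "prob_space (uniform_measure lborel {0..<2 * pi})"
    by (rule prob_space_uniform_measure) auto
  show "cis \<in> measurable (uniform_measure lborel {0..<2 * pi}) (restrict_space borel (sphere 0 1))"
    by (rule cis_measurable)
qed

lemma space_haar_T: "space haar_T = sphere 0 1"
  by (simp add: haar_T_def space_restrict_space)

lemma powi_measurable: "(\<lambda>z. z powi k) \<in> borel_measurable haar_T"
proof -
  have "(\<lambda>z::complex. z powi k) \<in> borel_measurable (restrict_space borel (sphere 0 1))"
    by (rule borel_measurable_continuous_on_restrict) (auto intro!: continuous_intros)
  then show ?thesis by (simp add: haar_T_def measurable_distr_eq1)
qed

lemma norm_powi_haar_T: "z \<in> space haar_T \<Longrightarrow> cmod (z powi k) = 1"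
  by (simp add: space_haar_T norm_power_int)

lemma integrable_times_powi:
  assumes "integrable haar_T f"
  shows "integrable haar_T (\<lambda>z. f z * z powi k)"
    and "cmod (\<integral>z. f z * z powi k \<partial>haar_T) \<le> (\<integral>z. cmod (f z) \<partial>haar_T)"
proof -
  have ae: "AE z in haar_T. cmod (f z * z powi k) = cmod (f z)"
    by (rule AE_I2) (simp add: norm_mult norm_powi_haar_T)
  have m: "(\<lambda>z. f z * z powi k) \<in> borel_measurable haar_T"
    using assms powi_measurable by (intro borel_measurable_times) auto
  show "integrable haar_T (\<lambda>z. f z * z powi k)"
    by (rule Bochner_Integration.integrable_bound[OF assms m]) (use ae in auto)
  have "cmod (\<integral>z. f z * z powi k \<partial>haar_T) \<le> (\<integral>z. cmod (f z * z powi k) \<partial>haar_T)"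
    by (rule integral_norm_bound)
  also have "\<dots> = (\<integral>z. cmod (f z) \<partial>haar_T)"
    using ae m assms by (intro integral_cong_AE) auto
  finally show "cmod (\<integral>z. f z * z powi k \<partial>haar_T) \<le> (\<integral>z. cmod (f z) \<partial>haar_T)" .
qed

lemma integrable_powi: "integrable haar_T (\<lambda>z. z powi k)"
proof -
  interpret prob_space haar_T by (rule prob_space_haar_T)
  show ?thesis using integrable_times_powi(1)[of "\<lambda>z. 1" k] by simp
qed

text \<open>
  On the circle \<open>z\<^sup>m\<close> becomes \<open>cis (m t)\<close>, which has the periodic antiderivative
  \<open>cis (m t) / (\<i> m)\<close>.
\<close>

lemma integral_powi_pos:
  assumes "m > 0"
  shows "(\<integral>z. z ^ m \<partial>haar_T) = 0"
proof -
  let ?A = "{0..<2 * pi}"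
  have "(\<integral>z. z ^ m \<partial>haar_T) = (\<integral>t. cis t ^ m \<partial>uniform_measure lborel ?A)"
    unfolding haar_T_def
    by (rule integral_distr[OF cis_measurable]) (auto intro!: borel_measurable_continuous_on_restrict continuous_intros)
  also have "uniform_measure lborel ?A = density lborel (\<lambda>t. ennreal (indicator ?A t / (2 * pi)))"
    unfolding uniform_measure_def
    by (intro arg_cong2[where f=density] ext refl)
      (auto simp: indicator_def divide_ennreal ennreal_1[symmetric] simp del: ennreal_1)
  also have "(\<integral>t. cis t ^ m \<partial>\<dots>) = (\<integral>t. (indicator ?A t / (2 * pi)) *\<^sub>R cis t ^ m \<partial>lborel)"
    by (rule integral_density) (auto intro!: borel_measurable_continuous_onI continuous_intros)
  also have "\<dots> = (\<integral>t. (1 / (2 * pi)) *\<^sub>R (indicator {0..2 * pi} t *\<^sub>R cis (of_nat m * t)) \<partial>lborel)"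
  proof (rule integral_cong_AE)
    have "AE t in lborel. t \<noteq> 2 * pi" by (rule AE_lborel_singleton)
    then show "AE t in lborel. (indicator ?A t / (2 * pi)) *\<^sub>R cis t ^ m =
        (1 / (2 * pi)) *\<^sub>R (indicator {0..2 * pi} t *\<^sub>R cis (of_nat m * t))"
      by eventually_elim (auto simp: indicator_def Complex.DeMoivre)
    have [measurable]: "(\<lambda>t. cis t ^ m) \<in> borel_measurable borel" "(\<lambda>t. cis (of_nat m * t)) \<in> borel_measurable borel"
      by (intro borel_measurable_continuous_onI continuous_intros)+
    show "(\<lambda>t. (indicator ?A t / (2 * pi)) *\<^sub>R cis t ^ m) \<in> borel_measurable lborel"
      "(\<lambda>t. (1 / (2 * pi)) *\<^sub>R (indicator {0..2 * pi} t *\<^sub>R cis (of_nat m * t))) \<in> borel_measurable lborel"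
      by measurable
  qed
  also have "\<dots> = (1 / (2 * pi)) *\<^sub>R (\<integral>t. indicator {0..2 * pi} t *\<^sub>R cis (of_nat m * t) \<partial>lborel)"
    by (rule integral_scaleR_right)
  also have "(\<integral>t. indicator {0..2 * pi} t *\<^sub>R cis (of_nat m * t) \<partial>lborel) =
      cis (of_nat m * (2 * pi)) / (\<i> * of_nat m) - cis (of_nat m * 0) / (\<i> * of_nat m)"
  proof (rule integral_FTC_Icc)
    show "(0::real) \<le> 2 * pi" by simp
    show "continuous_on {0..2 * pi} (\<lambda>t. cis (of_nat m * t))" by (intro continuous_intros)
    fix t :: real assume "0 \<le> t" "t \<le> 2 * pi"
    have "((\<lambda>t. exp (\<i> * of_nat m * of_real t) / (\<i> * of_nat m)) has_vector_derivative
        exp (\<i> * of_nat m * of_real t)) (at t within {0..2 * pi})"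
      using assms by (auto intro!: derivative_eq_intros has_vector_derivative_real_field simp: field_simps)
    then show "((\<lambda>t. cis (of_nat m * t) / (\<i> * of_nat m)) has_vector_derivative cis (of_nat m * t))
        (at t within {0..2 * pi})"
      by (simp add: cis_conv_exp mult.assoc)
  qed
  also have "cis (of_nat m * (2 * pi)) = 1"
    by (metis cis_multiple_2pi Ints_of_nat mult.commute)
  finally show ?thesis by simp
qed

text \<open>
  Fourier coefficients are the same for all functions of a class, so that any representative may
  be chosen.
\<close>

definition coeff_functional :: "int \<Rightarrow> (complex \<Rightarrow> complex) set \<Rightarrow> complex" where
  "coeff_functional n C = fourier_coeff (SOME f. f \<in> C) n"

lemma fourier_coeff_diff:
  assumes "integrable haar_T f" "integrable haar_T g"
  shows "cmod (fourier_coeff g n - fourier_coeff f n) \<le> (\<integral>z. cmod (g z - f z) \<partial>haar_T)"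
proof -
  have "fourier_coeff g n - fourier_coeff f n = (\<integral>z. (g z - f z) * z powi (-n) \<partial>haar_T)"
    unfolding fourier_coeff_def left_diff_distrib
    by (rule Bochner_Integration.integral_diff[symmetric]) (intro integrable_times_powi assms)+
  then show ?thesis using integrable_times_powi(2)[of "\<lambda>z. g z - f z" "-n"] assms by simp
qed

lemma fourier_coeff_class:
  assumes "integrable haar_T f" "g \<in> L1_class haar_T f"
  shows "fourier_coeff g n = fourier_coeff f n"
  using fourier_coeff_diff[OF assms(1), of g n] assms by (simp add: L1_class_mem)

lemma L1_class_self: "integrable M f \<Longrightarrow> f \<in> L1_class M f"
  by (simp add: L1_class_mem)

lemma coeff_functional_class:
  assumes "integrable haar_T f"
  shows "coeff_functional n (L1_class haar_T f) = fourier_coeff f n"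
  unfolding coeff_functional_def
  using someI[of "\<lambda>g. g \<in> L1_class haar_T f" f] L1_class_self[OF assms]
  by (intro fourier_coeff_class[OF assms]) auto

lemma coeff_functional_linear:
  assumes "C \<in> carrier B2"
  shows "D \<in> carrier B2 \<Longrightarrow> coeff_functional n (C \<oplus>\<^bsub>B2\<^esub> D) = coeff_functional n C + coeff_functional n D"
    and "coeff_functional n (c \<odot>\<^bsub>B2\<^esub> C) = c * coeff_functional n C"
    and "cmod (coeff_functional n C) \<le> nrm B2 C"
proof -
  obtain f where f: "integrable haar_T f" "C = L1_class haar_T f"
    using assms by (auto simp: B2_def carrier_L1)
  show "coeff_functional n (C \<oplus>\<^bsub>B2\<^esub> D) = coeff_functional n C + coeff_functional n D" if D: "D \<in> carrier B2"
  proof -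
    obtain g where g: "integrable haar_T g" "D = L1_class haar_T g"
      using D by (auto simp: B2_def carrier_L1)
    have "fourier_coeff (\<lambda>z. f z + g z) n = fourier_coeff f n + fourier_coeff g n"
      unfolding fourier_coeff_def distrib_right
      by (rule Bochner_Integration.integral_add) (intro integrable_times_powi f g)+
    then show ?thesis using f g by (simp add: B2_def L1_class_simps coeff_functional_class)
  qed
  have "fourier_coeff (\<lambda>z. c * f z) n = c * fourier_coeff f n"
    unfolding fourier_coeff_def mult.assoc by simp
  then show "coeff_functional n (c \<odot>\<^bsub>B2\<^esub> C) = c * coeff_functional n C"
    using f by (simp add: B2_def L1_class_simps coeff_functional_class)
  show "cmod (coeff_functional n C) \<le> nrm B2 C"
    using integrable_times_powi(2)[OF f(1), of "-n"] f
    by (simp add: B2_def L1_class_simps coeff_functional_class fourier_coeff_def)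
qed

lemma S2_iff: "C \<in> S2 \<longleftrightarrow> C \<in> carrier B2 \<and> (\<forall>n<0. coeff_functional n C = 0)"
proof (cases "C \<in> carrier B2")
  case True
  then obtain f where f: "integrable haar_T f" "C = L1_class haar_T f"
    by (auto simp: B2_def carrier_L1)
  have rep: "fourier_coeff g n = coeff_functional n C" if "g \<in> C" for g n
    using that fourier_coeff_class[OF f(1)] coeff_functional_class[OF f(1)] by (simp only: f(2))
  have "f \<in> C" using L1_class_self[OF f(1)] by (simp only: f(2))
  then have "(\<forall>g\<in>C. \<forall>n<0. fourier_coeff g n = 0) \<longleftrightarrow> (\<forall>n<0. coeff_functional n C = 0)"
    by (auto simp: rep)
  then show ?thesis using True by (simp add: S2_def)
qed (simp add: S2_def)

lemma banach_B2: "banach B2"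
  unfolding B2_def by (rule banach_L1)

lemma S2_subspace: "lin_subspace B2 S2" "nrm_closed B2 S2"
proof -
  interpret complex_normed_space B2 using banach_B2 by (rule banachD)
  have z: "coeff_functional n \<zero>\<^bsub>B2\<^esub> = 0" for n
    using coeff_functional_linear(2)[of "\<zero>\<^bsub>B2\<^esub>" n 0] by simp
  have d: "coeff_functional n (C \<ominus>\<^bsub>B2\<^esub> D) = coeff_functional n C - coeff_functional n D"
    if "C \<in> carrier B2" "D \<in> carrier B2" for n C D
    using that coeff_functional_linear(1)[of C "(-1) \<odot>\<^bsub>B2\<^esub> D" n] coeff_functional_linear(2)[of D n "-1"]
    by (simp add: minus_eq neg_eq)
  show "lin_subspace B2 S2"
    unfolding lin_subspace_def by (auto simp: S2_iff z coeff_functional_linear)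
  show "nrm_closed B2 S2"
    unfolding nrm_closed_def
  proof (intro ballI impI)
    fix C assume C: "C \<in> carrier B2" and *: "\<forall>e>0. \<exists>D\<in>S2. nrm B2 (C \<ominus>\<^bsub>B2\<^esub> D) < e"
    have "coeff_functional n C = 0" if n: "n < 0" for n
    proof -
      have "cmod (coeff_functional n C) \<le> 0 + e" if e: "e > 0" for e
      proof -
        obtain D where D: "D \<in> S2" "nrm B2 (C \<ominus>\<^bsub>B2\<^esub> D) < e" using * e by auto
        then have "cmod (coeff_functional n (C \<ominus>\<^bsub>B2\<^esub> D)) < e"
          using coeff_functional_linear(3)[of "C \<ominus>\<^bsub>B2\<^esub> D" n] C by (simp add: S2_iff)
        then show ?thesis using C D n by (simp add: d S2_iff)
      qed
      then have "cmod (coeff_functional n C) \<le> 0" by (rule field_le_epsilon)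
      then show ?thesis by simp
    qed
    then show "C \<in> S2" using C by (simp add: S2_iff)
  qed
qed

lemma S1_subspace: "lin_subspace B1 S1" "nrm_closed B1 S1" and banach_B1: "banach B1"
proof -
  show B: "banach B1" unfolding B1_def by (rule banach_L1)
  then interpret complex_normed_space B1 by (rule banachD)
  have "range (\<lambda>k. L1_class haar_D (\<lambda>d. complex_of_real (d k))) \<subseteq> carrier B1"
    using integrable_coordinate by (auto simp: B1_def carrier_L1)
  then show "lin_subspace B1 S1" "nrm_closed B1 S1"
    unfolding S1_def by (rule closed_span_subspace)+
qed

lemma S3_subspace: "lin_subspace B3 S3" "nrm_closed B3 S3" and banach_B3: "banach B3"
proof -
  interpret B2: complex_normed_space B2 using banach_B2 by (rule banachD)
  interpret Q: quotient_space B2 S2 by unfold_locales (rule S2_subspace)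
  show B: "banach B3"
    unfolding B3_def banach_def using Q.normed_quotient[OF S2_subspace(2)] Q.complete_quotient banachD(2)[OF banach_B2] by blast
  then interpret complex_normed_space B3 by (rule banachD)
  have "(\<lambda>k::nat. S2 +>\<^bsub>B2\<^esub> L1_class haar_T (\<lambda>z. z powi (- (3 ^ k)))) ` {1..} \<subseteq> carrier B3"
  proof -
    have "L1_class haar_T (\<lambda>z. z powi k) \<in> carrier B2" for k
      using integrable_powi by (auto simp: B2_def carrier_L1)
    then show ?thesis by (auto simp: B3_def Q.carrier_quotient)
  qed
  then show "lin_subspace B3 S3" "nrm_closed B3 S3"
    unfolding S3_def by (rule closed_span_subspace)+
qed

lemma (in transported) subspace_transport:
  assumes "lin_subspace V N" "nrm_closed V N"
  shows "lin_subspace (transport f V) (f ` N)" "nrm_closed (transport f V) (f ` N)"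
proof -
  have N: "n \<in> carrier V" if "n \<in> N" for n using assms(1) that by (auto simp: lin_subspace_def)
  show "lin_subspace (transport f V) (f ` N)"
    using assms(1) N by (auto simp: lin_subspace_def carrier_transport zero_transport transport_simps)
  show "nrm_closed (transport f V) (f ` N)"
    unfolding nrm_closed_def carrier_transport
  proof (intro ballI impI)
    fix y assume "y \<in> f ` carrier V" and *: "\<forall>e>0. \<exists>n\<in>f ` N. nrm (transport f V) (y \<ominus>\<^bsub>transport f V\<^esub> n) < e"
    then obtain x where x: "x \<in> carrier V" "y = f x" by auto
    have "\<forall>e>0. \<exists>n\<in>N. nrm V (x \<ominus> n) < e"
      using * x N by (auto simp: diff_transport transport_simps)
    then show "y \<in> f ` N" using assms(2) x by (auto simp: nrm_closed_def)
  qed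
qed

lemma basic_spaces:
  shows "banach (basic_B i)"
    and "lin_subspace (basic_B i) (carrier (basic_S i))"
    and "nrm_closed (basic_B i) (carrier (basic_S i))"
    and "basic_S i = subspace_of (basic_B i) (carrier (basic_S i))"
proof -
  have T: "banach (transport f V) \<and> lin_subspace (transport f V) (f ` N) \<and> nrm_closed (transport f V) (f ` N)"
    if V: "banach V" "inj f" "lin_subspace V N" "nrm_closed V N" for f :: "'b \<Rightarrow> basic" and V N
  proof -
    interpret complex_seminormed_space V using V(1) by (rule banachD)
    have "inj_on f (carrier V)" using V(2) by (rule inj_on_subset) simp
    then interpret transported V f by unfold_locales
    show ?thesis using banach_transport[OF V(1) \<open>inj_on f (carrier V)\<close>] subspace_transport V by blast
  qed
  have inj: "inj Basic1" "inj Basic2" "inj Basic3" by (auto simp: inj_def)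
  note facts = T[OF banach_B1 inj(1) S1_subspace] T[OF banach_B2 inj(2) S2_subspace] T[OF banach_B3 inj(3) S3_subspace]
  show "basic_S i = subspace_of (basic_B i) (carrier (basic_S i))"
    by (simp add: basic_S_def)
  show "banach (basic_B i)" "lin_subspace (basic_B i) (carrier (basic_S i))" "nrm_closed (basic_B i) (carrier (basic_S i))"
    using facts by (auto simp: basic_S_def basic_B_def)
qed

text \<open>
  Two facts about \<open>H\<^sup>1\<close> drive the construction. The mean is a bounded functional on it that does not
  vanish at the constant \<open>1\<close>, which provides an operator of rank one into every non-zero space. The
  function \<open>1/z\<close> is integrable and not in \<open>H\<^sup>1\<close>.
\<close>

lemma basic_S_functional:
  shows "\<exists>\<phi>. (\<forall>x\<in>carrier (basic_S 2). \<forall>y\<in>carrier (basic_S 2). \<phi> (x \<oplus>\<^bsub>basic_S 2\<^esub> y) = \<phi> x + \<phi> y) \<and>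
    (\<forall>c. \<forall>x\<in>carrier (basic_S 2). \<phi> (c \<odot>\<^bsub>basic_S 2\<^esub> x) = c * \<phi> x) \<and>
    (\<forall>x\<in>carrier (basic_S 2). cmod (\<phi> x) \<le> nrm (basic_S 2) x) \<and> (\<exists>x\<in>carrier (basic_S 2). \<phi> x \<noteq> 0)"
proof -
  interpret complex_seminormed_space B2 using banach_B2 by (rule banachD)
  interpret transported B2 Basic2 by unfold_locales (auto simp: inj_on_def)
  interpret P: prob_space haar_T by (rule prob_space_haar_T)
  define \<phi> where "\<phi> x = coeff_functional 0 (inv_into (carrier B2) Basic2 x)" for x
  have \<phi>: "\<phi> (Basic2 C) = coeff_functional 0 C" if "C \<in> carrier B2" for C
    using that by (simp add: \<phi>_def inv_f)
  have S2c: "C \<in> carrier B2" if "C \<in> S2" for C using that by (simp add: S2_iff)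
  have one: "L1_class haar_T (\<lambda>z. 1) \<in> S2"
  proof -
    have "fourier_coeff (\<lambda>z. 1) n = 0" if "n < 0" for n
    proof -
      have "z powi (-n) = z ^ nat (-n)" for z :: complex using that by (simp add: power_int_def)
      then show ?thesis using integral_powi_pos[of "nat (-n)"] that by (simp add: fourier_coeff_def)
    qed
    then show ?thesis by (auto simp: S2_iff coeff_functional_class B2_def carrier_L1)
  qed
  have "coeff_functional 0 (L1_class haar_T (\<lambda>z. 1)) = 1"
    by (simp add: coeff_functional_class fourier_coeff_def P.prob_space)
  then have "\<phi> (Basic2 (L1_class haar_T (\<lambda>z. 1))) \<noteq> 0" using \<phi>[OF S2c[OF one]] by simp
  then show ?thesis
    using one S2c
    by (intro exI[of _ \<phi>])
       (auto simp: basic_S_def basic_B_def transport_simps \<phi> coeff_functional_linear)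
qed

lemma basic_S_proper: "\<exists>b\<in>carrier (basic_B 2). b \<notin> carrier (basic_S 2)"
proof -
  interpret P: prob_space haar_T by (rule prob_space_haar_T)
  interpret complex_seminormed_space B2 using banach_B2 by (rule banachD)
  interpret transported B2 Basic2 by unfold_locales (auto simp: inj_on_def)
  let ?C = "L1_class haar_T (\<lambda>z. z powi (-1))"
  have C: "?C \<in> carrier B2"
    unfolding B2_def carrier_L1 by (intro imageI CollectI integrable_powi)
  have "fourier_coeff (\<lambda>z. z powi (-1)) (-1) = (\<integral>z. 1 \<partial>haar_T)"
    unfolding fourier_coeff_def
    by (rule Bochner_Integration.integral_cong) (auto simp: space_haar_T intro!: left_inverse)
  then have "coeff_functional (-1) ?C = 1"
    unfolding coeff_functional_class[OF integrable_powi] by (simp add: P.prob_space)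
  then have "coeff_functional (-1) ?C \<noteq> 0" by (metis one_neq_zero)
  then have "?C \<notin> S2" unfolding S2_iff by (metis neg_less_0_iff_less zero_less_one)
  then show ?thesis using C by (auto simp: basic_S_def basic_B_def carrier_transport simp del: power_int_minus1_right)
qed

section \<open>Commuting isometric involutions and their averages\<close>

definition involutions :: "'a cnormed \<Rightarrow> (nat \<Rightarrow> 'a \<Rightarrow> 'a) \<Rightarrow> bool" where
  "involutions V \<tau> \<longleftrightarrow> (\<forall>i. linear_map V V (\<tau> i)) \<and>
     (\<forall>i. \<forall>x\<in>carrier V. nrm V (\<tau> i x) = nrm V x \<and> \<tau> i (\<tau> i x) = x) \<and>
     (\<forall>i k. \<forall>x\<in>carrier V. \<tau> i (\<tau> k x) = \<tau> k (\<tau> i x))"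

lemma involutionsD:
  assumes "involutions V \<tau>"
  shows "linear_map V V (\<tau> i)"
    and "x \<in> carrier V \<Longrightarrow> \<tau> i x \<in> carrier V"
    and "x \<in> carrier V \<Longrightarrow> nrm V (\<tau> i x) = nrm V x"
    and "x \<in> carrier V \<Longrightarrow> \<tau> i (\<tau> i x) = x"
    and "x \<in> carrier V \<Longrightarrow> \<tau> i (\<tau> k x) = \<tau> k (\<tau> i x)"
proof -
  show L: "linear_map V V (\<tau> i)" for i using assms by (simp add: involutions_def)
  show "x \<in> carrier V \<Longrightarrow> \<tau> i x \<in> carrier V" using linear_mapD(1)[OF L] .
  show "x \<in> carrier V \<Longrightarrow> nrm V (\<tau> i x) = nrm V x" "x \<in> carrier V \<Longrightarrow> \<tau> i (\<tau> i x) = x"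
    "x \<in> carrier V \<Longrightarrow> \<tau> i (\<tau> k x) = \<tau> k (\<tau> i x)"
    using assms unfolding involutions_def by blast+
qed

lemma involutionsI:
  assumes "\<And>i. linear_map V V (\<tau> i)"
    and "\<And>i x. x \<in> carrier V \<Longrightarrow> nrm V (\<tau> i x) = nrm V x"
    and "\<And>i x. x \<in> carrier V \<Longrightarrow> \<tau> i (\<tau> i x) = x"
    and "\<And>i k x. x \<in> carrier V \<Longrightarrow> \<tau> i (\<tau> k x) = \<tau> k (\<tau> i x)"
  shows "involutions V \<tau>"
  using assms unfolding involutions_def by blast

text \<open>
  This is the product of the operators \<open>(1 + \<tau> i) / 2\<close> for \<open>i < n\<close>, that is, the mean over the
  finite group generated by the first \<open>n\<close> involutions.
\<close>

primrec average :: "'a cnormed \<Rightarrow> (nat \<Rightarrow> 'a \<Rightarrow> 'a) \<Rightarrow> nat \<Rightarrow> 'a \<Rightarrow> 'a" where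
  "average V \<tau> 0 x = x"
| "average V \<tau> (Suc n) x = (1/2) \<odot>\<^bsub>V\<^esub> (average V \<tau> n x \<oplus>\<^bsub>V\<^esub> \<tau> n (average V \<tau> n x))"

locale involutive_space = complex_seminormed_space +
  fixes \<tau> assumes \<tau>: "involutions V \<tau>"
begin

lemmas \<tau>_closed [simp] = involutionsD(2)[OF \<tau>]
lemmas \<tau>_simps = linear_mapD(2,3)[OF involutionsD(1)[OF \<tau>]]

lemma average_closed [simp]: "x \<in> carrier V \<Longrightarrow> average V \<tau> n x \<in> carrier V"
  by (induction n) auto

lemma average_linear: "linear_map V V (average V \<tau> n)"
proof -
  have "average V \<tau> n (x \<oplus> y) = average V \<tau> n x \<oplus> average V \<tau> n y" if "x \<in> carrier V" "y \<in> carrier V" for x y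
    by (induction n) (use that in \<open>simp_all add: \<tau>_simps sm_add_r a_ac\<close>)
  moreover have "average V \<tau> n (c \<odot> x) = c \<odot> average V \<tau> n x" if "x \<in> carrier V" for x c
    by (induction n) (use that in \<open>simp_all add: \<tau>_simps sm_add_r sm_assoc mult.commute\<close>)
  ultimately show ?thesis by (auto simp: linear_map_def)
qed

lemma nrm_average: "x \<in> carrier V \<Longrightarrow> nrm V (average V \<tau> n x) \<le> nrm V x"
proof (induction n)
  case (Suc n)
  let ?y = "average V \<tau> n x"
  have "nrm V (?y \<oplus> \<tau> n ?y) \<le> nrm V ?y + nrm V (\<tau> n ?y)"
    using Suc.prems by (intro nrm_triangle) auto
  then show ?case using Suc by (simp add: nrm_smult involutionsD(3)[OF \<tau>] norm_divide)
qed simp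

lemma average_commute: "x \<in> carrier V \<Longrightarrow> \<tau> i (average V \<tau> n x) = average V \<tau> n (\<tau> i x)"
proof (induction n)
  case (Suc n)
  then show ?case using involutionsD(5)[OF \<tau>, of "average V \<tau> n x" i n] by (simp add: \<tau>_simps)
qed simp

lemma average_fixed: "x \<in> carrier V \<Longrightarrow> i < n \<Longrightarrow> \<tau> i (average V \<tau> n x) = average V \<tau> n x"
proof (induction n)
  case (Suc n)
  let ?y = "average V \<tau> n x"
  have y: "?y \<in> carrier V" using Suc.prems by simp
  show ?case
  proof (cases "i = n")
    case True
    then show ?thesis using y by (simp add: \<tau>_simps involutionsD(4)[OF \<tau>] a_comm)
  next
    case False
    then have "\<tau> i ?y = ?y" using Suc by simp
    then show ?thesis using y involutionsD(5)[OF \<tau> y, of i n] by (simp add: \<tau>_simps)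
  qed
qed simp

lemma average_id:
  assumes "x \<in> carrier V" "\<And>i. i < n \<Longrightarrow> \<tau> i x = x"
  shows "average V \<tau> n x = x"
  using assms(2)
proof (induction n)
  case (Suc n)
  then have "average V \<tau> (Suc n) x = (1/2) \<odot> (x \<oplus> x)" by simp
  also have "x \<oplus> x = 2 \<odot> x" using sm_add_l[of x 1 1] assms(1) by simp
  finally show ?case using assms(1) by (simp add: sm_assoc)
qed simp

lemma average_linear_commute:
  assumes h: "linear_map V V h" "\<And>i x. x \<in> carrier V \<Longrightarrow> h (\<tau> i x) = \<tau> i (h x)" and x: "x \<in> carrier V"
  shows "average V \<tau> n (h x) = h (average V \<tau> n x)"
  by (induction n) (use x linear_mapD[OF h(1)] in \<open>auto simp: h(2)\<close>)

text \<open>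
  The mean over a group absorbs the means over its subgroups.
\<close>

lemma average_average:
  assumes x: "x \<in> carrier V"
  shows "average V \<tau> m (average V \<tau> n x) = average V \<tau> (max m n) x"
proof -
  have le: "average V \<tau> m (average V \<tau> n x) = average V \<tau> n x" if "m \<le> n" for m n
    by (rule average_id) (use x that average_fixed[OF x] in auto)
  show ?thesis
  proof (cases "m \<le> n")
    case True
    then show ?thesis by (simp add: le max_def)
  next
    case False
    have "average V \<tau> m (average V \<tau> n x) = average V \<tau> n (average V \<tau> m x)"
      by (rule average_linear_commute[OF average_linear _ x]) (simp add: average_commute)
    then show ?thesis using False le[of n m] by (simp add: max_def)
  qed
qed

end

lemma decreasing_projections_average:
  assumes "banach V" "involutions V \<tau>"
  shows "decreasing_projections V (average V \<tau>)"
proof -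
  interpret complex_banach_space V using assms(1) by (simp add: banach_iff)
  interpret involutive_space V \<tau> by unfold_locales fact
  show ?thesis
    by unfold_locales (auto simp: average_linear nrm_average average_average)
qed

text \<open>
  Averages formed in an early space can be compared with those in a later one.
\<close>

lemma average_equivariant:
  assumes "complex_seminormed_space V" "involutions V \<tau>" "linear_map V W h"
    and "\<And>i x. x \<in> carrier V \<Longrightarrow> h (\<tau> i x) = \<sigma> i (h x)" and x: "x \<in> carrier V"
  shows "h (average V \<tau> n x) = average W \<sigma> n (h x)"
proof -
  interpret complex_seminormed_space V by fact
  interpret involutive_space V \<tau> by unfold_locales fact
  note h = linear_mapD[OF assms(3)]
  show ?thesis
  proof (induction n)
    case (Suc n)
    have y: "average V \<tau> n x \<in> carrier V" using x by simp
    then show ?case using h(2)[OF y \<tau>_closed[OF y]] h(3)[of "average V \<tau> n x \<oplus>\<^bsub>V\<^esub> \<tau> n (average V \<tau> n x)" "1/2"]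
      by (simp add: Suc assms(4))
  qed simp
qed

subsection \<open>Induced involutions\<close>

lemma (in quotient_space) image_coset:
  assumes "linear_map V V h" "h ` N \<subseteq> N" "\<And>x. x \<in> carrier V \<Longrightarrow> h (h x) = x" "x \<in> carrier V"
  shows "h ` (N +> x) = N +> h x"
proof -
  note h = linear_mapD[OF assms(1)]
  have hd: "h (y \<ominus> x) = h y \<ominus> h x" if "y \<in> carrier V" "x \<in> carrier V" for x y
    using linear_map_zero_diff(2)[OF seminormed seminormed assms(1)] that by simp
  have sub: "h y \<in> N +> h x" if "y \<in> N +> x" "x \<in> carrier V" for x y
    using that h(1) assms(2) hd[of y x] by (auto simp: mem_coset_iff)
  show ?thesis
  proof
    show "h ` (N +> x) \<subseteq> N +> h x" using sub assms(4) by blast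
    show "N +> h x \<subseteq> h ` (N +> x)"
    proof
      fix y assume y: "y \<in> N +> h x"
      then have "h y \<in> N +> x" using sub[OF y h(1)[OF assms(4)]] assms(3,4) by simp
      moreover have "y \<in> carrier V" using y h(1)[OF assms(4)] by (simp add: mem_coset_iff)
      ultimately show "y \<in> h ` (N +> x)" using assms(3)[of y] by (metis imageI)
    qed
  qed
qed

lemma (in quotient_space) involutions_quotient:
  assumes \<tau>: "involutions V \<tau>" and N\<tau>: "\<And>i. \<tau> i ` N \<subseteq> N"
  shows "involutions (quotient V N) (\<lambda>i C. \<tau> i ` C)"
    and "x \<in> carrier V \<Longrightarrow> \<tau> i ` (N +> x) = N +> \<tau> i x"
proof -
  note t = involutionsD[OF \<tau>] linear_mapD[OF involutionsD(1)[OF \<tau>]]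
  show img: "\<tau> i ` (N +> x) = N +> \<tau> i x" if "x \<in> carrier V" for i x
    by (rule image_coset[OF t(1) N\<tau> t(4) that])
  have nrm_le: "nrm (quotient V N) (N +> \<tau> i x) \<le> nrm (quotient V N) (N +> x)" if x: "x \<in> carrier V" for i x
  proof (rule nrm_quotient_greatest[OF x])
    fix y assume y: "y \<in> N +> x"
    then have "\<tau> i y \<in> N +> \<tau> i x" using img[OF x, of i] by blast
    then have "nrm (quotient V N) (N +> \<tau> i x) \<le> nrm V (\<tau> i y)"
      using x t(2) by (intro nrm_quotient_le) auto
    also have "\<dots> = nrm V y" using y x by (intro t(3)) (simp add: mem_coset_iff)
    finally show "nrm (quotient V N) (N +> \<tau> i x) \<le> nrm V y" .
  qed
  show "involutions (quotient V N) (\<lambda>i C. \<tau> i ` C)"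
  proof (rule involutionsI)
    fix i
    show "linear_map (quotient V N) (quotient V N) (\<lambda>C. \<tau> i ` C)"
      by (auto simp: linear_map_def carrier_quotient img t add_quotient smult_quotient)
  next
    fix i C assume "C \<in> carrier (quotient V N)"
    then obtain x where x: "x \<in> carrier V" "C = N +> x" by (auto simp: carrier_quotient)
    have "nrm (quotient V N) (N +> x) \<le> nrm (quotient V N) (N +> \<tau> i x)"
      using nrm_le[of "\<tau> i x" i] x t by simp
    then show "nrm (quotient V N) (\<tau> i ` C) = nrm (quotient V N) C"
      using x nrm_le[OF x(1), of i] by (simp add: img)
    show "\<tau> i ` \<tau> i ` C = C" using x t by (simp add: img)
  next
    fix i k C assume "C \<in> carrier (quotient V N)"
    then obtain x where x: "x \<in> carrier V" "C = N +> x" by (auto simp: carrier_quotient)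
    then have "\<tau> i ` \<tau> k ` C = N +> \<tau> i (\<tau> k x)" "\<tau> k ` \<tau> i ` C = N +> \<tau> k (\<tau> i x)"
      using t(2) by (simp_all add: img)
    then show "\<tau> i ` \<tau> k ` C = \<tau> k ` \<tau> i ` C" using t(5)[OF x(1), of i k] by simp
  qed
qed

lemma (in complex_seminormed_space) involutions_separated:
  assumes "involutions V \<tau>"
  shows "involutions (separated V) (\<lambda>i C. \<tau> i ` C)"
    and "x \<in> carrier V \<Longrightarrow> \<tau> i ` (seminorm_kernel V +> x) = seminorm_kernel V +> \<tau> i x"
proof -
  have "\<tau> i ` seminorm_kernel V \<subseteq> seminorm_kernel V" for i
    using involutionsD[OF assms] by (auto simp: seminorm_kernel_def)
  from sep.involutions_quotient[OF assms this]
  show "involutions (separated V) (\<lambda>i C. \<tau> i ` C)"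
    "x \<in> carrier V \<Longrightarrow> \<tau> i ` (seminorm_kernel V +> x) = seminorm_kernel V +> \<tau> i x"
    by (simp_all add: separated_def)
qed

definition transport_map :: "'a set \<Rightarrow> ('a \<Rightarrow> 'b) \<Rightarrow> ('a \<Rightarrow> 'a) \<Rightarrow> 'b \<Rightarrow> 'b" where
  "transport_map C f h y = f (h (inv_into C f y))"

lemma (in transported) involutions_transport:
  assumes \<tau>: "involutions V \<tau>"
  shows "involutions (transport f V) (\<lambda>i. transport_map (carrier V) f (\<tau> i))"
    and "x \<in> carrier V \<Longrightarrow> transport_map (carrier V) f (\<tau> i) (f x) = f (\<tau> i x)"
proof -
  note t = involutionsD[OF \<tau>] linear_mapD[OF involutionsD(1)[OF \<tau>]]
  show f: "transport_map (carrier V) f (\<tau> i) (f x) = f (\<tau> i x)" if "x \<in> carrier V" for i x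
    using that by (simp add: transport_map_def inv_f)
  show "involutions (transport f V) (\<lambda>i. transport_map (carrier V) f (\<tau> i))"
  proof (rule involutionsI)
    fix i
    show "linear_map (transport f V) (transport f V) (transport_map (carrier V) f (\<tau> i))"
      by (auto simp: linear_map_def carrier_transport f t transport_simps)
  next
    fix i y assume "y \<in> carrier (transport f V)"
    then obtain x where x: "x \<in> carrier V" "y = f x" by (auto simp: carrier_transport)
    then show "nrm (transport f V) (transport_map (carrier V) f (\<tau> i) y) = nrm (transport f V) y"
      "transport_map (carrier V) f (\<tau> i) (transport_map (carrier V) f (\<tau> i) y) = y"
      by (simp_all add: f t transport_simps)
  next
    fix i k y assume "y \<in> carrier (transport f V)"
    then obtain x where x: "x \<in> carrier V" "y = f x" by (auto simp: carrier_transport)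
    then show "transport_map (carrier V) f (\<tau> i) (transport_map (carrier V) f (\<tau> k) y) =
        transport_map (carrier V) f (\<tau> k) (transport_map (carrier V) f (\<tau> i) y)"
      using t(5)[OF x(1), of i k] by (simp add: f t(2))
  qed
qed

section \<open>Gluing a sum of Banach spaces to a given one\<close>

text \<open>
  The space \<open>tilde E\<close> in general form: the closed subspaces \<open>Y a\<close> of the spaces \<open>X a\<close> are
  identified with their images in \<open>E\<close> under contractions \<open>v a\<close>.
\<close>

locale gluing =
  fixes A :: "'i set" and X :: "'i \<Rightarrow> 'b cnormed" and Y :: "'i \<Rightarrow> 'b set"
    and v :: "'i \<Rightarrow> 'b \<Rightarrow> 'e" and E :: "'e cnormed"
  assumes X: "a \<in> A \<Longrightarrow> banach (X a)"
    and Y_subspace: "a \<in> A \<Longrightarrow> lin_subspace (X a) (Y a)"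
    and Y_closed: "a \<in> A \<Longrightarrow> nrm_closed (X a) (Y a)"
    and E: "banach E"
    and v_linear: "a \<in> A \<Longrightarrow> linear_map (subspace_of (X a) (Y a)) E (v a)"
    and v_le: "a \<in> A \<Longrightarrow> y \<in> Y a \<Longrightarrow> nrm E (v a y) \<le> nrm (X a) y"
begin

abbreviation B where "B \<equiv> l1_sum A X"
abbreviation S where "S \<equiv> l1_sum A (\<lambda>a. subspace_of (X a) (Y a))"
abbreviation P where "P \<equiv> l1_prod B E"

definition U :: "('i \<Rightarrow> 'b) \<Rightarrow> 'e" where "U s = vsum E (\<lambda>a. v a (s a)) A"
definition G :: "(('i \<Rightarrow> 'b) \<times> 'e) set" where "G = {(s, \<ominus>\<^bsub>E\<^esub> U s) |s. s \<in> carrier S}"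

sublocale E: complex_normed_space E using E by (rule banachD)
sublocale B: l1_sum_space A X by (rule l1_sum_space.intro) (rule banachD(3)[OF X])
sublocale PP: l1_prod_space B E by unfold_locales

lemma carrier_S: "s \<in> carrier S \<longleftrightarrow> s \<in> carrier B \<and> (\<forall>a\<in>A. s a \<in> Y a)"
  using Y_subspace by (fastforce simp: carrier_l1_sum PiE_iff lin_subspace_def)

text \<open>
  The contractions \<open>v a\<close> keep the norms summable; this is where completeness of \<open>E\<close> enters.
\<close>

lemma U_sum:
  assumes s: "s \<in> carrier S"
  shows "has_vsum E (\<lambda>a. v a (s a)) A (U s)" and "nrm E (U s) \<le> nrm B s"
proof -
  have sY: "s a \<in> Y a" "s a \<in> carrier (X a)" if "a \<in> A" for a
    using s that B.memD(1)[of s a] by (auto simp: carrier_S)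
  have c: "(\<lambda>a. v a (s a)) \<in> A \<rightarrow> carrier E"
    using sY(1) linear_mapD(1)[OF v_linear] by auto
  have sum: "(\<lambda>a. nrm (X a) (s a)) summable_on A" using s B.memD(2) by (simp add: carrier_S)
  have vs: "(\<lambda>a. nrm E (v a (s a))) summable_on A"
    by (rule summable_on_comparison_test[OF sum]) (use sY v_le c in \<open>auto simp: Pi_iff\<close>)
  obtain l where l: "has_vsum E (\<lambda>a. v a (s a)) A l" "nrm E l \<le> (\<Sum>\<^sub>\<infinity>a\<in>A. nrm E (v a (s a)))"
    using E.has_vsum_exists[OF banachD(2)[OF E] c vs] by blast
  have "U s = l" unfolding U_def by (rule E.vsum_eqI[OF l(1)])
  moreover have "(\<Sum>\<^sub>\<infinity>a\<in>A. nrm E (v a (s a))) \<le> (\<Sum>\<^sub>\<infinity>a\<in>A. nrm (X a) (s a))"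
    by (rule infsum_mono[OF vs sum]) (use sY v_le in auto)
  ultimately show "has_vsum E (\<lambda>a. v a (s a)) A (U s)" "nrm E (U s) \<le> nrm B s"
    using l by auto
qed

lemma U_closed: "s \<in> carrier S \<Longrightarrow> U s \<in> carrier E"
  using U_sum(1) by (simp add: has_vsum_def)

lemma U_eqI: "s \<in> carrier S \<Longrightarrow> has_vsum E (\<lambda>a. v a (s a)) A l \<Longrightarrow> U s = l"
  using E.has_vsum_unique U_sum(1) by blast

lemma has_vsum_cong:
  "has_vsum E f A l \<Longrightarrow> (\<And>a. a \<in> A \<Longrightarrow> f a = g a) \<Longrightarrow> has_vsum E g A l"
proof -
  assume f: "has_vsum E f A l" and fg: "\<And>a. a \<in> A \<Longrightarrow> f a = g a"
  have c: "f \<in> A \<rightarrow> carrier E" using f by (simp add: has_vsum_def)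
  have "finsum E g H = finsum E f H" if "H \<subseteq> A" for H
    using that c fg by (intro E.finsum_cong') (auto simp: subset_iff)
  with f c fg show "has_vsum E g A l"
    unfolding has_vsum_def by (auto simp: Pi_iff)
qed

lemma S_seminormed: "complex_seminormed_space S"
proof -
  have "complex_seminormed_space (subspace_of (X a) (Y a))" if "a \<in> A" for a
  proof -
    interpret complex_seminormed_space "X a" by (rule banachD(3)[OF X[OF that]])
    interpret quotient_space "X a" "Y a" by unfold_locales (rule Y_subspace[OF that])
    show ?thesis by (rule subspace_seminormed)
  qed
  then interpret l1_sum_space A "\<lambda>a. subspace_of (X a) (Y a)" by (rule l1_sum_space.intro)
  show ?thesis by (rule seminormed)
qed

lemma U_linear: "linear_map S E U"
proof -
  interpret S: complex_seminormed_space S by (rule S_seminormed)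
  have "U (s \<oplus>\<^bsub>S\<^esub> t) = U s \<oplus>\<^bsub>E\<^esub> U t" if s: "s \<in> carrier S" and t: "t \<in> carrier S" for s t
  proof (rule U_eqI)
    show "s \<oplus>\<^bsub>S\<^esub> t \<in> carrier S" using s t by (rule S.add.m_closed)
    show "has_vsum E (\<lambda>a. v a ((s \<oplus>\<^bsub>S\<^esub> t) a)) A (U s \<oplus>\<^bsub>E\<^esub> U t)"
      by (rule has_vsum_cong[OF E.has_vsum_add[OF U_sum(1)[OF s] U_sum(1)[OF t]]])
        (use s t linear_mapD(2)[OF v_linear] in \<open>auto simp: carrier_S\<close>)
  qed
  moreover have "U (c \<odot>\<^bsub>S\<^esub> s) = c \<odot>\<^bsub>E\<^esub> U s" if s: "s \<in> carrier S" for s c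
  proof (rule U_eqI)
    show "c \<odot>\<^bsub>S\<^esub> s \<in> carrier S" using s by (rule S.sm_closed)
    have L: "linear_map E E (\<lambda>x. c \<odot>\<^bsub>E\<^esub> x)"
      by (auto simp: linear_map_def E.sm_add_r E.sm_assoc mult.commute)
    show "has_vsum E (\<lambda>a. v a ((c \<odot>\<^bsub>S\<^esub> s) a)) A (c \<odot>\<^bsub>E\<^esub> U s)"
      by (rule has_vsum_cong[OF has_vsum_linear_map[OF E.complex_normed_space_axioms E.complex_normed_space_axioms L _ U_sum(1)[OF s]]])
        (use s linear_mapD(3)[OF v_linear] in \<open>auto simp: carrier_S E.nrm_smult\<close>)
  qed
  ultimately show ?thesis using U_closed by (auto simp: linear_map_def)
qed

lemma G_subspace: "lin_subspace P G"
proof -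
  interpret S: complex_seminormed_space S by (rule S_seminormed)
  note u = linear_mapD[OF U_linear] linear_map_zero_diff[OF S_seminormed E.seminormed U_linear]
  have zero: "\<zero>\<^bsub>P\<^esub> = (\<zero>\<^bsub>S\<^esub>, \<ominus>\<^bsub>E\<^esub> U \<zero>\<^bsub>S\<^esub>)" by (simp only: u(4)) (simp add: E.neg_eq)
  have add: "(s, \<ominus>\<^bsub>E\<^esub> U s) \<oplus>\<^bsub>P\<^esub> (t, \<ominus>\<^bsub>E\<^esub> U t) = (s \<oplus>\<^bsub>S\<^esub> t, \<ominus>\<^bsub>E\<^esub> U (s \<oplus>\<^bsub>S\<^esub> t))"
    if "s \<in> carrier S" "t \<in> carrier S" for s t
    using that by (simp add: u(2) E.minus_add u(1) del: l1_sum_simps) simp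
  have smult: "c \<odot>\<^bsub>P\<^esub> (s, \<ominus>\<^bsub>E\<^esub> U s) = (c \<odot>\<^bsub>S\<^esub> s, \<ominus>\<^bsub>E\<^esub> U (c \<odot>\<^bsub>S\<^esub> s))" if "s \<in> carrier S" for c s
    using that by (simp add: u(3) E.sm_minus_r u(1) del: l1_sum_simps) simp
  show ?thesis
    unfolding lin_subspace_def
  proof (intro conjI ballI allI)
    show "G \<subseteq> carrier P" using U_closed by (auto simp: G_def carrier_S)
    show "\<zero>\<^bsub>P\<^esub> \<in> G" unfolding zero G_def using S.zero_closed by blast
    fix x y assume "x \<in> G" "y \<in> G"
    then obtain s t where "x = (s, \<ominus>\<^bsub>E\<^esub> U s)" "y = (t, \<ominus>\<^bsub>E\<^esub> U t)" "s \<in> carrier S" "t \<in> carrier S"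
      by (auto simp: G_def)
    then show "x \<oplus>\<^bsub>P\<^esub> y \<in> G" unfolding G_def using add[of s t] S.add.m_closed[of s t] by auto
  next
    fix x c assume "x \<in> G"
    then obtain s where "x = (s, \<ominus>\<^bsub>E\<^esub> U s)" "s \<in> carrier S" by (auto simp: G_def)
    then show "c \<odot>\<^bsub>P\<^esub> x \<in> G" unfolding G_def using smult[of s c] S.sm_closed[of s c] by auto
  qed
qed

text \<open>
  A limit of points of \<open>G\<close> has its coordinates in the closed subspaces \<open>Y a\<close>, and \<open>U\<close> is continuous,
  being a contraction.
\<close>

lemma G_closed: "nrm_closed P G"
  unfolding nrm_closed_def
proof (intro ballI impI)
  interpret S: complex_seminormed_space S by (rule S_seminormed)
  fix p assume "p \<in> carrier P" and *: "\<forall>e>0. \<exists>g\<in>G. nrm P (p \<ominus>\<^bsub>P\<^esub> g) < e"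
  then obtain x y where p: "p = (x, y)" "x \<in> carrier B" "y \<in> carrier E" by auto
  have approx: "\<exists>s\<in>carrier S. nrm B (x \<ominus>\<^bsub>B\<^esub> s) + nrm E (y \<oplus>\<^bsub>E\<^esub> U s) < e" if e: "e > 0" for e
  proof -
    from * e obtain g where g: "g \<in> G" "nrm P (p \<ominus>\<^bsub>P\<^esub> g) < e" by blast
    from g(1) obtain s where "s \<in> carrier S" "g = (s, \<ominus>\<^bsub>E\<^esub> U s)" unfolding G_def by blast
    with g(2) have s: "s \<in> carrier S" "nrm P (p \<ominus>\<^bsub>P\<^esub> (s, \<ominus>\<^bsub>E\<^esub> U s)) < e" by simp_all
    have "p \<ominus>\<^bsub>P\<^esub> (s, \<ominus>\<^bsub>E\<^esub> U s) = (x \<ominus>\<^bsub>B\<^esub> s, y \<oplus>\<^bsub>E\<^esub> U s)"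
      using p s(1) U_closed[OF s(1)] by (simp add: carrier_S E.minus_eq)
    then show ?thesis using s by (intro bexI[of _ s]) (simp_all del: l1_sum_simps)
  qed
  have "x a \<in> Y a" if a: "a \<in> A" for a
  proof -
    have "\<exists>n\<in>Y a. nrm (X a) (x a \<ominus>\<^bsub>X a\<^esub> n) < e" if e: "e > 0" for e
    proof -
      obtain s where s: "s \<in> carrier S" "nrm B (x \<ominus>\<^bsub>B\<^esub> s) + nrm E (y \<oplus>\<^bsub>E\<^esub> U s) < e"
        using approx[OF e] by blast
      have "nrm (X a) (x a \<ominus>\<^bsub>X a\<^esub> s a) \<le> nrm B (x \<ominus>\<^bsub>B\<^esub> s)"
        using p s a by (intro B.coordinate_diff_le) (auto simp: carrier_S)
      moreover have "nrm E (y \<oplus>\<^bsub>E\<^esub> U s) \<ge> 0" using p U_closed[OF s(1)] by simp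
      ultimately show ?thesis using s a by (intro bexI[of _ "s a"]) (auto simp: carrier_S)
    qed
    then show ?thesis using Y_closed[OF a] B.memD(1)[OF p(2) a] by (simp add: nrm_closed_def)
  qed
  then have xS: "x \<in> carrier S" using p by (simp add: carrier_S)
  have "nrm E (y \<oplus>\<^bsub>E\<^esub> U x) \<le> 0 + e" if e: "e > 0" for e
  proof -
    obtain s where s: "s \<in> carrier S" "nrm B (x \<ominus>\<^bsub>B\<^esub> s) + nrm E (y \<oplus>\<^bsub>E\<^esub> U s) < e"
      using approx[OF e] by blast
    have c: "U s \<in> carrier E" "U x \<in> carrier E" "s \<in> carrier B" using s xS U_closed by (auto simp: carrier_S)
    have "x \<ominus>\<^bsub>S\<^esub> s = x \<ominus>\<^bsub>B\<^esub> s"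
    proof -
      have "x \<ominus>\<^bsub>S\<^esub> s = x \<oplus>\<^bsub>S\<^esub> ((-1) \<odot>\<^bsub>S\<^esub> s)" using s(1) by (simp only: S.minus_eq S.neg_eq)
      also have "\<dots> = x \<oplus>\<^bsub>B\<^esub> ((-1) \<odot>\<^bsub>B\<^esub> s)" by simp
      also have "\<dots> = x \<ominus>\<^bsub>B\<^esub> s" using c(3) by (simp only: B.L.minus_eq B.L.neg_eq)
      finally show ?thesis .
    qed
    then have Ud: "nrm E (U x \<ominus>\<^bsub>E\<^esub> U s) \<le> nrm B (x \<ominus>\<^bsub>B\<^esub> s)"
      using U_sum(2)[OF S.minus_closed[OF xS s(1)]] linear_map_zero_diff(2)[OF S_seminormed E.seminormed U_linear xS s(1)]
      by simp
    have "nrm E (y \<oplus>\<^bsub>E\<^esub> U x) \<le> nrm E ((y \<oplus>\<^bsub>E\<^esub> U x) \<ominus>\<^bsub>E\<^esub> (y \<oplus>\<^bsub>E\<^esub> U s)) + nrm E (y \<oplus>\<^bsub>E\<^esub> U s)"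
      using p c by (intro E.nrm_le_diff) auto
    also have "(y \<oplus>\<^bsub>E\<^esub> U x) \<ominus>\<^bsub>E\<^esub> (y \<oplus>\<^bsub>E\<^esub> U s) = U x \<ominus>\<^bsub>E\<^esub> U s"
      using p c by (simp add: E.add_diff_add)
    finally show ?thesis using Ud s by linarith
  qed
  then have "nrm E (y \<oplus>\<^bsub>E\<^esub> U x) \<le> 0" by (rule field_le_epsilon)
  moreover have "nrm E (y \<oplus>\<^bsub>E\<^esub> U x) \<ge> 0" using p U_closed[OF xS] by simp
  ultimately have "y \<oplus>\<^bsub>E\<^esub> U x = \<zero>\<^bsub>E\<^esub>" using p U_closed[OF xS] E.nrm_eq_0[of "y \<oplus>\<^bsub>E\<^esub> U x"] by simp
  then have "y = \<ominus>\<^bsub>E\<^esub> U x" using p U_closed[OF xS] by (simp add: E.minus_equality[symmetric])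
  then show "p \<in> G" using p xS by (auto simp: G_def)
qed

sublocale Q: quotient_space P G by unfold_locales (rule G_subspace)

lemma banach_Q: "banach (quotient P G)"
proof -
  have "banach P" by (intro banach_l1_prod banach_l1_sum X E)
  then show ?thesis using Q.normed_quotient[OF G_closed] Q.complete_quotient by (simp add: banach_def)
qed

definition j :: "'e \<Rightarrow> (('i \<Rightarrow> 'b) \<times> 'e) set" where "j e = G +>\<^bsub>P\<^esub> (\<zero>\<^bsub>B\<^esub>, e)"

lemma linear_map_pair: "linear_map E P (\<lambda>e. (\<zero>\<^bsub>B\<^esub>, e))" "linear_map B P (\<lambda>b. (b, \<zero>\<^bsub>E\<^esub>))"
  using B.L.zero_closed by (auto simp: linear_map_def B.L.l_zero E.l_zero simp del: l1_sum_simps)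

lemma j_linear: "linear_map E (quotient P G) j"
  unfolding j_def by (rule linear_map_comp[OF linear_map_pair(1) Q.linear_map_quotient])

text \<open>
  Passing to another representative of \<open>j e\<close> moves the component in \<open>E\<close> by \<open>U s\<close> at the cost of
  \<open>\<parallel>s\<parallel>\<close>, which is at least \<open>\<parallel>U s\<parallel>\<close>.
\<close>

lemma nrm_j:
  assumes e: "e \<in> carrier E"
  shows "nrm (quotient P G) (j e) = nrm E e"
proof (rule antisym)
  have c: "(\<zero>\<^bsub>B\<^esub>, e) \<in> carrier P" using e B.L.zero_closed by (simp del: l1_sum_simps)
  have "nrm (quotient P G) (j e) \<le> nrm P (\<zero>\<^bsub>B\<^esub>, e)"
    unfolding j_def by (rule Q.nrm_quotient_le[OF c Q.self_mem_coset[OF c]])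
  then show "nrm (quotient P G) (j e) \<le> nrm E e" using B.L.nrm_zero by (simp del: l1_sum_simps)
  show "nrm E e \<le> nrm (quotient P G) (j e)"
    unfolding j_def
  proof (rule Q.nrm_quotient_greatest[OF c])
    fix p assume "p \<in> G +>\<^bsub>P\<^esub> (\<zero>\<^bsub>B\<^esub>, e)"
    then obtain s where s: "s \<in> carrier S" "p = (s, \<ominus>\<^bsub>E\<^esub> U s) \<oplus>\<^bsub>P\<^esub> (\<zero>\<^bsub>B\<^esub>, e)"
      by (auto simp: PP.P.a_r_coset_iff G_def)
    have sB: "s \<in> carrier B" using s by (simp add: carrier_S)
    have "p = (s, e \<ominus>\<^bsub>E\<^esub> U s)"
      using s e U_closed[OF s(1)] sB by (simp add: E.minus_eq E.a_comm B.L.r_zero del: l1_sum_simps)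
    moreover have "nrm E e \<le> nrm E (e \<ominus>\<^bsub>E\<^esub> U s) + nrm E (U s)"
      using e U_closed[OF s(1)] by (rule E.nrm_le_diff)
    ultimately show "nrm E e \<le> nrm P p" using U_sum(2)[OF s(1)] by simp
  qed
qed

text \<open>A vector of \<open>B\<close> stays as far from \<open>0\<close> in the quotient as its coordinates are from the \<open>Y a\<close>.\<close>

lemma nrm_Q_ge_sum:
  assumes b: "b \<in> carrier B" and F: "finite F" "F \<subseteq> A"
    and d: "\<And>a y. a \<in> F \<Longrightarrow> y \<in> Y a \<Longrightarrow> d a \<le> nrm (X a) (y \<oplus>\<^bsub>X a\<^esub> b a)"
  shows "sum d F \<le> nrm (quotient P G) (G +>\<^bsub>P\<^esub> (b, \<zero>\<^bsub>E\<^esub>))"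
proof (rule Q.nrm_quotient_greatest)
  show "(b, \<zero>\<^bsub>E\<^esub>) \<in> carrier P" using b by simp
  fix p assume "p \<in> G +>\<^bsub>P\<^esub> (b, \<zero>\<^bsub>E\<^esub>)"
  then obtain s where s: "s \<in> carrier S" "p = (s, \<ominus>\<^bsub>E\<^esub> U s) \<oplus>\<^bsub>P\<^esub> (b, \<zero>\<^bsub>E\<^esub>)"
    by (auto simp: PP.P.a_r_coset_iff G_def)
  have sB: "s \<in> carrier B" and sY: "\<And>a. a \<in> A \<Longrightarrow> s a \<in> Y a" using s by (auto simp: carrier_S)
  have "sum d F \<le> (\<Sum>a\<in>F. nrm (X a) ((s \<oplus>\<^bsub>B\<^esub> b) a))"
    using F d sY by (intro sum_mono) (auto simp: subset_iff)
  also have "\<dots> \<le> nrm B (s \<oplus>\<^bsub>B\<^esub> b)"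
    using sB b F by (intro B.finite_sum_le B.L.add.m_closed)
  also have "\<dots> \<le> nrm P p"
    using s U_closed[OF s(1)] by (simp del: l1_sum_simps)
  finally show "sum d F \<le> nrm P p" .
qed

end

text \<open>
  A permutation \<open>\<phi> i\<close> of the index set that carries the gluing maps \<open>v a\<close> to \<open>\<tau> i \<circ> v a\<close> leaves the
  relation \<open>G\<close> invariant, and therefore acts on the glued space and extends \<open>\<tau> i\<close>.
\<close>

locale gluing_involutions = gluing A X Y v E
  for A :: "'i set" and X :: "'i \<Rightarrow> 'b cnormed" and Y v and E :: "'e cnormed" +
  fixes \<phi> :: "nat \<Rightarrow> 'i \<Rightarrow> 'i" and \<tau> :: "nat \<Rightarrow> 'e \<Rightarrow> 'e"
  assumes \<phi>_closed: "a \<in> A \<Longrightarrow> \<phi> i a \<in> A"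
    and \<phi>_\<phi>: "a \<in> A \<Longrightarrow> \<phi> i (\<phi> i a) = a"
    and \<phi>_commute: "a \<in> A \<Longrightarrow> \<phi> i (\<phi> k a) = \<phi> k (\<phi> i a)"
    and X_\<phi>: "a \<in> A \<Longrightarrow> X (\<phi> i a) = X a"
    and Y_\<phi>: "a \<in> A \<Longrightarrow> Y (\<phi> i a) = Y a"
    and v_\<phi>: "a \<in> A \<Longrightarrow> y \<in> Y a \<Longrightarrow> v (\<phi> i a) y = \<tau> i (v a y)"
    and \<tau>: "involutions E \<tau>"
begin

definition permute :: "nat \<Rightarrow> ('i \<Rightarrow> 'b) \<Rightarrow> 'i \<Rightarrow> 'b" where
  "permute i b = (\<lambda>a\<in>A. b (\<phi> i a))"

definition \<theta> :: "nat \<Rightarrow> ('i \<Rightarrow> 'b) \<times> 'e \<Rightarrow> ('i \<Rightarrow> 'b) \<times> 'e" where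
  "\<theta> i = (\<lambda>(b, e). (permute i b, \<tau> i e))"

lemma bij_\<phi>: "bij_betw (\<phi> i) A A"
  by (rule bij_betwI[of _ _ _ "\<phi> i"]) (auto simp: \<phi>_closed \<phi>_\<phi>)

lemma permute_mem:
  assumes b: "b \<in> carrier B"
  shows "permute i b \<in> carrier B" "nrm B (permute i b) = nrm B b"
proof -
  have eq: "nrm (X a) (permute i b a) = (\<lambda>a. nrm (X a) (b a)) (\<phi> i a)" if "a \<in> A" for a
    using that by (simp add: permute_def X_\<phi>)
  have "(\<lambda>a. nrm (X a) (permute i b a)) summable_on A \<longleftrightarrow>
      (\<lambda>a. (\<lambda>a. nrm (X a) (b a)) (\<phi> i a)) summable_on A"
    by (rule summable_on_cong) (rule eq)
  also have "\<dots> \<longleftrightarrow> (\<lambda>a. nrm (X a) (b a)) summable_on A"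
    by (rule summable_on_reindex_bij_betw[OF bij_\<phi>])
  finally have s: "(\<lambda>a. nrm (X a) (permute i b a)) summable_on A" using B.memD(2)[OF b] by simp
  show "permute i b \<in> carrier B"
  proof (rule B.memI)
    fix a assume "a \<in> A"
    then show "permute i b a \<in> carrier (X a)"
      using B.memD(1)[OF b \<phi>_closed[of a i]] by (simp add: permute_def X_\<phi>)
  qed (use s in \<open>auto simp: permute_def\<close>)
  have "(\<Sum>\<^sub>\<infinity>a\<in>A. nrm (X a) (permute i b a)) = (\<Sum>\<^sub>\<infinity>a\<in>A. (\<lambda>a. nrm (X a) (b a)) (\<phi> i a))"
    by (rule infsum_cong) (rule eq)
  also have "\<dots> = (\<Sum>\<^sub>\<infinity>a\<in>A. nrm (X a) (b a))" by (rule infsum_reindex_bij_betw[OF bij_\<phi>])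
  finally show "nrm B (permute i b) = nrm B b" by simp
qed

lemma involutions_P: "involutions P \<theta>"
proof (rule involutionsI)
  note t = involutionsD[OF \<tau>] linear_mapD[OF involutionsD(1)[OF \<tau>]]
  fix i
  have "permute i (b \<oplus>\<^bsub>B\<^esub> c) = permute i b \<oplus>\<^bsub>B\<^esub> permute i c" for b c
    by (auto simp: permute_def \<phi>_closed X_\<phi>)
  moreover have "permute i (c \<odot>\<^bsub>B\<^esub> b) = c \<odot>\<^bsub>B\<^esub> permute i b" for b c
    by (auto simp: permute_def \<phi>_closed X_\<phi>)
  ultimately show "linear_map P P (\<theta> i)"
    by (auto simp: linear_map_def \<theta>_def permute_mem t simp del: l1_sum_simps)
next
  note t = involutionsD[OF \<tau>]
  fix i p assume "p \<in> carrier P"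
  then obtain b e where p: "p = (b, e)" "b \<in> carrier B" "e \<in> carrier E" by auto
  then show "nrm P (\<theta> i p) = nrm P p" by (simp add: \<theta>_def permute_mem t del: l1_sum_simps)
  have "permute i (permute i b) = b"
    using B.memD(4)[OF p(2)] by (auto simp: permute_def \<phi>_closed \<phi>_\<phi> intro!: extensionalityI[of _ A])
  then show "\<theta> i (\<theta> i p) = p" using p by (simp add: \<theta>_def t)
next
  note t = involutionsD[OF \<tau>]
  fix i k p assume "p \<in> carrier P"
  then obtain b e where p: "p = (b, e)" "e \<in> carrier E" by auto
  have "permute i (permute k b) = permute k (permute i b)"
    by (auto simp: permute_def \<phi>_closed \<phi>_commute)
  then show "\<theta> i (\<theta> k p) = \<theta> k (\<theta> i p)" using p t(5)[OF p(2), of i k] by (simp add: \<theta>_def)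
qed

lemma \<theta>_G: "\<theta> i ` G \<subseteq> G"
proof
  note t = involutionsD[OF \<tau>]
  fix p assume "p \<in> \<theta> i ` G"
  then obtain s where s: "s \<in> carrier S" "p = (permute i s, \<tau> i (\<ominus>\<^bsub>E\<^esub> U s))"
    by (auto simp: G_def \<theta>_def)
  have sB: "s \<in> carrier B" and sY: "\<And>a. a \<in> A \<Longrightarrow> s a \<in> Y a" using s by (auto simp: carrier_S)
  have ps: "permute i s \<in> carrier S"
  proof -
    have "s (\<phi> i a) \<in> Y a" if "a \<in> A" for a using sY[OF \<phi>_closed[OF that, of i]] by (simp add: Y_\<phi>[OF that])
    then show ?thesis using permute_mem(1)[OF sB, of i] by (simp add: carrier_S permute_def)
  qed
  have "U (permute i s) = \<tau> i (U s)"
  proof (rule U_eqI[OF ps])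
    have "has_vsum E (\<lambda>a. v (\<phi> i a) (s (\<phi> i a))) A (U s)"
      by (rule has_vsum_reindex[OF E.seminormed bij_\<phi> U_sum(1)[OF s(1)]])
    then have "has_vsum E (\<lambda>a. \<tau> i (v (\<phi> i a) (s (\<phi> i a)))) A (\<tau> i (U s))"
      by (rule has_vsum_linear_map[OF E.complex_normed_space_axioms E.complex_normed_space_axioms t(1), where K=1, rotated])
        (simp add: t)
    then show "has_vsum E (\<lambda>a. v a (permute i s a)) A (\<tau> i (U s))"
    proof (rule has_vsum_cong)
      fix a assume a: "a \<in> A"
      have "v (\<phi> i (\<phi> i a)) (s (\<phi> i a)) = \<tau> i (v (\<phi> i a) (s (\<phi> i a)))"
        by (rule v_\<phi>) (use a sY in \<open>auto simp: \<phi>_closed\<close>)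
      then show "\<tau> i (v (\<phi> i a) (s (\<phi> i a))) = v a (permute i s a)"
        using a by (simp add: permute_def \<phi>_\<phi>)
    qed
  qed
  moreover have "\<tau> i (\<ominus>\<^bsub>E\<^esub> U s) = \<ominus>\<^bsub>E\<^esub> \<tau> i (U s)"
    using linear_map_zero_diff(3)[OF E.seminormed E.seminormed t(1)] U_closed[OF s(1)] by simp
  ultimately show "p \<in> G" using s ps by (auto simp: G_def)
qed

lemmas involutions_Q = Q.involutions_quotient(1)[OF involutions_P \<theta>_G]
lemmas \<theta>_coset = Q.involutions_quotient(2)[OF involutions_P \<theta>_G]

lemma \<theta>_j: "e \<in> carrier E \<Longrightarrow> \<theta> i ` j e = j (\<tau> i e)"
proof -
  assume e: "e \<in> carrier E"
  have "permute i \<zero>\<^bsub>B\<^esub> = \<zero>\<^bsub>B\<^esub>"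
    by (auto simp: permute_def \<phi>_closed X_\<phi>)
  then show "\<theta> i ` j e = j (\<tau> i e)"
    unfolding j_def using e B.L.zero_closed by (subst \<theta>_coset) (auto simp: \<theta>_def simp del: l1_sum_simps)
qed

end

section \<open>Inductive limits and completions\<close>

text \<open>
  Threads and Cauchy sequences are both spaces of sequences with the limit of the norms as
  seminorm.
\<close>

definition seq_space :: "(nat \<Rightarrow> 'a cnormed) \<Rightarrow> (nat \<Rightarrow> 'a) set \<Rightarrow> (nat \<Rightarrow> 'a) cnormed" where
  "seq_space V C = mk_cnormed C (\<lambda>n. \<zero>\<^bsub>V n\<^esub>) (\<lambda>x y n. x n \<oplus>\<^bsub>V n\<^esub> y n) (\<lambda>c x n. c \<odot>\<^bsub>V n\<^esub> x n)
     (\<lambda>x. lim (\<lambda>n. nrm (V n) (x n)))"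

lemma seq_space_simps [simp]:
  "carrier (seq_space V C) = C" "\<zero>\<^bsub>seq_space V C\<^esub> = (\<lambda>n. \<zero>\<^bsub>V n\<^esub>)"
  "x \<oplus>\<^bsub>seq_space V C\<^esub> y = (\<lambda>n. x n \<oplus>\<^bsub>V n\<^esub> y n)" "c \<odot>\<^bsub>seq_space V C\<^esub> x = (\<lambda>n. c \<odot>\<^bsub>V n\<^esub> x n)"
  "nrm (seq_space V C) x = lim (\<lambda>n. nrm (V n) (x n))"
  by (simp_all add: seq_space_def)

locale sequence_space =
  fixes V :: "nat \<Rightarrow> 'a cnormed" and C :: "(nat \<Rightarrow> 'a) set"
  assumes V: "complex_seminormed_space (V n)"
    and C_closed: "x \<in> C \<Longrightarrow> x n \<in> carrier (V n)"
    and C_zero: "(\<lambda>n. \<zero>\<^bsub>V n\<^esub>) \<in> C"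
    and C_add: "x \<in> C \<Longrightarrow> y \<in> C \<Longrightarrow> (\<lambda>n. x n \<oplus>\<^bsub>V n\<^esub> y n) \<in> C"
    and C_smult: "x \<in> C \<Longrightarrow> (\<lambda>n. c \<odot>\<^bsub>V n\<^esub> x n) \<in> C"
    and C_convergent: "x \<in> C \<Longrightarrow> convergent (\<lambda>n. nrm (V n) (x n))"
begin

lemma nrm_lim: "x \<in> C \<Longrightarrow> (\<lambda>n. nrm (V n) (x n)) \<longlonglongrightarrow> nrm (seq_space V C) x"
  using C_convergent by (simp add: convergent_LIMSEQ_iff)

lemma nrm_eqI: "(\<lambda>n. nrm (V n) (x n)) \<longlonglongrightarrow> l \<Longrightarrow> nrm (seq_space V C) x = l"
  by (simp add: limI)

lemma seminormed: "complex_seminormed_space (seq_space V C)"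
  unfolding seq_space_def
proof (rule mk_seminormed_space)
  interpret V: complex_seminormed_space "V n" for n by (rule V)
  show "(\<lambda>n. \<zero>\<^bsub>V n\<^esub>) \<in> C" by (rule C_zero)
  fix x assume x: "x \<in> C"
  note xc = C_closed[OF x]
  show "(\<lambda>n. c \<odot>\<^bsub>V n\<^esub> x n) \<in> C" for c using x by (rule C_smult)
  show "(\<lambda>n. \<zero>\<^bsub>V n\<^esub> \<oplus>\<^bsub>V n\<^esub> x n) = x" "(\<lambda>n. 0 \<odot>\<^bsub>V n\<^esub> x n) = (\<lambda>n. \<zero>\<^bsub>V n\<^esub>)" "(\<lambda>n. 1 \<odot>\<^bsub>V n\<^esub> x n) = x"
    using xc by simp_all
  show "(\<lambda>n. (c + d) \<odot>\<^bsub>V n\<^esub> x n) = (\<lambda>n. c \<odot>\<^bsub>V n\<^esub> x n \<oplus>\<^bsub>V n\<^esub> d \<odot>\<^bsub>V n\<^esub> x n)" for c d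
    using xc by (simp add: V.sm_add_l)
  show "(\<lambda>n. (c * d) \<odot>\<^bsub>V n\<^esub> x n) = (\<lambda>n. c \<odot>\<^bsub>V n\<^esub> (d \<odot>\<^bsub>V n\<^esub> x n))" for c d
    using xc by (simp add: V.sm_assoc)
  show "lim (\<lambda>n. nrm (V n) (c \<odot>\<^bsub>V n\<^esub> x n)) = cmod c * lim (\<lambda>n. nrm (V n) (x n))" for c
  proof -
    have "(\<lambda>n. cmod c * nrm (V n) (x n)) \<longlonglongrightarrow> cmod c * nrm (seq_space V C) x"
      by (intro tendsto_mult_left nrm_lim x)
    then show ?thesis using xc by (simp add: V.nrm_smult limI)
  qed
  fix y assume y: "y \<in> C"
  note yc = C_closed[OF y]
  show "(\<lambda>n. x n \<oplus>\<^bsub>V n\<^esub> y n) \<in> C" using x y by (rule C_add)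
  show "(\<lambda>n. x n \<oplus>\<^bsub>V n\<^esub> y n) = (\<lambda>n. y n \<oplus>\<^bsub>V n\<^esub> x n)" using xc yc by (auto intro: V.a_comm)
  show "(\<lambda>n. c \<odot>\<^bsub>V n\<^esub> (x n \<oplus>\<^bsub>V n\<^esub> y n)) = (\<lambda>n. c \<odot>\<^bsub>V n\<^esub> x n \<oplus>\<^bsub>V n\<^esub> c \<odot>\<^bsub>V n\<^esub> y n)" for c
    using xc yc by (simp add: V.sm_add_r)
  show "lim (\<lambda>n. nrm (V n) (x n \<oplus>\<^bsub>V n\<^esub> y n)) \<le> lim (\<lambda>n. nrm (V n) (x n)) + lim (\<lambda>n. nrm (V n) (y n))"
  proof -
    have f1: "(\<lambda>n. nrm (V n) (x n) + nrm (V n) (y n)) \<longlonglongrightarrow> nrm (seq_space V C) x + nrm (seq_space V C) y"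
      by (intro tendsto_add nrm_lim x y)
    have f2: "(\<lambda>n. nrm (V n) (x n \<oplus>\<^bsub>V n\<^esub> y n)) \<longlonglongrightarrow> nrm (seq_space V C) (\<lambda>n. x n \<oplus>\<^bsub>V n\<^esub> y n)"
      by (intro nrm_lim C_add x y)
    have "nrm (seq_space V C) (\<lambda>n. x n \<oplus>\<^bsub>V n\<^esub> y n) \<le> nrm (seq_space V C) x + nrm (seq_space V C) y"
      by (rule LIMSEQ_le[OF f2 f1]) (use V.nrm_triangle[OF xc yc] in auto)
    then show ?thesis by simp
  qed
  fix w assume w: "w \<in> C"
  show "(\<lambda>n. x n \<oplus>\<^bsub>V n\<^esub> y n \<oplus>\<^bsub>V n\<^esub> w n) = (\<lambda>n. x n \<oplus>\<^bsub>V n\<^esub> (y n \<oplus>\<^bsub>V n\<^esub> w n))"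
    using xc yc C_closed[OF w] by (simp add: V.a_assoc)
qed

sublocale W: complex_seminormed_space "seq_space V C" by (rule seminormed)

lemma diff: 
  assumes "x \<in> C" "y \<in> C"
  shows "x \<ominus>\<^bsub>seq_space V C\<^esub> y = (\<lambda>n. x n \<ominus>\<^bsub>V n\<^esub> y n)"
proof -
  interpret V: complex_seminormed_space "V n" for n by (rule V)
  have "x \<ominus>\<^bsub>seq_space V C\<^esub> y = x \<oplus>\<^bsub>seq_space V C\<^esub> ((-1) \<odot>\<^bsub>seq_space V C\<^esub> y)"
    using assms by (simp only: W.minus_eq W.neg_eq seq_space_simps)
  then show ?thesis using C_closed[OF assms(2)] by (simp add: V.minus_eq V.neg_eq)
qed

lemma involutions_seq:
  assumes t: "\<And>n. involutions (V n) (\<tau> n)" and C: "\<And>i x. x \<in> C \<Longrightarrow> (\<lambda>n. \<tau> n i (x n)) \<in> C"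
  shows "involutions (seq_space V C) (\<lambda>i x n. \<tau> n i (x n))"
proof (rule involutionsI)
  note tD = involutionsD[OF t] linear_mapD[OF involutionsD(1)[OF t]]
  fix i
  show "linear_map (seq_space V C) (seq_space V C) (\<lambda>x n. \<tau> n i (x n))"
    using C C_closed tD by (auto simp: linear_map_def)
next
  note tD = involutionsD[OF t]
  fix i x assume "x \<in> carrier (seq_space V C)"
  then have "x \<in> C" by simp
  then show "nrm (seq_space V C) (\<lambda>n. \<tau> n i (x n)) = nrm (seq_space V C) x" "(\<lambda>n. \<tau> n i (\<tau> n i (x n))) = x"
    using C_closed tD by auto
next
  note tD = involutionsD[OF t]
  fix i k x assume "x \<in> carrier (seq_space V C)"
  then have "x \<in> C" by simp
  then show "(\<lambda>n. \<tau> n i (\<tau> n k (x n))) = (\<lambda>n. \<tau> n k (\<tau> n i (x n)))"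
    using tD(5)[OF C_closed, of x _ i k] by auto
qed

end

subsection \<open>Completion\<close>

context complex_normed_space
begin

lemma completion_eq: "completion V = separated (seq_space (\<lambda>_. V) {x. cauchy_seq V x})"
proof -
  have "Metric_space.MCauchy (carrier V) (ndist V) = cauchy_seq V" by (rule ext) (rule MCauchy_iff)
  then show ?thesis unfolding completion_def seq_space_def by simp
qed

sublocale Cauchy: sequence_space "\<lambda>_. V" "{x. cauchy_seq V x}"
proof
  fix n x assume "x \<in> {x. cauchy_seq V x}"
  then have x: "cauchy_seq V x" by simp
  then have xc: "x n \<in> carrier V" for n by (simp add: cauchy_seq_def)
  show "x n \<in> carrier V" by (rule xc)
  show "convergent (\<lambda>n. nrm V (x n))"
  proof (rule Cauchy_convergent, rule CauchyI)
    fix e :: real assume "0 < e"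
    then obtain N where N: "\<And>m n. m \<ge> N \<Longrightarrow> n \<ge> N \<Longrightarrow> nrm V (x m \<ominus> x n) < e"
      using x unfolding cauchy_seq_def by metis
    have "norm (nrm V (x m) - nrm V (x n)) < e" if "m \<ge> N" "n \<ge> N" for m n
      using abs_nrm_diff[OF xc xc, of m n] N[OF that] by simp
    then show "\<exists>M. \<forall>m\<ge>M. \<forall>n\<ge>M. norm (nrm V (x m) - nrm V (x n)) < e" by blast
  qed
  show "(\<lambda>n. c \<odot> x n) \<in> {x. cauchy_seq V x}" for c
    unfolding mem_Collect_eq cauchy_seq_def
  proof (intro conjI allI impI)
    fix e :: real assume "e > 0"
    have p: "cmod c + 1 > 0" by (simp add: add_nonneg_pos)
    then have "e / (cmod c + 1) > 0" using \<open>e > 0\<close> by simp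
    then obtain N where N: "\<And>m n. m \<ge> N \<Longrightarrow> n \<ge> N \<Longrightarrow> nrm V (x m \<ominus> x n) < e / (cmod c + 1)"
      using x unfolding cauchy_seq_def by metis
    have "nrm V (c \<odot> x m \<ominus> c \<odot> x n) < e" if "m \<ge> N" "n \<ge> N" for m n
    proof -
      have "nrm V (c \<odot> x m \<ominus> c \<odot> x n) = cmod c * nrm V (x m \<ominus> x n)" by (rule nrm_sm_diff[OF xc xc])
      also have "\<dots> \<le> (cmod c + 1) * nrm V (x m \<ominus> x n)" using xc by (intro mult_right_mono) auto
      also have "\<dots> < e" using N[OF that] p by (simp add: field_simps)
      finally show ?thesis .
    qed
    then show "\<exists>N. \<forall>m\<ge>N. \<forall>n\<ge>N. nrm V (c \<odot> x m \<ominus> c \<odot> x n) < e" by blast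
  qed (use xc in auto)
  fix y assume "y \<in> {x. cauchy_seq V x}"
  then have y: "cauchy_seq V y" by simp
  then have yc: "y n \<in> carrier V" for n by (simp add: cauchy_seq_def)
  show "(\<lambda>n. x n \<oplus> y n) \<in> {x. cauchy_seq V x}"
    unfolding mem_Collect_eq cauchy_seq_def
  proof (intro conjI allI impI)
    fix e :: real assume "e > 0"
    then have e2: "e / 2 > 0" by simp
    obtain N where N: "\<And>m n. m \<ge> N \<Longrightarrow> n \<ge> N \<Longrightarrow> nrm V (x m \<ominus> x n) < e / 2"
      using x e2 unfolding cauchy_seq_def by metis
    obtain M where M: "\<And>m n. m \<ge> M \<Longrightarrow> n \<ge> M \<Longrightarrow> nrm V (y m \<ominus> y n) < e / 2"
      using y e2 unfolding cauchy_seq_def by metis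
    have "nrm V (x m \<oplus> y m \<ominus> (x n \<oplus> y n)) < e" if "m \<ge> max M N" "n \<ge> max M N" for m n
      using nrm_add_diff[OF xc yc xc yc, of m m n n] N[of m n] M[of m n] that by simp
    then show "\<exists>N. \<forall>m\<ge>N. \<forall>n\<ge>N. nrm V (x m \<oplus> y m \<ominus> (x n \<oplus> y n)) < e" by blast
  qed (use xc yc in auto)
qed (auto simp: cauchy_seq_def intro: complex_seminormed_space_axioms exI[of _ 0])

text \<open>
  The diagonal argument: \<open>X k\<close> is replaced by a term \<open>y k\<close> of it beyond which its oscillation is below
  \<open>2\<^sup>-\<^sup>k\<close>. The sequence \<open>y\<close> is again Cauchy, and it is the limit of the sequences \<open>X k\<close>.
\<close>

lemma complete_cauchy_space: "seq_complete (seq_space (\<lambda>_. V) {x. cauchy_seq V x})"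
proof (rule Cauchy.W.seq_complete_if_fast)
  let ?W = "seq_space (\<lambda>_. V) {x. cauchy_seq V x}"
  fix X assume "\<And>k. X k \<in> carrier ?W" and fast: "\<And>k. nrm ?W (X (Suc k) \<ominus>\<^bsub>?W\<^esub> X k) \<le> (1/2)^k"
  then have X: "cauchy_seq V (X k)" for k by simp
  have Xc: "X k n \<in> carrier V" for k n using X[of k] by (simp add: cauchy_seq_def)
  have geo: "nrm ?W (X m \<ominus>\<^bsub>?W\<^esub> X k) \<le> 2 * (1/2)^k" if "k \<le> m" for k m
    using Cauchy.W.geometric_cauchy[of X 1 k m] X fast that by simp
  have "\<exists>N. \<forall>m\<ge>N. \<forall>n\<ge>N. nrm V (X k m \<ominus> X k n) < (1/2)^k" for k :: nat
    using X[of k] unfolding cauchy_seq_def by simp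
  then obtain N where N: "\<And>k m n. m \<ge> N k \<Longrightarrow> n \<ge> N k \<Longrightarrow> nrm V (X k m \<ominus> X k n) < (1/2)^k" by metis
  define y where "y k = X k (N k)" for k
  have yc: "y k \<in> carrier V" for k by (simp add: y_def Xc)
  have y_close: "nrm V (y k \<ominus> X k n) \<le> (1/2)^k" if "n \<ge> N k" for k n
    unfolding y_def using N[of k "N k" n] that by simp
  have dist: "nrm V (y m \<ominus> y k) \<le> 5 * (1/2)^k" if "k \<le> m" for k m
  proof -
    have lim: "(\<lambda>n. nrm V (X m n \<ominus> X k n)) \<longlonglongrightarrow> nrm ?W (X m \<ominus>\<^bsub>?W\<^esub> X k)"
      using Cauchy.nrm_lim[of "\<lambda>n. X m n \<ominus> X k n"] Cauchy.diff[of "X m" "X k"] X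
        Cauchy.W.minus_closed[of "X m" "X k"] by simp
    have "nrm ?W (X m \<ominus>\<^bsub>?W\<^esub> X k) < 3 * (1/2)^k"
      using geo[OF that] by (rule le_less_trans) simp
    from order_tendstoD(2)[OF lim this] obtain M where M: "\<And>n. n \<ge> M \<Longrightarrow> nrm V (X m n \<ominus> X k n) < 3 * (1/2)^k"
      by (auto simp: eventually_sequentially)
    define n where "n = max M (max (N k) (N m))"
    have "nrm V (y m \<ominus> y k) \<le> nrm V (y m \<ominus> X m n) + nrm V (X m n \<ominus> y k)"
      using yc Xc by (intro nrm_diff_triangle)
    moreover have "nrm V (X m n \<ominus> y k) \<le> nrm V (X m n \<ominus> X k n) + nrm V (X k n \<ominus> y k)"
      using yc Xc by (intro nrm_diff_triangle)
    moreover have "nrm V (y m \<ominus> X m n) \<le> (1/2)^k"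
    proof -
      have "nrm V (y m \<ominus> X m n) \<le> (1/2)^m" by (rule y_close) (simp add: n_def)
      also have "\<dots> \<le> (1/2)^k" using that by (intro power_decreasing) auto
      finally show ?thesis .
    qed
    moreover have "nrm V (X k n \<ominus> y k) \<le> (1/2)^k"
      using y_close[of k n] nrm_diff_comm[OF Xc yc, of k n k] by (simp add: n_def)
    moreover have "nrm V (X m n \<ominus> X k n) < 3 * (1/2)^k" by (rule M) (simp add: n_def)
    ultimately show ?thesis by linarith
  qed
  have y: "cauchy_seq V y"
  proof (rule cauchy_if_geometric[where C=5])
    show "nrm V (y (Suc k) \<ominus> y k) \<le> 5 * (1/2)^k" for k by (rule dist) simp
  qed (use yc in auto)
  have le: "nrm ?W (X k \<ominus>\<^bsub>?W\<^esub> y) \<le> 6 * (1/2)^k" for k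
  proof -
    have lim: "(\<lambda>n. nrm V (X k n \<ominus> y n)) \<longlonglongrightarrow> nrm ?W (X k \<ominus>\<^bsub>?W\<^esub> y)"
      using Cauchy.nrm_lim[of "\<lambda>n. X k n \<ominus> y n"] Cauchy.diff[of "X k" y] X y
        Cauchy.W.minus_closed[of "X k" y] by simp
    have "nrm V (X k n \<ominus> y n) \<le> 6 * (1/2)^k" if n: "n \<ge> max k (N k)" for n
    proof -
      have "nrm V (X k n \<ominus> y n) \<le> nrm V (X k n \<ominus> y k) + nrm V (y k \<ominus> y n)"
        using yc Xc by (intro nrm_diff_triangle)
      moreover have "nrm V (X k n \<ominus> y k) \<le> (1/2)^k"
        using y_close[of k n] nrm_diff_comm[OF Xc yc, of k n k] n by simp
      moreover have "nrm V (y k \<ominus> y n) \<le> 5 * (1/2)^k"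
        using dist[of k n] nrm_diff_comm[OF yc yc, of k n] n by simp
      ultimately show ?thesis by linarith
    qed
    then show ?thesis by (intro LIMSEQ_le_const2[OF lim]) blast
  qed
  have "(\<lambda>k. nrm ?W (X k \<ominus>\<^bsub>?W\<^esub> y)) \<longlonglongrightarrow> 0"
  proof (rule Lim_null_comparison)
    have "nrm ?W (X k \<ominus>\<^bsub>?W\<^esub> y) \<ge> 0" for k
      using X y by (intro Cauchy.W.nrm_nonneg Cauchy.W.minus_closed) auto
    then show "\<forall>\<^sub>F k in sequentially. norm (nrm ?W (X k \<ominus>\<^bsub>?W\<^esub> y)) \<le> 6 * (1/2)^k" using le by simp
    show "(\<lambda>k. 6 * (1/2)^k :: real) \<longlonglongrightarrow> 0"
      by (intro tendsto_mult_right_zero LIMSEQ_realpow_zero) auto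
  qed
  then show "\<exists>l. converges ?W X l" using y by (intro exI[of _ y]) (simp add: converges_def)
qed

lemma banach_completion: "banach (completion V)"
  unfolding banach_def completion_eq
  using Cauchy.W.normed_separated Cauchy.W.complete_separated[OF complete_cauchy_space] by blast

definition to_completion :: "'a \<Rightarrow> (nat \<Rightarrow> 'a) set" where
  "to_completion x = (let W = seq_space (\<lambda>_. V) {x. cauchy_seq V x} in seminorm_kernel W +>\<^bsub>W\<^esub> (\<lambda>_. x))"

lemma const_cauchy: "x \<in> carrier V \<Longrightarrow> cauchy_seq V (\<lambda>_. x)"
  by (simp add: cauchy_seq_def)

lemma to_completion_linear: "linear_map V (completion V) to_completion"
  and nrm_to_completion: "x \<in> carrier V \<Longrightarrow> nrm (completion V) (to_completion x) = nrm V x"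
proof -
  let ?W = "seq_space (\<lambda>_. V) {x. cauchy_seq V x}"
  have "linear_map V ?W (\<lambda>x _. x)" by (auto simp: linear_map_def const_cauchy)
  from linear_map_comp[OF this Cauchy.W.linear_map_separated]
  show "linear_map V (completion V) to_completion"
    by (simp add: completion_eq to_completion_def[abs_def] Let_def)
  show "x \<in> carrier V \<Longrightarrow> nrm (completion V) (to_completion x) = nrm V x"
    using Cauchy.W.nrm_separated[of "\<lambda>_. x"] by (simp add: completion_eq to_completion_def Let_def const_cauchy)
qed

lemma involutions_completion:
  assumes t: "involutions V \<tau>"
  shows "involutions (completion V) (\<lambda>i D. (\<lambda>x n. \<tau> i (x n)) ` D)"
    and "x \<in> carrier V \<Longrightarrow> (\<lambda>x n. \<tau> i (x n)) ` to_completion x = to_completion (\<tau> i x)"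
proof -
  note tD = involutionsD[OF t] linear_map_zero_diff(2)[OF seminormed seminormed involutionsD(1)[OF t]]
  have C: "(\<lambda>n. \<tau> i (x n)) \<in> {x. cauchy_seq V x}" if "x \<in> {x. cauchy_seq V x}" for i x
    using that by (auto simp: cauchy_seq_def tD(2) tD(6)[symmetric] tD(3))
  note I = Cauchy.involutions_seq[of "\<lambda>_. \<tau>", OF t C]
  show "involutions (completion V) (\<lambda>i D. (\<lambda>x n. \<tau> i (x n)) ` D)"
    using Cauchy.W.involutions_separated(1)[OF I] by (simp add: completion_eq)
  show "x \<in> carrier V \<Longrightarrow> (\<lambda>x n. \<tau> i (x n)) ` to_completion x = to_completion (\<tau> i x)"
    using Cauchy.W.involutions_separated(2)[OF I, of "\<lambda>_. x" i]
    by (simp add: to_completion_def Let_def const_cauchy)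
qed

end

subsection \<open>Threads\<close>

locale inductive_system =
  fixes E :: "nat \<Rightarrow> 'a cnormed" and j :: "nat \<Rightarrow> 'a \<Rightarrow> 'a"
  assumes E: "complex_seminormed_space (E n)"
    and j_linear: "linear_map (E n) (E (Suc n)) (j n)"
    and nrm_j: "x \<in> carrier (E n) \<Longrightarrow> nrm (E (Suc n)) (j n x) = nrm (E n) x"
begin

definition threads :: "(nat \<Rightarrow> 'a) set" where
  "threads = {x. (\<forall>n. x n \<in> carrier (E n)) \<and> (\<exists>N. \<forall>n\<ge>N. j n (x n) = x (Suc n))}"

lemma thread_space_eq: "thread_space E j = seq_space E threads"
  by (simp add: thread_space_def seq_space_def threads_def)

lemma thread_nrm_const:
  assumes x: "\<And>n. x n \<in> carrier (E n)" and "\<And>n. n \<ge> N \<Longrightarrow> j n (x n) = x (Suc n)" and "n \<ge> N"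
  shows "nrm (E n) (x n) = nrm (E N) (x N)"
  using assms(3)
proof (induction n rule: dec_induct)
  case (step n)
  then show ?case using nrm_j[OF x[of n]] assms(2)[of n] by simp
qed simp

lemma thread_nrm_tendsto:
  assumes x: "\<And>n. x n \<in> carrier (E n)" and "\<And>n. n \<ge> N \<Longrightarrow> j n (x n) = x (Suc n)"
  shows "(\<lambda>n. nrm (E n) (x n)) \<longlonglongrightarrow> nrm (E N) (x N)"
proof (rule tendsto_eventually)
  have "\<forall>n\<ge>N. nrm (E n) (x n) = nrm (E N) (x N)"
    using thread_nrm_const[of x N, OF assms(1,2)] by blast
  then show "\<forall>\<^sub>F n in sequentially. nrm (E n) (x n) = nrm (E N) (x N)"
    unfolding eventually_sequentially by (rule exI)
qed

sublocale T: sequence_space E threads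
proof (rule sequence_space.intro)
  interpret E: complex_seminormed_space "E n" for n by (rule E)
  note jD = linear_mapD[OF j_linear]
  show "complex_seminormed_space (E n)" for n by (rule E)
  show "(\<lambda>n. \<zero>\<^bsub>E n\<^esub>) \<in> threads"
    using linear_map_zero_diff(1)[OF E E j_linear] by (simp add: threads_def)
  fix x assume "x \<in> threads"
  then obtain N where x: "\<And>n. x n \<in> carrier (E n)" "\<And>n. n \<ge> N \<Longrightarrow> j n (x n) = x (Suc n)"
    by (auto simp: threads_def)
  show "x n \<in> carrier (E n)" for n by (rule x)
  show "convergent (\<lambda>n. nrm (E n) (x n))"
    using thread_nrm_tendsto[of x N] x by (auto simp: convergent_def)
  show "(\<lambda>n. c \<odot>\<^bsub>E n\<^esub> x n) \<in> threads" for c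
    using x by (auto simp: threads_def jD intro!: exI[of _ N])
  fix y assume "y \<in> threads"
  then obtain M where y: "\<And>n. y n \<in> carrier (E n)" "\<And>n. n \<ge> M \<Longrightarrow> j n (y n) = y (Suc n)"
    by (auto simp: threads_def)
  show "(\<lambda>n. x n \<oplus>\<^bsub>E n\<^esub> y n) \<in> threads"
    using x y by (auto simp: threads_def jD intro!: exI[of _ "max M N"])
qed

abbreviation Limit where "Limit \<equiv> separated (thread_space E j)"

lemma normed_Limit: "complex_normed_space Limit"
  unfolding thread_space_eq by (rule T.W.normed_separated)

text \<open>
  The first space is left out because the involutions that matter appear only in the second one. The
  entry \<open>\<zero>\<close> in front is harmless, as threads are compatible only from some point on.
\<close>

primrec climb :: "'a \<Rightarrow> nat \<Rightarrow> 'a" where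
  "climb x 0 = x"
| "climb x (Suc m) = j (Suc m) (climb x m)"

definition thread_from :: "'a \<Rightarrow> nat \<Rightarrow> 'a" where
  "thread_from x n = (case n of 0 \<Rightarrow> \<zero>\<^bsub>E 0\<^esub> | Suc m \<Rightarrow> climb x m)"

lemma climb_linear: "linear_map (E 1) (E (Suc m)) (\<lambda>x. climb x m)"
proof (induction m)
  case 0
  show ?case by (simp add: linear_map_def)
next
  case (Suc m)
  from linear_map_comp[OF this j_linear] show ?case by simp
qed

lemma thread_from_mem: "x \<in> carrier (E 1) \<Longrightarrow> thread_from x \<in> threads"
proof -
  interpret E0: complex_seminormed_space "E 0" by (rule E)
  assume x: "x \<in> carrier (E 1)"
  have "thread_from x n \<in> carrier (E n)" for n
    using linear_mapD(1)[OF climb_linear x] by (cases n) (auto simp: thread_from_def)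
  moreover have "j n (thread_from x n) = thread_from x (Suc n)" if "n \<ge> 1" for n
    using that by (cases n) (auto simp: thread_from_def)
  ultimately show ?thesis by (auto simp: threads_def)
qed

lemma thread_from_linear: "linear_map (E 1) (seq_space E threads) thread_from"
proof -
  interpret E0: complex_seminormed_space "E 0" by (rule E)
  have "thread_from (x \<oplus>\<^bsub>E 1\<^esub> y) n = thread_from x n \<oplus>\<^bsub>E n\<^esub> thread_from y n"
    if "x \<in> carrier (E 1)" "y \<in> carrier (E 1)" for x y n
    using linear_mapD(2)[OF climb_linear that] by (cases n) (auto simp: thread_from_def)
  moreover have "thread_from (c \<odot>\<^bsub>E 1\<^esub> x) n = c \<odot>\<^bsub>E n\<^esub> thread_from x n"
    if "x \<in> carrier (E 1)" for x c n
    using linear_mapD(3)[OF climb_linear that] by (cases n) (auto simp: thread_from_def)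
  ultimately show ?thesis using thread_from_mem by (auto simp: linear_map_def)
qed

lemma nrm_thread_from: "x \<in> carrier (E 1) \<Longrightarrow> nrm (seq_space E threads) (thread_from x) = nrm (E 1) x"
proof -
  assume x: "x \<in> carrier (E 1)"
  have "(\<lambda>n. nrm (E n) (thread_from x n)) \<longlonglongrightarrow> nrm (E 1) (thread_from x 1)"
  proof (rule thread_nrm_tendsto)
    show "thread_from x n \<in> carrier (E n)" for n using T.C_closed[OF thread_from_mem[OF x]] .
    show "j n (thread_from x n) = thread_from x (Suc n)" if "n \<ge> 1" for n
      using that by (cases n) (auto simp: thread_from_def)
  qed
  then have "nrm (seq_space E threads) (thread_from x) = nrm (E 1) (thread_from x 1)"
    by (rule T.nrm_eqI)
  then show ?thesis by (simp add: thread_from_def)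
qed

definition to_limit :: "'a \<Rightarrow> (nat \<Rightarrow> (nat \<Rightarrow> 'a) set) set" where
  "to_limit x = complex_normed_space.to_completion Limit
     (seminorm_kernel (seq_space E threads) +>\<^bsub>seq_space E threads\<^esub> thread_from x)"

lemma to_limit_linear: "linear_map (E 1) (banach_inductive_limit E j) to_limit"
  and nrm_to_limit: "x \<in> carrier (E 1) \<Longrightarrow> nrm (banach_inductive_limit E j) (to_limit x) = nrm (E 1) x"
proof -
  interpret L: complex_normed_space Limit by (rule normed_Limit)
  have 1: "linear_map (E 1) Limit (\<lambda>x. seminorm_kernel (seq_space E threads) +>\<^bsub>seq_space E threads\<^esub> thread_from x)"
    unfolding thread_space_eq by (rule linear_map_comp[OF thread_from_linear T.W.linear_map_separated])
  from linear_map_comp[OF this L.to_completion_linear]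
  show "linear_map (E 1) (banach_inductive_limit E j) to_limit"
    by (simp add: banach_inductive_limit_def to_limit_def[abs_def])
  assume x: "x \<in> carrier (E 1)"
  have "thread_from x \<in> carrier (seq_space E threads)" using thread_from_mem[OF x] by simp
  from T.W.nrm_separated[OF this] nrm_thread_from[OF x] L.nrm_to_completion[OF linear_mapD(1)[OF 1 x]]
  show "nrm (banach_inductive_limit E j) (to_limit x) = nrm (E 1) x"
    by (simp add: banach_inductive_limit_def to_limit_def thread_space_eq)
qed

lemma banach_limit: "banach (banach_inductive_limit E j)"
proof -
  interpret L: complex_normed_space Limit by (rule normed_Limit)
  show ?thesis unfolding banach_inductive_limit_def by (rule L.banach_completion)
qed

text \<open>
  The involutions act on threads entry by entry. Compatibility with the maps \<open>j n\<close> keeps threads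
  threads, and the quotient and the completion inherit the action.
\<close>

lemma involutions_limit:
  assumes t: "\<And>n. involutions (E n) (\<tau> n)"
    and tj: "\<And>n i x. x \<in> carrier (E n) \<Longrightarrow> \<tau> (Suc n) i (j n x) = j n (\<tau> n i x)"
  shows "\<exists>\<sigma>. involutions (banach_inductive_limit E j) \<sigma> \<and>
      (\<forall>i. \<forall>x\<in>carrier (E 1). \<sigma> i (to_limit x) = to_limit (\<tau> 1 i x))"
proof -
  interpret L: complex_normed_space Limit by (rule normed_Limit)
  have C: "(\<lambda>n. \<tau> n i (x n)) \<in> threads" if x: "x \<in> threads" for i x
  proof -
    obtain N where x: "\<And>n. x n \<in> carrier (E n)" "\<And>n. n \<ge> N \<Longrightarrow> j n (x n) = x (Suc n)"
      using x by (auto simp: threads_def)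
    have "j n (\<tau> n i (x n)) = \<tau> (Suc n) i (x (Suc n))" if "n \<ge> N" for n
      using tj[OF x(1), of n i] x(2)[OF that] by simp
    then show ?thesis using involutionsD(2)[OF t x(1)] by (auto simp: threads_def)
  qed
  note I = T.involutions_seq[of \<tau>, OF t C]
  let ?s = "\<lambda>i C. (\<lambda>x n. \<tau> n i (x n)) ` C"
  note J = T.W.involutions_separated[OF I, folded thread_space_eq]
  note K = L.involutions_completion[OF J(1)]
  have thread: "(\<lambda>n. \<tau> n i (thread_from x n)) = thread_from (\<tau> 1 i x)" if x: "x \<in> carrier (E 1)" for i x
  proof
    fix n
    have climb: "\<tau> (Suc m) i (climb x m) = climb (\<tau> 1 i x) m" for m
    proof (induction m)
      case (Suc m)
      then show ?case using tj[OF linear_mapD(1)[OF climb_linear x], of m i] by simp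
    qed simp
    have "\<tau> 0 i \<zero>\<^bsub>E 0\<^esub> = \<zero>\<^bsub>E 0\<^esub>"
      by (rule linear_map_zero_diff(1)[OF E E involutionsD(1)[OF t]])
    then show "\<tau> n i (thread_from x n) = thread_from (\<tau> 1 i x) n"
      using climb by (cases n) (auto simp: thread_from_def)
  qed
  let ?k = "\<lambda>x. seminorm_kernel (seq_space E threads) +>\<^bsub>seq_space E threads\<^esub> thread_from x"
  have "?s i (?k x) = ?k (\<tau> 1 i x)" if "x \<in> carrier (E 1)" for i x
    using J(2)[of "thread_from x" i] thread[OF that, of i] thread_from_mem[OF that] by (simp add: thread_space_eq)
  moreover have "?k x \<in> carrier Limit" if "x \<in> carrier (E 1)" for x
    unfolding thread_space_eq using linear_mapD(1)[OF linear_map_comp[OF thread_from_linear T.W.linear_map_separated] that] .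
  ultimately have "(\<lambda>y n. ?s i (y n)) ` to_limit x = to_limit (\<tau> 1 i x)" if "x \<in> carrier (E 1)" for i x
    unfolding to_limit_def using K(2)[of "?k x" i] that by simp
  then show ?thesis using K(1) unfolding banach_inductive_limit_def by blast
qed

end

section \<open>The spaces of the tower\<close>

text \<open>
  The normalised operator \<open>\<alpha> / \<parallel>\<alpha>\<parallel>\<close> through which the summand with index \<open>\<alpha>\<close> is glued.
\<close>

definition glue_map :: "'a cnormed \<Rightarrow> 'a op_index \<Rightarrow> basic \<Rightarrow> 'a" where
  "glue_map W = (\<lambda>(i, \<alpha>) x. of_real (1 / opnorm (basic_S i) W \<alpha>) \<odot>\<^bsub>W\<^esub> \<alpha> x)"

lemma basic_S_seminormed: "complex_seminormed_space (basic_S i)"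
proof -
  interpret complex_seminormed_space "basic_B i" by (rule banachD(3)[OF basic_spaces(1)])
  interpret quotient_space "basic_B i" "carrier (basic_S i)" by unfold_locales (rule basic_spaces(2))
  show ?thesis using subspace_seminormed by (simp only: basic_spaces(4)[symmetric])
qed

lemma index_AD:
  assumes "(i, \<alpha>) \<in> index_A W"
  shows "i \<in> {1, 2, 3}" "\<alpha> \<in> bounded_ops (basic_S i) W" "\<exists>x\<in>carrier (basic_S i). \<alpha> x \<noteq> \<zero>\<^bsub>W\<^esub>"
    "\<exists>Y. finite Y \<and> Y \<subseteq> carrier W \<and> \<alpha> ` carrier (basic_S i) \<subseteq> lin_span W Y"
  using assms by (auto simp: index_A_def nonzero_finite_rank_ops_def finite_rank_ops_def)

lemma index_AI:
  assumes "i \<in> {1, 2, 3}" "\<alpha> \<in> bounded_ops (basic_S i) W" "\<exists>x\<in>carrier (basic_S i). \<alpha> x \<noteq> \<zero>\<^bsub>W\<^esub>"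
    "finite Y" "Y \<subseteq> carrier W" "\<alpha> ` carrier (basic_S i) \<subseteq> lin_span W Y"
  shows "(i, \<alpha>) \<in> index_A W"
  using assms by (auto simp: index_A_def nonzero_finite_rank_ops_def finite_rank_ops_def)

locale tilde_space =
  fixes W :: "'a cnormed"
  assumes W: "banach W"
begin

sublocale W: complex_normed_space W by (rule banachD(1)[OF W])

lemma opnorm_pos:
  assumes "(i, \<alpha>) \<in> index_A W"
  shows "opnorm (basic_S i) W \<alpha> > 0"
proof -
  note bounds = opnorm_bounds[OF basic_S_seminormed W.seminormed index_AD(2)[OF assms]]
  obtain x where x: "x \<in> carrier (basic_S i)" "\<alpha> x \<noteq> \<zero>\<^bsub>W\<^esub>" using index_AD(3)[OF assms] by blast
  have "\<alpha> x \<in> carrier W" using linear_mapD(1)[OF bounded_opsD(1)[OF index_AD(2)[OF assms]] x(1)] .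
  then have "nrm W (\<alpha> x) \<noteq> 0" "nrm W (\<alpha> x) \<ge> 0" using x(2) W.nrm_eq_0 by auto
  with bounds(2)[OF x(1)] have "opnorm (basic_S i) W \<alpha> \<noteq> 0" by auto
  with bounds(1) show ?thesis by linarith
qed

sublocale gluing "index_A W" "\<lambda>a. basic_B (fst a)" "\<lambda>a. carrier (basic_S (fst a))" "glue_map W" W
proof (rule gluing.intro)
  fix a assume a: "a \<in> index_A W"
  obtain i \<alpha> where a_eq: "a = (i, \<alpha>)" by (cases a)
  have ia: "(i, \<alpha>) \<in> index_A W" using a a_eq by simp
  note \<alpha> = bounded_opsD(1)[OF index_AD(2)[OF ia]]
  show "banach (basic_B (fst a))" "lin_subspace (basic_B (fst a)) (carrier (basic_S (fst a)))"
    "nrm_closed (basic_B (fst a)) (carrier (basic_S (fst a)))"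
    by (rule basic_spaces)+
  have "linear_map (basic_S i) W (\<lambda>x. of_real (1 / opnorm (basic_S i) W \<alpha>) \<odot>\<^bsub>W\<^esub> \<alpha> x)"
    using linear_mapD[OF \<alpha>] by (auto simp: linear_map_def W.sm_add_r W.sm_assoc mult.commute)
  then show "linear_map (subspace_of (basic_B (fst a)) (carrier (basic_S (fst a)))) W (glue_map W a)"
    by (simp add: a_eq glue_map_def basic_spaces(4)[symmetric])
  fix y assume "y \<in> carrier (basic_S (fst a))"
  then have y: "y \<in> carrier (basic_S i)" by (simp add: a_eq)
  have nrm_S: "nrm (basic_S i) y = nrm (basic_B i) y" by (subst basic_spaces(4)) simp
  have "nrm W (glue_map W a y) = nrm W (\<alpha> y) / opnorm (basic_S i) W \<alpha>"
    using linear_mapD(1)[OF \<alpha> y] opnorm_pos[OF ia] by (simp add: a_eq glue_map_def W.nrm_smult norm_divide)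
  also have "\<dots> \<le> nrm (basic_S i) y"
    using opnorm_bounds(2)[OF basic_S_seminormed W.seminormed index_AD(2)[OF ia] y] opnorm_pos[OF ia]
    by (simp add: field_simps)
  finally show "nrm W (glue_map W a y) \<le> nrm (basic_B (fst a)) y" by (simp add: a_eq nrm_S)
qed (rule W)

lemma big_B_eq: "big_B W = B"
  by (simp add: big_B_def case_prod_unfold)

lemma big_S_eq: "big_S W = S"
  unfolding big_S_def case_prod_unfold by (subst basic_spaces(4)) simp

lemma op_u_eq: "op_u W = U"
  unfolding op_u_def[abs_def] U_def[abs_def] by (simp add: glue_map_def case_prod_unfold)

lemma graph_u_eq: "graph_u W = G"
  by (simp add: graph_u_def G_def op_u_eq big_S_eq)

lemma tilde_eq: "tilde W = quotient P G"
  by (simp add: tilde_def big_B_eq graph_u_eq)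

lemma tilde_j_eq: "tilde_j W = j"
  by (rule ext) (simp add: tilde_j_def j_def big_B_eq graph_u_eq del: l1_sum_simps)

lemma banach_tilde: "banach (tilde W)"
  unfolding tilde_eq by (rule banach_Q)

end

text \<open>
  Summable families have countable support, so the stored graph determines the representative and
  hence its coset.
\<close>

lemma inj_on_code:
  assumes "banach W"
  shows "inj_on (code W) (carrier (tilde W))"
proof -
  interpret tilde_space W by unfold_locales fact
  have countable: "countable (support_graph W x)" if x: "x \<in> carrier B" for x
  proof -
    have "x a \<noteq> \<zero>\<^bsub>basic_B (fst a)\<^esub> \<longleftrightarrow> nrm (basic_B (fst a)) (x a) \<noteq> 0" if a: "a \<in> index_A W" for a
    proof -
      interpret complex_normed_space "basic_B (fst a)" by (rule banachD(1)[OF basic_spaces(1)])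
      show ?thesis using B.memD(1)[OF x a] nrm_eq_0 by blast
    qed
    then have "support_graph W x \<subseteq> (\<lambda>a. (a, x a)) ` {a \<in> index_A W. nrm (basic_B (fst a)) (x a) \<noteq> 0}"
      by (auto simp: support_graph_def)
    then show ?thesis
      using summable_countable_real[OF B.memD(2)[OF x]] by (meson countable_image countable_subset)
  qed
  have graph_inj: "x = y" if x: "x \<in> carrier B" and y: "y \<in> carrier B" and eq: "support_graph W x = support_graph W y" for x y
  proof (rule extensionalityI[of _ "index_A W"])
    fix a assume a: "a \<in> index_A W"
    have sx: "(a, z) \<in> support_graph W x \<longleftrightarrow> z = x a \<and> x a \<noteq> \<zero>\<^bsub>basic_B (fst a)\<^esub>" for z
      using a by (cases a) (auto simp: support_graph_def)
    have sy: "(a, z) \<in> support_graph W y \<longleftrightarrow> z = y a \<and> y a \<noteq> \<zero>\<^bsub>basic_B (fst a)\<^esub>" for z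
      using a by (cases a) (auto simp: support_graph_def)
    show "x a = y a" using sx sy eq by metis
  qed (use B.memD(4) x y in auto)
  show ?thesis
  proof (rule inj_onI)
    fix C D assume CD: "C \<in> carrier (tilde W)" "D \<in> carrier (tilde W)" "code W C = code W D"
    obtain p q where pq: "p \<in> carrier P" "C = G +>\<^bsub>P\<^esub> p" "q \<in> carrier P" "D = G +>\<^bsub>P\<^esub> q"
      using CD by (auto simp: tilde_eq Q.carrier_quotient)
    define p' where "p' = (SOME r. r \<in> C)"
    define q' where "q' = (SOME r. r \<in> D)"
    have pC: "p \<in> C" and qD: "q \<in> D"
      unfolding pq(2,4) using Q.self_mem_coset[OF pq(1)] Q.self_mem_coset[OF pq(3)] by auto
    have "p' \<in> C" unfolding p'_def using pC by (rule someI[of "\<lambda>r. r \<in> C"])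
    moreover have "q' \<in> D" unfolding q'_def using qD by (rule someI[of "\<lambda>r. r \<in> D"])
    ultimately have p'q': "p' \<in> G +>\<^bsub>P\<^esub> p" "q' \<in> G +>\<^bsub>P\<^esub> q" using pq by auto
    obtain x e y f where xy: "p' = (x, e)" "q' = (y, f)" by (cases p', cases q')
    have c: "x \<in> carrier B" "y \<in> carrier B"
      using p'q' pq Q.mem_coset_iff by (auto simp: xy)
    have "Node (acset (support_graph W x)) e = Node (acset (support_graph W y)) f"
      using CD(3) by (simp add: code_def p'_def[symmetric] q'_def[symmetric] xy)
    then have "e = f" "support_graph W x = support_graph W y" using countable c by auto
    then have "p' = q'" using graph_inj c xy by simp
    then show "C = D" using Q.mem_coset_eq[OF pq(1) p'q'(1)] Q.mem_coset_eq[OF pq(3) p'q'(2)] pq by simp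
  qed
qed

locale coded_tilde = tilde_space W for W :: "'e stage cnormed"
begin

lemma seminormed_tilde: "complex_seminormed_space (tilde W)"
  using banach_tilde by (rule banachD)

sublocale C: transported "tilde W" "code W"
proof (rule transported.intro)
  show "complex_seminormed_space (tilde W)" by (rule seminormed_tilde)
  show "transported_axioms (tilde W) (code W)"
    by (rule transported_axioms.intro) (rule inj_on_code[OF W])
qed

abbreviation W' where "W' \<equiv> transport (code W) (tilde W)"

lemma banach_W': "banach W'"
  by (rule banach_transport[OF banach_tilde inj_on_code[OF W]])

definition next_j :: "'e stage \<Rightarrow> 'e stage" where "next_j e = code W (tilde_j W e)"

lemma next_j_linear: "linear_map W W' next_j"
  unfolding next_j_def
  by (rule linear_map_comp[OF _ C.linear_map_transport]) (simp add: tilde_j_eq tilde_eq j_linear)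

lemma nrm_next_j: "e \<in> carrier W \<Longrightarrow> nrm W' (next_j e) = nrm W e"
  using C.transport_simps(3)[of "tilde_j W e"] linear_mapD(1)[OF j_linear, of e] nrm_j[of e]
  by (simp add: next_j_def tilde_j_eq tilde_eq)

text \<open>
  The action on the glued space, transported along \<open>code\<close>. The values on cosets are recorded for the
  computation of averages.
\<close>

lemma involutions_next:
  assumes "gluing_involutions (index_A W) (\<lambda>a. basic_B (fst a)) (\<lambda>a. carrier (basic_S (fst a))) (glue_map W) W \<phi> \<tau>"
  shows "\<exists>\<sigma>. involutions W' \<sigma> \<and> (\<forall>i. \<forall>e\<in>carrier W. \<sigma> i (next_j e) = next_j (\<tau> i e)) \<and>
    (\<forall>i. \<forall>p\<in>carrier P. \<sigma> i (code W (G +>\<^bsub>P\<^esub> p)) = code W (G +>\<^bsub>P\<^esub> gluing_involutions.\<theta> (index_A W) \<phi> \<tau> i p))"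
proof -
  interpret gi: gluing_involutions "index_A W" "\<lambda>a. basic_B (fst a)" "\<lambda>a. carrier (basic_S (fst a))" "glue_map W" W \<phi> \<tau>
    by fact
  have I: "involutions (tilde W) (\<lambda>i C. gi.\<theta> i ` C)" unfolding tilde_eq by (rule gi.involutions_Q)
  note J = C.involutions_transport[OF I]
  have Qc: "G +>\<^bsub>P\<^esub> p \<in> carrier (tilde W)" if "p \<in> carrier P" for p
    using that by (auto simp: tilde_eq Q.carrier_quotient)
  have jc: "j e \<in> carrier (tilde W)" if "e \<in> carrier W" for e
    using linear_mapD(1)[OF j_linear that] by (simp add: tilde_eq)
  show ?thesis
    using J(1) J(2)[OF jc] J(2)[OF Qc] gi.\<theta>_j gi.\<theta>_coset
    by (intro exI[of _ "\<lambda>i. transport_map (carrier (tilde W)) (code W) ((`) (gi.\<theta> i))"])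
       (simp add: next_j_def tilde_j_eq)
qed

text \<open>
  The construction is functorial: an isometric involution of \<open>W\<close> permutes the operators into \<open>W\<close>
  by composition and preserves their norms.
\<close>

lemma involutions_functorial:
  assumes \<tau>: "involutions W \<tau>"
  shows "\<exists>\<sigma>. involutions W' \<sigma> \<and> (\<forall>i. \<forall>e\<in>carrier W. \<sigma> i (next_j e) = next_j (\<tau> i e))"
proof -
  note t = involutionsD[OF \<tau>] linear_mapD[OF involutionsD(1)[OF \<tau>]]
  define \<phi> :: "nat \<Rightarrow> 'e stage op_index \<Rightarrow> 'e stage op_index"
    where "\<phi> i a = (fst a, \<lambda>x\<in>carrier (basic_S (fst a)). \<tau> i (snd a x))" for i a
  have \<alpha>c: "\<alpha> x \<in> carrier W" if "(k, \<alpha>) \<in> index_A W" "x \<in> carrier (basic_S k)" for k \<alpha> x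
    using linear_mapD(1)[OF bounded_opsD(1)[OF index_AD(2)[OF that(1)]] that(2)] .
  have \<phi>_mem: "\<phi> i a \<in> index_A W" if a: "a \<in> index_A W" for i a
  proof -
    obtain k \<alpha> where a_eq: "a = (k, \<alpha>)" by (cases a)
    have ka: "(k, \<alpha>) \<in> index_A W" using a a_eq by simp
    note D = index_AD[OF ka]
    note L = linear_mapD[OF bounded_opsD(1)[OF D(2)]]
    interpret S: complex_seminormed_space "basic_S k" by (rule basic_S_seminormed)
    let ?\<beta> = "\<lambda>x\<in>carrier (basic_S k). \<tau> i (\<alpha> x)"
    obtain K where K: "\<And>x. x \<in> carrier (basic_S k) \<Longrightarrow> nrm W (\<alpha> x) \<le> K * nrm (basic_S k) x"
      using bounded_opsD(3)[OF D(2)] by blast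
    obtain Y where Y: "finite Y" "Y \<subseteq> carrier W" "\<alpha> ` carrier (basic_S k) \<subseteq> lin_span W Y"
      using D(4) by blast
    obtain x where x: "x \<in> carrier (basic_S k)" "\<alpha> x \<noteq> \<zero>\<^bsub>W\<^esub>" using D(3) by blast
    have "(k, ?\<beta>) \<in> index_A W"
    proof (rule index_AI[OF D(1)])
      show "?\<beta> \<in> bounded_ops (basic_S k) W"
        by (rule bounded_opsI[of _ _ _ K]) (auto simp: linear_map_def L t K)
      have "\<tau> i (\<alpha> x) \<noteq> \<zero>\<^bsub>W\<^esub>"
        using t(4)[OF \<alpha>c[OF ka x(1)], of i] x(2) linear_map_zero_diff(1)[OF W.seminormed W.seminormed t(1), of i] by metis
      then show "\<exists>x\<in>carrier (basic_S k). ?\<beta> x \<noteq> \<zero>\<^bsub>W\<^esub>" using x(1) by (intro bexI[of _ x]) auto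
      show "finite (\<tau> i ` Y)" "\<tau> i ` Y \<subseteq> carrier W" using Y t by auto
      show "?\<beta> ` carrier (basic_S k) \<subseteq> lin_span W (\<tau> i ` Y)"
      proof
        fix z assume "z \<in> ?\<beta> ` carrier (basic_S k)"
        then obtain u where u: "u \<in> carrier (basic_S k)" "z = \<tau> i (\<alpha> u)" by auto
        then obtain c F where F: "finite F" "F \<subseteq> Y" "\<alpha> u = finsum W (\<lambda>y. c y \<odot>\<^bsub>W\<^esub> y) F"
          using Y(3) by (auto simp: lin_span_def)
        have Fc: "y \<in> carrier W" if "y \<in> F" for y using that F Y by auto
        have inj: "inj_on (\<tau> i) F" using t(4) Fc by (metis inj_onI)
        have "z = finsum W (\<lambda>y. \<tau> i (c y \<odot>\<^bsub>W\<^esub> y)) F"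
          unfolding u(2) F(3) by (rule linear_map_finsum[OF W.seminormed W.seminormed t(1)]) (use Fc in auto)
        also have "\<dots> = finsum W (\<lambda>y. c (\<tau> i (\<tau> i y)) \<odot>\<^bsub>W\<^esub> \<tau> i y) F"
          using Fc by (intro W.finsum_cong') (auto simp: t)
        also have "\<dots> = finsum W (\<lambda>y. c (\<tau> i y) \<odot>\<^bsub>W\<^esub> y) (\<tau> i ` F)"
          by (rule W.finsum_reindex[symmetric, OF _ inj]) (use Fc t in auto)
        finally show "z \<in> lin_span W (\<tau> i ` Y)"
          unfolding lin_span_def using F
          by (intro CollectI exI[of _ "\<lambda>y. c (\<tau> i y)"] exI[of _ "\<tau> i ` F"]) auto
      qed
    qed
    then show ?thesis by (simp add: \<phi>_def a_eq)
  qed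
  have opnorm_\<phi>: "opnorm (basic_S (fst a)) W (snd (\<phi> i a)) = opnorm (basic_S (fst a)) W (snd a)"
    if a: "a \<in> index_A W" for i a
    unfolding opnorm_def
  proof (rule SUP_cong)
    fix x assume "x \<in> {x \<in> carrier (basic_S (fst a)). nrm (basic_S (fst a)) x \<le> 1}"
    then show "nrm W (snd (\<phi> i a) x) = nrm W (snd a x)"
      using \<alpha>c[of "fst a" "snd a" x] a t(3) by (simp add: \<phi>_def)
  qed simp
  have "gluing_involutions (index_A W) (\<lambda>a. basic_B (fst a)) (\<lambda>a. carrier (basic_S (fst a))) (glue_map W) W \<phi> \<tau>"
  proof (rule gluing_involutions.intro[OF gluing_axioms], rule gluing_involutions_axioms.intro)
    show "involutions W \<tau>" by (rule \<tau>)
    fix a i assume a: "a \<in> index_A W"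
    obtain k \<alpha> where a_eq: "a = (k, \<alpha>)" by (cases a)
    have ka: "(k, \<alpha>) \<in> index_A W" using a a_eq by simp
    have ext: "\<alpha> \<in> extensional (carrier (basic_S k))" by (rule bounded_opsD(2)[OF index_AD(2)[OF ka]])
    show "\<phi> i a \<in> index_A W" by (rule \<phi>_mem[OF a])
    show "\<phi> i (\<phi> i a) = a"
      using ext \<alpha>c[OF ka] t(4) by (auto simp: \<phi>_def a_eq intro!: extensionalityI[of _ "carrier (basic_S k)"])
    show "\<phi> i (\<phi> l a) = \<phi> l (\<phi> i a)" for l
      using t(5)[OF \<alpha>c[OF ka], of _ i l] by (auto simp: \<phi>_def a_eq)
    show "basic_B (fst (\<phi> i a)) = basic_B (fst a)" "carrier (basic_S (fst (\<phi> i a))) = carrier (basic_S (fst a))"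
      by (simp_all add: \<phi>_def)
    fix y assume y: "y \<in> carrier (basic_S (fst a))"
    then have yk: "y \<in> carrier (basic_S k)" by (simp add: a_eq)
    show "glue_map W (\<phi> i a) y = \<tau> i (glue_map W a y)"
      using opnorm_\<phi>[OF a, of i] \<alpha>c[OF ka yk] yk t
      by (simp add: glue_map_def case_prod_unfold a_eq \<phi>_def)
  qed
  from involutions_next[OF this] show ?thesis by blast
qed

end

section \<open>Copies of one operator\<close>

lemma opnorm_smult:
  assumes "complex_seminormed_space V" "complex_seminormed_space W" "T \<in> bounded_ops V W" "r > 0"
    and T': "\<And>x. x \<in> carrier V \<Longrightarrow> T' x = of_real r \<odot>\<^bsub>W\<^esub> T x"
  shows "opnorm V W T' = r * opnorm V W T"
proof -
  interpret V: complex_seminormed_space V by fact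
  interpret W: complex_seminormed_space W by fact
  note Tc = linear_mapD(1)[OF bounded_opsD(1)[OF assms(3)]]
  note b = opnorm_bounds[OF assms(1-3)]
  have nT': "nrm W (T' x) = r * nrm W (T x)" if "x \<in> carrier V" for x
    using T'[OF that] Tc[OF that] \<open>r > 0\<close> by (simp add: W.nrm_smult)
  have le: "nrm W (T' x) \<le> (r * opnorm V W T) * nrm V x" if "x \<in> carrier V" for x
    using b(2)[OF that] \<open>r > 0\<close> by (simp add: nT'[OF that])
  have pos: "0 \<le> r * opnorm V W T" using b(1) \<open>r > 0\<close> by simp
  have bdd: "bdd_above ((\<lambda>x. nrm W (T' x)) ` {x \<in> carrier V. nrm V x \<le> 1})"
  proof (rule bdd_aboveI2)
    fix x assume "x \<in> {x \<in> carrier V. nrm V x \<le> 1}"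
    then show "nrm W (T' x) \<le> r * opnorm V W T"
      using le[of x] mult_left_mono[of "nrm V x" 1 "r * opnorm V W T"] pos by auto
  qed
  show ?thesis
  proof (rule antisym)
    show "opnorm V W T' \<le> r * opnorm V W T"
      by (rule opnorm_leI[OF assms(1) pos le])
    have "opnorm V W T \<le> opnorm V W T' / r"
      unfolding opnorm_def[of V W T]
    proof (rule cSUP_least)
      show "{x \<in> carrier V. nrm V x \<le> 1} \<noteq> {}" by (auto intro!: exI[of _ "\<zero>\<^bsub>V\<^esub>"])
      fix x assume x: "x \<in> {x \<in> carrier V. nrm V x \<le> 1}"
      have "nrm W (T' x) \<le> opnorm V W T'" unfolding opnorm_def by (rule cSUP_upper[OF x bdd])
      then show "nrm W (T x) \<le> opnorm V W T' / r"
        using x nT'[of x] \<open>r > 0\<close> by (simp add: field_simps)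
    qed
    then show "r * opnorm V W T \<le> opnorm V W T'" using \<open>r > 0\<close> by (simp add: field_simps)
  qed
qed

definition flip :: "nat \<Rightarrow> nat set \<Rightarrow> nat set" where
  "flip i F = (if i \<in> F then F - {i} else insert i F)"

lemma flip_simps:
  "finite F \<Longrightarrow> finite (flip i F)" "flip i (flip i F) = F" "flip i (flip k F) = flip k (flip i F)"
  by (auto simp: flip_def)

lemma flip_subset: "flip n F \<subseteq> {..<n} \<longleftrightarrow> n \<in> F \<and> F \<subseteq> {..<Suc n}"
  by (auto simp: flip_def less_Suc_eq)

context coded_tilde
begin

text \<open>
  Positive multiples of an operator \<open>\<alpha>\<close> have the same normalisation \<open>\<alpha> / \<parallel>\<alpha>\<parallel>\<close>, so the
  corresponding summands are glued to \<open>W\<close> in the same way and may be permuted freely. Finite sets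
  of natural numbers index infinitely many of them, and flipping the membership of \<open>i\<close> gives
  commuting involutions. The mean over the first \<open>n\<close> flips spreads a vector \<open>b\<close> of one summand evenly
  over \<open>2\<^sup>n\<close> summands. If \<open>b\<close> has distance \<open>d\<close> from the glued subspace, consecutive means stay at
  distance \<open>d\<close>: half of the mass of each has to move to new summands.
\<close>

lemma involutions_with_drifting_averages:
  assumes e0: "e0 \<in> carrier W" "e0 \<noteq> \<zero>\<^bsub>W\<^esub>"
  shows "\<exists>\<sigma> x d. involutions W' \<sigma> \<and> (\<forall>i. \<forall>e\<in>carrier W. \<sigma> i (next_j e) = next_j e) \<and>
    x \<in> carrier W' \<and> d > 0 \<and>
    (\<forall>n. d \<le> nrm W' (average W' \<sigma> (Suc n) x \<ominus>\<^bsub>W'\<^esub> average W' \<sigma> n x))"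
proof -
  interpret S2: complex_seminormed_space "basic_S 2" by (rule basic_S_seminormed)
  interpret B2: complex_normed_space "basic_B 2" by (rule banachD(1)[OF basic_spaces(1)])
  interpret W': complex_seminormed_space W' by (rule banachD(3)[OF banach_W'])
  from basic_S_functional obtain \<phi>0 where \<phi>0: "\<forall>x\<in>carrier (basic_S 2). \<forall>y\<in>carrier (basic_S 2).
        \<phi>0 (x \<oplus>\<^bsub>basic_S 2\<^esub> y) = \<phi>0 x + \<phi>0 y"
      "\<forall>c. \<forall>x\<in>carrier (basic_S 2). \<phi>0 (c \<odot>\<^bsub>basic_S 2\<^esub> x) = c * \<phi>0 x"
      "\<forall>x\<in>carrier (basic_S 2). cmod (\<phi>0 x) \<le> nrm (basic_S 2) x"
      "\<exists>x\<in>carrier (basic_S 2). \<phi>0 x \<noteq> 0"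
    by (elim exE conjE) (rule that)
  have \<phi>0_add: "\<phi>0 (x \<oplus>\<^bsub>basic_S 2\<^esub> y) = \<phi>0 x + \<phi>0 y"
    if "x \<in> carrier (basic_S 2)" "y \<in> carrier (basic_S 2)" for x y
    using \<phi>0(1)[rule_format, OF that] .
  have \<phi>0_smult: "\<phi>0 (c \<odot>\<^bsub>basic_S 2\<^esub> x) = c * \<phi>0 x" if "x \<in> carrier (basic_S 2)" for c x
    using \<phi>0(2)[rule_format, OF that] .
  have \<phi>0_le: "cmod (\<phi>0 x) \<le> nrm (basic_S 2) x" if "x \<in> carrier (basic_S 2)" for x
    using \<phi>0(3) that by (rule bspec)
  obtain x1 where x1: "x1 \<in> carrier (basic_S 2)" "\<phi>0 x1 \<noteq> 0" using \<phi>0(4) by blast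
  obtain b where b: "b \<in> carrier (basic_B 2)" "b \<notin> carrier (basic_S 2)" using basic_S_proper by blast
  then obtain d where d: "d > 0" "\<And>y. y \<in> carrier (basic_S 2) \<Longrightarrow> d \<le> nrm (basic_B 2) (b \<ominus>\<^bsub>basic_B 2\<^esub> y)"
    using basic_spaces(3)[of 2] unfolding nrm_closed_def by (meson not_less)
  have S_sub: "y \<in> carrier (basic_B 2)" "c \<odot>\<^bsub>basic_B 2\<^esub> y \<in> carrier (basic_S 2)"
    if "y \<in> carrier (basic_S 2)" for y c
    using basic_spaces(2)[of 2] that by (auto simp: lin_subspace_def)

  \<comment> \<open>the positive scale determines the finite set, and is \<open>1\<close> for the empty set\<close>
  define r where "r F = real (set_encode F) + 1" for F
  have r: "r F > 0" for F by (simp add: r_def add_nonneg_pos)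
  define \<alpha> where "\<alpha> F = (\<lambda>x\<in>carrier (basic_S 2). (of_real (r F) * \<phi>0 x) \<odot>\<^bsub>W\<^esub> e0)" for F
  define copy :: "nat set \<Rightarrow> 'e stage op_index" where "copy F = (2, \<alpha> F)" for F
  have \<alpha>_bounded: "\<alpha> F \<in> bounded_ops (basic_S 2) W" for F
  proof (rule bounded_opsI)
    show "linear_map (basic_S 2) W (\<alpha> F)"
      using e0 by (auto simp: linear_map_def \<alpha>_def \<phi>0_add \<phi>0_smult W.sm_add_l[symmetric] W.sm_assoc algebra_simps)
    show "\<alpha> F \<in> extensional (carrier (basic_S 2))" by (simp add: \<alpha>_def)
    fix x assume x: "x \<in> carrier (basic_S 2)"
    have "nrm W (\<alpha> F x) = cmod (\<phi>0 x) * (r F * nrm W e0)"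
      using e0 x r[of F] by (simp add: \<alpha>_def W.nrm_smult norm_mult)
    also have "\<dots> \<le> nrm (basic_S 2) x * (r F * nrm W e0)"
      using e0 r[of F] by (intro mult_right_mono \<phi>0_le x mult_nonneg_nonneg) auto
    finally show "nrm W (\<alpha> F x) \<le> (r F * nrm W e0) * nrm (basic_S 2) x" by (simp add: mult.commute)
  qed
  have sm_cancel: "c = c'" if "c \<odot>\<^bsub>W\<^esub> e0 = c' \<odot>\<^bsub>W\<^esub> e0" for c c'
  proof -
    have "(c - c') \<odot>\<^bsub>W\<^esub> e0 = \<zero>\<^bsub>W\<^esub>" using that e0 by (simp add: W.sm_diff_l)
    then have "cmod (c - c') * nrm W e0 = 0" using W.nrm_smult[OF e0(1), of "c - c'"] by simp
    then show ?thesis using e0 W.nrm_eq_0 by simp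
  qed
  have copy_mem: "copy F \<in> index_A W" for F
    unfolding copy_def
  proof (rule index_AI[OF _ \<alpha>_bounded])
    have "(of_real (r F) * \<phi>0 x1) \<odot>\<^bsub>W\<^esub> e0 \<noteq> 0 \<odot>\<^bsub>W\<^esub> e0"
      using sm_cancel[of "of_real (r F) * \<phi>0 x1" 0] r[of F] x1 by auto
    then show "\<exists>x\<in>carrier (basic_S 2). \<alpha> F x \<noteq> \<zero>\<^bsub>W\<^esub>"
      using x1 e0 by (intro bexI[of _ x1]) (auto simp: \<alpha>_def)
    show "finite {e0}" "{e0} \<subseteq> carrier W" using e0 by auto
    have "c \<odot>\<^bsub>W\<^esub> e0 \<in> lin_span W {e0}" for c
      unfolding lin_span_def using e0
      by (intro CollectI exI[of _ "\<lambda>_. c"] exI[of _ "{e0}"]) (simp add: W.finsum_insert W.finsum_empty)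
    then show "\<alpha> F ` carrier (basic_S 2) \<subseteq> lin_span W {e0}" by (auto simp: \<alpha>_def)
  qed simp
  have copy_inj: "F = H" if "copy F = copy H" "finite F" "finite H" for F H
  proof -
    have "\<alpha> F x1 = \<alpha> H x1" using that by (simp add: copy_def)
    then have "of_real (r F) * \<phi>0 x1 = of_real (r H) * \<phi>0 x1" using x1 by (intro sm_cancel) (simp add: \<alpha>_def)
    then have "r F = r H" using x1 by simp
    then show ?thesis using that by (simp add: r_def set_encode_eq)
  qed
  have glue_copy: "glue_map W (copy F) y = glue_map W (copy {}) y" if y: "y \<in> carrier (basic_S 2)" for F y
  proof -
    have \<alpha>F: "\<alpha> F x = of_real (r F) \<odot>\<^bsub>W\<^esub> \<alpha> {} x" if "x \<in> carrier (basic_S 2)" for x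
      using that e0 by (simp add: \<alpha>_def r_def set_encode_def W.sm_assoc)
    have "opnorm (basic_S 2) W (\<alpha> F) = r F * opnorm (basic_S 2) W (\<alpha> {})"
      by (rule opnorm_smult[OF S2.seminormed W.seminormed \<alpha>_bounded r \<alpha>F])
    moreover have "\<alpha> {} y \<in> carrier W" using linear_mapD(1)[OF bounded_opsD(1)[OF \<alpha>_bounded] y] .
    ultimately show ?thesis
      using r[of F] by (simp add: glue_map_def copy_def \<alpha>F[OF y] W.sm_assoc)
  qed

  define \<phi> where "\<phi> i a = (if a \<in> copy ` Collect finite then copy (flip i (the_inv_into (Collect finite) copy a)) else a)"
    for i a
  have inj: "inj_on copy (Collect finite)" by (rule inj_onI) (use copy_inj in auto)
  have \<phi>_copy: "\<phi> i (copy F) = copy (flip i F)" if "finite F" for i F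
    using that by (simp add: \<phi>_def the_inv_into_f_f[OF inj])
  have \<phi>_other: "\<phi> i a = a" if "a \<notin> copy ` Collect finite" for i a
    using that by (simp add: \<phi>_def)
  have fst_\<phi>: "fst (\<phi> i a) = fst a" for i a
    by (cases "a \<in> copy ` Collect finite") (auto simp: \<phi>_copy \<phi>_other, simp add: copy_def)
  have gi: "gluing_involutions (index_A W) (\<lambda>a. basic_B (fst a)) (\<lambda>a. carrier (basic_S (fst a))) (glue_map W) W \<phi> (\<lambda>_ x. x)"
  proof (rule gluing_involutions.intro[OF gluing_axioms], rule gluing_involutions_axioms.intro)
    show "involutions W (\<lambda>_ x. x)" by (auto simp: involutions_def linear_map_def)
    fix a i assume a: "a \<in> index_A W"
    show "\<phi> i a \<in> index_A W" "\<phi> i (\<phi> i a) = a" "\<phi> i (\<phi> k a) = \<phi> k (\<phi> i a)" for k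
      using a copy_mem flip_simps
      by (cases "a \<in> copy ` Collect finite"; auto simp: \<phi>_copy \<phi>_other)+
    show "basic_B (fst (\<phi> i a)) = basic_B (fst a)" "carrier (basic_S (fst (\<phi> i a))) = carrier (basic_S (fst a))"
      by (simp_all add: fst_\<phi>)
    fix y assume y: "y \<in> carrier (basic_S (fst a))"
    show "glue_map W (\<phi> i a) y = glue_map W a y"
    proof (cases "a \<in> copy ` Collect finite")
      case True
      then obtain F where F: "finite F" "a = copy F" by auto
      then have "y \<in> carrier (basic_S 2)" using y by (simp add: copy_def)
      then show ?thesis using F glue_copy[of y F] glue_copy[of y "flip i F"] by (simp add: \<phi>_copy)
    qed (simp add: \<phi>_other)
  qed
  interpret gi: gluing_involutions "index_A W" "\<lambda>a. basic_B (fst a)" "\<lambda>a. carrier (basic_S (fst a))" "glue_map W" W \<phi> "\<lambda>_ x. x"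
    by (rule gi)
  obtain \<sigma> where \<sigma>: "involutions W' \<sigma>" "\<And>i e. e \<in> carrier W \<Longrightarrow> \<sigma> i (next_j e) = next_j e"
    "\<And>i p. p \<in> carrier P \<Longrightarrow> \<sigma> i (code W (G +>\<^bsub>P\<^esub> p)) = code W (G +>\<^bsub>P\<^esub> gi.\<theta> i p)"
    using involutions_next[OF gi] by auto

  define L where "L v = code W (G +>\<^bsub>P\<^esub> (v, \<zero>\<^bsub>W\<^esub>))" for v
  have L_linear: "linear_map B W' L"
  proof -
    have "linear_map B (tilde W) (\<lambda>v. G +>\<^bsub>P\<^esub> (v, \<zero>\<^bsub>W\<^esub>))"
      unfolding tilde_eq by (rule linear_map_comp[OF linear_map_pair(2) Q.linear_map_quotient])
    from linear_map_comp[OF this C.linear_map_transport] show ?thesis by (simp add: L_def[abs_def])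
  qed
  have \<sigma>_L: "\<sigma> i (L v) = L (gi.permute i v)" if "v \<in> carrier B" for i v
    using \<sigma>(3)[of "(v, \<zero>\<^bsub>W\<^esub>)" i] that by (simp add: L_def gi.\<theta>_def)

  \<comment> \<open>representative of the average of order \<open>n\<close>: the vector \<open>b\<close> spread evenly over \<open>2\<^sup>n\<close> copies\<close>
  define w where "w n = (\<lambda>a\<in>index_A W. if a \<in> copy ` Pow {..<n}
      then of_real ((1/2)^n) \<odot>\<^bsub>basic_B 2\<^esub> b else \<zero>\<^bsub>basic_B (fst a)\<^esub>)" for n
  have fin_sub: "finite F" if "F \<subseteq> {..<n}" for F and n :: nat
    using that finite_subset by blast
  have finite_in_Pow: "finite F" if "F \<in> Pow {..<n}" for F and n :: nat
    using that finite_subset[of F "{..<n}"] by auto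
  have w_copy: "w n (copy F) = (if F \<subseteq> {..<n} then of_real ((1/2)^n) \<odot>\<^bsub>basic_B 2\<^esub> b else \<zero>\<^bsub>basic_B 2\<^esub>)"
    if "finite F" for n F
  proof -
    have "copy F \<in> copy ` Pow {..<n} \<longleftrightarrow> F \<subseteq> {..<n}"
      using copy_inj[OF _ that] finite_in_Pow by blast
    then show ?thesis using copy_mem[of F] by (simp add: w_def copy_def)
  qed
  have w_other: "w n a = \<zero>\<^bsub>basic_B (fst a)\<^esub>" if "a \<in> index_A W" "a \<notin> copy ` Collect finite" for n a
    using that finite_in_Pow by (auto simp: w_def)
  have w_mem: "w n \<in> carrier B" for n
  proof (rule B.memI)
    show "w n \<in> extensional (index_A W)" by (simp add: w_def)
    fix a assume a: "a \<in> index_A W"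
    interpret Ba: complex_seminormed_space "basic_B (fst a)" by (rule banachD(3)[OF basic_spaces(1)])
    show "w n a \<in> carrier (basic_B (fst a))"
      using a b(1) by (auto simp: w_def copy_def)
  next
    have "{a \<in> index_A W. nrm (basic_B (fst a)) (w n a) \<noteq> 0} \<subseteq> copy ` Pow {..<n}"
    proof
      fix a assume a: "a \<in> {a \<in> index_A W. nrm (basic_B (fst a)) (w n a) \<noteq> 0}"
      interpret Ba: complex_seminormed_space "basic_B (fst a)" by (rule banachD(3)[OF basic_spaces(1)])
      show "a \<in> copy ` Pow {..<n}" using a by (auto simp: w_def split: if_splits)
    qed
    then have "finite {a \<in> index_A W. nrm (basic_B (fst a)) (w n a) \<noteq> 0}" by (rule finite_subset) auto
    then show "(\<lambda>a. nrm (basic_B (fst a)) (w n a)) summable_on index_A W"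
      by (rule finite_nonzero_values_imp_summable_on)
  qed
  have half: "(1/2) \<odot>\<^bsub>B\<^esub> (w n \<oplus>\<^bsub>B\<^esub> gi.permute n (w n)) = w (Suc n)" for n
  proof (rule extensionalityI[of _ "index_A W"])
    fix a assume a: "a \<in> index_A W"
    interpret Ba: complex_seminormed_space "basic_B (fst a)" by (rule banachD(3)[OF basic_spaces(1)])
    have lhs: "((1/2) \<odot>\<^bsub>B\<^esub> (w n \<oplus>\<^bsub>B\<^esub> gi.permute n (w n))) a
        = (1/2) \<odot>\<^bsub>basic_B (fst a)\<^esub> (w n a \<oplus>\<^bsub>basic_B (fst a)\<^esub> w n (\<phi> n a))"
      using a by (simp add: gi.permute_def)
    show "((1/2) \<odot>\<^bsub>B\<^esub> (w n \<oplus>\<^bsub>B\<^esub> gi.permute n (w n))) a = w (Suc n) a"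
    proof (cases "a \<in> copy ` Collect finite")
      case True
      then obtain F where F: "finite F" "a = copy F" by auto
      have [simp]: "fst (copy F) = 2" by (simp add: copy_def)
      have wF: "w n (\<phi> n (copy F)) = (if n \<in> F \<and> F \<subseteq> {..<Suc n} then of_real ((1/2)^n) \<odot>\<^bsub>basic_B 2\<^esub> b else \<zero>\<^bsub>basic_B 2\<^esub>)"
        using F by (simp add: \<phi>_copy w_copy flip_simps(1) flip_subset)
      have e: "(1/2) \<odot>\<^bsub>basic_B 2\<^esub> (of_real ((1/2)^n) \<odot>\<^bsub>basic_B 2\<^esub> b) = of_real ((1/2)^Suc n) \<odot>\<^bsub>basic_B 2\<^esub> b"
        using b by (simp add: B2.sm_assoc)
      have sub: "F \<subseteq> {..<n} \<longleftrightarrow> F \<subseteq> {..<Suc n} \<and> n \<notin> F"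
        by (auto simp: subset_iff less_Suc_eq)
      consider "F \<subseteq> {..<n}" "\<not> (n \<in> F \<and> F \<subseteq> {..<Suc n})" "F \<subseteq> {..<Suc n}"
        | "\<not> F \<subseteq> {..<n}" "n \<in> F \<and> F \<subseteq> {..<Suc n}"
        | "\<not> F \<subseteq> {..<n}" "\<not> (n \<in> F \<and> F \<subseteq> {..<Suc n})" "\<not> F \<subseteq> {..<Suc n}"
        using sub by argo
      then show ?thesis
        unfolding lhs unfolding F(2)
        by cases (use b e in \<open>simp_all add: w_copy[OF F(1)] wF del: of_real_power power_Suc\<close>)
    next
      case False
      then show ?thesis unfolding lhs using a by (simp add: w_other \<phi>_other)
    qed
  qed (simp_all add: w_def)
  have avg: "average W' \<sigma> n (L (w 0)) = L (w n)" for n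
  proof (induction n)
    case (Suc n)
    have "average W' \<sigma> (Suc n) (L (w 0)) = (1/2) \<odot>\<^bsub>W'\<^esub> (L (w n) \<oplus>\<^bsub>W'\<^esub> L (gi.permute n (w n)))"
      by (simp add: Suc \<sigma>_L w_mem)
    also have "\<dots> = L ((1/2) \<odot>\<^bsub>B\<^esub> (w n \<oplus>\<^bsub>B\<^esub> gi.permute n (w n)))"
      using w_mem[of n] gi.permute_mem(1)[OF w_mem, of n n]
      by (simp add: linear_mapD[OF L_linear] del: l1_sum_simps)
    finally show ?case by (simp only: half)
  qed simp
  have "d \<le> nrm W' (average W' \<sigma> (Suc n) (L (w 0)) \<ominus>\<^bsub>W'\<^esub> average W' \<sigma> n (L (w 0)))" for n
  proof -
    let ?v = "w (Suc n) \<ominus>\<^bsub>B\<^esub> w n" and ?F = "copy ` Pow {..<Suc n}"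
    have v: "?v \<in> carrier B" by (intro B.L.minus_closed w_mem)
    \<comment> \<open>consecutive averages differ by \<open>\<plusminus> 2\<^sup>-\<^sup>(\<^sup>n\<^sup>+\<^sup>1\<^sup>) b\<close> on each of \<open>2\<^sup>n\<^sup>+\<^sup>1\<close> copies\<close>
    have coord: "?v (copy F) = (if F \<subseteq> {..<n} then - of_real ((1/2)^Suc n) else of_real ((1/2)^Suc n)) \<odot>\<^bsub>basic_B 2\<^esub> b"
      if F: "F \<subseteq> {..<Suc n}" for F
    proof -
      have fin: "finite F" using F by (rule fin_sub)
      have "?v (copy F) = w (Suc n) (copy F) \<ominus>\<^bsub>basic_B 2\<^esub> w n (copy F)"
        using copy_mem[of F] by (simp add: B.diff[OF w_mem w_mem] copy_def)
      also have "\<dots> = (if F \<subseteq> {..<n} then - of_real ((1/2)^Suc n) else of_real ((1/2)^Suc n)) \<odot>\<^bsub>basic_B 2\<^esub> b"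
      proof (cases "F \<subseteq> {..<n}")
        case True
        have "w (Suc n) (copy F) \<ominus>\<^bsub>basic_B 2\<^esub> w n (copy F) =
            (of_real ((1/2)^Suc n) - of_real ((1/2)^n)) \<odot>\<^bsub>basic_B 2\<^esub> b"
          unfolding w_copy[OF fin] using True F b(1) by (simp only: B2.sm_diff_l if_True)
        also have "(of_real ((1/2)^Suc n) - of_real ((1/2)^n) :: complex) = - of_real ((1/2)^Suc n)" by simp
        finally show ?thesis using True by simp
      next
        case False
        then show ?thesis unfolding w_copy[OF fin] using F b(1) by (simp del: of_real_power power_Suc)
      qed
      finally show ?thesis .
    qed
    have "(\<Sum>a\<in>?F. (1/2)^Suc n * d) \<le> nrm (quotient P G) (G +>\<^bsub>P\<^esub> (?v, \<zero>\<^bsub>W\<^esub>))"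
    proof (rule nrm_Q_ge_sum[OF v])
      show "finite ?F" by simp
      show "?F \<subseteq> index_A W" using copy_mem by auto
      fix a y assume "a \<in> ?F" and y: "y \<in> carrier (basic_S (fst a))"
      then obtain F where F: "F \<subseteq> {..<Suc n}" "a = copy F" by auto
      have yS: "y \<in> carrier (basic_S 2)" using y F by (simp add: copy_def)
      define c :: complex where "c = (if F \<subseteq> {..<n} then - of_real ((1/2)^Suc n) else of_real ((1/2)^Suc n))"
      have c: "cmod c = (1/2)^Suc n" "c \<noteq> 0" by (auto simp: c_def norm_power norm_mult norm_divide)
      have "y \<oplus>\<^bsub>basic_B 2\<^esub> c \<odot>\<^bsub>basic_B 2\<^esub> b = c \<odot>\<^bsub>basic_B 2\<^esub> (b \<ominus>\<^bsub>basic_B 2\<^esub> ((- inverse c) \<odot>\<^bsub>basic_B 2\<^esub> y))"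
        using b S_sub(1)[OF yS] c(2)
        by (simp add: B2.minus_eq B2.neg_eq B2.sm_add_r B2.sm_assoc B2.a_comm)
      then have "nrm (basic_B 2) (y \<oplus>\<^bsub>basic_B 2\<^esub> c \<odot>\<^bsub>basic_B 2\<^esub> b) =
          cmod c * nrm (basic_B 2) (b \<ominus>\<^bsub>basic_B 2\<^esub> ((- inverse c) \<odot>\<^bsub>basic_B 2\<^esub> y))"
        using b S_sub(1)[OF yS] by (simp add: B2.nrm_smult)
      moreover have "cmod c * d \<le> cmod c * nrm (basic_B 2) (b \<ominus>\<^bsub>basic_B 2\<^esub> ((- inverse c) \<odot>\<^bsub>basic_B 2\<^esub> y))"
        by (intro mult_left_mono d(2) S_sub(2) yS) simp
      ultimately have "(1/2)^Suc n * d \<le> nrm (basic_B 2) (y \<oplus>\<^bsub>basic_B 2\<^esub> c \<odot>\<^bsub>basic_B 2\<^esub> b)" using c(1) by simp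
      then show "(1/2)^Suc n * d \<le> nrm (basic_B (fst a)) (y \<oplus>\<^bsub>basic_B (fst a)\<^esub> ?v a)"
        unfolding F(2) coord[OF F(1)] c_def[symmetric] by (simp add: copy_def)
    qed
    moreover have "(\<Sum>a\<in>?F. (1/2)^Suc n * d) = d"
    proof -
      have "inj_on copy (Pow {..<Suc n})" by (rule inj_on_subset[OF inj]) (use finite_in_Pow in auto)
      then have "card ?F = 2^Suc n" by (simp add: card_image card_Pow)
      then show ?thesis by (simp add: power_divide)
    qed
    moreover have "nrm (quotient P G) (G +>\<^bsub>P\<^esub> (?v, \<zero>\<^bsub>W\<^esub>)) = nrm W' (L ?v)"
      using C.transport_simps(3)[of "G +>\<^bsub>P\<^esub> (?v, \<zero>\<^bsub>W\<^esub>)"] v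
      by (simp add: L_def tilde_eq Q.carrier_quotient del: l1_sum_simps)
    moreover have "L ?v = L (w (Suc n)) \<ominus>\<^bsub>W'\<^esub> L (w n)"
      by (rule linear_map_zero_diff(2)[OF B.seminormed W'.seminormed L_linear w_mem w_mem])
    ultimately show ?thesis by (simp only: avg)
  qed
  then show ?thesis
    using \<sigma> d(1) linear_mapD(1)[OF L_linear w_mem[of 0]] by blast
qed

end

section \<open>An operator on the limit space\<close>

lemma banach_tower: "banach E \<Longrightarrow> banach (tower E n)"
proof (induction n)
  case 0
  then show ?case by (simp add: banach_transport inj_on_def)
next
  case (Suc n)
  then interpret coded_tilde "tower E n" by unfold_locales simp
  show ?case using banach_W' by simp
qed

theorem theorem3p11:
  fixes E :: "'e cnormed"
  assumes "complex_banach_space E"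
    and "carrier E \<noteq> {\<zero>\<^bsub>E\<^esub>}"
  shows "\<exists>T. well_bounded (pisier_space E) T \<and> \<not> type_B (pisier_space E) T"
proof -
  have E: "banach E" using assms(1) by (simp add: banach_iff)
  interpret E: complex_normed_space E using E by (rule banachD)
  interpret t: coded_tilde "tower E n" for n by unfold_locales (rule banach_tower[OF E])
  have tower_j_eq: "tower_j E n = t.next_j n" for n
    by (rule ext) (simp add: tower_j_def t.next_j_def)
  have semi: "complex_seminormed_space (tower E n)" for n by (rule banachD(3)[OF banach_tower[OF E]])
  interpret sys: inductive_system "tower E" "tower_j E"
  proof (rule inductive_system.intro)
    show "complex_seminormed_space (tower E n)" for n by (rule semi)
    show "linear_map (tower E n) (tower E (Suc n)) (tower_j E n)" for n
      unfolding tower_j_eq tower.simps by (rule t.next_j_linear)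
    show "nrm (tower E (Suc n)) (tower_j E n x) = nrm (tower E n) x" if "x \<in> carrier (tower E n)" for n x
      unfolding tower_j_eq tower.simps using that by (rule t.nrm_next_j)
  qed
  obtain e where e: "e \<in> carrier E" "e \<noteq> \<zero>\<^bsub>E\<^esub>" using assms(2) E.zero_closed by blast
  interpret a: transported E Atom
    by (rule transported.intro[OF E.seminormed]) (simp add: transported_axioms_def inj_on_def)
  have "Atom e \<in> carrier (tower E 0)" "Atom e \<noteq> \<zero>\<^bsub>tower E 0\<^esub>"
    using e by (simp_all add: a.carrier_transport a.zero_transport)
  from t.involutions_with_drifting_averages[OF this]
  obtain \<sigma> x d where \<sigma>: "involutions (tower E 1) \<sigma>"
      "\<And>i u. u \<in> carrier (tower E 0) \<Longrightarrow> \<sigma> i (tower_j E 0 u) = tower_j E 0 u"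
    and x: "x \<in> carrier (tower E 1)" and d: "d > 0"
    and drift: "\<And>n. d \<le> nrm (tower E 1) (average (tower E 1) \<sigma> (Suc n) x \<ominus>\<^bsub>tower E 1\<^esub> average (tower E 1) \<sigma> n x)"
    unfolding tower_j_eq One_nat_def tower.simps(2) by blast
  have "\<exists>s. \<forall>n. (involutions (tower E (Suc n)) (s n) \<and> (n = 0 \<longrightarrow> s n = \<sigma>)) \<and>
      (\<forall>i. \<forall>u\<in>carrier (tower E (Suc n)). s (Suc n) i (tower_j E (Suc n) u) = tower_j E (Suc n) (s n i u))"
  proof (rule dependent_nat_choice)
    show "\<exists>s. involutions (tower E (Suc 0)) s \<and> (0 = (0::nat) \<longrightarrow> s = \<sigma>)" using \<sigma>(1) by auto
    fix s n assume "involutions (tower E (Suc n)) s \<and> (n = 0 \<longrightarrow> s = \<sigma>)"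
    then have "involutions (tower E (Suc n)) s" by blast
    from t.involutions_functorial[OF this]
    show "\<exists>s'. (involutions (tower E (Suc (Suc n))) s' \<and> (Suc n = 0 \<longrightarrow> s' = \<sigma>)) \<and>
        (\<forall>i. \<forall>u\<in>carrier (tower E (Suc n)). s' i (tower_j E (Suc n) u) = tower_j E (Suc n) (s i u))"
      unfolding tower_j_eq tower.simps(2)[of E "Suc n"] by blast
  qed
  then obtain s where s: "\<And>n. involutions (tower E (Suc n)) (s n)" "s 0 = \<sigma>"
    "\<And>n i u. u \<in> carrier (tower E (Suc n)) \<Longrightarrow> s (Suc n) i (tower_j E (Suc n) u) = tower_j E (Suc n) (s n i u)"
    by blast
  define \<tau> where "\<tau> n = (case n of 0 \<Rightarrow> \<lambda>_ u. u | Suc m \<Rightarrow> s m)" for n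
  have \<tau>: "involutions (tower E n) (\<tau> n)" for n
    by (cases n) (auto simp: \<tau>_def s(1) simp del: tower.simps(2), auto simp: involutions_def linear_map_def)
  have \<tau>_j: "\<tau> (Suc n) i (tower_j E n u) = tower_j E n (\<tau> n i u)" if "u \<in> carrier (tower E n)" for n i u
    using that \<sigma>(2) s(2,3) by (cases n) (auto simp: \<tau>_def simp del: tower.simps(2))
  obtain \<rho> where \<rho>: "involutions (pisier_space E) \<rho>"
    "\<And>i u. u \<in> carrier (tower E 1) \<Longrightarrow> \<rho> i (sys.to_limit u) = sys.to_limit (\<sigma> i u)"
    using sys.involutions_limit[OF \<tau> \<tau>_j] by (auto simp: pisier_space_def \<tau>_def s(2))
  have X: "banach (pisier_space E)" unfolding pisier_space_def by (rule sys.banach_limit)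
  interpret decreasing_projections "pisier_space E" "average (pisier_space E) \<rho>"
    by (rule decreasing_projections_average[OF X \<rho>(1)])
  let ?R = "average (pisier_space E) \<rho>" and ?x = "sys.to_limit x"
  note lim = sys.to_limit_linear[folded pisier_space_def]
  have Rx: "?R n ?x = sys.to_limit (average (tower E 1) \<sigma> n x)" for n
    by (rule average_equivariant[OF semi \<sigma>(1) lim _ x, symmetric]) (rule \<rho>(2)[symmetric])
  interpret inv1: involutive_space "tower E 1" \<sigma>
    by (rule involutive_space.intro[OF semi]) (rule involutive_space_axioms.intro[OF \<sigma>(1)])
  have c: "average (tower E 1) \<sigma> n x \<in> carrier (tower E 1)" for n by (rule inv1.average_closed[OF x])
  have "d \<le> nrm (pisier_space E) (?R (Suc n) ?x \<ominus>\<^bsub>pisier_space E\<^esub> ?R n ?x)" for n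
    using drift[of n] sys.nrm_to_limit[OF t.W.minus_closed[OF c c], of "Suc n" n]
    unfolding Rx pisier_space_def[symmetric] linear_map_zero_diff(2)[OF semi seminormed lim c c, symmetric] by simp
  then have "\<not> cauchy_seq (pisier_space E) (\<lambda>n. ?R n ?x)"
    using d unfolding cauchy_seq_def by (metis le_SucI le_refl not_less)
  moreover have "?x \<in> carrier (pisier_space E)" by (rule linear_mapD(1)[OF lim x])
  ultimately show ?thesis by (intro exists_not_type_B)
qed

end
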